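(* Let $n\ge1$ and let $\psi\in C(\mathbb{R};L^2_x(\mathbb{R}^n))$ be a global solution of $$i\partial_t\psi-H_0\psi=N(x,t,|\psi|)\psi,\qquad \psi(x,0)=\psi_0\in L^2_x(\mathbb{R}^n),$$ satisfying $\sup_{t\in\mathbb{R}}\|\psi(t)\|_{L^2_x}<\infty$ (the bound depending on $\|\psi_0\|_{L^2}$). Let $V(x,t):=N(x,t,|\psi(x,t)|)$ and assume that for some $\delta>1$, $\sup_{(x,t)\in\mathbb{R}^n\times\mathbb{R}}\langle x\rangle^\delta|V(x,t)|<\infty$. Let $e=\frac12(1+\frac1\delta)$. Then for every $b\in(0,1-e)$ and $\alpha\in(b,1-b)$: (1) The limit $$\Omega_{\alpha,b}^*\psi(0):=\lim_{t\to\infty}e^{itH_0}F_c\Big(\frac{|x-2tP|}{t^\alpha}\le1\Big)F_1(t^b|P|>1)\psi(t)$$ exists in $L^2_x(\mathbb{R}^n)$, and $$\text{w-}\lim_{t\to\infty}e^{itH_0}\Big(1-F_c\Big(\frac{|x-2tP|}{t^\alpha}\le1\Big)F_1(t^b|P|>1)\Big)\psi(t)=0\quad\text{in }L^2_x(\mathbb{R}^n).$$ (2) If moreover $\delta>2$, then for every $\epsilon>0$ there exist $\psi_+\in L^2_x(\mathbb{R}^n)$ and $\psi_{w,\epsilon}(t)\in L^2_x(\mathbb{R}^n)$ ($t\ge1$) such that $$\lim_{t\to\infty}\|\psi(t)-e^{-itH_0}\psi_+-\psi_{w,\epsilon}(t)\|_{L^2_x(\mathbb{R}^n)}=0,$$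 and the weakly localized part $\psi_{w,\epsilon}$ is localized in the region $|x|\le t^{1/2+\epsilon}$ in the sense that, for $t\ge1$, $$(\psi_{w,\epsilon}(t),|x|\psi_{w,\epsilon}(t))_{L^2_x(\mathbb{R}^n)}\lesssim t^{1/2+\epsilon}\|\psi(0)\|^2_{L^2_x(\mathbb{R}^n)},$$ with implicit constant independent of $t$.
   Context: $H_0=-\Delta_x$ on $\mathbb{R}^n$, $P=-i\nabla_x$, $\langle x\rangle=(1+|x|^2)^{1/2}$. $N$ may be complex-valued, nonlinear and time-dependent. Fix smooth $\chi_c,F_1:\mathbb{R}\to[0,1]$, each equal to $1$ on $[1,\infty)$ and to $0$ on $(-\infty,1/2]$. Define $F_c(A/\lambda\le1):=1-\chi_c(A/\lambda)$ and $F_1(t^b|P|>1):=F_1(t^b|P|)$, the Fourier multiplier with symbol $F_1(t^b|\xi|)$. For a function $F$, $F(|x-2tP|/t^\alpha):=e^{-itH_0}F(|x|/t^\alpha)e^{itH_0}$. *)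

theory Defs
  imports "HOL-Analysis.Analysis"
begin

text \<open>Functions on R^n are modelled as maps real^'n \<Rightarrow> complex; the space
L^2_x(R^n) is the set of Lebesgue-measurable square-integrable such maps,
with the usual inner product and norm (equality a.e. is implicit).\<close>

definition sqint :: "(real^'n \<Rightarrow> complex) \<Rightarrow> bool" where
  "sqint f \<longleftrightarrow> f \<in> borel_measurable lebesgue \<and>
      integrable lebesgue (\<lambda>x. (cmod (f x))\<^sup>2)"

definition l2norm :: "(real^'n \<Rightarrow> complex) \<Rightarrow> real" where
  "l2norm f = sqrt (LINT x|lebesgue. (cmod (f x))\<^sup>2)"

definition l2inner :: "(real^'n \<Rightarrow> complex) \<Rightarrow> (real^'n \<Rightarrow> complex) \<Rightarrow> complex" where
  "l2inner f g = (LINT x|lebesgue. cnj (f x) * g x)"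

text \<open>Fourier integral with sign s (s = -1: transform, s = 1: inverse),
normalised by (2 pi)^(-n/2), on integrable functions.\<close>

definition fourier_int :: "real \<Rightarrow> (real^'n \<Rightarrow> complex) \<Rightarrow> real^'n \<Rightarrow> complex" where
  "fourier_int s f \<xi> =
     complex_of_real ((2 * pi) powr (- real CARD('n) / 2)) *
     (LINT x|lebesgue. cis (s * (x \<bullet> \<xi>)) * f x)"

text \<open>Plancherel extension to L^2: the L^2-limit of the Fourier integrals of
the truncations of f to balls of radius R, as R \<rightarrow> \<infinity>.\<close>

definition fourier_L2 :: "real \<Rightarrow> (real^'n \<Rightarrow> complex) \<Rightarrow> real^'n \<Rightarrow> complex" where
  "fourier_L2 s f = (SOME g. sqint g \<and>
      ((\<lambda>R. l2norm (\<lambda>\<xi>. fourier_int s (\<lambda>x. if x \<in> cball 0 R then f x else 0) \<xi> - g \<xi>))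
         \<longlongrightarrow> 0) at_top)"

text \<open>Fourier multiplier m(P), P = -i nabla: F^{-1} m F.\<close>

definition fmult :: "(real^'n \<Rightarrow> complex) \<Rightarrow> (real^'n \<Rightarrow> complex) \<Rightarrow> real^'n \<Rightarrow> complex" where
  "fmult m f = fourier_L2 1 (\<lambda>\<xi>. m \<xi> * fourier_L2 (-1) f \<xi>)"

text \<open>Free Schroedinger group: schr t = e^{-i t H_0}, H_0 = -Laplacian = |P|^2.\<close>

definition schr :: "real \<Rightarrow> (real^'n \<Rightarrow> complex) \<Rightarrow> real^'n \<Rightarrow> complex" where
  "schr t = fmult (\<lambda>\<xi>. cis (- t * (norm \<xi>)\<^sup>2))"

text \<open>F_c(|x - 2tP| / t^alpha \<le> 1) = e^{-itH_0} (1 - chi_c(|x|/t^alpha)) e^{itH_0}.\<close>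

definition Fc_op :: "(real \<Rightarrow> real) \<Rightarrow> real \<Rightarrow> real \<Rightarrow>
    (real^'n \<Rightarrow> complex) \<Rightarrow> real^'n \<Rightarrow> complex" where
  "Fc_op chi_c \<alpha> t f =
     schr t (\<lambda>x. complex_of_real (1 - chi_c (norm x / t powr \<alpha>)) * schr (- t) f x)"

definition F1_op :: "(real \<Rightarrow> real) \<Rightarrow> real \<Rightarrow> real \<Rightarrow>
    (real^'n \<Rightarrow> complex) \<Rightarrow> real^'n \<Rightarrow> complex" where
  "F1_op F1 b t = fmult (\<lambda>\<xi>. complex_of_real (F1 (t powr b * norm \<xi>)))"

definition smooth_fun :: "(real \<Rightarrow> real) \<Rightarrow> bool" where
  "smooth_fun f \<longleftrightarrow> (\<forall>k x. ((deriv ^^ k) f) differentiable (at x))"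

definition cutoff :: "(real \<Rightarrow> real) \<Rightarrow> bool" where
  "cutoff f \<longleftrightarrow> smooth_fun f \<and> (\<forall>x. 0 \<le> f x \<and> f x \<le> 1) \<and>
      (\<forall>x\<ge>1. f x = 1) \<and> (\<forall>x\<le>1/2. f x = 0)"

text \<open>Global (mild, Duhamel) solution in C(R; L^2) of
  i psi_t - H_0 psi = N(x,t,|psi|) psi,
stated weakly: for every phi in L^2 and every t,
  (phi, psi(t)) = (phi, e^{-itH_0} psi(0)) - i int_0^t (phi, e^{-i(t-s)H_0} V(s) psi(s)) ds,
with V(x,s) = N(x,s,|psi(x,s)|).\<close>

definition global_solution ::
  "(real^'n \<Rightarrow> real \<Rightarrow> real \<Rightarrow> complex) \<Rightarrow> (real \<Rightarrow> real^'n \<Rightarrow> complex) \<Rightarrow> bool" where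
  "global_solution N \<psi> \<longleftrightarrow>
     (\<forall>t. sqint (\<psi> t)) \<and>
     (\<forall>t. ((\<lambda>s. l2norm (\<lambda>x. \<psi> s x - \<psi> t x)) \<longlongrightarrow> 0) (at t)) \<and>
     (\<forall>\<phi> t. sqint \<phi> \<longrightarrow>
        interval_lebesgue_integrable lborel 0 t
          (\<lambda>s. l2inner \<phi> (schr (t - s) (\<lambda>x. N x s (cmod (\<psi> s x)) * \<psi> s x))) \<and>
        l2inner \<phi> (\<psi> t) =
          l2inner \<phi> (schr t (\<psi> 0)) -
          \<i> * (LBINT s=0..t. l2inner \<phi> (schr (t - s) (\<lambda>x. N x s (cmod (\<psi> s x)) * \<psi> s x))))"

end

(*
  Let Phi(t) = e^{itH_0} psi(t).  Functions are tested against wave packets concentrated in phase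
  space at scale sigma in position and 1/sigma in frequency, whose windows have compact frequency
  support; the free flow moves the packet at (x, xi) to (x + 2 t xi, xi), up to tails that are small
  by non-stationary phase.  Where all these classical positions have norm at least D, the
  Duhamel integrand contributes O(D^{-delta}), because the source V psi decays like
  <x>^{-delta} |psi|.

  (1) With sigma = t^beta, b < beta < alpha, both cutoffs commute with the phase space localisation
  up to o(1), and on their common support a source emitted at a later time s is tested at distance
  about s t^{-b}; the integral of (s t^{-b})^{-delta} over s >= t is o(1) since b < 1 - 1/delta.
  Hence the localised parts of Phi(T) and Phi(t) differ by o(1) uniformly in T >= t, and duality turns this into weak
  convergence of Phi(t) and strong convergence of the localised part, to the same limit.

  (2) Let psi_+ be the weak limit, sigma = t^{1/2}, v = psi - e^{-itH_0} psi_+ and R = t^{1/2+epsilon}.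
  The part of v in |x| > R tends to 0: incoming and slow packets there have stayed away from the
  origin since time 0, and outgoing ones will do so up to time infinity, where
  e^{itH_0} v tends weakly to 0.  What remains is supported in |x| <= 2R.
*)
theory Submission
  imports Defs "HOL-Probability.Characteristic_Functions"
begin

section \<open>Square-integrable functions\<close>

text \<open>The window is a product of truncated powers (1 - x^2)^K rather than a Gaussian. Its
  compact support turns the commutator with a Fourier multiplier into a plain Lipschitz estimate,
  while the order K of vanishing at the edge dictates the decay in space; K is fixed once \<delta>
  is known. Since the phase space transform is an isometry, every localisation is the norm over a
  set in phase space, and no symbol calculus is needed. The flow carries packets to packets only if
  the window evolves as well, and after time s its width is about \<sigma> + |s|/\<sigma>. This
  dictates the scales: for s of order t the two terms balance at \<sigma> = t^(1/2), which produces
  the region t^(1/2+\<epsilon>), and a source acting for a time t at that distance contributes about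
  t * t^(-\<delta>/2), hence \<delta> > 2. The obstacle is that Duhamel's formula is only available
  against test functions, while norms of localised parts are wanted. These are recovered from test
  functionals which are themselves bounded by the localised norm; the Riesz theorem supplies the
  extremal one.\<close>

definition L2 :: "'a measure \<Rightarrow> ('a \<Rightarrow> complex) \<Rightarrow> bool" where
  "L2 M f \<longleftrightarrow> f \<in> borel_measurable M \<and> integrable M (\<lambda>x. (cmod (f x))\<^sup>2)"

definition nm :: "'a measure \<Rightarrow> ('a \<Rightarrow> complex) \<Rightarrow> real" where
  "nm M f = sqrt (LINT x|M. (cmod (f x))\<^sup>2)"

definition ip :: "'a measure \<Rightarrow> ('a \<Rightarrow> complex) \<Rightarrow> ('a \<Rightarrow> complex) \<Rightarrow> complex" where
  "ip M f g = (LINT x|M. cnj (f x) * g x)"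

text \<open>Keeping the measure arbitrary lets one theory serve \<open>lebesgue\<close>, in which
  the statement is phrased, \<open>lborel\<close>, where Fubini and changes of variables are carried
  out, and the product measure of phase space.\<close>

lemma sqint_eq_L2: "sqint = L2 lebesgue"
  and l2norm_eq_nm: "l2norm = nm lebesgue"
  and l2inner_eq_ip: "l2inner = ip lebesgue"
  by (auto simp: fun_eq_iff sqint_def L2_def l2norm_def nm_def l2inner_def ip_def)

lemma borel_measurable_cnj'[measurable (raw)]:
  "f \<in> borel_measurable M \<Longrightarrow> (\<lambda>x. cnj (f x)) \<in> borel_measurable M"
  by (rule borel_measurable_continuous_on[of cnj]) (auto intro!: continuous_intros)

lemma L2_measurable[measurable_dest]: "L2 M f \<Longrightarrow> f \<in> borel_measurable M"
  by (simp add: L2_def)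

lemma L2_integrable: "L2 M f \<Longrightarrow> integrable M (\<lambda>x. (cmod (f x))\<^sup>2)"
  by (simp add: L2_def)

lemma nm_nonneg[simp]: "nm M f \<ge> 0"
  by (simp add: nm_def)

lemma nm_sq: "(nm M f)\<^sup>2 = (LINT x|M. (cmod (f x))\<^sup>2)"
  by (simp add: nm_def)

lemma nn_integral_nm:
  assumes "L2 M f" shows "(\<integral>\<^sup>+x. ennreal ((cmod (f x))\<^sup>2) \<partial>M) = ennreal ((nm M f)\<^sup>2)"
  unfolding nm_sq by (rule nn_integral_eq_integral[OF L2_integrable[OF assms]]) auto

lemma L2_I_nn:
  assumes "f \<in> borel_measurable M" "(\<integral>\<^sup>+x. ennreal ((cmod (f x))\<^sup>2) \<partial>M) < \<infinity>"
  shows "L2 M f"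
  unfolding L2_def using assms by (auto intro!: integrableI_bounded)

lemma L2_I_nn_le:
  assumes "f \<in> borel_measurable M" "(\<integral>\<^sup>+x. ennreal ((cmod (f x))\<^sup>2) \<partial>M) \<le> ennreal (B\<^sup>2)" "B \<ge> 0"
  shows "L2 M f" "nm M f \<le> B"
proof -
  show f: "L2 M f"
    using assms(2) by (intro L2_I_nn assms(1)) (auto simp: order_le_less_trans)
  have "(nm M f)\<^sup>2 \<le> B\<^sup>2"
    using assms(2) unfolding nn_integral_nm[OF f] by (simp add: ennreal_le_iff)
  then show "nm M f \<le> B" using assms(3) by (rule power2_le_imp_le)
qed

lemma L2_bound:
  assumes "L2 M f" "g \<in> borel_measurable M" "AE x in M. cmod (g x) \<le> c * cmod (f x)"
  shows "L2 M g"
  unfolding L2_def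
proof (intro conjI assms(2))
  have "integrable M (\<lambda>x. c\<^sup>2 * (cmod (f x))\<^sup>2)" using L2_integrable[OF assms(1)] by simp
  then show "integrable M (\<lambda>x. (cmod (g x))\<^sup>2)"
  proof (rule Bochner_Integration.integrable_bound)
    show "(\<lambda>x. (cmod (g x))\<^sup>2) \<in> borel_measurable M" using assms(2) by measurable
    show "AE x in M. norm ((cmod (g x))\<^sup>2) \<le> norm (c\<^sup>2 * (cmod (f x))\<^sup>2)"
      using assms(3)
    proof eventually_elim
      case (elim x)
      then have "(cmod (g x))\<^sup>2 \<le> (c * cmod (f x))\<^sup>2" by (intro power_mono) auto
      then show ?case by (simp add: power_mult_distrib)
    qed
  qed
qed

lemma nm_bound:
  assumes "L2 M f" "g \<in> borel_measurable M" "AE x in M. cmod (g x) \<le> c * cmod (f x)" "c \<ge> 0"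
  shows "nm M g \<le> c * nm M f"
proof (rule L2_I_nn_le(2)[OF assms(2)])
  have "(\<integral>\<^sup>+x. ennreal ((cmod (g x))\<^sup>2) \<partial>M) \<le> (\<integral>\<^sup>+x. ennreal (c\<^sup>2) * ennreal ((cmod (f x))\<^sup>2) \<partial>M)"
  proof (rule nn_integral_mono_AE, use assms(3) in eventually_elim)
    case (elim x)
    then have "(cmod (g x))\<^sup>2 \<le> (c * cmod (f x))\<^sup>2" by (intro power_mono) auto
    then show ?case by (simp add: power_mult_distrib flip: ennreal_mult)
  qed
  also have "\<dots> = ennreal (c\<^sup>2) * ennreal ((nm M f)\<^sup>2)"
    using assms(1) by (subst nn_integral_cmult) (auto simp: nn_integral_nm[OF assms(1)] L2_def)
  finally show "(\<integral>\<^sup>+x. ennreal ((cmod (g x))\<^sup>2) \<partial>M) \<le> ennreal ((c * nm M f)\<^sup>2)"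
    by (simp add: power_mult_distrib flip: ennreal_mult)
qed (use assms(4) in auto)

lemma nm_cong_AE:
  assumes "AE x in M. f x = g x" "f \<in> borel_measurable M" "g \<in> borel_measurable M"
  shows "nm M f = nm M g"
  unfolding nm_def using assms by (intro arg_cong[where f=sqrt] integral_cong_AE) auto

lemma ip_cong_AE:
  assumes "AE x in M. f x = f' x" "AE x in M. g x = g' x"
    "f \<in> borel_measurable M" "f' \<in> borel_measurable M" "g \<in> borel_measurable M" "g' \<in> borel_measurable M"
  shows "ip M f g = ip M f' g'"
  unfolding ip_def using assms by (intro integral_cong_AE) auto

lemma cmod_add_sq_le: "(cmod (a + b))\<^sup>2 \<le> 2 * (cmod a)\<^sup>2 + 2 * (cmod b)\<^sup>2"
proof -
  have "(cmod (a + b))\<^sup>2 \<le> (cmod a + cmod b)\<^sup>2" by (intro power_mono norm_triangle_ineq) auto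
  moreover have "0 \<le> (cmod a - cmod b)\<^sup>2" by simp
  ultimately show ?thesis unfolding power2_sum power2_diff by linarith
qed

lemma L2_zero[simp]: "L2 M (\<lambda>_. 0)"
  by (simp add: L2_def)

lemma nm_zero[simp]: "nm M (\<lambda>_. 0) = 0"
  by (simp add: nm_def)

lemma L2_add:
  assumes "L2 M f" "L2 M g" shows "L2 M (\<lambda>x. f x + g x)"
  unfolding L2_def
proof
  show m: "(\<lambda>x. f x + g x) \<in> borel_measurable M" using assms by (auto simp: L2_def)
  have "integrable M (\<lambda>x. 2 * (cmod (f x))\<^sup>2 + 2 * (cmod (g x))\<^sup>2)" using assms by (auto simp: L2_def)
  then show "integrable M (\<lambda>x. (cmod (f x + g x))\<^sup>2)"
    by (rule Bochner_Integration.integrable_bound) (use m in \<open>auto simp: cmod_add_sq_le\<close>)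
qed

lemma L2_scale: "L2 M f \<Longrightarrow> L2 M (\<lambda>x. c * f x)"
  by (rule L2_bound[where c="cmod c"]) (auto simp: L2_def norm_mult)

lemma L2_diff: "L2 M f \<Longrightarrow> L2 M g \<Longrightarrow> L2 M (\<lambda>x. f x - g x)"
  using L2_add[of M f "\<lambda>x. -1 * g x"] L2_scale[of M g "-1"] by simp

lemma ip_integrable:
  assumes "L2 M f" "L2 M g" shows "integrable M (\<lambda>x. cnj (f x) * g x)"
proof -
  have "integrable M (\<lambda>x. (cmod (f x))\<^sup>2 + (cmod (g x))\<^sup>2)" using assms by (auto simp: L2_def)
  then show ?thesis
  proof (rule Bochner_Integration.integrable_bound)
    show "(\<lambda>x. cnj (f x) * g x) \<in> borel_measurable M" using assms by (auto simp: L2_def)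
    show "AE x in M. norm (cnj (f x) * g x) \<le> norm ((cmod (f x))\<^sup>2 + (cmod (g x))\<^sup>2)"
    proof (rule AE_I2)
      fix x
      have *: "0 \<le> (cmod (f x) - cmod (g x))\<^sup>2" "0 \<le> cmod (f x) * cmod (g x)" by auto
      have "cmod (f x) * cmod (g x) \<le> (cmod (f x))\<^sup>2 + (cmod (g x))\<^sup>2"
        using * unfolding power2_diff by linarith
      then show "norm (cnj (f x) * g x) \<le> norm ((cmod (f x))\<^sup>2 + (cmod (g x))\<^sup>2)"
        by (simp add: norm_mult)
    qed
  qed
qed

lemma ip_add_right: "L2 M f \<Longrightarrow> L2 M g \<Longrightarrow> L2 M h \<Longrightarrow> ip M f (\<lambda>x. g x + h x) = ip M f g + ip M f h"
  unfolding ip_def by (simp add: distrib_left ip_integrable)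

lemma ip_scale_right: "ip M f (\<lambda>x. c * g x) = c * ip M f g"
  unfolding ip_def by (simp add: mult.left_commute)

lemma ip_diff_right: "L2 M f \<Longrightarrow> L2 M g \<Longrightarrow> L2 M h \<Longrightarrow> ip M f (\<lambda>x. g x - h x) = ip M f g - ip M f h"
  unfolding ip_def by (simp add: right_diff_distrib ip_integrable)

lemma ip_cnj: "cnj (ip M f g) = ip M g f"
  unfolding ip_def Bochner_Integration.integral_cnj[symmetric] by (simp add: mult.commute)

lemma ip_add_left: "L2 M f \<Longrightarrow> L2 M g \<Longrightarrow> L2 M h \<Longrightarrow> ip M (\<lambda>x. g x + h x) f = ip M g f + ip M h f"
  unfolding ip_def by (simp add: distrib_right ip_integrable)

lemma ip_diff_left: "L2 M f \<Longrightarrow> L2 M g \<Longrightarrow> L2 M h \<Longrightarrow> ip M (\<lambda>x. g x - h x) f = ip M g f - ip M h f"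
  unfolding ip_def by (simp add: left_diff_distrib ip_integrable)

lemma ip_scale_left: "ip M (\<lambda>x. c * g x) f = cnj c * ip M g f"
  unfolding ip_def by (simp add: mult.assoc)

lemma ip_self: "ip M f f = complex_of_real ((nm M f)\<^sup>2)"
  unfolding ip_def nm_sq integral_complex_of_real[symmetric]
  by (simp only: complex_norm_square[of "f _"] mult.commute)

lemma nm_scale: "nm M (\<lambda>x. c * f x) = cmod c * nm M f"
  by (simp add: nm_def norm_mult power_mult_distrib real_sqrt_mult)

lemma nm_minus_commute: "nm M (\<lambda>x. f x - g x) = nm M (\<lambda>x. g x - f x)"
  by (simp add: nm_def norm_minus_commute)

text \<open>Integrates 2|f||g| \<le> r|f|^2 + |g|^2/r and takes r to be the quotient of the norms.
  If one norm vanishes there is no optimal r, so r is taken very large or very small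
  instead.\<close>

lemma Cauchy_Schwarz_L2:
  assumes f: "L2 M f" and g: "L2 M g"
  shows "cmod (ip M f g) \<le> nm M f * nm M g"
proof -
  have *: "2 * cmod (ip M f g) \<le> r * (nm M f)\<^sup>2 + (nm M g)\<^sup>2 / r" if "r > 0" for r
  proof -
    have "cmod (ip M f g) \<le> (LINT x|M. cmod (cnj (f x) * g x))"
      unfolding ip_def by (rule integral_norm_bound)
    also have "\<dots> \<le> (LINT x|M. r/2 * (cmod (f x))\<^sup>2 + (1/(2*r)) * (cmod (g x))\<^sup>2)"
    proof (rule integral_mono)
      fix x
      have "0 \<le> (r * cmod (f x) - cmod (g x))\<^sup>2" by simp
      then have "2 * r * (cmod (f x) * cmod (g x)) \<le> r\<^sup>2 * (cmod (f x))\<^sup>2 + (cmod (g x))\<^sup>2"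
        unfolding power2_diff by (simp add: power_mult_distrib mult.assoc)
      then show "cmod (cnj (f x) * g x) \<le> r/2 * (cmod (f x))\<^sup>2 + (1/(2*r)) * (cmod (g x))\<^sup>2"
        using that by (simp add: norm_mult field_simps power2_eq_square)
    qed (use f g in \<open>auto simp: L2_def intro!: integrable_norm ip_integrable\<close>)
    also have "\<dots> = r/2 * (nm M f)\<^sup>2 + (1/(2*r)) * (nm M g)\<^sup>2"
      unfolding nm_sq using f g by (subst Bochner_Integration.integral_add) (auto simp: L2_def)
    finally show ?thesis using that by (simp add: field_simps)
  qed
  consider "nm M f = 0" | "nm M g = 0" | "nm M f > 0" "nm M g > 0"
    using nm_nonneg[of M f] nm_nonneg[of M g] by linarith
  then show ?thesis
  proof cases
    case 1
    have "cmod (ip M f g) \<le> e" if "e > 0" for e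
    proof -
      have p: "(nm M g)\<^sup>2 + 1 > 0" by (simp add: add_nonneg_pos)
      have "2 * cmod (ip M f g) \<le> (nm M g)\<^sup>2 / (((nm M g)\<^sup>2+1)/e)"
        using *[of "((nm M g)\<^sup>2+1)/e"] 1 that p by simp
      also have "\<dots> \<le> e" using that p by (simp add: field_simps)
      finally show ?thesis using norm_ge_zero[of "ip M f g"] by linarith
    qed
    then show ?thesis using 1 field_le_epsilon[of "cmod (ip M f g)" 0] by simp
  next
    case 2
    have "cmod (ip M f g) \<le> e" if "e > 0" for e
    proof -
      have p: "(nm M f)\<^sup>2 + 1 > 0" by (simp add: add_nonneg_pos)
      have "2 * cmod (ip M f g) \<le> e / ((nm M f)\<^sup>2+1) * (nm M f)\<^sup>2"
        using *[of "e/((nm M f)\<^sup>2+1)"] 2 that p by simp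
      also have "\<dots> \<le> e" using that p by (simp add: field_simps)
      finally show ?thesis using norm_ge_zero[of "ip M f g"] by linarith
    qed
    then show ?thesis using 2 field_le_epsilon[of "cmod (ip M f g)" 0] by simp
  next
    case 3
    then show ?thesis using *[of "nm M g / nm M f"] by (simp add: power2_eq_square field_simps)
  qed
qed

lemma nm_add_sq:
  assumes "L2 M f" "L2 M g"
  shows "(nm M (\<lambda>x. f x + g x))\<^sup>2 = (nm M f)\<^sup>2 + (nm M g)\<^sup>2 + 2 * Re (ip M f g)"
proof -
  have "complex_of_real ((nm M (\<lambda>x. f x + g x))\<^sup>2) = ip M f f + ip M f g + cnj (ip M f g) + ip M g g"
    unfolding ip_self[symmetric] ip_cnj using assms by (simp add: ip_add_left ip_add_right L2_add)
  from arg_cong[OF this, of Re] show ?thesis by (simp add: ip_self)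
qed

lemma nm_triangle:
  assumes "L2 M f" "L2 M g" shows "nm M (\<lambda>x. f x + g x) \<le> nm M f + nm M g"
proof (rule power2_le_imp_le)
  show "(nm M (\<lambda>x. f x + g x))\<^sup>2 \<le> (nm M f + nm M g)\<^sup>2"
    using Cauchy_Schwarz_L2[OF assms] complex_Re_le_cmod[of "ip M f g"]
    unfolding nm_add_sq[OF assms] power2_sum by (simp add: algebra_simps)
qed auto

lemma nm_triangle_diff:
  assumes "L2 M f" "L2 M g" "L2 M h"
  shows "nm M (\<lambda>x. f x - h x) \<le> nm M (\<lambda>x. f x - g x) + nm M (\<lambda>x. g x - h x)"
  using nm_triangle[of M "\<lambda>x. f x - g x" "\<lambda>x. g x - h x"] assms by (simp add: L2_diff)

lemma nm_diff_le:
  assumes "L2 M f" "L2 M g" shows "nm M (\<lambda>x. f x - g x) \<le> nm M f + nm M g"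
  using nm_triangle_diff[of M f "\<lambda>_. 0" g] assms nm_minus_commute[of M "\<lambda>_. 0" g] by simp

lemma nm_abs_diff:
  assumes "L2 M f" "L2 M g" shows "\<bar>nm M f - nm M g\<bar> \<le> nm M (\<lambda>x. f x - g x)"
  using nm_triangle[of M "\<lambda>x. f x - g x" g] nm_triangle[of M "\<lambda>x. g x - f x" f] assms
    nm_minus_commute[of M f g] by (simp add: L2_diff)

lemma nm_eq_0_AE:
  assumes "L2 M f" "nm M f = 0" shows "AE x in M. f x = 0"
  using assms integral_nonneg_eq_0_iff_AE[OF L2_integrable[OF assms(1)]] by (auto simp: nm_def)

lemma L2_eqI:
  assumes f: "L2 M f" and g: "L2 M g" and eq: "\<And>h. L2 M h \<Longrightarrow> ip M h f = ip M h g"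
  shows "AE x in M. f x = g x"
proof -
  let ?d = "\<lambda>x. f x - g x"
  have "ip M ?d ?d = 0"
    using eq[OF L2_diff[OF f g]] f g by (simp add: ip_diff_right L2_diff)
  then have "nm M ?d = 0" by (simp add: ip_self)
  from nm_eq_0_AE[OF L2_diff[OF f g] this] show ?thesis by simp
qed

section \<open>Convergence in norm, completeness and the Riesz representation theorem\<close>

lemma tendsto_ip:
  assumes "\<And>n. L2 M (f n)" "\<And>n. L2 M (g n)" "L2 M f'" "L2 M g'"
    and f: "((\<lambda>n. nm M (\<lambda>x. f n x - f' x)) \<longlongrightarrow> 0) F" and g: "((\<lambda>n. nm M (\<lambda>x. g n x - g' x)) \<longlongrightarrow> 0) F"
  shows "((\<lambda>n. ip M (f n) (g n)) \<longlongrightarrow> ip M f' g') F"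
proof -
  let ?a = "\<lambda>n. nm M (\<lambda>x. f n x - f' x)" and ?b = "\<lambda>n. nm M (\<lambda>x. g n x - g' x)"
  have bd: "norm (ip M (f n) (g n) - ip M f' g') \<le> ?a n * (?b n + nm M g') + nm M f' * ?b n" for n
  proof -
    have "ip M (f n) (g n) - ip M f' g' = ip M (\<lambda>x. f n x - f' x) (g n) + ip M f' (\<lambda>x. g n x - g' x)"
      using assms by (simp add: ip_diff_left ip_diff_right)
    also have "norm \<dots> \<le> ?a n * nm M (g n) + nm M f' * ?b n"
      using assms by (intro norm_triangle_le add_mono Cauchy_Schwarz_L2) (auto simp: L2_diff)
    also have "\<dots> \<le> ?a n * (?b n + nm M g') + nm M f' * ?b n"
      using nm_triangle[of M "\<lambda>x. g n x - g' x" g'] assms by (intro add_mono mult_left_mono) (auto simp: L2_diff)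
    finally show ?thesis .
  qed
  have "((\<lambda>n. ?a n * (?b n + nm M g') + nm M f' * ?b n) \<longlongrightarrow> 0 * (0 + nm M g') + nm M f' * 0) F"
    by (intro tendsto_intros f g)
  then have "((\<lambda>n. ip M (f n) (g n) - ip M f' g') \<longlongrightarrow> 0) F"
    by (intro Lim_null_comparison[OF always_eventually[rule_format, OF bd]]) simp
  then show ?thesis by (simp add: LIM_zero_iff)
qed

lemma tendsto_nm:
  assumes "\<And>n. L2 M (f n)" "L2 M f'"
    and f: "((\<lambda>n. nm M (\<lambda>x. f n x - f' x)) \<longlongrightarrow> 0) F"
  shows "((\<lambda>n. nm M (f n)) \<longlongrightarrow> nm M f') F"
proof -
  have "((\<lambda>n. nm M (f n) - nm M f') \<longlongrightarrow> 0) F"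
    by (rule Lim_null_comparison[OF always_eventually f]) (use assms nm_abs_diff in auto)
  then show ?thesis by (simp add: LIM_zero_iff)
qed

text \<open>Riesz-Fischer. Along a rapidly Cauchy subsequence with increments d_k, the weighted
  squares 2^k |d_k|^2 are summed instead of the moduli: their integrals are at most 2^(-k), so
  almost everywhere they are bounded and |d_k| = O(2^(-k/2)) is summable. This avoids a countable
  Minkowski inequality.\<close>

lemma L2_complete:
  fixes f :: "nat \<Rightarrow> 'a \<Rightarrow> complex"
  assumes f: "\<And>n. L2 M (f n)"
    and cauchy: "\<And>e. e > 0 \<Longrightarrow> \<exists>N. \<forall>m\<ge>N. \<forall>n\<ge>N. nm M (\<lambda>x. f m x - f n x) < e"
  shows "\<exists>g. L2 M g \<and> (\<lambda>n. nm M (\<lambda>x. f n x - g x)) \<longlonglongrightarrow> 0"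
proof -
  have [measurable]: "f n \<in> borel_measurable M" for n using f[of n] by (rule L2_measurable)
  obtain N where N: "\<And>k m n. m \<ge> N k \<Longrightarrow> n \<ge> N k \<Longrightarrow> nm M (\<lambda>x. f m x - f n x) < (1/2)^k"
    using cauchy[of "(1/2)^_"] by (simp only: zero_less_power half_gt_zero zero_less_one) metis
  \<comment> \<open>Summing all earlier thresholds makes \<open>r k\<close> exceed
    \<open>N j\<close> for every j \<le> k, so \<open>N\<close> need not be monotone.\<close>
  define r where "r k = k + (\<Sum>j\<le>k. N j)" for k
  have rN: "r k \<ge> N j" if "j \<le> k" for j k
    unfolding r_def using member_le_sum[of j "{..k}" N] that by auto
  let ?d = "\<lambda>k x. f (r (Suc k)) x - f (r k) x"
  have d: "nm M (?d k) < (1/2)^k" for k by (intro N rN) auto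
  have "(\<integral>\<^sup>+x. (\<Sum>k. ennreal (2^k * (cmod (?d k x))\<^sup>2)) \<partial>M) = (\<Sum>k. \<integral>\<^sup>+x. ennreal (2^k * (cmod (?d k x))\<^sup>2) \<partial>M)"
    by (intro nn_integral_suminf) measurable
  also have "\<dots> \<le> (\<Sum>k. ennreal ((1/2)^k))"
  proof (intro suminf_le)
    fix k
    have "(\<integral>\<^sup>+x. ennreal (2^k * (cmod (?d k x))\<^sup>2) \<partial>M) = ennreal (2^k * (nm M (?d k))\<^sup>2)"
      using L2_diff[OF f f, of "r (Suc k)" "r k"]
      by (simp add: ennreal_mult nn_integral_cmult nn_integral_nm[symmetric])
    also have "\<dots> \<le> ennreal (2^k * ((1/2)^k)\<^sup>2)"
      using d[of k] by (intro ennreal_leI mult_left_mono power_mono) auto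
    also have "\<dots> = ennreal ((1/2)^k)" by (simp add: power2_eq_square power_divide)
    finally show "(\<integral>\<^sup>+x. ennreal (2^k * (cmod (?d k x))\<^sup>2) \<partial>M) \<le> ennreal ((1/2)^k)" .
  qed auto
  also have "\<dots> < \<infinity>" by (subst suminf_ennreal2) (auto intro: summable_geometric)
  finally have "AE x in M. (\<Sum>k. ennreal (2^k * (cmod (?d k x))\<^sup>2)) \<noteq> \<infinity>"
    by (intro nn_integral_PInf_AE) auto
  then have conv: "AE x in M. convergent (\<lambda>k. f (r k) x)"
  proof eventually_elim
    case (elim x)
    then have "summable (\<lambda>k. 2^k * (cmod (?d k x))\<^sup>2)"
      by (intro summable_suminf_not_top) auto
    from summable_imp_Bseq[OF this] obtain B where "\<And>k. norm (2^k * (cmod (?d k x))\<^sup>2) \<le> B"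
      by (auto simp: Bseq_def)
    then have B: "2^k * (cmod (?d k x))\<^sup>2 \<le> B" for k
      by (metis abs_le_D1 real_norm_def)
    have "summable (\<lambda>k. ?d k x)"
    proof (rule summable_comparison_test)
      show "\<exists>N. \<forall>n\<ge>N. norm (?d n x) \<le> sqrt B * (sqrt (1/2))^n"
      proof (intro exI allI impI)
        fix k
        have "(cmod (?d k x))\<^sup>2 \<le> B * (1/2)^k"
          using B[of k] by (simp add: field_simps power_divide)
        from real_sqrt_le_mono[OF this] show "norm (?d k x) \<le> sqrt B * (sqrt (1/2))^k"
          by (simp add: real_sqrt_mult real_sqrt_power)
      qed
      show "summable (\<lambda>k. sqrt B * (sqrt (1/2))^k)"
        by (intro summable_mult summable_geometric) (simp add: real_sqrt_divide)
    qed
    then have "convergent (\<lambda>n. \<Sum>k<n. ?d k x)" by (rule summable_iff_convergent[THEN iffD1])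
    then have "convergent (\<lambda>n. f (r n) x - f (r 0) x)" by (simp only: sum_lessThan_telescope[of "\<lambda>k. f (r k) x"])
    then have "convergent (\<lambda>n. (f (r n) x - f (r 0) x) + f (r 0) x)" by (intro convergent_add convergent_const)
    then show ?case by simp
  qed
  define g where "g x = lim (\<lambda>k. f (r k) x)" for x
  have [measurable]: "g \<in> borel_measurable M" unfolding g_def by measurable
  have lim: "AE x in M. (\<lambda>k. f (r k) x) \<longlonglongrightarrow> g x"
    using conv by eventually_elim (auto simp: g_def convergent_LIMSEQ_iff)
  \<comment> \<open>Fatou's lemma along the subsequence; square integrability of the difference, and
    hence of the limit, comes from the same bound.\<close>
  have bd: "L2 M (\<lambda>x. f n x - g x) \<and> nm M (\<lambda>x. f n x - g x) \<le> (1/2)^k" if "n \<ge> N k" for n k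
  proof -
    have "(\<integral>\<^sup>+x. ennreal ((cmod (f n x - g x))\<^sup>2) \<partial>M) \<le> (\<integral>\<^sup>+x. liminf (\<lambda>j. ennreal ((cmod (f n x - f (r j) x))\<^sup>2)) \<partial>M)"
    proof (rule nn_integral_mono_AE, use lim in eventually_elim)
      case (elim x)
      have "(\<lambda>j. ennreal ((cmod (f n x - f (r j) x))\<^sup>2)) \<longlonglongrightarrow> ennreal ((cmod (f n x - g x))\<^sup>2)"
        using elim by (intro tendsto_intros)
      from lim_imp_Liminf[OF sequentially_bot this] show ?case by simp
    qed
    also have "\<dots> \<le> liminf (\<lambda>j. \<integral>\<^sup>+x. ennreal ((cmod (f n x - f (r j) x))\<^sup>2) \<partial>M)"
      by (intro nn_integral_liminf) measurable
    also have "\<dots> \<le> liminf (\<lambda>j. ennreal (((1/2)^k)\<^sup>2))"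
    proof (rule Liminf_mono, rule eventually_sequentiallyI[of k])
      fix j assume "k \<le> j"
      then have "nm M (\<lambda>x. f n x - f (r j) x) < (1/2)^k" using that by (intro N rN) auto
      then show "(\<integral>\<^sup>+x. ennreal ((cmod (f n x - f (r j) x))\<^sup>2) \<partial>M) \<le> ennreal (((1/2)^k)\<^sup>2)"
        unfolding nn_integral_nm[OF L2_diff[OF f f]] by (intro ennreal_leI power_mono) auto
    qed
    also have "\<dots> = ennreal (((1/2)^k)\<^sup>2)" by (simp add: Liminf_const)
    finally show ?thesis using L2_I_nn_le[of "\<lambda>x. f n x - g x" M "(1/2)^k"] by simp
  qed
  have g: "L2 M g"
    using L2_diff[OF f[of "N 0"] conjunct1[OF bd[of 0 "N 0"]]] by simp
  have "(\<lambda>n. nm M (\<lambda>x. f n x - g x)) \<longlonglongrightarrow> 0"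
  proof (rule LIMSEQ_I)
    fix e :: real assume "0 < e"
    then obtain k where k: "(1/2)^k < e" using real_arch_pow_inv[of e "1/2"] by auto
    show "\<exists>no. \<forall>n\<ge>no. norm (nm M (\<lambda>x. f n x - g x) - 0) < e"
      using bd[of k] k by (intro exI[of _ "N k"]) (auto intro: order_le_less_trans)
  qed
  with g show ?thesis by blast
qed

lemma L2_complete_at_top:
  fixes f :: "real \<Rightarrow> 'a \<Rightarrow> complex"
  assumes f: "\<And>R. L2 M (f R)"
    and cauchy: "\<And>e. e > 0 \<Longrightarrow> \<exists>N. \<forall>R\<ge>N. \<forall>R'\<ge>N. nm M (\<lambda>x. f R x - f R' x) < e"
  shows "\<exists>g. L2 M g \<and> ((\<lambda>R. nm M (\<lambda>x. f R x - g x)) \<longlongrightarrow> 0) at_top"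
proof -
  have "\<exists>g. L2 M g \<and> (\<lambda>n. nm M (\<lambda>x. f (real n) x - g x)) \<longlonglongrightarrow> 0"
  proof (rule L2_complete[OF f])
    fix e :: real assume "e > 0"
    then obtain N where "\<forall>R\<ge>N. \<forall>R'\<ge>N. nm M (\<lambda>x. f R x - f R' x) < e" using cauchy by blast
    then show "\<exists>N. \<forall>m\<ge>N. \<forall>n\<ge>N. nm M (\<lambda>x. f (real m) x - f (real n) x) < e"
      by (intro exI[of _ "nat \<lceil>N\<rceil>"]) (auto simp: nat_le_iff ceiling_le_iff)
  qed
  then obtain g where g: "L2 M g" and lim: "(\<lambda>n. nm M (\<lambda>x. f (real n) x - g x)) \<longlonglongrightarrow> 0" by blast
  have "((\<lambda>R. nm M (\<lambda>x. f R x - g x)) \<longlongrightarrow> 0) at_top"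
  proof (rule tendstoI)
    fix e :: real assume e: "e > 0"
    then obtain N where N: "\<And>R R'. R \<ge> N \<Longrightarrow> R' \<ge> N \<Longrightarrow> nm M (\<lambda>x. f R x - f R' x) < e/2"
      using cauchy[of "e/2"] by auto
    obtain n0 where n0: "\<And>n. n \<ge> n0 \<Longrightarrow> nm M (\<lambda>x. f (real n) x - g x) < e/2"
      using LIMSEQ_D[OF lim, of "e/2"] e by auto
    define n where "n = max n0 (nat \<lceil>N\<rceil>)"
    have n: "n \<ge> n0" "real n \<ge> N" unfolding n_def by linarith+
    show "\<forall>\<^sub>F R in at_top. dist (nm M (\<lambda>x. f R x - g x)) 0 < e"
      using eventually_ge_at_top[of N]
    proof eventually_elim
      case (elim R)
      show ?case
        using nm_triangle_diff[OF f[of R] f[of "real n"] g] N[OF elim n(2)] n0[OF n(1)] by simp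
    qed
  qed
  with g show ?thesis by blast
qed

text \<open>The representative is the minimiser of J f = |f|^2 - 2 Re (l f), which is bounded below
  by completing the square. The parallelogram law at the midpoint makes a minimising sequence
  Cauchy, and the first variation of J at its limit gives the real part of the identity; the
  imaginary part follows by inserting \<i> f.\<close>

lemma L2_Riesz:
  fixes l :: "('a \<Rightarrow> complex) \<Rightarrow> complex"
  assumes add: "\<And>f g. L2 M f \<Longrightarrow> L2 M g \<Longrightarrow> l (\<lambda>x. f x + g x) = l f + l g"
    and scale: "\<And>c f. L2 M f \<Longrightarrow> l (\<lambda>x. c * f x) = c * l f"
    and bd: "\<And>f. L2 M f \<Longrightarrow> cmod (l f) \<le> K * nm M f"
  shows "\<exists>q. L2 M q \<and> (\<forall>f. L2 M f \<longrightarrow> l f = ip M q f)"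
proof -
  define J where "J f = (nm M f)\<^sup>2 - 2 * Re (l f)" for f
  have Jlb: "J f \<ge> - K\<^sup>2" if "L2 M f" for f
  proof -
    have "Re (l f) \<le> K * nm M f" using bd[OF that] complex_Re_le_cmod order_trans by blast
    moreover have "0 \<le> (nm M f - K)\<^sup>2" by simp
    ultimately show ?thesis unfolding J_def power2_diff by (simp add: algebra_simps)
  qed
  define d where "d = Inf (J ` Collect (L2 M))"
  have bdd: "bdd_below (J ` Collect (L2 M))" using Jlb by (auto intro!: bdd_belowI[of _ "- K\<^sup>2"])
  have dle: "d \<le> J f" if "L2 M f" for f unfolding d_def using that bdd by (intro cInf_lower) auto
  have "\<exists>f. L2 M f \<and> J f < d + 1 / Suc n" for n
  proof -
    have "J ` Collect (L2 M) \<noteq> {}" by (auto intro: exI[of _ "\<lambda>_. 0"])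
    from cInf_lessD[OF this, of "d + 1 / Suc n"] show ?thesis unfolding d_def by auto
  qed
  then obtain f where f: "\<And>n. L2 M (f n)" and Jf: "\<And>n. J (f n) < d + 1 / Suc n" by metis
  have par: "(nm M (\<lambda>x. u x - v x))\<^sup>2 \<le> 2 * (J u - d) + 2 * (J v - d)" if u: "L2 M u" and v: "L2 M v" for u v
  proof -
    let ?w = "\<lambda>x. (1/2) * (u x + v x)"
    define jw where "jw = J ?w"
    define s where "s = (nm M (\<lambda>x. u x + v x))\<^sup>2"
    define t where "t = (nm M (\<lambda>x. u x - v x))\<^sup>2"
    have "s = (nm M u)\<^sup>2 + (nm M v)\<^sup>2 + 2 * Re (ip M u v)"
      unfolding s_def by (rule nm_add_sq[OF u v])
    moreover have "t = (nm M u)\<^sup>2 + (nm M v)\<^sup>2 - 2 * Re (ip M u v)"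
      using nm_add_sq[OF u L2_scale[OF v, of "-1"]] nm_scale[of M "-1" v] ip_scale_right[of M u "-1" v] by (simp add: t_def)
    moreover have "jw = s / 4 - (Re (l u) + Re (l v))"
      unfolding jw_def s_def J_def scale[OF L2_add[OF u v]] add[OF u v] nm_scale by (simp add: power_mult_distrib power_divide field_simps)
    moreover have "d \<le> jw" unfolding jw_def by (rule dle[OF L2_scale[OF L2_add[OF u v]]])
    moreover have "J u = (nm M u)\<^sup>2 - 2 * Re (l u)" "J v = (nm M v)\<^sup>2 - 2 * Re (l v)"
      by (simp_all add: J_def)
    ultimately have "t \<le> 2 * (J u - d) + 2 * (J v - d)" by argo
    then show ?thesis by (simp add: t_def)
  qed
  have "\<exists>q. L2 M q \<and> (\<lambda>n. nm M (\<lambda>x. f n x - q x)) \<longlonglongrightarrow> 0"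
  proof (rule L2_complete[OF f])
    fix e :: real assume e: "e > 0"
    obtain N :: nat where N: "4 / e\<^sup>2 < real N" using reals_Archimedean2 by blast
    have e2: "1 / real (Suc n) < e\<^sup>2 / 4" if "n \<ge> N" for n
    proof -
      have "4 / e\<^sup>2 < real (Suc n)" using N that by linarith
      then show ?thesis using e by (simp add: field_simps)
    qed
    show "\<exists>N. \<forall>m\<ge>N. \<forall>n\<ge>N. nm M (\<lambda>x. f m x - f n x) < e"
    proof (intro exI allI impI)
      fix m n assume mn: "N \<le> m" "N \<le> n"
      have "(nm M (\<lambda>x. f m x - f n x))\<^sup>2 < e\<^sup>2"
        using par[OF f f, of m n] Jf[of m] Jf[of n] e2[OF mn(1)] e2[OF mn(2)] by argo
      from power2_less_imp_less[OF this] e show "nm M (\<lambda>x. f m x - f n x) < e" by simp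
    qed
  qed
  then obtain q where q: "L2 M q" and lim: "(\<lambda>n. nm M (\<lambda>x. f n x - q x)) \<longlonglongrightarrow> 0" by blast
  have l_diff: "l (\<lambda>x. u x - v x) = l u - l v" if "L2 M u" "L2 M v" for u v
    using add[OF that(1) L2_scale[OF that(2), of "-1"]] scale[OF that(2), of "-1"] by simp
  have "(\<lambda>n. l (f n) - l q) \<longlonglongrightarrow> 0"
  proof (rule Lim_null_comparison)
    show "\<forall>\<^sub>F n in sequentially. norm (l (f n) - l q) \<le> K * nm M (\<lambda>x. f n x - q x)"
      using bd[OF L2_diff[OF f q]] by (simp add: l_diff f q)
    show "(\<lambda>n. K * nm M (\<lambda>x. f n x - q x)) \<longlonglongrightarrow> 0" using tendsto_mult[OF tendsto_const lim, of K] by simp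
  qed
  then have "(\<lambda>n. l (f n)) \<longlonglongrightarrow> l q" by (simp add: LIM_zero_iff)
  then have "(\<lambda>n. J (f n)) \<longlonglongrightarrow> J q" unfolding J_def
    by (intro tendsto_intros tendsto_nm[OF f q lim])
  moreover have "(\<lambda>n. d + 1 / real (Suc n)) \<longlonglongrightarrow> d + 0" by (intro tendsto_intros LIMSEQ_Suc[OF lim_1_over_n])
  ultimately have "J q \<le> d + 0" by (intro LIMSEQ_le) (use Jf less_imp_le in blast)+
  then have Jq: "J q \<le> J f" if "L2 M f" for f using dle[OF that] by simp
  have Re: "Re (l f) = Re (ip M q f)" if f: "L2 M f" for f
  proof -
    have ineq: "0 \<le> c\<^sup>2 * (nm M f)\<^sup>2 + c * (2 * (Re (ip M q f) - Re (l f)))" for c :: real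
    proof -
      have cf: "L2 M (\<lambda>x. complex_of_real c * f x)" by (rule L2_scale[OF f])
      have "J (\<lambda>x. q x + complex_of_real c * f x) =
          J q + c\<^sup>2 * (nm M f)\<^sup>2 + c * (2 * (Re (ip M q f) - Re (l f)))"
        unfolding J_def nm_add_sq[OF q cf] add[OF q cf] scale[OF f] ip_scale_right nm_scale
        by (simp add: power_mult_distrib algebra_simps)
      then show ?thesis using Jq[OF L2_add[OF q cf]] by simp
    qed
    \<comment> \<open>The variation is tested with the step - D / A, close to the minimiser of the
      quadratic in c. Adding one to the squared norm in \<open>A\<close> keeps the division valid
      when f vanishes.\<close>
    define D where "D = Re (ip M q f) - Re (l f)"
    define A where "A = (nm M f)\<^sup>2 + 1"
    have A: "A > 0" by (simp add: A_def add_nonneg_pos)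
    have "0 \<le> (-(D/A))\<^sup>2 * (nm M f)\<^sup>2 + (-(D/A)) * (2 * D)" using ineq[of "-(D/A)"] by (simp add: D_def)
    also have "\<dots> \<le> (D/A)\<^sup>2 * A - 2 * (D/A) * D"
      using mult_left_mono[of "(nm M f)\<^sup>2" A "(D/A)\<^sup>2"] by (simp add: A_def mult_ac)
    also have "\<dots> = - (D\<^sup>2 / A)" using A by (simp add: power2_eq_square field_simps)
    finally have "D\<^sup>2 / A \<le> 0" by simp
    then have "D = 0" using A by (simp add: divide_le_0_iff)
    then show ?thesis by (simp add: D_def)
  qed
  have "l f = ip M q f" if f: "L2 M f" for f
  proof (rule complex_eqI)
    show "Re (l f) = Re (ip M q f)" by (rule Re[OF f])
    show "Im (l f) = Im (ip M q f)"
      using Re[OF L2_scale[OF f, of "\<i>"]] by (simp add: scale[OF f] ip_scale_right)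
  qed
  with q show ?thesis by blast
qed

section \<open>The Fourier integral on integrable functions\<close>

lemma cis_measurable'[measurable (raw)]:
  "f \<in> borel_measurable M \<Longrightarrow> (\<lambda>x. cis (f x)) \<in> borel_measurable M"
  by (rule borel_measurable_continuous_on[of cis]) (auto intro!: continuous_intros)

section \<open>Products of one-dimensional integrals and affine changes of variables\<close>

lemma prod_Basis_vec: "(\<Prod>b\<in>Basis. f b) = (\<Prod>i\<in>UNIV. f (axis i (1::real) :: real^'n))"
proof -
  have *: "Basis = (\<lambda>i. axis i (1::real) :: real^'n) ` UNIV" by (auto simp: Basis_vec_def)
  have "inj (\<lambda>i. axis i (1::real) :: real^'n)" by (auto simp: inj_def axis_eq_axis)
  from prod.reindex[OF this, of f] show ?thesis unfolding * by (simp add: o_def)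
qed

text \<open>\<open>lborel\<close> is the image of a product measure indexed by the basis vectors;
  \<open>ix\<close> translates a basis vector back into its coordinate index.\<close>

lemma
  fixes f :: "'n::finite \<Rightarrow> real \<Rightarrow> complex"
  assumes f: "\<And>i. integrable lborel (f i)"
  shows lborel_integral_prod_vec: "(LINT x|lborel. (\<Prod>i\<in>UNIV. f i ((x::real^'n) $ i))) = (\<Prod>i\<in>UNIV. LINT t|lborel. f i t)" (is ?a)
    and lborel_integrable_prod_vec: "integrable lborel (\<lambda>x::real^'n. \<Prod>i\<in>UNIV. f i (x $ i))" (is ?b)
proof -
  define ix :: "real^'n \<Rightarrow> 'n" where "ix b = (SOME i. b = axis i 1)" for b
  have ix: "ix (axis i 1) = i" for i
    unfolding ix_def by (rule some1_equality) (auto simp: axis_eq_axis)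
  interpret product_sigma_finite "\<lambda>_::real^'n. lborel :: real measure" by standard
  have [measurable]: "f i \<in> borel_measurable borel" for i using f[of i] by simp
  have eq: "(\<Prod>i\<in>UNIV. f i ((\<Sum>b\<in>Basis. g b *\<^sub>R b) $ i)) = (\<Prod>b\<in>(Basis::(real^'n) set). f (ix b) (g b))"
    for g :: "real^'n \<Rightarrow> real"
  proof -
    have "(\<Sum>b\<in>Basis. g b *\<^sub>R b) $ i = g (axis i 1)" for i
    proof -
      have "(\<Sum>b\<in>Basis. g b *\<^sub>R b) $ i = (\<Sum>b\<in>Basis. g b *\<^sub>R b) \<bullet> axis i 1" by (simp add: inner_axis)
      also have "\<dots> = g (axis i 1)" by (rule inner_sum_left_Basis) (auto simp: Basis_vec_def)
      finally show ?thesis .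
    qed
    then show ?thesis by (simp add: prod_Basis_vec ix)
  qed
  have int: "integrable (PiM (Basis::(real^'n) set) (\<lambda>_. lborel :: real measure)) (\<lambda>g. \<Prod>b\<in>Basis. f (ix b) (g b))"
    by (rule product_integrable_prod) (auto intro: f)
  have val: "(LINT g|(PiM (Basis::(real^'n) set) (\<lambda>_. lborel :: real measure)). (\<Prod>b\<in>Basis. f (ix b) (g b))) = (\<Prod>b\<in>(Basis::(real^'n) set). LINT t|lborel. f (ix b) t)"
    by (rule product_integral_prod) (auto intro: f)
  have meas: "(\<lambda>g. \<Sum>b\<in>Basis. g b *\<^sub>R b) \<in> measurable (PiM (Basis::(real^'n) set) (\<lambda>_. lborel :: real measure)) borel"
    by measurable
  have meas2: "(\<lambda>x::real^'n. \<Prod>i\<in>UNIV. f i (x $ i)) \<in> borel_measurable borel" by measurable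
  show ?a
    by (subst lborel_eq, subst integral_distr[OF meas meas2]) (simp only: eq val, simp only: prod_Basis_vec ix)
  show ?b
    by (subst lborel_eq, subst integrable_distr_eq[OF meas meas2]) (simp only: eq int)
qed

lemma
  fixes f :: "'a::euclidean_space \<Rightarrow> 'b::{banach, second_countable_topology}"
  assumes [measurable]: "f \<in> borel_measurable borel" and c: "c \<noteq> 0"
  shows lborel_integral_affine: "(LINT x|lborel. f x) = \<bar>c\<bar> ^ DIM('a) *\<^sub>R (LINT x|lborel. f (t + c *\<^sub>R x))" (is ?a)
    and lborel_integrable_affine: "integrable lborel (\<lambda>x. f (t + c *\<^sub>R x)) \<longleftrightarrow> integrable lborel f" (is ?b)
proof -
  have *: "(lborel::'a measure) = density (distr lborel borel (\<lambda>x. t + c *\<^sub>R x)) (\<lambda>_. ennreal (\<bar>c\<bar> ^ DIM('a)))"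
    using lborel_affine[OF c, of t] by simp
  show ?a
    by (subst *, subst integral_density) (auto simp: integral_distr)
  show ?b
  proof -
    let ?k = "\<bar>c\<bar> ^ DIM('a)"
    have "integrable lborel f \<longleftrightarrow> integrable lborel (\<lambda>x. ?k *\<^sub>R f (t + c *\<^sub>R x))"
      by (subst *, subst integrable_density) (auto simp: integrable_distr_eq)
    also have "\<dots> \<longleftrightarrow> integrable lborel (\<lambda>x. f (t + c *\<^sub>R x))"
      using integrable_scaleR_right[of "1 / ?k" lborel "\<lambda>x. ?k *\<^sub>R f (t + c *\<^sub>R x)"] c by auto
    finally show ?thesis by simp
  qed
qed

lemma lborel_nn_integral_translate:
  fixes f :: "'a::euclidean_space \<Rightarrow> ennreal"
  assumes [measurable]: "f \<in> borel_measurable borel"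
  shows "(\<integral>\<^sup>+x. f (t + x) \<partial>lborel) = (\<integral>\<^sup>+x. f x \<partial>lborel)"
proof -
  have "(\<integral>\<^sup>+x. f x \<partial>lborel) = (\<integral>\<^sup>+x. f x \<partial>distr lborel borel ((+) t))" by (simp add: lborel_distr_plus)
  also have "\<dots> = (\<integral>\<^sup>+x. f (t + x) \<partial>lborel)" by (subst nn_integral_distr) auto
  finally show ?thesis by simp
qed

lemma
  assumes "L2 (lborel::'a::euclidean_space measure) f"
  shows L2_translate: "L2 lborel (\<lambda>x. f (t + x))"
    and nm_translate: "nm lborel (\<lambda>x. f (t + x)) = nm lborel f"
proof -
  have [measurable]: "f \<in> borel_measurable borel" using assms by (simp add: L2_def)
  show "L2 lborel (\<lambda>x. f (t + x))"
    using lborel_integrable_affine[of "\<lambda>x. (cmod (f x))\<^sup>2" 1 t] assms by (simp add: L2_def)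
  show "nm lborel (\<lambda>x. f (t + x)) = nm lborel f"
    using lborel_integral_affine[of "\<lambda>x. (cmod (f x))\<^sup>2" 1 t] by (simp add: nm_def)
qed

subsection \<open>Continuity of translations in the mean\<close>

text \<open>These functions form a closed subspace, and the lemmas below enlarge it from indicators
  of open sets to all of L2. Sequences suffice because the property is used under dominated
  convergence along a sequence.\<close>

definition translation_continuous :: "('a::euclidean_space \<Rightarrow> complex) \<Rightarrow> bool" where
  "translation_continuous f \<longleftrightarrow> L2 lborel f \<and>
     (\<forall>Z. Z \<longlonglongrightarrow> 0 \<longrightarrow> (\<lambda>k. nm lborel (\<lambda>x. f (Z k + x) - f x)) \<longlonglongrightarrow> 0)"

lemma translation_continuous_add:
  assumes "translation_continuous f" "translation_continuous g"
  shows "translation_continuous (\<lambda>x. f x + g x)"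
  unfolding translation_continuous_def
proof (intro conjI allI impI)
  have L: "L2 lborel f" "L2 lborel g" using assms by (auto simp: translation_continuous_def)
  then show "L2 lborel (\<lambda>x. f x + g x)" by (rule L2_add)
  fix Z :: "nat \<Rightarrow> 'a" assume Z: "Z \<longlonglongrightarrow> 0"
  have lim: "(\<lambda>k. nm lborel (\<lambda>x. f (Z k + x) - f x) + nm lborel (\<lambda>x. g (Z k + x) - g x)) \<longlonglongrightarrow> 0 + 0"
    using assms Z by (intro tendsto_add) (auto simp: translation_continuous_def)
  show "(\<lambda>k. nm lborel (\<lambda>x. f (Z k + x) + g (Z k + x) - (f x + g x))) \<longlonglongrightarrow> 0"
  proof (rule tendsto_sandwich[OF _ _ tendsto_const])
    show "\<forall>\<^sub>F k in sequentially. nm lborel (\<lambda>x. f (Z k + x) + g (Z k + x) - (f x + g x))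
        \<le> nm lborel (\<lambda>x. f (Z k + x) - f x) + nm lborel (\<lambda>x. g (Z k + x) - g x)"
    proof (intro always_eventually allI)
      fix k
      have "(\<lambda>x. f (Z k + x) + g (Z k + x) - (f x + g x)) = (\<lambda>x. (f (Z k + x) - f x) + (g (Z k + x) - g x))"
        by auto
      then show "nm lborel (\<lambda>x. f (Z k + x) + g (Z k + x) - (f x + g x))
        \<le> nm lborel (\<lambda>x. f (Z k + x) - f x) + nm lborel (\<lambda>x. g (Z k + x) - g x)"
        using nm_triangle[OF L2_diff[OF L2_translate[OF L(1)] L(1)] L2_diff[OF L2_translate[OF L(2)] L(2)], of "Z k" "Z k"]
        by simp
    qed
    show "(\<lambda>k. nm lborel (\<lambda>x. f (Z k + x) - f x) + nm lborel (\<lambda>x. g (Z k + x) - g x)) \<longlonglongrightarrow> 0"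
      using lim by simp
  qed auto
qed

lemma translation_continuous_scale:
  assumes "translation_continuous f" shows "translation_continuous (\<lambda>x. c * f x)"
proof -
  have "(\<lambda>k. cmod c * nm lborel (\<lambda>x. f (Z k + x) - f x)) \<longlonglongrightarrow> cmod c * 0" if "Z \<longlonglongrightarrow> 0" for Z
    using assms that by (intro tendsto_mult tendsto_const) (auto simp: translation_continuous_def)
  then show ?thesis
    using assms by (auto simp: translation_continuous_def L2_scale nm_scale right_diff_distrib[symmetric])
qed

lemma translation_continuous_closed:
  assumes f: "L2 lborel f" and ap: "\<And>e. e > 0 \<Longrightarrow> \<exists>h. translation_continuous h \<and> nm lborel (\<lambda>x. f x - h x) \<le> e"
  shows "translation_continuous f"
  unfolding translation_continuous_def
proof (intro conjI allI impI f)
  fix Z :: "nat \<Rightarrow> 'a" assume Z: "Z \<longlonglongrightarrow> 0"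
  show "(\<lambda>k. nm lborel (\<lambda>x. f (Z k + x) - f x)) \<longlonglongrightarrow> 0"
  proof (rule LIMSEQ_I)
    fix e :: real assume e: "0 < e"
    then obtain h where h: "translation_continuous h" and fh: "nm lborel (\<lambda>x. f x - h x) \<le> e/4"
      using ap[of "e/4"] by auto
    have hL: "L2 lborel h" using h by (simp add: translation_continuous_def)
    have "(\<lambda>k. nm lborel (\<lambda>x. h (Z k + x) - h x)) \<longlonglongrightarrow> 0" using h Z by (simp add: translation_continuous_def)
    from LIMSEQ_D[OF this, of "e/4"] e obtain K where K: "\<And>k. k \<ge> K \<Longrightarrow> nm lborel (\<lambda>x. h (Z k + x) - h x) < e/4"
      by auto
    show "\<exists>no. \<forall>n\<ge>no. norm (nm lborel (\<lambda>x. f (Z n + x) - f x) - 0) < e"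
    proof (intro exI allI impI)
      fix k assume k: "K \<le> k"
      have "nm lborel (\<lambda>x. f (Z k + x) - f x) \<le> nm lborel (\<lambda>x. f (Z k + x) - h (Z k + x)) + nm lborel (\<lambda>x. h (Z k + x) - f x)"
        by (intro nm_triangle_diff L2_translate f hL)
      also have "nm lborel (\<lambda>x. f (Z k + x) - h (Z k + x)) = nm lborel (\<lambda>x. f x - h x)"
        by (rule nm_translate[OF L2_diff[OF f hL]])
      also have "nm lborel (\<lambda>x. h (Z k + x) - f x) \<le> nm lborel (\<lambda>x. h (Z k + x) - h x) + nm lborel (\<lambda>x. h x - f x)"
        by (intro nm_triangle_diff L2_translate f hL)
      also have "nm lborel (\<lambda>x. h x - f x) = nm lborel (\<lambda>x. f x - h x)" by (rule nm_minus_commute)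
      finally have "nm lborel (\<lambda>x. f (Z k + x) - f x) < e" using fh K[OF k] e by linarith
      then show "norm (nm lborel (\<lambda>x. f (Z k + x) - f x) - 0) < e" by simp
    qed
  qed
qed

lemma L2_indicator:
  assumes "A \<in> sets M" "emeasure M A < \<infinity>"
  shows "L2 M (indicator A)" "(nm M (indicator A))\<^sup>2 = measure M A"
proof -
  have [simp]: "(\<lambda>x. (cmod (indicator A x))\<^sup>2) = (indicator A :: 'a \<Rightarrow> real)"
    by (auto simp: indicator_def)
  show "L2 M (indicator A)" using assms by (simp add: L2_def)
  show "(nm M (indicator A))\<^sup>2 = measure M A" using assms by (simp add: nm_sq)
qed

text \<open>Translated indicators converge pointwise on U, but not necessarily on its boundary.
  Convergence on U is enough for the inner product of u with its translate, and |u(Z + .) - u|^2 =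
  2|u|^2 - 2 Re <u, u(Z + .)> then gives the norm.\<close>

lemma translation_continuous_open:
  assumes U: "open U" and fin: "emeasure lborel U < \<infinity>"
  shows "translation_continuous (indicator U :: 'a::euclidean_space \<Rightarrow> complex)"
  unfolding translation_continuous_def
proof (intro conjI allI impI)
  have [measurable]: "U \<in> sets borel" using U by auto
  let ?u = "indicator U :: 'a \<Rightarrow> complex"
  show L: "L2 lborel ?u" using fin by (intro L2_indicator) auto
  fix Z :: "nat \<Rightarrow> 'a" assume Z: "Z \<longlonglongrightarrow> 0"
  have "(\<lambda>k. ip lborel ?u (\<lambda>x. ?u (Z k + x))) \<longlonglongrightarrow> ip lborel ?u ?u"
    unfolding ip_def
  proof (rule integral_dominated_convergence[where w="indicator U :: 'a \<Rightarrow> real"])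
    show "AE x in lborel. (\<lambda>k. cnj (?u x) * ?u (Z k + x)) \<longlonglongrightarrow> cnj (?u x) * ?u x"
    proof (rule AE_I2)
      fix x
      show "(\<lambda>k. cnj (?u x) * ?u (Z k + x)) \<longlonglongrightarrow> cnj (?u x) * ?u x"
      proof (cases "x \<in> U")
        case True
        have "(\<lambda>k. Z k + x) \<longlonglongrightarrow> 0 + x" by (intro tendsto_intros Z)
        then have "\<forall>\<^sub>F k in sequentially. Z k + x \<in> U" using U True by (intro topological_tendstoD) auto
        then have "\<forall>\<^sub>F k in sequentially. cnj (?u x) * ?u (Z k + x) = cnj (?u x) * ?u x"
          by eventually_elim (use True in auto)
        then show ?thesis by (rule tendsto_eventually)
      qed simp
    qed
    show "integrable lborel (indicator U :: 'a \<Rightarrow> real)" using fin by simp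
  qed (auto simp: indicator_def)
  then have "(\<lambda>k. Re (ip lborel ?u (\<lambda>x. ?u (Z k + x)))) \<longlonglongrightarrow> Re (ip lborel ?u ?u)"
    by (rule tendsto_Re)
  then have "(\<lambda>k. 2 * (nm lborel ?u)\<^sup>2 - 2 * Re (ip lborel ?u (\<lambda>x. ?u (Z k + x)))) \<longlonglongrightarrow> 2 * (nm lborel ?u)\<^sup>2 - 2 * Re (ip lborel ?u ?u)"
    by (rule tendsto_diff[OF tendsto_const tendsto_mult[OF tendsto_const]])
  moreover have "(nm lborel (\<lambda>x. ?u (Z k + x) - ?u x))\<^sup>2 = 2 * (nm lborel ?u)\<^sup>2 - 2 * Re (ip lborel ?u (\<lambda>x. ?u (Z k + x)))" for k
    using nm_add_sq[OF L2_scale[OF L, of "-1"] L2_translate[OF L, of "Z k"]]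
    by (simp add: ip_scale_left[of _ "-1", simplified] nm_scale[of _ "-1", simplified] nm_translate[OF L])
  ultimately have "(\<lambda>k. (nm lborel (\<lambda>x. ?u (Z k + x) - ?u x))\<^sup>2) \<longlonglongrightarrow> 2 * (nm lborel ?u)\<^sup>2 - 2 * Re (ip lborel ?u ?u)"
    by (simp only:)
  also have "2 * (nm lborel ?u)\<^sup>2 - 2 * Re (ip lborel ?u ?u) = 0" by (simp only: ip_self Re_complex_of_real)
  finally have "(\<lambda>k. (nm lborel (\<lambda>x. ?u (Z k + x) - ?u x))\<^sup>2) \<longlonglongrightarrow> 0" .
  from tendsto_real_sqrt[OF this] show "(\<lambda>k. nm lborel (\<lambda>x. ?u (Z k + x) - ?u x)) \<longlonglongrightarrow> 0" by simp
qed

text \<open>Outer regularity approximates A by an open set, up to an error of small measure.\<close>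

lemma translation_continuous_indicator:
  assumes A: "A \<in> sets borel" and fin: "emeasure lborel A < \<infinity>"
  shows "translation_continuous (indicator A :: 'a::euclidean_space \<Rightarrow> complex)"
proof (rule translation_continuous_closed)
  show L: "L2 lborel (indicator A :: 'a \<Rightarrow> complex)" using A fin by (intro L2_indicator) auto
  fix e :: real assume e: "e > 0"
  obtain U where U: "open U" "A \<subseteq> U" "emeasure lborel (U - A) < ennreal (e\<^sup>2)"
    using outer_regular_lborel[OF A, of "e\<^sup>2"] e by auto
  have sU: "U \<in> sets borel" using U by auto
  have fd: "emeasure lborel (U - A) < \<infinity>" using U(3) by (auto intro: order_less_trans)
  have "emeasure lborel U \<le> emeasure lborel A + emeasure lborel (U - A)"
    using U(2) A sU emeasure_subadditive[of A lborel "U - A"] by (simp add: Un_absorb1)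
  also have "\<dots> < \<infinity>" using fin fd by simp
  finally have fU: "emeasure lborel U < \<infinity>" .
  show "\<exists>h. translation_continuous h \<and> nm lborel (\<lambda>x. indicator A x - h x :: complex) \<le> e"
  proof (intro exI conjI)
    show "translation_continuous (indicator U :: 'a \<Rightarrow> complex)" by (rule translation_continuous_open[OF U(1) fU])
    have "(\<lambda>x. indicator U x - indicator A x :: complex) = indicator (U - A)"
      using U(2) by (auto simp: indicator_def fun_eq_iff)
    then have "(nm lborel (\<lambda>x. indicator A x - indicator U x :: complex))\<^sup>2 = measure lborel (U - A)"
      using L2_indicator(2)[of "U - A" lborel] fd A sU by (simp add: nm_minus_commute[of _ "indicator A"])
    also have "\<dots> \<le> e\<^sup>2" using U(3) by (simp add: measure_def enn2real_leI)
    finally show "nm lborel (\<lambda>x. indicator A x - indicator U x :: complex) \<le> e"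
      by (rule power2_le_imp_le) (use e in simp)
  qed
qed

lemma L2_translation_continuous:
  fixes f :: "'a::euclidean_space \<Rightarrow> complex"
  assumes f: "L2 lborel f" shows "translation_continuous f"
proof (rule translation_continuous_closed[OF f])
  fix e :: real assume e: "e > 0"
  have [measurable]: "f \<in> borel_measurable borel" using f by (simp add: L2_def)
  obtain F where F: "\<And>i. simple_function lborel (F i)" and Flim: "\<And>x. (\<lambda>i. F i x) \<longlonglongrightarrow> f x"
    and Fb: "\<And>i x. dist (F i x) 0 \<le> 2 * dist (f x) 0"
    using borel_measurable_implies_sequence_metric[of f lborel 0] by auto
  have [measurable]: "F i \<in> borel_measurable borel" for i
    using borel_measurable_simple_function[OF F[of i]] by simp
  have FL: "L2 lborel (F i)" for i
    by (rule L2_bound[OF f, where c=2]) (use Fb in auto)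
  have "(\<lambda>i. LINT x|lborel. (cmod (f x - F i x))\<^sup>2) \<longlonglongrightarrow> (LINT x|(lborel::'a measure). 0)"
  proof (rule integral_dominated_convergence[where w="\<lambda>x. (3 * cmod (f x))\<^sup>2"])
    show "integrable lborel (\<lambda>x. (3 * cmod (f x))\<^sup>2)" using f by (simp add: L2_def power_mult_distrib)
    show "AE x in lborel. (\<lambda>i. (cmod (f x - F i x))\<^sup>2) \<longlonglongrightarrow> 0"
    proof (rule AE_I2)
      fix x
      have "(\<lambda>i. (cmod (f x - F i x))\<^sup>2) \<longlonglongrightarrow> (cmod (f x - f x))\<^sup>2" by (intro tendsto_intros Flim)
      then show "(\<lambda>i. (cmod (f x - F i x))\<^sup>2) \<longlonglongrightarrow> 0" by simp
    qed
    show "AE x in lborel. norm ((cmod (f x - F i x))\<^sup>2) \<le> (3 * cmod (f x))\<^sup>2" for i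
    proof (rule AE_I2)
      fix x
      have "cmod (f x - F i x) \<le> 3 * cmod (f x)"
        using norm_triangle_ineq4[of "f x" "F i x"] Fb[of i x] by simp
      then have "(cmod (f x - F i x))\<^sup>2 \<le> (3 * cmod (f x))\<^sup>2" by (intro power_mono) auto
      then show "norm ((cmod (f x - F i x))\<^sup>2) \<le> (3 * cmod (f x))\<^sup>2" by simp
    qed
  qed auto
  then have "(\<lambda>i. nm lborel (\<lambda>x. f x - F i x)) \<longlonglongrightarrow> 0"
    unfolding nm_def using tendsto_real_sqrt by fastforce
  from LIMSEQ_D[OF this e] obtain i where i: "nm lborel (\<lambda>x. f x - F i x) < e" by auto
  have "translation_continuous (F i)"
  proof -
    have fin: "finite (F i ` UNIV)" using simple_functionD(1)[OF F[of i]] by simp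
    have tc: "translation_continuous (\<lambda>x. y * indicator (F i -` {y}) x)" for y
    proof (cases "y = 0")
      case True
      then show ?thesis by (simp add: translation_continuous_def)
    next
      case False
      have s: "F i -` {y} \<in> sets borel" using simple_functionD(2)[OF F[of i], of "{y}"] by simp
      \<comment> \<open>Chebyshev's inequality: a nonzero value of a square-integrable function is
        taken on a set of finite measure only.\<close>
      have "emeasure lborel (F i -` {y}) = (\<integral>\<^sup>+x. indicator (F i -` {y}) x \<partial>lborel)" using s by simp
      also have "\<dots> \<le> (\<integral>\<^sup>+x. ennreal (1 / (cmod y)\<^sup>2) * ennreal ((cmod (F i x))\<^sup>2) \<partial>lborel)"
        using False by (intro nn_integral_mono) (auto simp: indicator_def simp flip: ennreal_mult)
      also have "\<dots> < \<infinity>"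
        using FL[of i] by (subst nn_integral_cmult) (auto simp: nn_integral_nm ennreal_mult_less_top)
      finally show ?thesis
        by (intro translation_continuous_scale translation_continuous_indicator s)
    qed
    have "translation_continuous (\<lambda>x. \<Sum>y\<in>Y. y * indicator (F i -` {y}) x)" if "finite Y" for Y
      using that
    proof (induction Y)
      case empty
      then show ?case by (simp add: translation_continuous_def)
    next
      case (insert y Y)
      show ?case unfolding sum.insert[OF insert(1,2)] by (rule translation_continuous_add[OF tc insert(3)])
    qed
    from this[OF fin] have "translation_continuous (\<lambda>x. \<Sum>y\<in>F i ` UNIV. y * indicator (F i -` {y}) x)" .
    also have "(\<lambda>x. \<Sum>y\<in>F i ` UNIV. y * indicator (F i -` {y}) x) = F i"
    proof
      fix x
      have "(\<Sum>y\<in>F i ` UNIV. y * indicator (F i -` {y}) x) = (\<Sum>y\<in>F i ` UNIV. if y = F i x then y else 0)"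
        by (intro sum.cong) (auto simp: indicator_def)
      then show "(\<Sum>y\<in>F i ` UNIV. y * indicator (F i -` {y}) x) = F i x" using fin by simp
    qed
    finally show ?thesis .
  qed
  with i show "\<exists>h. translation_continuous h \<and> nm lborel (\<lambda>x. f x - h x) \<le> e" by (intro exI[of _ "F i"]) simp
qed

subsection \<open>Plancherel's identity on integrable square-integrable functions\<close>

lemma integrable_cis_mult:
  fixes f :: "'a \<Rightarrow> complex"
  assumes "integrable M f" "g \<in> borel_measurable M"
  shows "integrable M (\<lambda>x. cis (g x) * f x)"
  by (rule Bochner_Integration.integrable_bound[OF assms(1)]) (use assms in \<open>auto simp: norm_mult\<close>)

text \<open>Read off from the characteristic function of the standard normal distribution.\<close>

lemma gaussian_fourier_1d:
  shows "integrable lborel (\<lambda>x::real. cis (t * x) * exp (- x\<^sup>2 / 2))"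
    and "(LINT x|lborel. cis (t * x) * complex_of_real (exp (- x\<^sup>2 / 2))) = sqrt (2 * pi) * exp (- t\<^sup>2 / 2)"
proof -
  have i: "integrable lborel (\<lambda>x::real. exp (- x\<^sup>2 / 2))"
    using integrable_mult_right[of "sqrt (2*pi)" lborel std_normal_density] integrable_normal_density[of 1 0]
    by (simp add: std_normal_density_def)
  show "integrable lborel (\<lambda>x::real. cis (t * x) * exp (- x\<^sup>2 / 2))"
    by (rule integrable_cis_mult) (use i in auto)
  have "char std_normal_distribution t = (LINT x|lborel. complex_of_real (std_normal_density x) * cis (t * x))"
    unfolding char_def by (subst integral_density) (auto simp: cis_conv_exp mult_ac scaleR_conv_of_real)
  also have "\<dots> = complex_of_real (1 / sqrt (2*pi)) * (LINT x|lborel. cis (t * x) * complex_of_real (exp (- x\<^sup>2 / 2)))"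
    by (subst integral_mult_right_zero[symmetric]) (auto simp: std_normal_density_def mult_ac)
  finally show "(LINT x|lborel. cis (t * x) * complex_of_real (exp (- x\<^sup>2 / 2))) = sqrt (2 * pi) * exp (- t\<^sup>2 / 2)"
    unfolding char_std_normal_distribution by (simp add: field_simps)
qed

definition gauss :: "real^'n \<Rightarrow> real" where "gauss x = exp (- (norm x)\<^sup>2 / 2)"

lemma gauss_measurable[measurable]: "gauss \<in> borel_measurable borel"
  unfolding gauss_def by measurable

lemma gauss_prod: "gauss x = (\<Prod>i\<in>UNIV. exp (- (x$i)\<^sup>2 / 2))"
  unfolding gauss_def norm_vec_def L2_set_def
  by (simp add: sum_nonneg exp_sum[symmetric] sum_negf sum_divide_distrib)

lemma gauss_fourier:
  fixes z :: "real^'n"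
  shows "integrable lborel (\<lambda>x. cis (z \<bullet> x) * complex_of_real (gauss x))" (is ?a)
    and "(LINT x|lborel. cis (z \<bullet> x) * complex_of_real (gauss x)) = (sqrt (2 * pi)) ^ CARD('n) * gauss z" (is ?b)
proof -
  have eq: "cis (z \<bullet> x) * complex_of_real (gauss x) = (\<Prod>i\<in>UNIV. cis (z$i * x$i) * complex_of_real (exp (- (x$i)\<^sup>2 / 2)))" for x
    by (simp add: gauss_prod prod.distrib inner_vec_def cis_conv_exp exp_sum sum_distrib_left)
  show ?a unfolding eq by (rule lborel_integrable_prod_vec) (rule gaussian_fourier_1d)
  have "(LINT x|lborel. cis (z \<bullet> x) * complex_of_real (gauss x)) = (\<Prod>i\<in>UNIV. complex_of_real (sqrt (2 * pi) * exp (- (z$i)\<^sup>2 / 2)))"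
    unfolding eq by (subst lborel_integral_prod_vec) (use gaussian_fourier_1d in auto)
  also have "\<dots> = (sqrt (2 * pi)) ^ CARD('n) * gauss z" by (simp add: gauss_prod prod.distrib)
  finally show ?b .
qed

lemma gauss_integrable: "integrable lborel (gauss :: real^'n \<Rightarrow> real)"
  and gauss_integral: "(LINT x|lborel. gauss (x::real^'n)) = (sqrt (2 * pi)) ^ CARD('n)"
proof -
  have i: "integrable lborel (\<lambda>x::real^'n. complex_of_real (gauss x))" using gauss_fourier(1)[of 0] by simp
  from integrable_Re[OF i] show "integrable lborel (gauss :: real^'n \<Rightarrow> real)" by simp
  have "complex_of_real (LINT x|lborel. gauss (x::real^'n)) = complex_of_real ((sqrt (2 * pi)) ^ CARD('n))"
    using gauss_fourier(2)[of "0::real^'n"] by (simp add: gauss_def integral_complex_of_real)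
  then show "(LINT x|lborel. gauss (x::real^'n)) = (sqrt (2 * pi)) ^ CARD('n)" by (simp only: of_real_eq_iff)
qed

lemma gauss_scaled_fourier:
  fixes z :: "real^'n"
  assumes e: "\<epsilon> > 0"
  shows "integrable lborel (\<lambda>x. cis (z \<bullet> x) * complex_of_real (gauss (\<epsilon> *\<^sub>R x)))" (is ?a)
    and "\<epsilon> ^ CARD('n) *\<^sub>R (LINT x|lborel. cis (z \<bullet> x) * complex_of_real (gauss (\<epsilon> *\<^sub>R x)))
      = (sqrt (2 * pi)) ^ CARD('n) * gauss ((1/\<epsilon>) *\<^sub>R z)" (is ?b)
proof -
  let ?f = "\<lambda>x. cis (((1/\<epsilon>) *\<^sub>R z) \<bullet> x) * complex_of_real (gauss x)"
  have eq: "?f (0 + \<epsilon> *\<^sub>R x) = cis (z \<bullet> x) * complex_of_real (gauss (\<epsilon> *\<^sub>R x))" for x using e by simp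
  have m: "?f \<in> borel_measurable borel" by measurable
  show ?a using lborel_integrable_affine[OF m, of \<epsilon> 0] e gauss_fourier(1)[of "(1/\<epsilon>) *\<^sub>R z"] unfolding eq by simp
  show ?b using lborel_integral_affine[OF m, of \<epsilon> 0] e gauss_fourier(2)[of "(1/\<epsilon>) *\<^sub>R z"] unfolding eq by simp
qed

text \<open>Fubini, the kernel having modulus one. It is used twice in Plancherel's identity and
  later yields the adjoint of the Fourier integral.\<close>

lemma fourier_multiplication_formula:
  fixes f u :: "real^'n \<Rightarrow> complex"
  assumes f: "integrable lborel f" and u: "integrable lborel u"
  shows "(LINT \<xi>|lborel. u \<xi> * (LINT x|lborel. cis (a * (x \<bullet> \<xi>)) * f x)) =
         (LINT x|lborel. f x * (LINT \<xi>|lborel. cis (a * (x \<bullet> \<xi>)) * u \<xi>))"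
proof -
  have [measurable]: "f \<in> borel_measurable borel" "u \<in> borel_measurable borel" using f u by auto
  let ?g = "\<lambda>\<xi> x. u \<xi> * (cis (a * (x \<bullet> \<xi>)) * f x)"
  have "integrable (lborel \<Otimes>\<^sub>M lborel) (case_prod ?g)"
  proof (rule lborel_pair.Fubini_integrable)
    have "(\<lambda>\<xi>. LINT x|lborel. norm (case (\<xi>, x) of (x, y) \<Rightarrow> ?g x y)) = (\<lambda>\<xi>. norm (u \<xi>) * (LINT x|lborel. norm (f x)))"
      by (simp add: norm_mult)
    then show "integrable lborel (\<lambda>\<xi>. LINT x|lborel. norm (case (\<xi>, x) of (x, y) \<Rightarrow> ?g x y))"
      using u by simp
    show "AE \<xi> in lborel. integrable lborel (\<lambda>x. case (\<xi>, x) of (x, y) \<Rightarrow> ?g x y)"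
      using f by (intro AE_I2) (auto intro!: integrable_mult_right integrable_cis_mult)
  qed measurable
  from lborel_pair.Fubini_integral[OF this]
  have "(LINT x|lborel. LINT \<xi>|lborel. ?g \<xi> x) = (LINT \<xi>|lborel. LINT x|lborel. ?g \<xi> x)" .
  moreover have "(LINT \<xi>|lborel. ?g \<xi> x) = f x * (LINT \<xi>|lborel. cis (a * (x \<bullet> \<xi>)) * u \<xi>)" for x
    by (subst integral_mult_right_zero[symmetric]) (simp add: mult_ac)
  ultimately show ?thesis by simp
qed

text \<open>Gaussian regularisation. Weighting |F|^2 by a Gaussian of width 1/\<epsilon> allows
  Fubini and gives a Gaussian average of the autocorrelation of f at scale \<epsilon>. As \<epsilon>
  decreases to 0 the average tends to the value at 0, while monotone convergence recovers the full
  integral of |F|^2 and shows in the same stroke that it is finite. The parameter a is one of 1 and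
  -1, so both signs of the transform are covered.\<close>

lemma Plancherel_lborel:
  fixes f :: "real^'n \<Rightarrow> complex"
  assumes fi: "integrable lborel f" and f2: "L2 lborel f" and a: "a\<^sup>2 = (1::real)"
  defines "F \<equiv> \<lambda>\<xi>. LINT x|lborel. cis (a * (x \<bullet> \<xi>)) * f x"
  shows "L2 lborel F" "(nm lborel F)\<^sup>2 = (2 * pi) ^ CARD('n) * (nm lborel f)\<^sup>2"
proof -
  have [measurable]: "f \<in> borel_measurable borel" using f2 by (simp add: L2_def)
  have [measurable]: "F \<in> borel_measurable borel" unfolding F_def by measurable
  define B where "B = (LINT x|lborel. cmod (f x))"
  have FB: "cmod (F \<xi>) \<le> B" for \<xi>
    unfolding F_def B_def by (rule order_trans[OF integral_norm_bound]) (simp add: norm_mult)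
  have B0: "B \<ge> 0" by (simp add: B_def)
  have g0: "gauss x \<ge> 0" for x :: "real^'n" by (simp add: gauss_def)
  define c where "c = (sqrt (2 * pi)) ^ CARD('n)"
  \<comment> \<open>The autocorrelation of f; its continuity at 0 is the mean continuity of
    translations.\<close>
  define A where "A u = ip lborel f (\<lambda>y. f (u + y))" for u
  have Ab: "cmod (A u) \<le> (nm lborel f)\<^sup>2" for u
    using Cauchy_Schwarz_L2[OF f2 L2_translate[OF f2, of u]] by (simp add: A_def nm_translate[OF f2] power2_eq_square)
  define J where "J \<epsilon> = (LINT \<xi>|lborel. complex_of_real (gauss (\<epsilon> *\<^sub>R \<xi>)) * (F \<xi> * cnj (F \<xi>)))" for \<epsilon>
  have gi: "integrable lborel (\<lambda>\<xi>::real^'n. complex_of_real (gauss (\<epsilon> *\<^sub>R \<xi>)))" if "\<epsilon> > 0" for \<epsilon>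
    using gauss_scaled_fourier(1)[OF that, of 0] by simp
  have gFi: "integrable lborel (\<lambda>\<xi>. complex_of_real (gauss (\<epsilon> *\<^sub>R \<xi>)) * F \<xi>)" if "\<epsilon> > 0" for \<epsilon>
    by (rule Bochner_Integration.integrable_bound[OF integrable_mult_right[OF gi[OF that], of "complex_of_real B"]])
      (use FB B0 g0 in \<open>auto simp: norm_mult mult.commute[of B] intro!: mult_left_mono\<close>)
  have J: "J \<epsilon> = c * (LINT u|lborel. complex_of_real (gauss u) * A (\<epsilon> *\<^sub>R u))" if e: "\<epsilon> > 0" for \<epsilon>
  proof -
    have cnjF: "cnj (F \<xi>) = (LINT x|lborel. cis (- a * (x \<bullet> \<xi>)) * cnj (f x))" for \<xi>
      unfolding F_def Bochner_Integration.integral_cnj[symmetric] by (simp add: cis_cnj)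
    have "J \<epsilon> = (LINT \<xi>|lborel. (complex_of_real (gauss (\<epsilon> *\<^sub>R \<xi>)) * F \<xi>) * (LINT x|lborel. cis (- a * (x \<bullet> \<xi>)) * cnj (f x)))"
      unfolding J_def cnjF by (simp add: mult_ac)
    also have "\<dots> = (LINT y|lborel. cnj (f y) * (LINT \<xi>|lborel. cis (- a * (y \<bullet> \<xi>)) * (complex_of_real (gauss (\<epsilon> *\<^sub>R \<xi>)) * F \<xi>)))"
      by (rule fourier_multiplication_formula) (use fi gFi[OF e] in auto)
    also have "\<dots> = (LINT y|lborel. cnj (f y) * (c * (LINT u|lborel. complex_of_real (gauss u) * f (y + \<epsilon> *\<^sub>R u))))"
    proof (rule Bochner_Integration.integral_cong[OF refl])
      fix y :: "real^'n"
      let ?u = "\<lambda>\<xi>. cis (- a * (y \<bullet> \<xi>)) * complex_of_real (gauss (\<epsilon> *\<^sub>R \<xi>))"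
      let ?k = "\<lambda>z. LINT \<xi>|lborel. cis (a * (z \<bullet> \<xi>)) * complex_of_real (gauss (\<epsilon> *\<^sub>R \<xi>))"
      have k: "\<epsilon> ^ CARD('n) *\<^sub>R ?k (\<epsilon> *\<^sub>R z) = c * gauss z" for z :: "real^'n"
      proof -
        have "norm (a *\<^sub>R z) = norm z" using a by (simp add: power2_eq_1_iff) auto
        then have "gauss (a *\<^sub>R z) = gauss z" by (simp add: gauss_def)
        then show ?thesis
          using gauss_scaled_fourier(2)[OF e, of "a *\<^sub>R \<epsilon> *\<^sub>R z"] e by (simp add: c_def mult_ac)
      qed
      have "(LINT \<xi>|lborel. cis (- a * (y \<bullet> \<xi>)) * (complex_of_real (gauss (\<epsilon> *\<^sub>R \<xi>)) * F \<xi>)) = (LINT \<xi>|lborel. ?u \<xi> * F \<xi>)"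
        by (simp add: mult_ac)
      also have "\<dots> = (LINT x|lborel. f x * (LINT \<xi>|lborel. cis (a * (x \<bullet> \<xi>)) * ?u \<xi>))"
        unfolding F_def by (rule fourier_multiplication_formula[OF fi integrable_cis_mult[OF gi[OF e]]]) measurable
      also have "\<dots> = (LINT x|lborel. f x * ?k (x - y))"
      proof -
        have "cis (a * (x \<bullet> \<xi>)) * ?u \<xi> = cis (a * ((x - y) \<bullet> \<xi>)) * complex_of_real (gauss (\<epsilon> *\<^sub>R \<xi>))" for x \<xi>
          by (simp add: mult.assoc[symmetric] cis_mult inner_diff_left right_diff_distrib)
        then show ?thesis by (simp only:)
      qed
      also have "\<dots> = \<bar>\<epsilon>\<bar> ^ DIM(real^'n) *\<^sub>R (LINT u|lborel. f (y + \<epsilon> *\<^sub>R u) * ?k (y + \<epsilon> *\<^sub>R u - y))"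
        by (rule lborel_integral_affine, measurable) (use e in simp)
      also have "\<dots> = (LINT u|lborel. f (y + \<epsilon> *\<^sub>R u) * (\<epsilon> ^ CARD('n) *\<^sub>R ?k (\<epsilon> *\<^sub>R u)))"
        using e by (simp add: mult_scaleR_right)
      also have "\<dots> = c * (LINT u|lborel. complex_of_real (gauss u) * f (y + \<epsilon> *\<^sub>R u))"
        unfolding k by (subst integral_mult_right_zero[symmetric]) (simp add: mult_ac)
      finally show "cnj (f y) * (LINT \<xi>|lborel. cis (- a * (y \<bullet> \<xi>)) * (complex_of_real (gauss (\<epsilon> *\<^sub>R \<xi>)) * F \<xi>)) =
         cnj (f y) * (c * (LINT u|lborel. complex_of_real (gauss u) * f (y + \<epsilon> *\<^sub>R u)))" by simp
    qed
    also have "\<dots> = c * (LINT y|lborel. LINT u|lborel. cnj (f y) * (complex_of_real (gauss u) * f (y + \<epsilon> *\<^sub>R u)))"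
      by (subst integral_mult_right_zero[symmetric]) (simp add: mult_ac)
    also have "(LINT y|lborel. LINT u|lborel. cnj (f y) * (complex_of_real (gauss u) * f (y + \<epsilon> *\<^sub>R u))) =
        (LINT u|lborel. LINT y|lborel. cnj (f y) * (complex_of_real (gauss u) * f (y + \<epsilon> *\<^sub>R u)))"
    proof (rule lborel_pair.Fubini_integral)
      let ?g = "\<lambda>(u, y). cnj (f y) * (complex_of_real (gauss u) * f (y + \<epsilon> *\<^sub>R u))"
      show "integrable (lborel \<Otimes>\<^sub>M lborel) ?g"
      proof (rule lborel_pair.Fubini_integrable)
        show "?g \<in> borel_measurable (lborel \<Otimes>\<^sub>M lborel)" by measurable
        have ii: "integrable lborel (\<lambda>y. cnj (f y) * f (\<epsilon> *\<^sub>R u + y))" for u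
          by (rule ip_integrable[OF f2 L2_translate[OF f2]])
        have i1: "integrable lborel (\<lambda>y. ?g (u, y))" for u
          using integrable_mult_right[OF ii, of "complex_of_real (gauss u)" u] by (simp add: mult_ac add_ac)
        then show "AE u in lborel. integrable lborel (\<lambda>y. ?g (u, y))" by simp
        show "integrable lborel (\<lambda>u. LINT y|lborel. norm (?g (u, y)))"
        proof (rule Bochner_Integration.integrable_bound)
          show "integrable lborel (\<lambda>u::real^'n. gauss u * (nm lborel f)\<^sup>2)" by (auto intro: gauss_integrable)
          show "(\<lambda>u. LINT y|lborel. norm (?g (u, y))) \<in> borel_measurable lborel" by measurable
          have ab: "L2 lborel (\<lambda>y. complex_of_real (cmod (f y)))" using f2 by (simp add: L2_def)
          have "(LINT y|lborel. norm (?g (u, y))) \<le> gauss u * (nm lborel f)\<^sup>2" for u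
          proof -
            have "complex_of_real (LINT y|lborel. norm (?g (u, y))) = gauss u * ip lborel (\<lambda>y. complex_of_real (cmod (f y))) (\<lambda>y. complex_of_real (cmod (f (\<epsilon> *\<^sub>R u + y))))"
              unfolding ip_def integral_complex_of_real[symmetric]
              by (subst integral_mult_right_zero[symmetric]) (simp add: norm_mult gauss_def mult_ac add_ac)
            then have "norm (complex_of_real (LINT y|lborel. norm (?g (u, y)))) \<le> gauss u * (nm lborel (\<lambda>y. complex_of_real (cmod (f y))) * nm lborel (\<lambda>y. complex_of_real (cmod (f (\<epsilon> *\<^sub>R u + y)))))"
              using Cauchy_Schwarz_L2[OF ab L2_translate[OF ab, of "\<epsilon> *\<^sub>R u"]]
              by (simp add: norm_mult gauss_def)
            also have "\<dots> = gauss u * (nm lborel f)\<^sup>2"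
              unfolding nm_translate[OF ab] by (simp add: nm_def power2_eq_square)
            finally show ?thesis unfolding norm_of_real by linarith
          qed
          then show "AE u in lborel. norm (LINT y|lborel. norm (?g (u, y))) \<le> norm (gauss u * (nm lborel f)\<^sup>2)"
            by (intro AE_I2) (auto simp: gauss_def)
        qed
      qed
    qed
    also have "\<dots> = (LINT u|lborel. complex_of_real (gauss u) * A (\<epsilon> *\<^sub>R u))"
      unfolding A_def ip_def
      by (intro Bochner_Integration.integral_cong[OF refl], subst integral_mult_right_zero[symmetric]) (simp add: mult_ac add_ac)
    finally show ?thesis .
  qed
  define \<epsilon> where "\<epsilon> k = 1 / real (Suc k)" for k
  have e0: "\<epsilon> k > 0" for k by (simp add: \<epsilon>_def)
  have elim: "\<epsilon> \<longlonglongrightarrow> 0" unfolding \<epsilon>_def by (rule LIMSEQ_Suc[OF lim_1_over_n])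
  have Alim: "(\<lambda>k. A (\<epsilon> k *\<^sub>R u)) \<longlonglongrightarrow> ip lborel f f" for u
    unfolding A_def
  proof (rule tendsto_ip)
    have "(\<lambda>k. \<epsilon> k *\<^sub>R u) \<longlonglongrightarrow> 0 *\<^sub>R u" by (intro tendsto_intros elim)
    then show "(\<lambda>k. nm lborel (\<lambda>x. f (\<epsilon> k *\<^sub>R u + x) - f x)) \<longlonglongrightarrow> 0"
      using L2_translation_continuous[OF f2] unfolding translation_continuous_def by simp
  qed (use f2 L2_translate in auto)
  have [measurable]: "A \<in> borel_measurable borel" unfolding A_def ip_def by measurable
  have "(\<lambda>k. LINT u|lborel. complex_of_real (gauss u) * A (\<epsilon> k *\<^sub>R u)) \<longlonglongrightarrow> (LINT u|lborel. complex_of_real (gauss (u::real^'n)) * ip lborel f f)"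
  proof (rule integral_dominated_convergence[where w="\<lambda>u. gauss u * (nm lborel f)\<^sup>2"])
    show "integrable lborel (\<lambda>u::real^'n. gauss u * (nm lborel f)\<^sup>2)" by (auto intro: gauss_integrable)
    show "AE u in lborel. (\<lambda>k. complex_of_real (gauss u) * A (\<epsilon> k *\<^sub>R u)) \<longlonglongrightarrow> complex_of_real (gauss u) * ip lborel f f"
      by (intro AE_I2 tendsto_intros Alim)
    show "AE u in lborel. norm (complex_of_real (gauss u) * A (\<epsilon> k *\<^sub>R u)) \<le> gauss u * (nm lborel f)\<^sup>2" for k
      using Ab by (intro AE_I2) (auto simp: norm_mult gauss_def)
  qed measurable
  also have "(LINT u|lborel. complex_of_real (gauss (u::real^'n)) * ip lborel f f) = c * ip lborel f f"
    unfolding integral_mult_left_zero integral_complex_of_real gauss_integral c_def by (rule refl)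
  finally have "(\<lambda>k. complex_of_real c * (LINT u|lborel. complex_of_real (gauss u) * A (\<epsilon> k *\<^sub>R u))) \<longlonglongrightarrow> c * (c * ip lborel f f)"
    by (rule tendsto_mult[OF tendsto_const])
  then have lim: "(\<lambda>k. J (\<epsilon> k)) \<longlonglongrightarrow> c * (c * ip lborel f f)"
    by (simp only: J[OF e0])
  \<comment> \<open>One factor comes from the transform of the Gaussian, the other from its total
    mass.\<close>
  have "c * c = (sqrt (2 * pi) * sqrt (2 * pi)) ^ CARD('n)" unfolding c_def by (simp only: power_mult_distrib)
  then have c2: "c * c = (2*pi) ^ CARD('n)" by simp
  have "complex_of_real c * (complex_of_real c * ip lborel f f) = complex_of_real ((c * c) * (nm lborel f)\<^sup>2)"
    unfolding ip_self by (simp only: of_real_mult mult.assoc)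
  then have "Re (c * (c * ip lborel f f)) = (2*pi) ^ CARD('n) * (nm lborel f)\<^sup>2"
    unfolding c2 by (simp only: Re_complex_of_real)
  with tendsto_Re[OF lim] have "(\<lambda>k. Re (J (\<epsilon> k))) \<longlonglongrightarrow> (2*pi) ^ CARD('n) * (nm lborel f)\<^sup>2"
    by (simp only:)
  then have lim1: "(\<lambda>k. ennreal (Re (J (\<epsilon> k)))) \<longlonglongrightarrow> ennreal ((2*pi) ^ CARD('n) * (nm lborel f)\<^sup>2)"
    by (rule tendsto_ennrealI)
  have JR: "ennreal (Re (J (\<epsilon> k))) = (\<integral>\<^sup>+\<xi>. ennreal (gauss (\<epsilon> k *\<^sub>R \<xi>) * (cmod (F \<xi>))\<^sup>2) \<partial>lborel)" for k
  proof -
    have i: "integrable lborel (\<lambda>\<xi>. complex_of_real (gauss (\<epsilon> k *\<^sub>R \<xi>)) * F \<xi> * cnj (F \<xi>))"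
      by (rule Bochner_Integration.integrable_bound[OF integrable_mult_right[OF gFi[OF e0], of "complex_of_real B" k]])
        (use FB B0 g0 in \<open>auto simp: norm_mult mult.commute[of B] intro!: mult_left_mono\<close>)
    have ii: "integrable lborel (\<lambda>\<xi>. gauss (\<epsilon> k *\<^sub>R \<xi>) * (cmod (F \<xi>))\<^sup>2)"
      using integrable_Re[OF i] by (simp add: mult.assoc complex_norm_square[symmetric] flip: of_real_mult)
    have "J (\<epsilon> k) = complex_of_real (LINT \<xi>|lborel. gauss (\<epsilon> k *\<^sub>R \<xi>) * (cmod (F \<xi>))\<^sup>2)"
      unfolding J_def complex_norm_square[symmetric] of_real_mult[symmetric] integral_complex_of_real ..
    then show ?thesis using nn_integral_eq_integral[OF ii] by (simp add: gauss_def)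
  qed
  \<comment> \<open>The sequence \<open>\<epsilon>\<close> decreases, so the weights increase to 1
    and monotone convergence applies before |F|^2 is known to be integrable.\<close>
  have "(\<lambda>k. \<integral>\<^sup>+\<xi>. ennreal (gauss (\<epsilon> k *\<^sub>R \<xi>) * (cmod (F \<xi>))\<^sup>2) \<partial>lborel) \<longlonglongrightarrow> (\<integral>\<^sup>+\<xi>. ennreal ((cmod (F \<xi>))\<^sup>2) \<partial>lborel)"
  proof (rule nn_integral_LIMSEQ)
    show "incseq (\<lambda>k \<xi>. ennreal (gauss (\<epsilon> k *\<^sub>R \<xi>) * (cmod (F \<xi>))\<^sup>2))"
    proof (intro incseq_SucI le_funI ennreal_leI mult_right_mono)
      fix k and \<xi> :: "real^'n"
      have "\<epsilon> (Suc k) * norm \<xi> \<le> \<epsilon> k * norm \<xi>" by (intro mult_right_mono) (auto simp: \<epsilon>_def frac_le)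
      then have "(\<epsilon> (Suc k) * norm \<xi>)\<^sup>2 \<le> (\<epsilon> k * norm \<xi>)\<^sup>2" using e0[of "Suc k"] by (intro power_mono) auto
      then show "gauss (\<epsilon> k *\<^sub>R \<xi>) \<le> gauss (\<epsilon> (Suc k) *\<^sub>R \<xi>)" by (simp add: gauss_def power_mult_distrib)
    qed auto
    show "(\<lambda>k. ennreal (gauss (\<epsilon> k *\<^sub>R \<xi>) * (cmod (F \<xi>))\<^sup>2)) \<longlonglongrightarrow> ennreal ((cmod (F \<xi>))\<^sup>2)" for \<xi>
    proof -
      have "(\<lambda>k. gauss (\<epsilon> k *\<^sub>R \<xi>) * (cmod (F \<xi>))\<^sup>2) \<longlonglongrightarrow> exp (- (norm (0 *\<^sub>R \<xi>))\<^sup>2 / 2) * (cmod (F \<xi>))\<^sup>2"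
        unfolding gauss_def by (intro tendsto_intros elim) auto
      then show ?thesis by (intro tendsto_ennrealI) simp
    qed
  qed measurable
  then have eq: "(\<integral>\<^sup>+\<xi>. ennreal ((cmod (F \<xi>))\<^sup>2) \<partial>lborel) = ennreal ((2*pi) ^ CARD('n) * (nm lborel f)\<^sup>2)"
    using lim1 unfolding JR by (rule LIMSEQ_unique)
  show L: "L2 lborel F" by (rule L2_I_nn) (auto simp: eq)
  show "(nm lborel F)\<^sup>2 = (2 * pi) ^ CARD('n) * (nm lborel f)\<^sup>2"
    using eq unfolding nn_integral_nm[OF L] by (simp add: ennreal_inj)
qed

section \<open>The Fourier transform on square-integrable functions\<close>

text \<open>Functions in the statement are only Lebesgue measurable, whereas joint measurability and
  Fubini are handled on \<open>lborel\<close>. Each operator below ignores null sets, so a Borel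
  representative may be substituted first.\<close>

lemma lebesgue_borel_representative:
  fixes f :: "'a::euclidean_space \<Rightarrow> complex"
  assumes f: "f \<in> borel_measurable lebesgue"
  obtains g where "g \<in> borel_measurable borel" "AE x in lebesgue. f x = g x"
proof -
  have "(\<lambda>x. Re (f x)) \<in> borel_measurable lebesgue" "(\<lambda>x. Im (f x)) \<in> borel_measurable lebesgue"
    using f by auto
  then obtain r i where r: "r \<in> borel_measurable lborel" "AE x in lborel. Re (f x) = r x"
    and i: "i \<in> borel_measurable lborel" "AE x in lborel. Im (f x) = i x"
    using completion_ex_borel_measurable_real by metis
  show thesis
  proof (rule that)
    show "(\<lambda>x. Complex (r x) (i x)) \<in> borel_measurable borel"
      using r(1) i(1) unfolding Complex_eq by measurable
    have "AE x in lborel. f x = Complex (r x) (i x)"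
      using r(2) i(2) by eventually_elim (simp add: complex_eq_iff)
    then show "AE x in lebesgue. f x = Complex (r x) (i x)" by (simp only: AE_completion_iff)
  qed
qed

lemma borel_lebesgue:
  fixes f :: "'a::euclidean_space \<Rightarrow> complex"
  assumes f: "f \<in> borel_measurable borel"
  shows L2_lebesgue_iff: "L2 lebesgue f \<longleftrightarrow> L2 lborel f"
    and nm_lebesgue: "nm lebesgue f = nm lborel f"
    and integrable_lebesgue_iff: "integrable lebesgue f \<longleftrightarrow> integrable lborel f"
    and integral_lebesgue: "integral\<^sup>L lebesgue f = integral\<^sup>L lborel f"
    and lebesgue_measurable_borel: "f \<in> borel_measurable lebesgue"
proof -
  show m: "f \<in> borel_measurable lebesgue" using f by (simp add: measurable_completion)
  have "(\<lambda>x. (cmod (f x))\<^sup>2) \<in> borel_measurable lborel" using f by measurable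
  then show "L2 lebesgue f \<longleftrightarrow> L2 lborel f" "nm lebesgue f = nm lborel f"
    using f m by (auto simp: L2_def nm_def integrable_completion integral_completion)
  show "integrable lebesgue f \<longleftrightarrow> integrable lborel f" "integral\<^sup>L lebesgue f = integral\<^sup>L lborel f"
    using f by (auto simp: integrable_completion integral_completion)
qed

lemma ip_lebesgue:
  assumes "f \<in> borel_measurable borel" "g \<in> borel_measurable borel"
  shows "ip lebesgue f g = ip lborel f g"
  unfolding ip_def using assms by (intro integral_lebesgue) measurable

lemma L2_cong_AE:
  assumes "AE x in M. f x = g x" "f \<in> borel_measurable M" "g \<in> borel_measurable M"
  shows "L2 M f \<longleftrightarrow> L2 M g"
proof -
  have "integrable M (\<lambda>x. (cmod (f x))\<^sup>2) \<longleftrightarrow> integrable M (\<lambda>x. (cmod (g x))\<^sup>2)"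
    using assms by (intro integrable_cong_AE) auto
  then show ?thesis using assms by (simp add: L2_def)
qed

lemma L2_borel_representative:
  fixes f :: "'a::euclidean_space \<Rightarrow> complex"
  assumes f: "L2 lebesgue f"
  obtains g where "L2 lborel g" "L2 lebesgue g" "g \<in> borel_measurable borel" "AE x in lebesgue. f x = g x"
    "nm lebesgue f = nm lborel g"
proof -
  have fm: "f \<in> borel_measurable lebesgue" using f by (simp add: L2_def)
  then obtain g where g: "g \<in> borel_measurable borel" "AE x in lebesgue. f x = g x"
    by (rule lebesgue_borel_representative)
  have gm: "g \<in> borel_measurable lebesgue" by (rule lebesgue_measurable_borel[OF g(1)])
  have "L2 lebesgue g" using L2_cong_AE[OF g(2) fm gm] f by simp
  moreover have "nm lebesgue f = nm lebesgue g" by (rule nm_cong_AE[OF g(2) fm gm])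
  ultimately show thesis
    using g by (intro that) (auto simp: L2_lebesgue_iff nm_lebesgue)
qed

subsection \<open>The Fourier integral\<close>

lemma fourier_int_cong_AE:
  assumes "AE x in lebesgue. f x = g x" "f \<in> borel_measurable lebesgue" "g \<in> borel_measurable lebesgue"
  shows "fourier_int a f = fourier_int a g"
proof
  fix \<xi>
  have "(LINT x|lebesgue. cis (a * (x \<bullet> \<xi>)) * f x) = (LINT x|lebesgue. cis (a * (x \<bullet> \<xi>)) * g x)"
  proof (rule integral_cong_AE)
    have [measurable]: "(\<lambda>x. cis (a * (x \<bullet> \<xi>))) \<in> borel_measurable lebesgue"
      by (intro lebesgue_measurable_borel) measurable
    show "(\<lambda>x. cis (a * (x \<bullet> \<xi>)) * f x) \<in> borel_measurable lebesgue" "(\<lambda>x. cis (a * (x \<bullet> \<xi>)) * g x) \<in> borel_measurable lebesgue"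
      using assms by measurable
    show "AE x in lebesgue. cis (a * (x \<bullet> \<xi>)) * f x = cis (a * (x \<bullet> \<xi>)) * g x"
      using assms(1) by eventually_elim simp
  qed
  then show "fourier_int a f \<xi> = fourier_int a g \<xi>" by (simp add: fourier_int_def)
qed

lemma fourier_int_borel:
  assumes [measurable]: "f \<in> borel_measurable borel"
  shows "fourier_int a f \<xi> = complex_of_real ((2 * pi) powr (- real CARD('n) / 2)) *
    (LINT x|lborel. cis (a * (x \<bullet> \<xi>)) * f (x::real^'n))"
  unfolding fourier_int_def by (subst integral_lebesgue) auto

lemma fourier_int_measurable:
  assumes "f \<in> borel_measurable lebesgue"
  shows "fourier_int a f \<in> borel_measurable borel"
proof -
  obtain g where [measurable]: "g \<in> borel_measurable borel" and g: "AE x in lebesgue. f x = g x"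
    using lebesgue_borel_representative[OF assms] .
  have "fourier_int a f = fourier_int a g" by (rule fourier_int_cong_AE[OF g assms lebesgue_measurable_borel]) simp
  also have "\<dots> \<in> borel_measurable borel"
  proof -
    have "fourier_int a g = (\<lambda>\<xi>. complex_of_real ((2 * pi) powr (- real CARD('a) / 2)) * (LINT x|lborel. cis (a * (x \<bullet> \<xi>)) * g x))"
      by (rule ext, rule fourier_int_borel) simp
    then show ?thesis by simp
  qed
  finally show ?thesis .
qed

lemma fourier_const_sq: "((2 * pi) powr (- real n / 2))\<^sup>2 * (2 * pi) ^ n = 1"
proof -
  have "((2 * pi) powr (- real n / 2))\<^sup>2 = (2 * pi) powr (- real n)"
    by (simp add: power2_eq_square powr_add[symmetric])
  also have "\<dots> = inverse ((2 * pi) ^ n)" by (simp add: powr_minus powr_realpow)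
  finally show ?thesis by (simp only:) (rule left_inverse, simp)
qed

lemma fourier_int_Plancherel:
  fixes f :: "real^'n \<Rightarrow> complex"
  assumes f: "L2 lebesgue f" "integrable lebesgue f" and a: "a\<^sup>2 = 1"
  shows "L2 lebesgue (fourier_int a f)" "nm lebesgue (fourier_int a f) = nm lebesgue f"
proof -
  obtain g where g: "L2 lborel g" "L2 lebesgue g" and m: "g \<in> borel_measurable borel" and ae: "AE x in lebesgue. f x = g x"
    and n: "nm lebesgue f = nm lborel g" using L2_borel_representative[OF f(1)] by blast
  have fm: "f \<in> borel_measurable lebesgue" using f(2) by simp
  have "integrable lebesgue g"
    using f(2) integrable_cong_AE[OF fm lebesgue_measurable_borel[OF m] ae] by simp
  then have gi: "integrable lborel g" using integrable_lebesgue_iff[OF m] by simp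
  have eq: "fourier_int a f = fourier_int a g"
    by (rule fourier_int_cong_AE[OF ae fm lebesgue_measurable_borel[OF m]])
  let ?F = "\<lambda>\<xi>. LINT x|lborel. cis (a * (x \<bullet> \<xi>)) * g x"
  note P = Plancherel_lborel[OF gi g(1) a]
  have eq2: "fourier_int a f = (\<lambda>\<xi>. complex_of_real ((2 * pi) powr (- real CARD('n) / 2)) * ?F \<xi>)"
    unfolding eq by (simp add: fourier_int_borel[OF m] fun_eq_iff)
  have Fm: "fourier_int a f \<in> borel_measurable borel" by (rule fourier_int_measurable[OF fm])
  have "L2 lborel (fourier_int a f)" unfolding eq2 by (rule L2_scale[OF P(1)])
  then show "L2 lebesgue (fourier_int a f)" using L2_lebesgue_iff[OF Fm] by simp
  have "(nm lborel (fourier_int a f))\<^sup>2 = (nm lborel g)\<^sup>2"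
    unfolding eq2 nm_scale power_mult_distrib P(2)
    using fourier_const_sq[of "CARD('n)"] by (simp add: mult.assoc[symmetric])
  then have "nm lborel (fourier_int a f) = nm lborel g" by simp
  then show "nm lebesgue (fourier_int a f) = nm lebesgue f" using n nm_lebesgue[OF Fm] by simp
qed

lemma fourier_int_adjoint:
  fixes f g :: "real^'n \<Rightarrow> complex"
  assumes f: "integrable lebesgue f" and g: "integrable lebesgue g"
  shows "ip lebesgue (fourier_int a f) g = ip lebesgue f (fourier_int (-a) g)"
proof -
  have fm: "f \<in> borel_measurable lebesgue" "g \<in> borel_measurable lebesgue" using f g by auto
  obtain f' where m: "f' \<in> borel_measurable borel" and ae: "AE x in lebesgue. f x = f' x"
    using lebesgue_borel_representative[OF fm(1)] by blast
  obtain g' where m': "g' \<in> borel_measurable borel" and ae': "AE x in lebesgue. g x = g' x"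
    using lebesgue_borel_representative[OF fm(2)] by blast
  note [measurable] = m m'
  have fm': "f' \<in> borel_measurable lebesgue" "g' \<in> borel_measurable lebesgue"
    using m m' by (auto intro: lebesgue_measurable_borel)
  have i: "integrable lborel f'" "integrable lborel g'"
    using f g integrable_cong_AE[OF fm(1) fm'(1) ae] integrable_cong_AE[OF fm(2) fm'(2) ae']
      integrable_lebesgue_iff[OF m] integrable_lebesgue_iff[OF m'] by auto
  let ?c = "complex_of_real ((2 * pi) powr (- real CARD('n) / 2))"
  note Fm = fourier_int_measurable[OF fm'(1), of a] fourier_int_measurable[OF fm'(2), of "-a"]
  have "ip lebesgue (fourier_int a f) g = ip lebesgue (fourier_int a f') g'"
    unfolding fourier_int_cong_AE[OF ae fm(1) fm'(1)]
    by (rule ip_cong_AE) (use ae' fm fm' Fm in \<open>auto intro: lebesgue_measurable_borel\<close>)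
  also have "\<dots> = ip lborel (fourier_int a f') g'" by (rule ip_lebesgue[OF Fm(1) m'])
  also have "\<dots> = ?c * (LINT \<xi>|lborel. g' \<xi> * (LINT x|lborel. cis (- a * (x \<bullet> \<xi>)) * cnj (f' x)))"
    unfolding ip_def fourier_int_borel[OF m] complex_cnj_mult Bochner_Integration.integral_cnj[symmetric]
    by (subst integral_mult_right_zero[symmetric]) (simp add: cis_cnj mult_ac)
  also have "\<dots> = ?c * (LINT x|lborel. cnj (f' x) * (LINT \<xi>|lborel. cis (- a * (x \<bullet> \<xi>)) * g' \<xi>))"
    by (subst fourier_multiplication_formula) (use i in auto)
  also have "\<dots> = ip lborel f' (fourier_int (-a) g')"
    unfolding ip_def fourier_int_borel[OF m']
    by (subst integral_mult_right_zero[symmetric]) (simp add: inner_commute mult_ac)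
  also have "\<dots> = ip lebesgue f' (fourier_int (-a) g')" by (rule ip_lebesgue[OF m Fm(2), symmetric])
  also have "\<dots> = ip lebesgue f (fourier_int (-a) g)"
    unfolding fourier_int_cong_AE[OF ae' fm(2) fm'(2)]
    by (rule ip_cong_AE) (use ae fm fm' Fm in \<open>auto intro: lebesgue_measurable_borel\<close>)
  finally show ?thesis .
qed

subsection \<open>Truncations\<close>

definition trunc :: "real \<Rightarrow> (real^'n \<Rightarrow> complex) \<Rightarrow> real^'n \<Rightarrow> complex" where
  "trunc R f x = (if x \<in> cball 0 R then f x else 0)"

lemma trunc_measurable[measurable (raw)]:
  "f \<in> borel_measurable lebesgue \<Longrightarrow> trunc R f \<in> borel_measurable lebesgue"
  unfolding trunc_def[abs_def] by (intro measurable_If_set) auto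

lemma L2_trunc: "L2 lebesgue f \<Longrightarrow> L2 lebesgue (trunc R f)"
  by (rule L2_bound[where c=1 and f=f]) (auto simp: trunc_def intro!: trunc_measurable L2_measurable)

lemma integrable_trunc:
  assumes f: "L2 lebesgue f" shows "integrable lebesgue (trunc R f)"
proof -
  have "L2 lebesgue (indicator (cball 0 R) :: real^'n \<Rightarrow> complex)"
    by (rule L2_indicator) (use emeasure_bounded_finite[OF bounded_cball, of 0 R] in auto)
  from ip_integrable[OF this f] have "integrable lebesgue (\<lambda>x. cnj (indicator (cball 0 R) x) * f x)" .
  also have "(\<lambda>x. cnj (indicator (cball 0 R) x) * f x) = trunc R f" by (auto simp: trunc_def indicator_def fun_eq_iff)
  finally show ?thesis .
qed

lemma trunc_tendsto:
  fixes f :: "real^'n \<Rightarrow> complex"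
  assumes f: "L2 lebesgue f" shows "((\<lambda>R. nm lebesgue (\<lambda>x. trunc R f x - f x)) \<longlongrightarrow> 0) at_top"
proof -
  have fm: "f \<in> borel_measurable lebesgue" using f by (simp add: L2_def)
  have "((\<lambda>R. LINT x|lebesgue. (cmod (trunc R f x - f x))\<^sup>2) \<longlongrightarrow> (LINT x|(lebesgue :: (real^'n) measure). 0)) at_top"
  proof (rule integral_dominated_convergence_at_top[where w="\<lambda>x. (cmod (f x))\<^sup>2"])
    show "(\<lambda>x. (cmod (trunc R f x - f x))\<^sup>2) \<in> borel_measurable lebesgue" for R
      using trunc_measurable[OF fm, of R] fm by measurable
    show "AE x in lebesgue. ((\<lambda>R. (cmod (trunc R f x - f x))\<^sup>2) \<longlongrightarrow> 0) at_top"
    proof (rule AE_I2)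
      fix x
      have "\<forall>\<^sub>F R in at_top. (cmod (trunc R f x - f x))\<^sup>2 = 0"
        using eventually_ge_at_top[of "norm x"] by eventually_elim (simp add: trunc_def)
      then show "((\<lambda>R. (cmod (trunc R f x - f x))\<^sup>2) \<longlongrightarrow> 0) at_top" by (rule tendsto_eventually)
    qed
    show "\<forall>\<^sub>F R in at_top. AE x in lebesgue. norm ((cmod (trunc R f x - f x))\<^sup>2) \<le> (cmod (f x))\<^sup>2"
      by (intro always_eventually allI AE_I2) (auto simp: trunc_def)
  qed (use f in \<open>auto simp: L2_def\<close>)
  then have "((\<lambda>R. sqrt (LINT x|lebesgue. (cmod (trunc R f x - f x))\<^sup>2)) \<longlongrightarrow> sqrt 0) at_top"
    by (intro tendsto_real_sqrt) simp
  then show ?thesis by (simp add: nm_def)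
qed

lemma fourier_int_add:
  assumes "integrable lebesgue f" "integrable lebesgue g"
  shows "fourier_int a (\<lambda>x. f x + g x) \<xi> = fourier_int a f \<xi> + fourier_int a g \<xi>"
proof -
  have c: "(\<lambda>x. a * (x \<bullet> \<xi>)) \<in> borel_measurable lebesgue"
    by (rule measurable_completion) measurable
  show ?thesis unfolding fourier_int_def using assms
    by (simp add: distrib_left integrable_cis_mult c)
qed

lemma fourier_int_scale: "fourier_int a (\<lambda>x. c * f x) \<xi> = c * fourier_int a f \<xi>"
  unfolding fourier_int_def by (simp add: mult.left_commute)

lemma fourier_int_diff:
  assumes "integrable lebesgue f" "integrable lebesgue g"
  shows "fourier_int a (\<lambda>x. f x - g x) \<xi> = fourier_int a f \<xi> - fourier_int a g \<xi>"
  using fourier_int_add[of f "\<lambda>x. -1 * g x" a \<xi>] fourier_int_scale[of a "-1" g \<xi>] assms by simp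

subsection \<open>The extension to square-integrable functions\<close>

abbreviation fourier_limit :: "real \<Rightarrow> (real^'n \<Rightarrow> complex) \<Rightarrow> (real^'n \<Rightarrow> complex) \<Rightarrow> bool" where
  "fourier_limit a f g \<equiv> L2 lebesgue g \<and>
     ((\<lambda>R. nm lebesgue (\<lambda>\<xi>. fourier_int a (trunc R f) \<xi> - g \<xi>)) \<longlongrightarrow> 0) at_top"

lemma fourier_L2_trunc: "fourier_L2 a f = (SOME g. fourier_limit a f g)"
  unfolding fourier_L2_def sqint_eq_L2 l2norm_eq_nm trunc_def[abs_def] ..

text \<open>Truncations are both integrable and square integrable, so Plancherel's identity carries
  their Cauchy property over to their Fourier integrals.\<close>

lemma fourier_limit_exists:
  assumes f: "L2 lebesgue f" and a: "a\<^sup>2 = 1"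
  shows "\<exists>g. fourier_limit a f g"
proof (rule L2_complete_at_top)
  show "L2 lebesgue (fourier_int a (trunc R f))" for R
    by (rule fourier_int_Plancherel[OF L2_trunc[OF f] integrable_trunc[OF f] a])
  fix e :: real assume e: "e > 0"
  from order_tendstoD(2)[OF trunc_tendsto[OF f], of "e/2"] e
  obtain N where N: "\<And>R. R \<ge> N \<Longrightarrow> nm lebesgue (\<lambda>x. trunc R f x - f x) < e/2"
    by (auto simp: eventually_at_top_linorder)
  have "nm lebesgue (\<lambda>\<xi>. fourier_int a (trunc R f) \<xi> - fourier_int a (trunc R' f) \<xi>) < e" if "R \<ge> N" "R' \<ge> N" for R R'
  proof -
    have "nm lebesgue (\<lambda>\<xi>. fourier_int a (trunc R f) \<xi> - fourier_int a (trunc R' f) \<xi>)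
        = nm lebesgue (fourier_int a (\<lambda>x. trunc R f x - trunc R' f x))"
      by (intro arg_cong[where f="nm lebesgue"] ext fourier_int_diff[symmetric] integrable_trunc f)
    also have "\<dots> = nm lebesgue (\<lambda>x. trunc R f x - trunc R' f x)"
      by (intro fourier_int_Plancherel(2) L2_diff L2_trunc f Bochner_Integration.integrable_diff integrable_trunc a)
    also have "\<dots> \<le> nm lebesgue (\<lambda>x. trunc R f x - f x) + nm lebesgue (\<lambda>x. f x - trunc R' f x)"
      by (intro nm_triangle_diff L2_trunc f)
    also have "\<dots> < e" using N[OF that(1)] N[OF that(2)] nm_minus_commute[of lebesgue f "trunc R' f"] by simp
    finally show ?thesis .
  qed
  then show "\<exists>N. \<forall>R\<ge>N. \<forall>R'\<ge>N. nm lebesgue (\<lambda>\<xi>. fourier_int a (trunc R f) \<xi> - fourier_int a (trunc R' f) \<xi>) < e" by blast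
qed

lemma
  assumes "L2 lebesgue f" "a\<^sup>2 = 1"
  shows L2_fourier_L2: "L2 lebesgue (fourier_L2 a f)"
    and fourier_L2_limit: "((\<lambda>R. nm lebesgue (\<lambda>\<xi>. fourier_int a (trunc R f) \<xi> - fourier_L2 a f \<xi>)) \<longlongrightarrow> 0) at_top"
  using someI_ex[OF fourier_limit_exists[OF assms]] unfolding fourier_L2_trunc[symmetric] by blast+

lemma L2_limit_unique:
  assumes "\<And>R. L2 M (u R)" "L2 M g" "L2 M h" "F \<noteq> bot"
    "((\<lambda>R. nm M (\<lambda>x. u R x - g x)) \<longlongrightarrow> 0) F" "((\<lambda>R. nm M (\<lambda>x. u R x - h x)) \<longlongrightarrow> 0) F"
  shows "AE x in M. g x = h x"
proof -
  have b: "nm M (\<lambda>x. g x - h x) \<le> nm M (\<lambda>x. u R x - g x) + nm M (\<lambda>x. u R x - h x)" for R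
    using nm_triangle_diff[of M g "u R" h] assms nm_minus_commute[of M g "u R"] by simp
  have "((\<lambda>R. nm M (\<lambda>x. u R x - g x) + nm M (\<lambda>x. u R x - h x)) \<longlongrightarrow> 0 + 0) F"
    by (intro tendsto_add assms)
  from tendsto_lowerbound[OF this always_eventually[OF allI[OF b]] assms(4)]
  have "nm M (\<lambda>x. g x - h x) = 0" using nm_nonneg[of M "\<lambda>x. g x - h x"] by simp
  from nm_eq_0_AE[OF L2_diff[OF assms(2,3)] this] show ?thesis by simp
qed

lemma fourier_L2_eqI:
  assumes f: "L2 lebesgue f" and a: "a\<^sup>2 = 1" and g: "fourier_limit a f g"
  shows "AE x in lebesgue. fourier_L2 a f x = g x"
proof (rule L2_limit_unique)
  show "L2 lebesgue (fourier_int a (trunc R f))" for R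
    by (rule fourier_int_Plancherel[OF L2_trunc[OF f] integrable_trunc[OF f] a])
qed (use g L2_fourier_L2[OF f a] fourier_L2_limit[OF f a] in auto)

text \<open>The choice operator sees f only through Fourier integrals of truncations, which ignore
  null sets. The conclusion is therefore a literal equality of functions, which is why compositions
  such as \<open>schr_schr\<close> hold everywhere and not just almost everywhere.\<close>

lemma fourier_L2_cong_AE:
  assumes "AE x in lebesgue. f x = g x" "f \<in> borel_measurable lebesgue" "g \<in> borel_measurable lebesgue"
  shows "fourier_L2 a f = fourier_L2 a g"
proof -
  have "fourier_int a (trunc R f) = fourier_int a (trunc R g)" for R
  proof (rule fourier_int_cong_AE)
    show "AE x in lebesgue. trunc R f x = trunc R g x"
      using assms(1) by eventually_elim (simp add: trunc_def)
  qed (use assms in \<open>auto intro: trunc_measurable\<close>)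
  then show ?thesis unfolding fourier_L2_trunc by simp
qed

text \<open>Some truncation to a ball of integer radius is not measurable, hence neither is any
  larger one, nor its product with a measurable phase. Such a product is not integrable, so its
  integral takes the default value 0; the limit defining the transform thus sees the zero
  function.\<close>

lemma fourier_L2_nonmeasurable:
  fixes f :: "real^'n \<Rightarrow> complex"
  assumes f: "f \<notin> borel_measurable lebesgue"
  shows "fourier_L2 a f = fourier_L2 a (\<lambda>_. 0)"
proof -
  have "\<exists>n::nat. trunc (real n) f \<notin> borel_measurable lebesgue"
  proof (rule ccontr)
    assume "\<nexists>n::nat. trunc (real n) f \<notin> borel_measurable lebesgue"
    then have m: "\<And>n::nat. trunc (real n) f \<in> borel_measurable lebesgue" by blast
    have "f \<in> borel_measurable lebesgue"
    proof (rule borel_measurable_LIMSEQ_metric[OF m])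
      fix x :: "real^'n"
      obtain k :: nat where "norm x \<le> real k" using real_arch_simple by blast
      then have "\<forall>\<^sub>F n in sequentially. trunc (real n) f x = f x"
        by (intro eventually_sequentiallyI[of k]) (auto simp: trunc_def)
      then show "(\<lambda>n. trunc (real n) f x) \<longlonglongrightarrow> f x" by (rule tendsto_eventually)
    qed
    with f show False by blast
  qed
  then obtain n :: nat where n: "trunc (real n) f \<notin> borel_measurable lebesgue" by blast
  have "fourier_int a (trunc R f) = fourier_int a (trunc R (\<lambda>_. 0))" if R: "R \<ge> real n" for R
  proof
    fix \<xi>
    have c: "(\<lambda>x::real^'n. cis (b * (x \<bullet> \<xi>))) \<in> borel_measurable lebesgue" for b
      by (rule measurable_completion) measurable
    have "\<not> integrable lebesgue (\<lambda>x. cis (a * (x \<bullet> \<xi>)) * trunc R f x)"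
    proof
      assume "integrable lebesgue (\<lambda>x. cis (a * (x \<bullet> \<xi>)) * trunc R f x)"
      then have "(\<lambda>x. cis (a * (x \<bullet> \<xi>)) * trunc R f x) \<in> borel_measurable lebesgue" by simp
      then have "(\<lambda>x. cis (- a * (x \<bullet> \<xi>)) * (cis (a * (x \<bullet> \<xi>)) * trunc R f x)) \<in> borel_measurable lebesgue"
        using c[of "-a"] by measurable
      also have "(\<lambda>x. cis (- a * (x \<bullet> \<xi>)) * (cis (a * (x \<bullet> \<xi>)) * trunc R f x)) = trunc R f"
        by (simp add: mult.assoc[symmetric] cis_mult fun_eq_iff)
      finally have "trunc (real n) (trunc R f) \<in> borel_measurable lebesgue" by (rule trunc_measurable)
      also have "trunc (real n) (trunc R f) = trunc (real n) f" using R by (auto simp: trunc_def fun_eq_iff)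
      finally show False using n by blast
    qed
    then show "fourier_int a (trunc R f) \<xi> = fourier_int a (trunc R (\<lambda>_. 0)) \<xi>"
      by (simp add: fourier_int_def not_integrable_integral_eq trunc_def[abs_def])
  qed
  then have ev: "\<forall>\<^sub>F R in at_top. fourier_int a (trunc R f) = fourier_int a (trunc R (\<lambda>_. 0))"
    by (intro eventually_at_top_linorderI[of "real n"]) blast
  have "fourier_limit a f g = fourier_limit a (\<lambda>_. 0) g" for g
    by (intro conj_cong refl tendsto_cong, rule eventually_mono[OF ev]) simp
  then show ?thesis unfolding fourier_L2_trunc by simp
qed

lemma nm_fourier_L2:
  assumes f: "L2 lebesgue f" and a: "a\<^sup>2 = 1"
  shows "nm lebesgue (fourier_L2 a f) = nm lebesgue f"
proof (rule tendsto_unique[OF trivial_limit_at_top_linorder])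
  note P = fourier_int_Plancherel[OF L2_trunc[OF f] integrable_trunc[OF f] a]
  show "((\<lambda>R. nm lebesgue (fourier_int a (trunc R f))) \<longlongrightarrow> nm lebesgue (fourier_L2 a f)) at_top"
    by (intro tendsto_nm P L2_fourier_L2 fourier_L2_limit f a)
  show "((\<lambda>R. nm lebesgue (fourier_int a (trunc R f))) \<longlongrightarrow> nm lebesgue f) at_top"
    unfolding P(2) by (intro tendsto_nm L2_trunc f trunc_tendsto)
qed

lemma fourier_L2_adjoint:
  assumes f: "L2 lebesgue f" and g: "L2 lebesgue g" and a: "a\<^sup>2 = 1"
  shows "ip lebesgue (fourier_L2 a f) g = ip lebesgue f (fourier_L2 (-a) g)"
proof (rule tendsto_unique[OF trivial_limit_at_top_linorder])
  have a': "(-a)\<^sup>2 = 1" using a by simp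
  note P = fourier_int_Plancherel[OF L2_trunc integrable_trunc]
  show "((\<lambda>R. ip lebesgue (fourier_int a (trunc R f)) (trunc R g)) \<longlongrightarrow> ip lebesgue (fourier_L2 a f) g) at_top"
    by (intro tendsto_ip P L2_fourier_L2 fourier_L2_limit L2_trunc trunc_tendsto f g a)
  show "((\<lambda>R. ip lebesgue (fourier_int a (trunc R f)) (trunc R g)) \<longlongrightarrow> ip lebesgue f (fourier_L2 (-a) g)) at_top"
    unfolding fourier_int_adjoint[OF integrable_trunc[OF f] integrable_trunc[OF g]]
    by (intro tendsto_ip P L2_fourier_L2 fourier_L2_limit L2_trunc trunc_tendsto f g a')
qed

text \<open>A choice of limits is not visibly linear. Adjointness moves the transform to the test
  function, after which both sides have the same inner products.\<close>

lemma fourier_L2_add: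
  assumes f: "L2 lebesgue f" and g: "L2 lebesgue g" and a: "a\<^sup>2 = 1"
  shows "AE x in lebesgue. fourier_L2 a (\<lambda>x. f x + g x) x = fourier_L2 a f x + fourier_L2 a g x"
proof (rule L2_eqI)
  have a': "(-a)\<^sup>2 = 1" using a by simp
  fix h :: "real^'a \<Rightarrow> complex" assume h: "L2 lebesgue h"
  have "cnj (ip lebesgue (fourier_L2 a (\<lambda>x. f x + g x)) h) = cnj (ip lebesgue (\<lambda>x. fourier_L2 a f x + fourier_L2 a g x) h)"
    using assms h a' by (simp add: fourier_L2_adjoint L2_add ip_add_left L2_fourier_L2)
  then show "ip lebesgue h (fourier_L2 a (\<lambda>x. f x + g x)) = ip lebesgue h (\<lambda>x. fourier_L2 a f x + fourier_L2 a g x)"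
    by (simp only: ip_cnj)
qed (use assms in \<open>auto intro!: L2_fourier_L2 L2_add\<close>)

lemma fourier_L2_scale:
  assumes f: "L2 lebesgue f" and a: "a\<^sup>2 = 1"
  shows "AE x in lebesgue. fourier_L2 a (\<lambda>x. c * f x) x = c * fourier_L2 a f x"
proof (rule L2_eqI)
  have a': "(-a)\<^sup>2 = 1" using a by simp
  fix h :: "real^'a \<Rightarrow> complex" assume h: "L2 lebesgue h"
  have "cnj (ip lebesgue (fourier_L2 a (\<lambda>x. c * f x)) h) = cnj (ip lebesgue (\<lambda>x. c * fourier_L2 a f x) h)"
    using assms h a' by (simp add: fourier_L2_adjoint L2_scale ip_scale_left)
  then show "ip lebesgue h (fourier_L2 a (\<lambda>x. c * f x)) = ip lebesgue h (\<lambda>x. c * fourier_L2 a f x)"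
    by (simp only: ip_cnj)
qed (use assms in \<open>auto intro!: L2_fourier_L2 L2_scale\<close>)

text \<open>Polarisation of the norm identity; the imaginary part comes from replacing g by \<i>
  g.\<close>

lemma ip_fourier_L2:
  assumes f: "L2 lebesgue f" and g: "L2 lebesgue g" and a: "a\<^sup>2 = 1"
  shows "ip lebesgue (fourier_L2 a f) (fourier_L2 a g) = ip lebesgue f g"
proof -
  have re: "Re (ip lebesgue (fourier_L2 a f) (fourier_L2 a h)) = Re (ip lebesgue f h)" if h: "L2 lebesgue h" for h
  proof -
    note Lf = L2_fourier_L2[OF f a] and Lh = L2_fourier_L2[OF h a]
    have "nm lebesgue (\<lambda>x. fourier_L2 a f x + fourier_L2 a h x) = nm lebesgue (fourier_L2 a (\<lambda>x. f x + h x))"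
      by (intro nm_cong_AE AE_symmetric[OF fourier_L2_add[OF f h a]] L2_measurable L2_add Lf Lh L2_fourier_L2 f h a)
    also have "\<dots> = nm lebesgue (\<lambda>x. f x + h x)" by (intro nm_fourier_L2 L2_add f h a)
    finally show ?thesis
      using nm_add_sq[OF Lf Lh] nm_add_sq[OF f h] by (simp add: nm_fourier_L2 f h a)
  qed
  show ?thesis
  proof (rule complex_eqI)
    show "Re (ip lebesgue (fourier_L2 a f) (fourier_L2 a g)) = Re (ip lebesgue f g)" by (rule re[OF g])
    have "ip lebesgue (fourier_L2 a f) (fourier_L2 a (\<lambda>x. \<i> * g x)) = ip lebesgue (fourier_L2 a f) (\<lambda>x. \<i> * fourier_L2 a g x)"
      by (intro ip_cong_AE AE_I2 refl fourier_L2_scale L2_measurable L2_fourier_L2 L2_scale f g a)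
    then show "Im (ip lebesgue (fourier_L2 a f) (fourier_L2 a g)) = Im (ip lebesgue f g)"
      using re[OF L2_scale[OF g, of "\<i>"]] by (simp add: ip_scale_right)
  qed
qed

text \<open>Adjointness followed by isometry: the composition has the same inner products as f. As a
  may have either sign, the two transforms are inverse to each other.\<close>

lemma fourier_L2_inverse:
  assumes f: "L2 lebesgue f" and a: "a\<^sup>2 = 1"
  shows "AE x in lebesgue. fourier_L2 (-a) (fourier_L2 a f) x = f x"
proof (rule L2_eqI)
  have a': "(-a)\<^sup>2 = 1" using a by simp
  show "L2 lebesgue (fourier_L2 (-a) (fourier_L2 a f))" by (intro L2_fourier_L2 f a a')
  fix h :: "real^'a \<Rightarrow> complex" assume h: "L2 lebesgue h"
  show "ip lebesgue h (fourier_L2 (-a) (fourier_L2 a f)) = ip lebesgue h f"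
    using fourier_L2_adjoint[OF h L2_fourier_L2[OF f a] a] ip_fourier_L2[OF h f a] by simp
qed (rule f)

lemma fourier_L2_eq_fourier_int:
  assumes f: "L2 lebesgue f" "integrable lebesgue f" and a: "a\<^sup>2 = 1"
  shows "AE x in lebesgue. fourier_L2 a f x = fourier_int a f x"
proof (rule fourier_L2_eqI[OF f(1) a], intro conjI)
  show "L2 lebesgue (fourier_int a f)" by (rule fourier_int_Plancherel[OF f a])
  have "nm lebesgue (\<lambda>\<xi>. fourier_int a (trunc R f) \<xi> - fourier_int a f \<xi>) = nm lebesgue (\<lambda>x. trunc R f x - f x)" for R
  proof -
    have "nm lebesgue (fourier_int a (\<lambda>x. trunc R f x - f x)) = nm lebesgue (\<lambda>x. trunc R f x - f x)"
      by (intro fourier_int_Plancherel(2) L2_diff L2_trunc f Bochner_Integration.integrable_diff integrable_trunc a)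
    moreover have "(\<lambda>\<xi>. fourier_int a (trunc R f) \<xi> - fourier_int a f \<xi>) = fourier_int a (\<lambda>x. trunc R f x - f x)"
      by (intro ext fourier_int_diff[symmetric] integrable_trunc f)
    ultimately show ?thesis by simp
  qed
  then show "((\<lambda>R. nm lebesgue (\<lambda>\<xi>. fourier_int a (trunc R f) \<xi> - fourier_int a f \<xi>)) \<longlongrightarrow> 0) at_top"
    using trunc_tendsto[OF f(1)] by simp
qed

subsection \<open>Fourier multipliers and the free group\<close>

lemma cmod_mult_le_one: "cmod a \<le> 1 \<Longrightarrow> cmod (a * b) \<le> 1 * cmod b"
  using mult_right_mono[of "cmod a" 1 "cmod b"] by (simp add: norm_mult)

lemma L2_bounded_mult:
  assumes m: "m \<in> borel_measurable borel" "\<And>\<xi>. cmod (m \<xi>) \<le> 1" and f: "L2 lebesgue f"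
  shows "L2 lebesgue (\<lambda>x::real^'n. m x * f x)"
  using L2_measurable[OF f] lebesgue_measurable_borel[OF m(1)]
  by (intro L2_bound[OF f, where c=1] AE_I2 cmod_mult_le_one m(2)) auto

lemma
  fixes m :: "real^'n \<Rightarrow> complex"
  assumes m: "m \<in> borel_measurable borel" "\<And>\<xi>. cmod (m \<xi>) \<le> 1" and f: "L2 lebesgue f"
  shows L2_fmult: "L2 lebesgue (fmult m f)"
    and fourier_fmult: "AE \<xi> in lebesgue. fourier_L2 (-1) (fmult m f) \<xi> = m \<xi> * fourier_L2 (-1) f \<xi>"
proof -
  have L: "L2 lebesgue (\<lambda>\<xi>. m \<xi> * fourier_L2 (-1) f \<xi>)" by (intro L2_bounded_mult m L2_fourier_L2 f) simp
  show "L2 lebesgue (fmult m f)" unfolding fmult_def by (intro L2_fourier_L2 L) simp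
  show "AE \<xi> in lebesgue. fourier_L2 (-1) (fmult m f) \<xi> = m \<xi> * fourier_L2 (-1) f \<xi>"
    using fourier_L2_inverse[OF L, of 1] by (simp add: fmult_def)
qed

lemma fmult_fmult:
  fixes m :: "real^'n \<Rightarrow> complex"
  assumes m: "m \<in> borel_measurable borel" "\<And>\<xi>. cmod (m \<xi>) \<le> 1"
    and k: "k \<in> borel_measurable borel" "\<And>\<xi>. cmod (k \<xi>) \<le> 1" and f: "L2 lebesgue f"
  shows "fmult k (fmult m f) = fmult (\<lambda>\<xi>. k \<xi> * m \<xi>) f"
  unfolding fmult_def[of k] fmult_def[of "\<lambda>\<xi>. k \<xi> * m \<xi>"]
proof (rule fourier_L2_cong_AE)
  show "AE \<xi> in lebesgue. k \<xi> * fourier_L2 (-1) (fmult m f) \<xi> = k \<xi> * m \<xi> * fourier_L2 (-1) f \<xi>"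
    using fourier_fmult[OF m f] by eventually_elim simp
  show "(\<lambda>\<xi>. k \<xi> * fourier_L2 (-1) (fmult m f) \<xi>) \<in> borel_measurable lebesgue"
    by (intro L2_measurable L2_bounded_mult k L2_fourier_L2 L2_fmult m f) simp
  have "L2 lebesgue (\<lambda>\<xi>. (k \<xi> * m \<xi>) * fourier_L2 (-1) f \<xi>)"
    using m k by (intro L2_bounded_mult L2_fourier_L2 f) (auto simp: norm_mult intro: mult_le_one)
  then show "(\<lambda>\<xi>. k \<xi> * m \<xi> * fourier_L2 (-1) f \<xi>) \<in> borel_measurable lebesgue" by (rule L2_measurable)
qed

lemma ip_fmult:
  fixes m :: "real^'n \<Rightarrow> complex"
  assumes m: "m \<in> borel_measurable borel" "\<And>\<xi>. cmod (m \<xi>) \<le> 1" and f: "L2 lebesgue f" and g: "L2 lebesgue g"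
  shows "ip lebesgue g (fmult m f) = ip lebesgue (fourier_L2 (-1) g) (\<lambda>\<xi>. m \<xi> * fourier_L2 (-1) f \<xi>)"
proof -
  have L: "L2 lebesgue (\<lambda>\<xi>. m \<xi> * fourier_L2 (-1) f \<xi>)" by (intro L2_bounded_mult m L2_fourier_L2 f) simp
  show ?thesis
    using fourier_L2_adjoint[OF L g, of 1] unfolding fmult_def
    by (metis ip_cnj power_one)
qed

lemma ip_fmult_adjoint:
  fixes m :: "real^'n \<Rightarrow> complex"
  assumes m: "m \<in> borel_measurable borel" "\<And>\<xi>. cmod (m \<xi>) \<le> 1" and f: "L2 lebesgue f" and g: "L2 lebesgue g"
  shows "ip lebesgue (fmult (\<lambda>\<xi>. cnj (m \<xi>)) g) f = ip lebesgue g (fmult m f)"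
proof -
  have m': "(\<lambda>\<xi>. cnj (m \<xi>)) \<in> borel_measurable borel" "\<And>\<xi>. cmod (cnj (m \<xi>)) \<le> 1" using m by auto
  have "ip lebesgue (fmult (\<lambda>\<xi>. cnj (m \<xi>)) g) f = cnj (ip lebesgue f (fmult (\<lambda>\<xi>. cnj (m \<xi>)) g))" by (simp only: ip_cnj)
  also have "\<dots> = ip lebesgue (\<lambda>\<xi>. cnj (m \<xi>) * fourier_L2 (-1) g \<xi>) (fourier_L2 (-1) f)"
    unfolding ip_fmult[OF m' g f] by (simp only: ip_cnj)
  also have "\<dots> = ip lebesgue g (fmult m f)" unfolding ip_fmult[OF m f g] unfolding ip_def by (simp add: mult_ac)
  finally show ?thesis .
qed

lemma nm_fmult_le:
  fixes m :: "real^'n \<Rightarrow> complex"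
  assumes m: "m \<in> borel_measurable borel" "\<And>\<xi>. cmod (m \<xi>) \<le> 1" and f: "L2 lebesgue f"
  shows "nm lebesgue (fmult m f) \<le> nm lebesgue f"
proof -
  have L: "L2 lebesgue (\<lambda>\<xi>. m \<xi> * fourier_L2 (-1) f \<xi>)" by (intro L2_bounded_mult m L2_fourier_L2 f) simp
  have "nm lebesgue (fmult m f) = nm lebesgue (\<lambda>\<xi>. m \<xi> * fourier_L2 (-1) f \<xi>)"
    unfolding fmult_def by (rule nm_fourier_L2[OF L]) simp
  also have "\<dots> \<le> 1 * nm lebesgue (fourier_L2 (-1) f)"
    by (intro nm_bound AE_I2 cmod_mult_le_one m L2_measurable[OF L] L2_fourier_L2 f) auto
  finally show ?thesis by (simp add: nm_fourier_L2 f)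
qed

lemma fmult_diff:
  fixes m :: "real^'n \<Rightarrow> complex"
  assumes m: "m \<in> borel_measurable borel" "\<And>\<xi>. cmod (m \<xi>) \<le> 1" and f: "L2 lebesgue f" and g: "L2 lebesgue g"
  shows "AE x in lebesgue. fmult m (\<lambda>x. f x - g x) x = fmult m f x - fmult m g x"
proof (rule L2_eqI)
  have m': "(\<lambda>\<xi>. cnj (m \<xi>)) \<in> borel_measurable borel" "\<And>\<xi>. cmod (cnj (m \<xi>)) \<le> 1" using m by auto
  fix h :: "real^'n \<Rightarrow> complex" assume h: "L2 lebesgue h"
  show "ip lebesgue h (fmult m (\<lambda>x. f x - g x)) = ip lebesgue h (\<lambda>x. fmult m f x - fmult m g x)"
    using m f g h by (simp add: ip_fmult_adjoint[symmetric] ip_diff_right L2_fmult L2_diff m')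
qed (intro L2_fmult L2_diff m f g)+

lemma fmult_one:
  assumes f: "L2 lebesgue f" shows "AE x in lebesgue. fmult (\<lambda>_. 1) f x = f x"
  using fourier_L2_inverse[OF f, of "-1"] by (simp add: fmult_def)

abbreviation schr_sym :: "real \<Rightarrow> real^'n \<Rightarrow> complex" where
  "schr_sym t \<equiv> (\<lambda>\<xi>. cis (- t * (norm \<xi>)\<^sup>2))"

lemma schr_sym: "schr_sym t \<in> borel_measurable borel" "cmod (schr_sym t \<xi>) \<le> 1"
proof -
  show "schr_sym t \<in> borel_measurable borel" by measurable
  show "cmod (schr_sym t \<xi>) \<le> 1" by simp
qed

lemma L2_schr: "L2 lebesgue f \<Longrightarrow> L2 lebesgue (schr t f)"
  unfolding schr_def by (rule L2_fmult[OF schr_sym])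

lemma schr_schr: "L2 lebesgue f \<Longrightarrow> schr s (schr t f) = schr (s + t) f"
  unfolding schr_def by (subst fmult_fmult[OF schr_sym schr_sym]) (auto simp: cis_mult algebra_simps)

lemma schr_0: "L2 lebesgue f \<Longrightarrow> AE x in lebesgue. schr 0 f x = f x"
  using fmult_one[of f] by (simp add: schr_def)

lemma ip_schr: "L2 lebesgue f \<Longrightarrow> L2 lebesgue g \<Longrightarrow> ip lebesgue (schr t g) f = ip lebesgue g (schr (-t) f)"
  using ip_fmult_adjoint[OF schr_sym, of f g "-t"] by (simp add: schr_def cis_cnj)

lemma nm_schr: assumes f: "L2 lebesgue f" shows "nm lebesgue (schr t f) = nm lebesgue f"
proof (rule antisym)
  have le: "nm lebesgue (schr s g) \<le> nm lebesgue g" if "L2 lebesgue g" for s g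
    unfolding schr_def by (rule nm_fmult_le[OF schr_sym that])
  show "nm lebesgue (schr t f) \<le> nm lebesgue f" by (rule le[OF f])
  have "nm lebesgue f = nm lebesgue (schr (-t) (schr t f))"
    unfolding schr_schr[OF f] using schr_0[OF f]
    by (intro nm_cong_AE L2_measurable L2_schr f) auto
  also have "\<dots> \<le> nm lebesgue (schr t f)" by (rule le[OF L2_schr[OF f]])
  finally show "nm lebesgue f \<le> nm lebesgue (schr t f)" .
qed

lemma schr_nonmeasurable: "f \<notin> borel_measurable lebesgue \<Longrightarrow> schr t f = schr t (\<lambda>_. 0)"
  by (simp add: schr_def fmult_def fourier_L2_nonmeasurable)

section \<open>Wave packets with compact frequency support\<close>

subsection \<open>Non-stationary phase in one variable\<close>

text \<open>Far from the classical trajectory the phase of a packet rescales to \<open>z * (x - \<theta> * x\<^sup>2)\<close> with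
  \<open>|\<theta>| \<le> 1/4\<close>, which has no stationary point in \<open>[-1, 1]\<close>. The exponents \<open>j\<close>, \<open>a\<close>, \<open>l\<close> make the
  family of integrands closed under integration by parts, each of which gains a factor \<open>1 / z\<close> at the cost of at most one power of \<open>1 - x\<^sup>2\<close>.\<close>

definition osc_fun :: "nat \<Rightarrow> nat \<Rightarrow> nat \<Rightarrow> real \<Rightarrow> real \<Rightarrow> complex \<Rightarrow> complex" where
  "osc_fun j a l \<theta> z w = w ^ j * (1 - w\<^sup>2) ^ a / (1 - 2 * \<theta> * w) ^ l * exp (\<i> * z * (w - \<theta> * w\<^sup>2))"

definition osc_int :: "nat \<Rightarrow> nat \<Rightarrow> nat \<Rightarrow> real \<Rightarrow> real \<Rightarrow> complex" where
  "osc_int j a l \<theta> z = integral {-1..1} (\<lambda>x. osc_fun j a l \<theta> z (of_real x))"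

lemma osc_denominator:
  assumes "\<bar>\<theta>\<bar> \<le> 1/4" "x \<in> {-1..1::real}"
  shows "1/2 \<le> 1 - 2 * \<theta> * x" "1 - 2 * complex_of_real \<theta> * complex_of_real x \<noteq> 0"
proof -
  have "\<bar>2 * \<theta> * x\<bar> \<le> 2 * (1/4) * 1"
    unfolding abs_mult using assms by (intro mult_mono) auto
  then show 1: "1/2 \<le> 1 - 2 * \<theta> * x" by linarith
  have "1 - 2 * complex_of_real \<theta> * complex_of_real x = complex_of_real (1 - 2 * \<theta> * x)" by simp
  also have "\<dots> \<noteq> 0" using 1 by (simp only: of_real_eq_0_iff)
  finally show "1 - 2 * complex_of_real \<theta> * complex_of_real x \<noteq> 0" .
qed

lemma osc_fun_continuous:
  assumes "\<bar>\<theta>\<bar> \<le> 1/4"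
  shows "continuous_on {-1..1} (\<lambda>x. osc_fun j a l \<theta> z (complex_of_real x))"
  unfolding osc_fun_def using osc_denominator(2)[OF assms] by (intro continuous_intros) auto

lemma osc_fun_bound:
  assumes \<theta>: "\<bar>\<theta>\<bar> \<le> 1/4" and x: "x \<in> {-1..1::real}"
  shows "cmod (osc_fun j a l \<theta> z (complex_of_real x)) \<le> 2 ^ l"
proof -
  have d: "1/2 \<le> 1 - 2 * \<theta> * x" by (rule osc_denominator(1)[OF assms])
  have x2: "0 \<le> 1 - x\<^sup>2" "1 - x\<^sup>2 \<le> 1" using x by (auto simp: abs_square_le_1 abs_le_iff)
  have eq: "osc_fun j a l \<theta> z (complex_of_real x) = complex_of_real (x ^ j * (1 - x\<^sup>2) ^ a / (1 - 2 * \<theta> * x) ^ l) * cis (z * (x - \<theta> * x\<^sup>2))"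
    by (simp add: osc_fun_def cis_conv_exp mult_ac)
  have "cmod (osc_fun j a l \<theta> z (complex_of_real x)) = \<bar>x\<bar> ^ j * (1 - x\<^sup>2) ^ a / (1 - 2 * \<theta> * x) ^ l"
    unfolding eq norm_mult norm_cis norm_of_real using d x2 by (simp add: abs_mult power_abs)
  also have "\<dots> \<le> 1 * 1 / (1/2) ^ l"
    using d x x2 by (intro frac_le mult_mono power_le_one power_mono) (auto intro!: zero_le_power)
  finally show ?thesis by (simp add: power_divide)
qed

text \<open>Integrates the derivative of \<open>H\<close>, which is the integrand divided by 1 -
  2\<theta>w, the derivative of the phase up to the factor z. The boundary terms vanish because 1 -
  w^2 occurs with exponent at least one. The derivative is computed for complex w and then
  restricted to the interval.\<close>

lemma osc_int_by_parts:
  fixes \<theta> z :: real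
  assumes \<theta>: "\<bar>\<theta>\<bar> \<le> 1/4" and z: "z \<noteq> 0"
  shows "\<i> * z * osc_int j (Suc a) l \<theta> z = 2 * Suc a * osc_int (Suc j) a (Suc l) \<theta> z
    - j * osc_int (j - 1) (Suc a) (Suc l) \<theta> z - 2 * \<theta> * Suc l * osc_int j (Suc a) (Suc (Suc l)) \<theta> z"
proof -
  define H where "H w = w ^ j * (1 - w\<^sup>2) ^ Suc a / (1 - 2 * complex_of_real \<theta> * w) ^ Suc l * exp (\<i> * z * (w - \<theta> * w\<^sup>2))" for w :: complex
  define H' where "H' w = j * osc_fun (j - 1) (Suc a) (Suc l) \<theta> z w - 2 * Suc a * osc_fun (Suc j) a (Suc l) \<theta> z w
     + 2 * \<theta> * Suc l * osc_fun j (Suc a) (Suc (Suc l)) \<theta> z w + \<i> * z * osc_fun j (Suc a) l \<theta> z w" for w :: complex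
  have der: "(H has_field_derivative H' w) (at w)" if "1 - 2 * complex_of_real \<theta> * w \<noteq> 0" for w
  proof -
    let ?p = "1 - 2 * complex_of_real \<theta> * w" and ?e = "exp (\<i> * z * (w - \<theta> * w\<^sup>2))"
    have 1: "((\<lambda>w. w ^ j * (1 - w\<^sup>2) ^ Suc a) has_field_derivative
       (j * w ^ (j - 1) * (1 - w\<^sup>2) ^ Suc a - 2 * Suc a * (w ^ Suc j * (1 - w\<^sup>2) ^ a))) (at w)"
    proof -
      have a1: "((\<lambda>w. w ^ j) has_field_derivative (j * w ^ (j - 1))) (at w)"
        by (auto intro!: derivative_eq_intros)
      have a2: "((\<lambda>w. (1 - w\<^sup>2) ^ Suc a) has_field_derivative (Suc a * (1 - w\<^sup>2) ^ a * (- 2 * w))) (at w)"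
      proof -
        have a0: "((\<lambda>w. 1 - w\<^sup>2) has_field_derivative (- 2 * w)) (at w)"
          by (auto intro!: derivative_eq_intros)
        show ?thesis by (rule DERIV_cong[OF DERIV_power_Suc[OF a0]]) (simp add: algebra_simps)
      qed
      show ?thesis by (rule DERIV_cong[OF DERIV_mult[OF a1 a2]]) (simp add: algebra_simps)
    qed
    have 2: "((\<lambda>w. inverse ((1 - 2 * complex_of_real \<theta> * w) ^ Suc l)) has_field_derivative
       (2 * \<theta> * Suc l / ?p ^ Suc (Suc l))) (at w)"
    proof -
      have d: "((\<lambda>w. (1 - 2 * complex_of_real \<theta> * w) ^ Suc l) has_field_derivative (Suc l * ?p ^ l * (- 2 * \<theta>))) (at w)"
      proof -
        have d0: "((\<lambda>w. 1 - 2 * complex_of_real \<theta> * w) has_field_derivative (- 2 * \<theta>)) (at w)"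
          by (auto intro!: derivative_eq_intros)
        show ?thesis by (rule DERIV_cong[OF DERIV_power_Suc[OF d0]]) (simp add: algebra_simps)
      qed
      have "((\<lambda>w. inverse ((1 - 2 * complex_of_real \<theta> * w) ^ Suc l)) has_field_derivative
          - (inverse (?p ^ Suc l) * (Suc l * ?p ^ l * (- 2 * \<theta>)) * inverse (?p ^ Suc l))) (at w)"
        by (rule DERIV_inverse'[OF d]) (use that in simp)
      also have "- (inverse (?p ^ Suc l) * (Suc l * ?p ^ l * (- 2 * \<theta>)) * inverse (?p ^ Suc l)) = 2 * \<theta> * Suc l / ?p ^ Suc (Suc l)"
      proof -
        have "- (inverse (p ^ Suc l) * (Suc l * p ^ l * (- 2 * \<theta>)) * inverse (p ^ Suc l)) = 2 * \<theta> * Suc l / p ^ Suc (Suc l)"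
          if "p \<noteq> 0" for p :: complex
          using that by (simp add: field_simps)
        from this[OF that] show ?thesis .
      qed
      finally show ?thesis .
    qed
    have 3: "((\<lambda>w. exp (\<i> * z * (w - \<theta> * w\<^sup>2))) has_field_derivative (?e * (\<i> * z * ?p))) (at w)"
      by (auto intro!: derivative_eq_intros simp: algebra_simps)
    have "(H has_field_derivative
        (((j * w ^ (j - 1) * (1 - w\<^sup>2) ^ Suc a - 2 * Suc a * (w ^ Suc j * (1 - w\<^sup>2) ^ a)) * inverse (?p ^ Suc l)
         + (2 * \<theta> * Suc l / ?p ^ Suc (Suc l)) * (w ^ j * (1 - w\<^sup>2) ^ Suc a)) * ?e
         + ?e * (\<i> * z * ?p) * (w ^ j * (1 - w\<^sup>2) ^ Suc a * inverse (?p ^ Suc l)))) (at w)"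
      unfolding H_def[abs_def] divide_inverse by (rule DERIV_mult[OF DERIV_mult[OF 1 2] 3, unfolded divide_inverse])
    also have "(((j * w ^ (j - 1) * (1 - w\<^sup>2) ^ Suc a - 2 * Suc a * (w ^ Suc j * (1 - w\<^sup>2) ^ a)) * inverse (?p ^ Suc l)
         + (2 * \<theta> * Suc l / ?p ^ Suc (Suc l)) * (w ^ j * (1 - w\<^sup>2) ^ Suc a)) * ?e
         + ?e * (\<i> * z * ?p) * (w ^ j * (1 - w\<^sup>2) ^ Suc a * inverse (?p ^ Suc l))) = H' w"
    proof -
      have c: "?p * inverse (?p ^ Suc l) = inverse (?p ^ l)" using that by simp
      have "?e * (\<i> * z * ?p) * (w ^ j * (1 - w\<^sup>2) ^ Suc a * inverse (?p ^ Suc l))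
          = \<i> * z * (w ^ j * (1 - w\<^sup>2) ^ Suc a * (?p * inverse (?p ^ Suc l)) * ?e)"
        by (simp only: mult_ac)
      also have "\<dots> = \<i> * z * osc_fun j (Suc a) l \<theta> z w"
        unfolding c osc_fun_def by (simp only: divide_inverse)
      finally have t: "?e * (\<i> * z * ?p) * (w ^ j * (1 - w\<^sup>2) ^ Suc a * inverse (?p ^ Suc l)) = \<i> * z * osc_fun j (Suc a) l \<theta> z w" .
      show ?thesis unfolding t H'_def
        by (simp only: osc_fun_def divide_inverse ring_distribs mult_ac)
    qed
    finally show ?thesis .
  qed
  have "((\<lambda>x. H' (complex_of_real x)) has_integral (H (complex_of_real 1) - H (complex_of_real (-1)))) {-1..1}"
    by (rule fundamental_theorem_of_calculus) (auto intro!: has_vector_derivative_real_field der osc_denominator(2)[OF \<theta>])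
  moreover have "H 1 = 0" "H (-1) = 0" by (auto simp: H_def)
  ultimately have "((\<lambda>x. H' (complex_of_real x)) has_integral 0) {-1..1}" by simp
  then have 0: "integral {-1..1} (\<lambda>x. H' (complex_of_real x)) = 0" by (rule integral_unique)
  have i: "(\<lambda>x. c * osc_fun j' a' l' \<theta> z (complex_of_real x)) integrable_on {-1..1}" for j' a' l' c
    by (intro integrable_continuous_real continuous_intros osc_fun_continuous \<theta>)
  have "integral {-1..1} (\<lambda>x. H' (complex_of_real x)) =
     j * osc_int (j - 1) (Suc a) (Suc l) \<theta> z - 2 * Suc a * osc_int (Suc j) a (Suc l) \<theta> z
     + 2 * \<theta> * Suc l * osc_int j (Suc a) (Suc (Suc l)) \<theta> z + \<i> * z * osc_int j (Suc a) l \<theta> z"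
    unfolding H'_def osc_int_def integral_mult_right[symmetric]
    by (subst integral_add, (intro integrable_add integrable_diff i)+)+ (simp add: integral_diff[OF i i])
  with 0 show ?thesis by (simp add: algebra_simps)
qed

text \<open>The exponent a drops by at most one in each integration by parts, so k steps are
  available. The constants are uniform in \<theta> because the denominators stay above 1/2. The
  truncated exponent \<open>j - 1\<close> is harmless at j = 0, where its coefficient is 0.\<close>

lemma osc_int_decay:
  "k \<le> a \<Longrightarrow> \<exists>C\<ge>0. \<forall>\<theta> z. \<bar>\<theta>\<bar> \<le> 1/4 \<longrightarrow> z \<noteq> 0 \<longrightarrow> cmod (osc_int j a l \<theta> z) * \<bar>z\<bar> ^ k \<le> C"
proof (induction k arbitrary: j a l)
  case 0
  have "cmod (osc_int j a l \<theta> z) \<le> 2 ^ l * (1 - (-1))" if "\<bar>\<theta>\<bar> \<le> 1/4" for \<theta> z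
    unfolding osc_int_def by (rule integral_bound[OF _ osc_fun_continuous osc_fun_bound]) (use that in auto)
  then show ?case by (intro exI[of _ "2 ^ l * (1 - (-1))"]) auto
next
  case (Suc k)
  then obtain b where b: "a = Suc b" "k \<le> b" by (cases a) auto
  obtain C1 where C1: "C1 \<ge> 0" "\<And>\<theta> z. \<bar>\<theta>\<bar> \<le> 1/4 \<Longrightarrow> z \<noteq> 0 \<Longrightarrow> cmod (osc_int (Suc j) b (Suc l) \<theta> z) * \<bar>z\<bar> ^ k \<le> C1"
    using Suc.IH[OF b(2)] by blast
  have "k \<le> Suc b" using b by simp
  note IH = Suc.IH[OF this]
  obtain C2 where C2: "C2 \<ge> 0" "\<And>\<theta> z. \<bar>\<theta>\<bar> \<le> 1/4 \<Longrightarrow> z \<noteq> 0 \<Longrightarrow> cmod (osc_int (j - 1) (Suc b) (Suc l) \<theta> z) * \<bar>z\<bar> ^ k \<le> C2"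
    using IH by blast
  obtain C3 where C3: "C3 \<ge> 0" "\<And>\<theta> z. \<bar>\<theta>\<bar> \<le> 1/4 \<Longrightarrow> z \<noteq> 0 \<Longrightarrow> cmod (osc_int j (Suc b) (Suc (Suc l)) \<theta> z) * \<bar>z\<bar> ^ k \<le> C3"
    using IH by blast
  let ?C = "2 * Suc b * C1 + j * C2 + Suc l * C3"
  have "cmod (osc_int j a l \<theta> z) * \<bar>z\<bar> ^ Suc k \<le> ?C" if t: "\<bar>\<theta>\<bar> \<le> 1/4" "z \<noteq> 0" for \<theta> z
  proof -
    let ?I1 = "osc_int (Suc j) b (Suc l) \<theta> z" and ?I2 = "osc_int (j - 1) (Suc b) (Suc l) \<theta> z"
      and ?I3 = "osc_int j (Suc b) (Suc (Suc l)) \<theta> z"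
    have "\<bar>z\<bar> * cmod (osc_int j a l \<theta> z) = cmod (\<i> * z * osc_int j a l \<theta> z)" by (simp add: norm_mult)
    also have "\<dots> = cmod (2 * Suc b * ?I1 - j * ?I2 - 2 * \<theta> * Suc l * ?I3)"
      unfolding b(1) osc_int_by_parts[OF t] ..
    also have "\<dots> \<le> cmod (2 * Suc b * ?I1) + cmod (j * ?I2) + cmod (2 * \<theta> * Suc l * ?I3)"
      by (intro order_trans[OF norm_triangle_ineq4] add_mono order_refl norm_triangle_ineq4)
    also have "\<dots> = 2 * Suc b * cmod ?I1 + j * cmod ?I2 + (2 * \<bar>\<theta>\<bar>) * (Suc l * cmod ?I3)"
      by (simp add: norm_mult del: of_nat_Suc)
    also have "\<dots> \<le> 2 * Suc b * cmod ?I1 + j * cmod ?I2 + 1 * (Suc l * cmod ?I3)"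
      using t(1) by (intro add_mono order_refl mult_right_mono) auto
    finally have "\<bar>z\<bar> * cmod (osc_int j a l \<theta> z) * \<bar>z\<bar> ^ k \<le> (2 * Suc b * cmod ?I1 + j * cmod ?I2 + 1 * (Suc l * cmod ?I3)) * \<bar>z\<bar> ^ k"
      by (intro mult_right_mono) auto
    also have "\<dots> = 2 * Suc b * (cmod ?I1 * \<bar>z\<bar> ^ k) + j * (cmod ?I2 * \<bar>z\<bar> ^ k) + Suc l * (cmod ?I3 * \<bar>z\<bar> ^ k)"
      by (simp only: distrib_right mult.assoc mult_1)
    also have "\<dots> \<le> ?C" using C1(2)[OF t] C2(2)[OF t] C3(2)[OF t] by (intro add_mono mult_left_mono) auto
    finally show ?thesis by (simp add: mult_ac)
  qed
  moreover have "?C \<ge> 0" using C1 C2 C3 by simp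
  ultimately show ?case by blast
qed

subsection \<open>The window and its evolution\<close>

definition wnd :: "nat \<Rightarrow> real \<Rightarrow> real" where
  "wnd K x = (if \<bar>x\<bar> \<le> 1 then (1 - x\<^sup>2) ^ K else 0)"

lemma wnd_measurable[measurable]: "wnd K \<in> borel_measurable borel"
  unfolding wnd_def by measurable

lemma wnd_bounds: "0 \<le> wnd K x" "wnd K x \<le> 1" "wnd K x \<le> indicator {-1..1} x"
  by (auto simp: wnd_def abs_square_le_1 indicator_def intro!: power_le_one)

text \<open>Free evolution for time s of the state whose Fourier transform is the window of width
  1/\<sigma>; at s = 0 it is a bump of width about \<sigma>.\<close>

definition packet1 :: "nat \<Rightarrow> real \<Rightarrow> real \<Rightarrow> real \<Rightarrow> complex" where
  "packet1 K \<sigma> s r = complex_of_real ((2 * pi) powr (-1/2)) *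
     (LINT \<eta>|lborel. cis (r * \<eta>) * (complex_of_real (wnd K (\<sigma> * \<eta>)) * cis (- s * \<eta>\<^sup>2)))"

lemma integrable_wnd:
  assumes "\<sigma> > 0" "g \<in> borel_measurable borel"
  shows "integrable lborel (\<lambda>\<eta>. complex_of_real (wnd K (\<sigma> * \<eta>)) * cis (g \<eta>))"
proof (rule Bochner_Integration.integrable_bound)
  show "integrable lborel (indicator {-1/\<sigma>..1/\<sigma>} :: real \<Rightarrow> real)"
    by (intro integrable_real_indicator) (auto simp: emeasure_lborel_Icc_eq)
  show "AE \<eta> in lborel. norm (complex_of_real (wnd K (\<sigma> * \<eta>)) * cis (g \<eta>)) \<le> norm (indicator {-1/\<sigma>..1/\<sigma>} \<eta> :: real)"
  proof (rule AE_I2)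
    fix \<eta> :: real
    have "(indicator {-1..1} (\<sigma> * \<eta>) :: real) = indicator {-1/\<sigma>..1/\<sigma>} \<eta>"
      using assms(1) by (auto simp: indicator_def field_simps)
    then show "norm (complex_of_real (wnd K (\<sigma> * \<eta>)) * cis (g \<eta>)) \<le> norm (indicator {-1/\<sigma>..1/\<sigma>} \<eta> :: real)"
      using wnd_bounds(1,3)[of K "\<sigma> * \<eta>"] by (simp add: norm_mult)
  qed
qed (use assms in measurable)

lemma packet1_measurable[measurable]: "packet1 K \<sigma> s \<in> borel_measurable borel"
  unfolding packet1_def by measurable

text \<open>Rescaling \<eta> = x / \<sigma> brings the phase to the form z (x - \<theta> x^2) with z
  = r / \<sigma> and \<theta> = s / (\<sigma> r). The hypothesis is exactly |\<theta>| \<le> 1/4: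
  the point r is at least twice as far away as the fastest frequency in the window travels, namely
  2|s|/\<sigma>.\<close>

lemma packet1_decay:
  assumes K: "K \<ge> 1"
  shows "\<exists>C\<ge>0. \<forall>\<sigma> s r. \<sigma> > 0 \<longrightarrow> r \<noteq> 0 \<longrightarrow> 4 * \<bar>s\<bar> \<le> \<bar>r\<bar> * \<sigma> \<longrightarrow> cmod (packet1 K \<sigma> s r) \<le> C / \<sigma> * (\<sigma> / \<bar>r\<bar>) ^ K"
proof -
  obtain C where C: "C \<ge> 0" "\<And>\<theta> z. \<bar>\<theta>\<bar> \<le> 1/4 \<Longrightarrow> z \<noteq> 0 \<Longrightarrow> cmod (osc_int 0 K 0 \<theta> z) * \<bar>z\<bar> ^ K \<le> C"
    using osc_int_decay[of K K 0 0] by auto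
  have "cmod (packet1 K \<sigma> s r) \<le> ((2 * pi) powr (-1/2) * C) / \<sigma> * (\<sigma> / \<bar>r\<bar>) ^ K"
    if \<sigma>: "\<sigma> > 0" and r: "r \<noteq> 0" and sr: "4 * \<bar>s\<bar> \<le> \<bar>r\<bar> * \<sigma>" for \<sigma> s r
  proof -
    define z where "z = r / \<sigma>"
    define \<theta> where "\<theta> = s / (\<sigma> * r)"
    have z: "z \<noteq> 0" using \<sigma> r by (simp add: z_def)
    have \<theta>: "\<bar>\<theta>\<bar> \<le> 1/4" using \<sigma> r sr by (simp add: \<theta>_def abs_mult field_simps)
    let ?f = "\<lambda>\<eta>. cis (r * \<eta>) * (complex_of_real (wnd K (\<sigma> * \<eta>)) * cis (- s * \<eta>\<^sup>2))"
    have "(LINT \<eta>|lborel. ?f \<eta>) = \<bar>1/\<sigma>\<bar> *\<^sub>R (LINT x|lborel. ?f (0 + (1/\<sigma>) * x))"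
      by (rule lborel_integral_real_affine) (use \<sigma> in simp)
    also have "(\<lambda>x. ?f (0 + (1/\<sigma>) * x)) = (\<lambda>x. indicator {-1..1} x *\<^sub>R osc_fun 0 K 0 \<theta> z (complex_of_real x))"
    proof
      fix x
      have "cis (r * (x / \<sigma>)) * cis (- s * (x / \<sigma>)\<^sup>2) = exp (\<i> * z * (x - \<theta> * x\<^sup>2))"
      proof -
        have e: "r * (x / \<sigma>) + - s * (x / \<sigma>)\<^sup>2 = z * (x - \<theta> * x\<^sup>2)"
          using \<sigma> r by (simp add: z_def \<theta>_def field_simps power2_eq_square)
        show ?thesis unfolding cis_mult e by (simp add: cis_conv_exp mult_ac)
      qed
      then show "?f (0 + (1/\<sigma>) * x) = indicator {-1..1} x *\<^sub>R osc_fun 0 K 0 \<theta> z (complex_of_real x)"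
        using \<sigma> by (auto simp: wnd_def osc_fun_def indicator_def abs_le_iff mult_ac)
    qed
    also have "(LINT x|lborel. indicator {-1..1} x *\<^sub>R osc_fun 0 K 0 \<theta> z (complex_of_real x)) = osc_int 0 K 0 \<theta> z"
      unfolding osc_int_def set_lebesgue_integral_def[symmetric]
      by (intro set_borel_integral_eq_integral(2) borel_integrable_atLeastAtMost' osc_fun_continuous \<theta>)
    finally have "cmod (packet1 K \<sigma> s r) = (2 * pi) powr (-1/2) / \<sigma> * cmod (osc_int 0 K 0 \<theta> z)"
      unfolding packet1_def using \<sigma> by (simp add: norm_mult)
    also have "cmod (osc_int 0 K 0 \<theta> z) \<le> C * (\<sigma> / \<bar>r\<bar>) ^ K"
      using C(2)[OF \<theta> z] z \<sigma> r by (simp add: z_def field_simps power_divide)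
    finally show ?thesis using \<sigma> by (simp add: mult_left_mono divide_right_mono)
  qed
  then show ?thesis using C(1) by (intro exI[of _ "(2 * pi) powr (-1/2) * C"]) auto
qed

lemma inverse_square_tail:
  assumes D: "D > 0"
  shows "(\<integral>\<^sup>+r. indicator {r. D \<le> \<bar>r\<bar>} r * ennreal (1 / r\<^sup>2) \<partial>lborel) \<le> ennreal (2 / D)"
proof -
  let ?f = "\<lambda>r::real. ennreal (1 / r\<^sup>2) * indicator {D..} r"
  have 1: "(\<integral>\<^sup>+r. ?f r \<partial>lborel) = ennreal (0 - (- (1 / D)))"
  proof (rule nn_integral_FTC_atLeast)
    show "DERIV (\<lambda>r. - (1 / r)) x :> 1 / x\<^sup>2" if "D \<le> x" for x
      using that D by (auto intro!: derivative_eq_intros simp: power2_eq_square)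
    have "((\<lambda>r::real. - inverse r) \<longlongrightarrow> - 0) at_top" by (intro tendsto_minus tendsto_inverse_0_at_top filterlim_ident)
    then show "((\<lambda>r::real. - (1 / r)) \<longlongrightarrow> 0) at_top" by (simp add: inverse_eq_divide)
  qed auto
  have 2: "(\<integral>\<^sup>+r. ?f (- r) \<partial>lborel) = (\<integral>\<^sup>+r. ?f r \<partial>lborel)"
    using nn_integral_real_affine[of ?f "-1" 0] by simp
  have "(\<integral>\<^sup>+r. indicator {r. D \<le> \<bar>r\<bar>} r * ennreal (1 / r\<^sup>2) \<partial>lborel) \<le> (\<integral>\<^sup>+r. ?f r + ?f (- r) \<partial>lborel)"
    by (intro nn_integral_mono) (auto simp: indicator_def abs_if split: if_splits)
  also have "\<dots> = (\<integral>\<^sup>+r. ?f r \<partial>lborel) + (\<integral>\<^sup>+r. ?f (- r) \<partial>lborel)" by (rule nn_integral_add) auto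
  also have "\<dots> = ennreal (2 / D)" unfolding 1 2 using D by (simp add: ennreal_plus[symmetric] del: ennreal_plus)
  finally show ?thesis by simp
qed

text \<open>Squaring the pointwise decay gives 2K powers of \<sigma> / |r|. All but two are bounded
  by their value at distance D; the remaining r^(-2) is integrated and returns one power of 1/D,
  whence the exponent 2K - 1.\<close>

lemma packet1_tail:
  assumes K: "K \<ge> 1"
  shows "\<exists>C\<ge>0. \<forall>\<sigma> s D. \<sigma> > 0 \<longrightarrow> D > 0 \<longrightarrow> 4 * \<bar>s\<bar> \<le> D * \<sigma> \<longrightarrow>
    (\<integral>\<^sup>+r. indicator {r. D \<le> \<bar>r\<bar>} r * ennreal ((cmod (packet1 K \<sigma> s r))\<^sup>2) \<partial>lborel) \<le> ennreal (C / \<sigma> * (\<sigma> / D) ^ (2 * K - 1))"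
proof -
  obtain C where C: "C \<ge> 0" "\<And>\<sigma> s r. \<sigma> > 0 \<Longrightarrow> r \<noteq> 0 \<Longrightarrow> 4 * \<bar>s\<bar> \<le> \<bar>r\<bar> * \<sigma> \<Longrightarrow> cmod (packet1 K \<sigma> s r) \<le> C / \<sigma> * (\<sigma> / \<bar>r\<bar>) ^ K"
    using packet1_decay[OF K] by blast
  have "(\<integral>\<^sup>+r. indicator {r. D \<le> \<bar>r\<bar>} r * ennreal ((cmod (packet1 K \<sigma> s r))\<^sup>2) \<partial>lborel) \<le> ennreal (2 * C\<^sup>2 / \<sigma> * (\<sigma> / D) ^ (2 * K - 1))"
    if \<sigma>: "\<sigma> > 0" and D: "D > 0" and sD: "4 * \<bar>s\<bar> \<le> D * \<sigma>" for \<sigma> s D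
  proof -
    let ?c = "C\<^sup>2 * (\<sigma> / D) ^ (2 * K - 2)"
    have "indicator {r. D \<le> \<bar>r\<bar>} r * ennreal ((cmod (packet1 K \<sigma> s r))\<^sup>2) \<le> ennreal ?c * (indicator {r. D \<le> \<bar>r\<bar>} r * ennreal (1 / r\<^sup>2))" for r
    proof (cases "D \<le> \<bar>r\<bar>")
      case True
      then have r: "r \<noteq> 0" using D by auto
      have "4 * \<bar>s\<bar> \<le> \<bar>r\<bar> * \<sigma>" using sD True \<sigma> by (meson mult_right_mono order_trans less_imp_le)
      then have "(cmod (packet1 K \<sigma> s r))\<^sup>2 \<le> (C / \<sigma> * (\<sigma> / \<bar>r\<bar>) ^ K)\<^sup>2" by (intro power_mono C \<sigma> r) auto
      also have "\<dots> = C\<^sup>2 / \<sigma>\<^sup>2 * (\<sigma> / \<bar>r\<bar>) ^ (2 * K)" by (simp add: power_mult_distrib power_divide power_mult mult.commute)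
      also have "(\<sigma> / \<bar>r\<bar>) ^ (2 * K) = (\<sigma> / \<bar>r\<bar>) ^ (2 * K - 2) * (\<sigma> / \<bar>r\<bar>)\<^sup>2"
      proof -
        have "2 * K = (2 * K - 2) + 2" using K by simp
        then show ?thesis by (metis power_add)
      qed
      also have "C\<^sup>2 / \<sigma>\<^sup>2 * ((\<sigma> / \<bar>r\<bar>) ^ (2 * K - 2) * (\<sigma> / \<bar>r\<bar>)\<^sup>2) = C\<^sup>2 * (\<sigma> / \<bar>r\<bar>) ^ (2 * K - 2) * (1 / r\<^sup>2)"
        using \<sigma> r by (simp add: power_divide)
      also have "\<dots> \<le> ?c * (1 / r\<^sup>2)"
        using True D \<sigma> by (intro mult_right_mono mult_left_mono power_mono divide_left_mono) auto
      finally show ?thesis using True \<sigma> D by (simp add: ennreal_mult[symmetric] ennreal_leI)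
    qed simp
    then have "(\<integral>\<^sup>+r. indicator {r. D \<le> \<bar>r\<bar>} r * ennreal ((cmod (packet1 K \<sigma> s r))\<^sup>2) \<partial>lborel)
       \<le> (\<integral>\<^sup>+r. ennreal ?c * (indicator {r. D \<le> \<bar>r\<bar>} r * ennreal (1 / r\<^sup>2)) \<partial>lborel)"
      by (intro nn_integral_mono)
    also have "\<dots> = ennreal ?c * (\<integral>\<^sup>+r. indicator {r. D \<le> \<bar>r\<bar>} r * ennreal (1 / r\<^sup>2) \<partial>lborel)"
      by (rule nn_integral_cmult) measurable
    also have "\<dots> \<le> ennreal ?c * ennreal (2 / D)" by (intro mult_left_mono inverse_square_tail D) auto
    also have "\<dots> = ennreal (?c * (2 / D))" using \<sigma> D by (subst ennreal_mult[symmetric]) auto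
    also have "?c * (2 / D) = 2 * C\<^sup>2 / \<sigma> * ((\<sigma> / D) ^ (2 * K - 2) * (\<sigma> / D))" using \<sigma> D by (simp add: field_simps)
    also have "(\<sigma> / D) ^ (2 * K - 2) * (\<sigma> / D) = (\<sigma> / D) ^ (2 * K - 1)"
    proof -
      have "2 * K - 1 = Suc (2 * K - 2)" using K by simp
      then show ?thesis by (simp only: power_Suc2)
    qed
    finally show ?thesis .
  qed
  then show ?thesis by (intro exI[of _ "2 * C\<^sup>2"]) auto
qed

section \<open>Packets in several variables\<close>

lemma nn_integral_prod_vec:
  fixes h :: "'n::finite \<Rightarrow> real \<Rightarrow> ennreal"
  assumes "\<And>i. h i \<in> borel_measurable borel"
  shows "(\<integral>\<^sup>+x. (\<Prod>i\<in>UNIV. h i ((x::real^'n) $ i)) \<partial>lborel) = (\<Prod>i\<in>UNIV. \<integral>\<^sup>+t. h i t \<partial>lborel)"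
proof -
  define ix :: "real^'n \<Rightarrow> 'n" where "ix b = (SOME i. b = axis i 1)" for b
  have ix: "ix (axis i 1) = i" for i
    unfolding ix_def by (rule some1_equality) (auto simp: axis_eq_axis)
  have "(\<integral>\<^sup>+x. (\<Prod>b\<in>Basis. h (ix b) ((x::real^'n) \<bullet> b)) \<partial>lborel) = (\<Prod>b\<in>(Basis::(real^'n) set). (\<integral>\<^sup>+t. h (ix b) t \<partial>lborel))"
    by (rule nn_integral_lborel_prod) (auto simp: assms)
  then show ?thesis by (simp only: prod_Basis_vec ix inner_axis) (simp add: mult.commute)
qed

text \<open>A product rather than a radial bump, so that evolved packets, masses and tails factor
  into one-dimensional ones.\<close>

definition window :: "nat \<Rightarrow> real \<Rightarrow> real^'n \<Rightarrow> real" where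
  "window K \<sigma> \<eta> = (\<Prod>i\<in>UNIV. wnd K (\<sigma> * \<eta> $ i))"

definition wmass :: "nat \<Rightarrow> real \<Rightarrow> real" where
  "wmass K \<sigma> = (LINT \<eta>|lborel. (wnd K (\<sigma> * \<eta>))\<^sup>2)"

definition packet :: "nat \<Rightarrow> real \<Rightarrow> real \<Rightarrow> real^'n \<Rightarrow> complex" where
  "packet K \<sigma> s = fourier_int 1 (\<lambda>\<eta>. complex_of_real (window K \<sigma> \<eta>) * cis (- s * (norm \<eta>)\<^sup>2))"

lemma window_measurable[measurable]: "window K \<sigma> \<in> borel_measurable borel"
  unfolding window_def by measurable

lemma window_bounds: "0 \<le> window K \<sigma> \<eta>" "window K \<sigma> \<eta> \<le> 1"
  unfolding window_def by (auto intro!: prod_nonneg prod_le_1 wnd_bounds)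

lemma window_support:
  assumes "window K \<sigma> (\<eta>::real^'n) \<noteq> 0" "\<sigma> > 0" shows "norm \<eta> \<le> CARD('n) / \<sigma>"
proof -
  have "\<bar>\<eta> $ i\<bar> \<le> 1 / \<sigma>" for i
    using assms by (auto simp: window_def wnd_def abs_mult field_simps split: if_splits)
  then have "(\<Sum>i\<in>UNIV. \<bar>\<eta> $ i\<bar>) \<le> (\<Sum>i\<in>(UNIV::'n set). 1 / \<sigma>)" by (intro sum_mono)
  then show ?thesis using norm_le_l1_cart[of \<eta>] by simp
qed

lemma window_cis_prod:
  "complex_of_real (window K \<sigma> \<eta>) * cis (- s * (norm (\<eta>::real^'n))\<^sup>2) = (\<Prod>i\<in>UNIV. complex_of_real (wnd K (\<sigma> * \<eta> $ i)) * cis (- s * (\<eta> $ i)\<^sup>2))"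
  by (simp add: window_def prod.distrib cis_conv_exp exp_sum[symmetric] norm_vec_def L2_set_def sum_nonneg sum_distrib_left sum_negf)

lemma integrable_window:
  assumes "\<sigma> > 0"
  shows "integrable lborel (\<lambda>\<eta>::real^'n. complex_of_real (window K \<sigma> \<eta>) * cis (- s * (norm \<eta>)\<^sup>2))"
  unfolding window_cis_prod by (rule lborel_integrable_prod_vec) (rule integrable_wnd[OF assms], measurable)

lemma packet_prod:
  assumes \<sigma>: "\<sigma> > 0"
  shows "packet K \<sigma> s (z::real^'n) = (\<Prod>i\<in>UNIV. packet1 K \<sigma> s (z $ i))"
proof -
  have eq: "cis (1 * (\<eta> \<bullet> z)) * (complex_of_real (window K \<sigma> \<eta>) * cis (- s * (norm \<eta>)\<^sup>2)) =
     (\<Prod>i\<in>UNIV. cis (z $ i * \<eta> $ i) * (complex_of_real (wnd K (\<sigma> * \<eta> $ i)) * cis (- s * (\<eta> $ i)\<^sup>2)))" for \<eta>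
    unfolding window_cis_prod prod.distrib[of "\<lambda>i. cis (z $ i * \<eta> $ i)"]
    by (simp add: inner_vec_def cis_conv_exp exp_sum sum_distrib_left mult.commute)
  have c: "(2 * pi) powr (- real CARD('n) / 2) = (\<Prod>i\<in>(UNIV::'n set). (2 * pi) powr (-1/2))"
    by (simp add: powr_realpow[symmetric] powr_powr)
  have "packet K \<sigma> s z = complex_of_real ((2 * pi) powr (- real CARD('n) / 2)) *
      (LINT \<eta>|lborel. (\<Prod>i\<in>UNIV. cis (z $ i * \<eta> $ i) * (complex_of_real (wnd K (\<sigma> * \<eta> $ i)) * cis (- s * (\<eta> $ i)\<^sup>2))))"
    unfolding packet_def by (subst fourier_int_borel, measurable) (simp only: eq)
  also have "(LINT \<eta>|lborel. (\<Prod>i\<in>UNIV. cis (z $ i * \<eta> $ i) * (complex_of_real (wnd K (\<sigma> * \<eta> $ i)) * cis (- s * (\<eta> $ i)\<^sup>2)))) =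
      (\<Prod>i\<in>UNIV. LINT \<eta>|lborel. cis (z $ i * \<eta>) * (complex_of_real (wnd K (\<sigma> * \<eta>)) * cis (- s * \<eta>\<^sup>2)))"
    by (rule lborel_integral_prod_vec) (intro integrable_cis_mult integrable_wnd \<sigma>, measurable)
  finally show ?thesis unfolding c by (simp add: packet1_def prod.distrib)
qed

lemma wmass_pos:
  assumes \<sigma>: "\<sigma> > 0" shows "wmass K \<sigma> = wmass K 1 / \<sigma>" "wmass K \<sigma> > 0"
    "(\<integral>\<^sup>+\<eta>. ennreal ((wnd K (\<sigma> * \<eta>))\<^sup>2) \<partial>lborel) = ennreal (wmass K \<sigma>)"
proof -
  have i: "integrable lborel (\<lambda>\<eta>. (wnd K (c * \<eta>))\<^sup>2)" if "c > 0" for c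
  proof (rule Bochner_Integration.integrable_bound)
    show "integrable lborel (\<lambda>\<eta>. cmod (complex_of_real (wnd K (c * \<eta>)) * cis 0))"
      by (intro integrable_norm integrable_wnd that) simp
    show "AE \<eta> in lborel. norm ((wnd K (c * \<eta>))\<^sup>2) \<le> norm (cmod (complex_of_real (wnd K (c * \<eta>)) * cis 0))"
      using wnd_bounds by (intro AE_I2) (auto simp: power2_eq_square mult_left_le)
  qed measurable
  show "(\<integral>\<^sup>+\<eta>. ennreal ((wnd K (\<sigma> * \<eta>))\<^sup>2) \<partial>lborel) = ennreal (wmass K \<sigma>)"
    unfolding wmass_def by (rule nn_integral_eq_integral[OF i[OF \<sigma>]]) simp
  have "wmass K 1 = \<bar>\<sigma>\<bar> *\<^sub>R (LINT x|lborel. (wnd K (1 * (0 + \<sigma> * x)))\<^sup>2)"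
    unfolding wmass_def by (rule lborel_integral_real_affine) (use \<sigma> in simp)
  then show 1: "wmass K \<sigma> = wmass K 1 / \<sigma>" using \<sigma> by (simp add: wmass_def)
  \<comment> \<open>On |x| \<le> 1/2 the window is at least (3/4)^K, which makes the mass
    positive.\<close>
  have "(LINT x|lborel. (3/4) ^ (2 * K) * indicator {-1/2..1/2::real} x) \<le> wmass K 1"
    unfolding wmass_def
  proof (rule integral_mono)
    fix x :: real
    show "(3/4) ^ (2 * K) * indicator {-1/2..1/2} x \<le> (wnd K (1 * x))\<^sup>2"
    proof (cases "x \<in> {-1/2..1/2}")
      case True
      then have "x\<^sup>2 \<le> (1/2)\<^sup>2" by (intro abs_le_square_iff[THEN iffD1]) (auto simp: abs_le_iff)
      then have "(3/4) ^ (2 * K) \<le> (1 - x\<^sup>2) ^ (2 * K)" by (intro power_mono) (auto simp: power2_eq_square)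
      then show ?thesis using True by (auto simp: wnd_def power_mult[symmetric] mult.commute)
    qed simp
  qed (use i[of 1] in auto)
  then have "wmass K 1 > 0" by (rule less_le_trans[rotated]) simp
  then show "wmass K \<sigma> > 0" using 1 \<sigma> by simp
qed

lemma
  assumes \<sigma>: "\<sigma> > 0"
  shows L2_window: "L2 lborel (\<lambda>\<eta>::real^'n. complex_of_real (window K \<sigma> \<eta>) * cis (- s * (norm \<eta>)\<^sup>2))"
    and nn_integral_window: "(\<integral>\<^sup>+\<eta>. ennreal ((window K \<sigma> (\<eta>::real^'n))\<^sup>2) \<partial>lborel) = ennreal (wmass K \<sigma> ^ CARD('n))"
proof -
  have "(\<integral>\<^sup>+\<eta>. ennreal ((window K \<sigma> (\<eta>::real^'n))\<^sup>2) \<partial>lborel) = (\<integral>\<^sup>+\<eta>. (\<Prod>i\<in>UNIV. ennreal ((wnd K (\<sigma> * (\<eta>::real^'n) $ i))\<^sup>2)) \<partial>lborel)"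
    by (simp add: window_def prod_power_distrib prod_ennreal)
  also have "\<dots> = (\<Prod>i\<in>(UNIV::'n set). \<integral>\<^sup>+\<eta>. ennreal ((wnd K (\<sigma> * \<eta>))\<^sup>2) \<partial>lborel)"
    by (rule nn_integral_prod_vec) measurable
  also have "\<dots> = ennreal (wmass K \<sigma> ^ CARD('n))"
    using wmass_pos[OF \<sigma>, of K] by (simp add: ennreal_power)
  finally show 1: "(\<integral>\<^sup>+\<eta>. ennreal ((window K \<sigma> (\<eta>::real^'n))\<^sup>2) \<partial>lborel) = ennreal (wmass K \<sigma> ^ CARD('n))" .
  show "L2 lborel (\<lambda>\<eta>::real^'n. complex_of_real (window K \<sigma> \<eta>) * cis (- s * (norm \<eta>)\<^sup>2))"
    by (rule L2_I_nn) (use 1 in \<open>auto simp: norm_mult\<close>)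
qed

lemma packet_measurable[measurable]: "packet K \<sigma> s \<in> borel_measurable borel"
  unfolding packet_def by (intro fourier_int_measurable lebesgue_measurable_borel) measurable

lemma packet_bounded:
  "\<exists>B. \<forall>z::real^'n. cmod (packet K \<sigma> s z) \<le> B"
proof (intro exI allI)
  fix z :: "real^'n"
  show "cmod (packet K \<sigma> s z) \<le> (2 * pi) powr (- real CARD('n) / 2) * (LINT \<eta>|lborel. window K \<sigma> (\<eta>::real^'n))"
    unfolding packet_def
    by (subst fourier_int_borel, measurable, unfold norm_mult)
      (intro mult_mono order_trans[OF integral_norm_bound], auto simp: norm_mult window_bounds)
qed

lemma
  assumes \<sigma>: "\<sigma> > 0"
  shows L2_packet: "L2 lborel (packet K \<sigma> s :: real^'n \<Rightarrow> complex)"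
    and nn_integral_packet: "(\<integral>\<^sup>+z. ennreal ((cmod (packet K \<sigma> s (z::real^'n)))\<^sup>2) \<partial>lborel) = ennreal (wmass K \<sigma> ^ CARD('n))"
proof -
  let ?w = "\<lambda>\<eta>::real^'n. complex_of_real (window K \<sigma> \<eta>) * cis (- s * (norm \<eta>)\<^sup>2)"
  have m: "?w \<in> borel_measurable borel" by measurable
  have w: "L2 lebesgue ?w" using L2_lebesgue_iff[OF m] L2_window[OF \<sigma>] by simp
  have wi: "integrable lebesgue ?w" using integrable_lebesgue_iff[OF m] integrable_window[OF \<sigma>] by simp
  note P = fourier_int_Plancherel[OF w wi power_one, folded packet_def]
  show L: "L2 lborel (packet K \<sigma> s :: real^'n \<Rightarrow> complex)"
    using P(1) unfolding L2_lebesgue_iff[OF packet_measurable] by simp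
  have n: "nm lborel (packet K \<sigma> s :: real^'n \<Rightarrow> complex) = nm lborel ?w"
    using P(2) by (simp only: nm_lebesgue[OF packet_measurable] nm_lebesgue[OF m])
  show "(\<integral>\<^sup>+z. ennreal ((cmod (packet K \<sigma> s (z::real^'n)))\<^sup>2) \<partial>lborel) = ennreal (wmass K \<sigma> ^ CARD('n))"
    unfolding nn_integral_nm[OF L] n nn_integral_nm[OF L2_window[OF \<sigma>], symmetric]
    using nn_integral_window[OF \<sigma>, where 'n='n, of K] by (simp add: norm_mult)
qed

text \<open>Read off from Plancherel's identity on \<open>real^2\<close>: the packet factors there,
  so the square of the wanted integral equals the square of the mass, and both are
  nonnegative.\<close>

lemma nn_integral_packet1:
  assumes \<sigma>: "\<sigma> > 0"
  shows "(\<integral>\<^sup>+r. ennreal ((cmod (packet1 K \<sigma> s r))\<^sup>2) \<partial>lborel) = ennreal (wmass K \<sigma>)"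
proof -
  let ?g = "\<integral>\<^sup>+r. ennreal ((cmod (packet1 K \<sigma> s r))\<^sup>2) \<partial>lborel"
  have "ennreal (wmass K \<sigma> ^ CARD(2)) = (\<integral>\<^sup>+z. ennreal ((cmod (packet K \<sigma> s (z::real^2)))\<^sup>2) \<partial>lborel)"
    using nn_integral_packet[OF \<sigma>, where 'n=2] by simp
  also have "\<dots> = (\<integral>\<^sup>+z. (\<Prod>i\<in>UNIV. ennreal ((cmod (packet1 K \<sigma> s ((z::real^2) $ i)))\<^sup>2)) \<partial>lborel)"
    by (simp add: packet_prod[OF \<sigma>] prod_norm[symmetric] prod_power_distrib prod_ennreal)
  also have "\<dots> = (\<Prod>i\<in>(UNIV::2 set). ?g)" by (rule nn_integral_prod_vec) measurable
  finally have eq: "?g ^ 2 = ennreal ((wmass K \<sigma>)\<^sup>2)" by simp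
  then have "?g \<noteq> \<infinity>" by (auto simp: power2_eq_square ennreal_mult_eq_top_iff)
  then obtain x where x: "?g = ennreal x" "x \<ge> 0" by (cases ?g) auto
  have "x\<^sup>2 = (wmass K \<sigma>)\<^sup>2" using eq x(2) unfolding x(1) by (simp add: ennreal_power ennreal_inj)
  then have "x = wmass K \<sigma>" using x(2) wmass_pos(2)[OF \<sigma>, of K] by (simp add: power2_eq_iff_nonneg)
  then show ?thesis using x by simp
qed

text \<open>A vector of norm at least D has a coordinate of size at least D / n, because the norm is
  at most the sum of the coordinates. For each such coordinate the one-dimensional tail is
  multiplied by the full mass in the others. The factor n in the hypothesis is the price of
  replacing D by D / n.\<close>

lemma packet_tail:
  assumes K: "K \<ge> 1"
  shows "\<exists>C\<ge>0. \<forall>\<sigma> s D::real. \<sigma> > 0 \<longrightarrow> D > 0 \<longrightarrow> 4 * real CARD('n) * \<bar>s\<bar> \<le> D * \<sigma> \<longrightarrow>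
    (\<integral>\<^sup>+z. indicator {z. D \<le> norm z} z * ennreal ((cmod (packet K \<sigma> s (z::real^'n)))\<^sup>2) \<partial>lborel)
      \<le> ennreal (C * (\<sigma> / D) ^ (2 * K - 1) * wmass K \<sigma> ^ CARD('n))"
proof -
  let ?n = "real CARD('n)"
  obtain C where C: "C \<ge> 0" "\<And>\<sigma> s D. \<sigma> > 0 \<Longrightarrow> D > 0 \<Longrightarrow> 4 * \<bar>s\<bar> \<le> D * \<sigma> \<Longrightarrow>
    (\<integral>\<^sup>+r. indicator {r. D \<le> \<bar>r\<bar>} r * ennreal ((cmod (packet1 K \<sigma> s r))\<^sup>2) \<partial>lborel) \<le> ennreal (C / \<sigma> * (\<sigma> / D) ^ (2 * K - 1))"
    using packet1_tail[OF K] by blast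
  let ?C = "?n * (C * ?n ^ (2 * K - 1) / wmass K 1)"
  have w1: "wmass K 1 > 0" by (rule wmass_pos) simp
  have "(\<integral>\<^sup>+z. indicator {z. D \<le> norm z} z * ennreal ((cmod (packet K \<sigma> s (z::real^'n)))\<^sup>2) \<partial>lborel)
      \<le> ennreal (?C * (\<sigma> / D) ^ (2 * K - 1) * wmass K \<sigma> ^ CARD('n))"
    if \<sigma>: "\<sigma> > 0" and D: "D > 0" and sD: "4 * real CARD('n) * \<bar>s\<bar> \<le> D * \<sigma>" for \<sigma> s D :: real
  proof -
    define E where "E = D / ?n"
    have E: "E > 0" using D by (simp add: E_def)
    have sE: "4 * \<bar>s\<bar> \<le> E * \<sigma>" using sD by (simp add: E_def field_simps)
    define h where "h j i r = (if i = j then indicator {r. E \<le> \<bar>r\<bar>} r else 1) * ennreal ((cmod (packet1 K \<sigma> s r))\<^sup>2)" for j i :: 'n and r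
    have [measurable]: "h j i \<in> borel_measurable borel" for j i unfolding h_def by measurable
    have pt: "indicator {z. D \<le> norm z} z * ennreal ((cmod (packet K \<sigma> s z))\<^sup>2) \<le> (\<Sum>j\<in>UNIV. \<Prod>i\<in>UNIV. h j i (z $ i))" for z :: "real^'n"
    proof (cases "D \<le> norm z")
      case True
      have "\<exists>j. E \<le> \<bar>z $ j\<bar>"
      proof (rule ccontr)
        assume "\<not> ?thesis"
        then have "(\<Sum>i\<in>UNIV. \<bar>z $ i\<bar>) < (\<Sum>i\<in>(UNIV::'n set). E)" by (intro sum_strict_mono) (auto simp: not_le)
        then show False using True norm_le_l1_cart[of z] by (simp add: E_def)
      qed
      then obtain j where j: "E \<le> \<bar>z $ j\<bar>" by blast
      have "ennreal ((cmod (packet K \<sigma> s z))\<^sup>2) = (\<Prod>i\<in>UNIV. h j i (z $ i))"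
        unfolding packet_prod[OF \<sigma>] prod_norm[symmetric] prod_power_distrib prod_ennreal[symmetric, OF zero_le_power2]
        by (intro prod.cong) (use j in \<open>auto simp: h_def\<close>)
      also have "\<dots> \<le> (\<Sum>j\<in>UNIV. \<Prod>i\<in>UNIV. h j i (z $ i))" by (rule member_le_sum) auto
      finally show ?thesis using True by simp
    qed simp
    have hint: "(\<integral>\<^sup>+z. (\<Prod>i\<in>UNIV. h j i ((z::real^'n) $ i)) \<partial>lborel) \<le> ennreal (C / \<sigma> * (\<sigma> / E) ^ (2 * K - 1) * wmass K \<sigma> ^ (CARD('n) - 1))" for j
    proof -
      have "(\<integral>\<^sup>+z. (\<Prod>i\<in>UNIV. h j i ((z::real^'n) $ i)) \<partial>lborel) = (\<Prod>i\<in>UNIV. \<integral>\<^sup>+r. h j i r \<partial>lborel)"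
        by (rule nn_integral_prod_vec) measurable
      also have "\<dots> = (\<integral>\<^sup>+r. h j j r \<partial>lborel) * (\<Prod>i\<in>UNIV - {j}. \<integral>\<^sup>+r. h j i r \<partial>lborel)"
        by (subst prod.remove[of UNIV j]) auto
      also have "(\<Prod>i\<in>UNIV - {j}. \<integral>\<^sup>+r. h j i r \<partial>lborel) = (\<Prod>i\<in>UNIV - {j}. ennreal (wmass K \<sigma>))"
        by (intro prod.cong) (auto simp: h_def nn_integral_packet1[OF \<sigma>])
      also have "\<dots> = ennreal (wmass K \<sigma> ^ (CARD('n) - 1))"
        using wmass_pos(2)[OF \<sigma>, of K] by (simp add: ennreal_power)
      also have "(\<integral>\<^sup>+r. h j j r \<partial>lborel) \<le> ennreal (C / \<sigma> * (\<sigma> / E) ^ (2 * K - 1))"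
        using C(2)[OF \<sigma> E sE] by (simp add: h_def)
      also have "ennreal (C / \<sigma> * (\<sigma> / E) ^ (2 * K - 1)) * ennreal (wmass K \<sigma> ^ (CARD('n) - 1)) =
          ennreal (C / \<sigma> * (\<sigma> / E) ^ (2 * K - 1) * wmass K \<sigma> ^ (CARD('n) - 1))"
        by (rule ennreal_mult[symmetric]) (use wmass_pos(2)[OF \<sigma>, of K] C(1) \<sigma> E in auto)
      finally show ?thesis by (simp add: mult_right_mono)
    qed
    have "(\<integral>\<^sup>+z. indicator {z. D \<le> norm z} z * ennreal ((cmod (packet K \<sigma> s (z::real^'n)))\<^sup>2) \<partial>lborel)
       \<le> (\<integral>\<^sup>+z. (\<Sum>j\<in>UNIV. \<Prod>i\<in>UNIV. h j i ((z::real^'n) $ i)) \<partial>lborel)" by (intro nn_integral_mono pt)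
    also have "\<dots> = (\<Sum>j\<in>UNIV. \<integral>\<^sup>+z. (\<Prod>i\<in>UNIV. h j i ((z::real^'n) $ i)) \<partial>lborel)"
      by (rule nn_integral_sum) measurable
    also have "\<dots> \<le> (\<Sum>j\<in>(UNIV::'n set). ennreal (C / \<sigma> * (\<sigma> / E) ^ (2 * K - 1) * wmass K \<sigma> ^ (CARD('n) - 1)))"
      by (intro sum_mono hint)
    also have "\<dots> = ennreal (?n * (C / \<sigma> * (\<sigma> / E) ^ (2 * K - 1) * wmass K \<sigma> ^ (CARD('n) - 1)))"
      unfolding sum_constant ennreal_of_nat_eq_real_of_nat
      by (rule ennreal_mult[symmetric]) (use wmass_pos(2)[OF \<sigma>, of K] C(1) \<sigma> E in auto)
    also have "?n * (C / \<sigma> * (\<sigma> / E) ^ (2 * K - 1) * wmass K \<sigma> ^ (CARD('n) - 1)) = ?C * (\<sigma> / D) ^ (2 * K - 1) * wmass K \<sigma> ^ CARD('n)"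
    proof -
      have "wmass K \<sigma> ^ CARD('n) = wmass K \<sigma> ^ (CARD('n) - 1) * wmass K \<sigma>"
        by (metis One_nat_def Suc_pred mult.commute power_Suc zero_less_card_finite)
      moreover have "wmass K \<sigma> = wmass K 1 / \<sigma>" by (rule wmass_pos(1)[OF \<sigma>])
      moreover have "\<sigma> / E = ?n * (\<sigma> / D)" by (simp add: E_def)
      ultimately show ?thesis using w1 by (simp add: power_mult_distrib power_divide field_simps)
    qed
    finally show ?thesis .
  qed
  moreover have "?C \<ge> 0" using C(1) w1 by simp
  ultimately show ?thesis by blast
qed

section \<open>The phase space transform\<close>

lemma lborel_nn_integral_reflect:
  fixes h :: "'a::euclidean_space \<Rightarrow> ennreal"
  assumes [measurable]: "h \<in> borel_measurable borel"
  shows "(\<integral>\<^sup>+x. h (y - x) \<partial>lborel) = (\<integral>\<^sup>+x. h x \<partial>lborel)"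
proof -
  have "(lborel::'a measure) = distr lborel borel (\<lambda>x. y - x)"
    using lborel_affine[of "-1" y] by (simp add: density_1)
  then have "(\<integral>\<^sup>+x. h x \<partial>lborel) = (\<integral>\<^sup>+x. h x \<partial>distr lborel borel (\<lambda>x. y - x))" by simp
  also have "\<dots> = (\<integral>\<^sup>+x. h (y - x) \<partial>lborel)" by (subst nn_integral_distr) auto
  finally show ?thesis by simp
qed

lemma nn_integral_convolution:
  fixes h g :: "'a::euclidean_space \<Rightarrow> ennreal"
  assumes [measurable]: "h \<in> borel_measurable borel" "g \<in> borel_measurable borel"
  shows "(\<integral>\<^sup>+x. \<integral>\<^sup>+y. h (y - x) * g y \<partial>lborel \<partial>lborel) = (\<integral>\<^sup>+z. h z \<partial>lborel) * (\<integral>\<^sup>+y. g y \<partial>lborel)"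
proof -
  have "(\<integral>\<^sup>+x. \<integral>\<^sup>+y. h (y - x) * g y \<partial>lborel \<partial>lborel) = (\<integral>\<^sup>+y. \<integral>\<^sup>+x. h (y - x) * g y \<partial>lborel \<partial>lborel)"
    by (rule lborel_pair.Fubini') measurable
  also have "\<dots> = (\<integral>\<^sup>+y. (\<integral>\<^sup>+z. h z \<partial>lborel) * g y \<partial>lborel)"
    by (intro nn_integral_cong) (simp add: nn_integral_multc lborel_nn_integral_reflect)
  also have "\<dots> = (\<integral>\<^sup>+z. h z \<partial>lborel) * (\<integral>\<^sup>+y. g y \<partial>lborel)" by (rule nn_integral_cmult) measurable
  finally show ?thesis .
qed

text \<open>The parameter \<open>s\<close> is the time for which the window has evolved: up to a phase, the transform of
  \<open>schr (- s) f\<close> with \<open>s = 0\<close> is the transform of \<open>f\<close> with parameter \<open>s\<close>, read at \<open>x + 2 s \<xi>\<close>.\<close>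

definition stft :: "nat \<Rightarrow> real \<Rightarrow> real \<Rightarrow> (real^'n \<Rightarrow> complex) \<Rightarrow> real^'n \<Rightarrow> real^'n \<Rightarrow> complex" where
  "stft K \<sigma> s f x \<xi> = (LINT y|lebesgue. cnj (packet K \<sigma> s (y - x)) * (cis (- (y \<bullet> \<xi>)) * f y))"

lemma stft_cong_AE:
  fixes f g :: "real^'n \<Rightarrow> complex"
  assumes "AE x in lebesgue. f x = g x" "f \<in> borel_measurable lebesgue" "g \<in> borel_measurable lebesgue"
  shows "stft K \<sigma> s f = stft K \<sigma> s g"
proof (intro ext)
  fix x \<xi> :: "real^'n"
  have [measurable]: "(\<lambda>y. cnj (packet K \<sigma> s (y - x))) \<in> borel_measurable lebesgue"
    by (rule lebesgue_measurable_borel) measurable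
  have [measurable]: "(\<lambda>y. cis (- (y \<bullet> \<xi>))) \<in> borel_measurable lebesgue"
    by (rule lebesgue_measurable_borel) measurable
  note [measurable] = assms(2,3)
  show "stft K \<sigma> s f x \<xi> = stft K \<sigma> s g x \<xi>"
    unfolding stft_def
  proof (rule integral_cong_AE)
    show "AE y in lebesgue. cnj (packet K \<sigma> s (y - x)) * (cis (- (y \<bullet> \<xi>)) * f y) = cnj (packet K \<sigma> s (y - x)) * (cis (- (y \<bullet> \<xi>)) * g y)"
      using assms(1) by eventually_elim simp
  qed measurable
qed

lemma stft_borel:
  assumes [measurable]: "f \<in> borel_measurable borel"
  shows "stft K \<sigma> s f x \<xi> = (LINT y|lborel. cnj (packet K \<sigma> s (y - x)) * (cis (- (y \<bullet> \<xi>)) * f y))"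
  unfolding stft_def by (rule integral_lebesgue) measurable

lemma stft_measurable:
  assumes "f \<in> borel_measurable lebesgue"
  shows "(\<lambda>z. stft K \<sigma> s f (fst z) (snd z)) \<in> borel_measurable (lborel \<Otimes>\<^sub>M lborel)"
proof -
  obtain g where [measurable]: "g \<in> borel_measurable borel" and ae: "AE x in lebesgue. f x = g x"
    using lebesgue_borel_representative[OF assms] .
  have "stft K \<sigma> s f = stft K \<sigma> s g" by (rule stft_cong_AE[OF ae assms lebesgue_measurable_borel]) simp
  then show ?thesis by (simp add: stft_borel)
qed

lemma L2_packet_translate:
  assumes \<sigma>: "\<sigma> > 0" shows "L2 lborel (\<lambda>y. packet K \<sigma> s (y - (x::real^'n)))"
  using L2_translate[OF L2_packet[OF \<sigma>, of K s], of "-x"] by simp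

lemma L2_mult_cis:
  assumes "L2 M f" "g \<in> borel_measurable M" shows "L2 M (\<lambda>x. cis (g x) * f x)"
  by (rule L2_bound[OF assms(1), where c=1]) (use assms in \<open>auto simp: norm_mult L2_measurable\<close>)

lemma stft_integrable:
  assumes \<sigma>: "\<sigma> > 0" and f: "L2 lebesgue (f :: real^'n \<Rightarrow> complex)"
  shows "integrable lebesgue (\<lambda>y. cnj (packet K \<sigma> s (y - x)) * (cis (- (y \<bullet> \<xi>)) * f y))"
proof (rule ip_integrable)
  have "(\<lambda>y. packet K \<sigma> s (y - x)) \<in> borel_measurable borel" by measurable
  from L2_lebesgue_iff[OF this] show "L2 lebesgue (\<lambda>y. packet K \<sigma> s (y - x))" using L2_packet_translate[OF \<sigma>] by simp
  show "L2 lebesgue (\<lambda>y. cis (- (y \<bullet> \<xi>)) * f y)"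
    by (rule L2_mult_cis[OF f], rule measurable_completion) measurable
qed

lemma stft_diff:
  assumes "\<sigma> > 0" "L2 lebesgue f" "L2 lebesgue g"
  shows "stft K \<sigma> s (\<lambda>y. f y - g y) x \<xi> = stft K \<sigma> s f x \<xi> - stft K \<sigma> s g x \<xi>"
  unfolding stft_def using assms by (simp add: right_diff_distrib stft_integrable)

lemma stft_add:
  assumes "\<sigma> > 0" "L2 lebesgue f" "L2 lebesgue g"
  shows "stft K \<sigma> s (\<lambda>y. f y + g y) x \<xi> = stft K \<sigma> s f x \<xi> + stft K \<sigma> s g x \<xi>"
  unfolding stft_def using assms by (simp add: distrib_left stft_integrable)

lemma stft_scale: "stft K \<sigma> s (\<lambda>y. c * f y) x \<xi> = c * stft K \<sigma> s f x \<xi>"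
  unfolding stft_def by (subst integral_mult_right_zero[symmetric]) (simp add: mult_ac)

lemma nn_integral_Plancherel:
  fixes u :: "real^'n \<Rightarrow> complex"
  assumes u: "integrable lborel u" "L2 lborel u" and a: "a\<^sup>2 = 1"
  shows "(\<integral>\<^sup>+\<xi>. ennreal ((cmod (LINT y|lborel. cis (a * (y \<bullet> \<xi>)) * u y))\<^sup>2) \<partial>lborel) =
    ennreal ((2 * pi) ^ CARD('n)) * (\<integral>\<^sup>+y. ennreal ((cmod (u y))\<^sup>2) \<partial>lborel)"
  unfolding nn_integral_nm[OF Plancherel_lborel(1)[OF u a]] Plancherel_lborel(2)[OF u a] nn_integral_nm[OF u(2)]
  by (simp add: ennreal_mult)

text \<open>For fixed x the transform is, as a function of \<xi>, the Fourier integral of f times a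
  translated packet. The product is integrable as a product of L2 functions and square integrable
  because the packet is bounded, which is what Plancherel's identity asks for.\<close>

lemma stft_slice:
  assumes \<sigma>: "\<sigma> > 0" and f: "L2 lborel (f :: real^'n \<Rightarrow> complex)"
  shows "(\<integral>\<^sup>+\<xi>. ennreal ((cmod (stft K \<sigma> s f x \<xi>))\<^sup>2) \<partial>lborel) =
    ennreal ((2 * pi) ^ CARD('n)) * (\<integral>\<^sup>+y. ennreal ((cmod (packet K \<sigma> s (y - x)))\<^sup>2) * ennreal ((cmod (f y))\<^sup>2) \<partial>lborel)"
proof -
  have [measurable]: "f \<in> borel_measurable borel" using f by (simp add: L2_def)
  let ?u = "\<lambda>y. cnj (packet K \<sigma> s (y - x)) * f y"
  have i: "integrable lborel ?u" by (rule ip_integrable[OF L2_packet_translate[OF \<sigma>] f])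
  obtain B where B: "\<And>z::real^'n. cmod (packet K \<sigma> s z) \<le> B" using packet_bounded by blast
  have u: "L2 lborel ?u"
    by (rule L2_bound[OF f, where c=B]) (use B in \<open>auto simp: norm_mult intro!: mult_right_mono\<close>)
  have "stft K \<sigma> s f x \<xi> = (LINT y|lborel. cis (-1 * (y \<bullet> \<xi>)) * ?u y)" for \<xi>
    by (simp add: stft_borel mult_ac)
  then show ?thesis
    using nn_integral_Plancherel[OF i u, of "-1"] by (simp add: norm_mult power_mult_distrib ennreal_mult)
qed

text \<open>By Parseval the transform is rewritten over frequencies, where the window is explicit
  and compactly supported, its evolution is a phase, and Fourier multipliers act by
  multiplication.\<close>

lemma stft_frequency:
  assumes \<sigma>: "\<sigma> > 0" and f: "L2 lebesgue (f :: real^'n \<Rightarrow> complex)"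
  shows "stft K \<sigma> s f x \<xi> = (LINT \<eta>|lebesgue. cis (x \<bullet> (\<eta> - \<xi>)) * (complex_of_real (window K \<sigma> (\<eta> - \<xi>)) * cis (s * (norm (\<eta> - \<xi>))\<^sup>2)) * fourier_L2 (-1) f \<eta>)"
proof -
  define w0 where "w0 \<eta> = cis (- (x \<bullet> \<eta>)) * (complex_of_real (window K \<sigma> \<eta>) * cis (- s * (norm \<eta>)\<^sup>2))" for \<eta>
  define w where "w \<eta> = w0 (-\<xi> + \<eta>)" for \<eta>
  define p where "p y = cis (y \<bullet> \<xi>) * packet K \<sigma> s (y - x)" for y
  have [measurable]: "w0 \<in> borel_measurable borel" "w \<in> borel_measurable borel" "p \<in> borel_measurable borel"
    unfolding w_def w0_def p_def by measurable
  have w0: "L2 lborel w0" "integrable lborel w0"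
    unfolding w0_def by (intro L2_mult_cis L2_window \<sigma> integrable_cis_mult integrable_window, measurable)+
  have w: "L2 lborel w" unfolding w_def[abs_def] by (rule L2_translate[OF w0(1)])
  have wi: "integrable lborel w"
    unfolding w_def[abs_def] using lborel_integrable_affine[of w0 1 "-\<xi>"] w0(2) by simp
  have w': "L2 lebesgue w" "integrable lebesgue w"
    using w wi by (simp_all add: L2_lebesgue_iff integrable_lebesgue_iff)
  have Fw: "fourier_int 1 w = p"
  proof
    fix y
    let ?c = "complex_of_real ((2 * pi) powr (- real CARD('n) / 2))"
    have "(LINT \<eta>|lborel. cis (1 * (\<eta> \<bullet> y)) * w \<eta>) = \<bar>1\<bar> ^ DIM(real^'n) *\<^sub>R (LINT \<eta>|lborel. cis (1 * ((\<xi> + 1 *\<^sub>R \<eta>) \<bullet> y)) * w (\<xi> + 1 *\<^sub>R \<eta>))"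
      by (rule lborel_integral_affine, measurable)
    also have "\<dots> = (LINT \<eta>|lborel. cis (y \<bullet> \<xi>) * (cis (1 * (\<eta> \<bullet> (y - x))) * (complex_of_real (window K \<sigma> \<eta>) * cis (- s * (norm \<eta>)\<^sup>2))))"
    proof -
      have "cis ((\<xi> + \<eta>) \<bullet> y) * w0 \<eta> = cis (y \<bullet> \<xi>) * (cis (\<eta> \<bullet> (y - x)) * (complex_of_real (window K \<sigma> \<eta>) * cis (- s * (norm \<eta>)\<^sup>2)))" for \<eta>
      proof -
        have "cis ((\<xi> + \<eta>) \<bullet> y) * cis (- (x \<bullet> \<eta>)) = cis (y \<bullet> \<xi>) * cis (\<eta> \<bullet> (y - x))"
          unfolding cis_mult by (simp add: inner_add_left inner_add_right inner_diff_right inner_commute add_diff_eq)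
        then show ?thesis unfolding w0_def mult.assoc[symmetric] by simp
      qed
      then show ?thesis by (simp add: w_def)
    qed
    also have "\<dots> = cis (y \<bullet> \<xi>) * (LINT \<eta>|lborel. cis (1 * (\<eta> \<bullet> (y - x))) * (complex_of_real (window K \<sigma> \<eta>) * cis (- s * (norm \<eta>)\<^sup>2)))"
      by (rule integral_mult_right_zero)
    finally have "fourier_int 1 w y = cis (y \<bullet> \<xi>) * (?c * (LINT \<eta>|lborel. cis (1 * (\<eta> \<bullet> (y - x))) * (complex_of_real (window K \<sigma> \<eta>) * cis (- s * (norm \<eta>)\<^sup>2))))"
      by (simp add: fourier_int_borel)
    also have "?c * (LINT \<eta>|lborel. cis (1 * (\<eta> \<bullet> (y - x))) * (complex_of_real (window K \<sigma> \<eta>) * cis (- s * (norm \<eta>)\<^sup>2))) = packet K \<sigma> s (y - x)"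
      unfolding packet_def by (rule fourier_int_borel[symmetric]) measurable
    finally show "fourier_int 1 w y = p y" by (simp add: p_def)
  qed
  have "AE y in lebesgue. fourier_L2 1 w y = p y"
    using fourier_L2_eq_fourier_int[OF w' power_one] by (simp add: Fw)
  then have "ip lebesgue (fourier_L2 1 w) f = ip lebesgue p f"
    using L2_fourier_L2[OF w'(1) power_one] f
    by (intro ip_cong_AE) (auto intro: L2_measurable lebesgue_measurable_borel)
  moreover have "ip lebesgue (fourier_L2 1 w) f = ip lebesgue w (fourier_L2 (-1) f)"
    by (rule fourier_L2_adjoint[OF w'(1) f power_one])
  moreover have "stft K \<sigma> s f x \<xi> = ip lebesgue p f"
    unfolding stft_def ip_def p_def by (simp add: cis_cnj mult_ac)
  moreover have "ip lebesgue w (fourier_L2 (-1) f) = (LINT \<eta>|lebesgue. cis (x \<bullet> (\<eta> - \<xi>)) * (complex_of_real (window K \<sigma> (\<eta> - \<xi>)) * cis (s * (norm (\<eta> - \<xi>))\<^sup>2)) * fourier_L2 (-1) f \<eta>)"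
    unfolding ip_def w_def w0_def by (simp add: cis_cnj)
  ultimately show ?thesis by simp
qed

lemma stft_covariance:
  assumes \<sigma>: "\<sigma> > 0" and f: "L2 lebesgue (f :: real^'n \<Rightarrow> complex)"
  shows "stft K \<sigma> 0 (schr (- s) f) x \<xi> = cis (s * (norm \<xi>)\<^sup>2) * stft K \<sigma> s f (x + (2 * s) *\<^sub>R \<xi>) \<xi>"
proof -
  have FS: "AE \<eta> in lebesgue. fourier_L2 (-1) (schr (- s) f) \<eta> = cis (s * (norm \<eta>)\<^sup>2) * fourier_L2 (-1) f \<eta>"
    using fourier_fmult[OF schr_sym f, of "-s"] by (simp add: schr_def)
  have m: "fourier_L2 (-1) (schr (- s) f) \<in> borel_measurable lebesgue" "fourier_L2 (-1) f \<in> borel_measurable lebesgue"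
    by (intro L2_measurable L2_fourier_L2 L2_schr f; simp)+
  have b: "g \<in> borel_measurable borel \<Longrightarrow> h \<in> borel_measurable lebesgue \<Longrightarrow> (\<lambda>\<eta>. g \<eta> * h \<eta>) \<in> borel_measurable lebesgue"
    for g h :: "real^'n \<Rightarrow> complex" by (rule borel_measurable_times[OF lebesgue_measurable_borel])
  let ?g = "\<lambda>\<eta>. cis (s * (norm \<xi>)\<^sup>2) * (cis ((x + (2 * s) *\<^sub>R \<xi>) \<bullet> (\<eta> - \<xi>)) * (complex_of_real (window K \<sigma> (\<eta> - \<xi>)) * cis (s * (norm (\<eta> - \<xi>))\<^sup>2)))"
  have id: "cis (x \<bullet> (\<eta> - \<xi>)) * (complex_of_real (window K \<sigma> (\<eta> - \<xi>)) * cis (0 * (norm (\<eta> - \<xi>))\<^sup>2)) * cis (s * (norm \<eta>)\<^sup>2) = ?g \<eta>" for \<eta>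
  proof -
    \<comment> \<open>Taylor expansion of the norm squared about \<xi>: the linear term shifts the
      position to x + 2s\<xi>, the quadratic one evolves the window.\<close>
    have e: "x \<bullet> (\<eta> - \<xi>) + s * (norm \<eta>)\<^sup>2 = s * (norm \<xi>)\<^sup>2 + ((x + (2 * s) *\<^sub>R \<xi>) \<bullet> (\<eta> - \<xi>) + s * (norm (\<eta> - \<xi>))\<^sup>2)"
      unfolding power2_norm_eq_inner by (simp add: inner_simps inner_commute algebra_simps)
    have "cis (x \<bullet> (\<eta> - \<xi>)) * cis (s * (norm \<eta>)\<^sup>2) = cis (s * (norm \<xi>)\<^sup>2) * (cis ((x + (2 * s) *\<^sub>R \<xi>) \<bullet> (\<eta> - \<xi>)) * cis (s * (norm (\<eta> - \<xi>))\<^sup>2))"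
      unfolding cis_mult e ..
    then show ?thesis by (simp add: mult_ac)
  qed
  have g0m: "(\<lambda>\<eta>. cis (x \<bullet> (\<eta> - \<xi>)) * (complex_of_real (window K \<sigma> (\<eta> - \<xi>)) * cis (0 * (norm (\<eta> - \<xi>))\<^sup>2))) \<in> borel_measurable borel"
    and gm: "?g \<in> borel_measurable borel" by measurable
  have "stft K \<sigma> 0 (schr (- s) f) x \<xi> = (LINT \<eta>|lebesgue. ?g \<eta> * fourier_L2 (-1) f \<eta>)"
    unfolding stft_frequency[OF \<sigma> L2_schr[OF f]]
  proof (rule integral_cong_AE)
    show "AE \<eta> in lebesgue. cis (x \<bullet> (\<eta> - \<xi>)) * (complex_of_real (window K \<sigma> (\<eta> - \<xi>)) * cis (0 * (norm (\<eta> - \<xi>))\<^sup>2)) * fourier_L2 (-1) (schr (- s) f) \<eta> = ?g \<eta> * fourier_L2 (-1) f \<eta>"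
      using FS by eventually_elim (simp only: id[symmetric] mult.assoc)
  qed (rule b[OF g0m m(1)] b[OF gm m(2)])+
  also have "\<dots> = cis (s * (norm \<xi>)\<^sup>2) * stft K \<sigma> s f (x + (2 * s) *\<^sub>R \<xi>) \<xi>"
    unfolding stft_frequency[OF \<sigma> f] by (subst integral_mult_right_zero[symmetric]) (simp only: mult.assoc)
  finally show ?thesis .
qed

subsection \<open>Normalisation\<close>

abbreviation PS :: "((real^'n) \<times> (real^'n)) measure" where "PS \<equiv> lborel \<Otimes>\<^sub>M lborel"

text \<open>The constant makes this an isometry from L2 into L2 of phase space, for every s.\<close>

definition pst :: "nat \<Rightarrow> real \<Rightarrow> real \<Rightarrow> (real^'n \<Rightarrow> complex) \<Rightarrow> (real^'n) \<times> (real^'n) \<Rightarrow> complex" where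
  "pst K \<sigma> s f z = complex_of_real (1 / sqrt ((2 * pi) ^ CARD('n) * wmass K \<sigma> ^ CARD('n))) * stft K \<sigma> s f (fst z) (snd z)"

lemma pst_measurable:
  "f \<in> borel_measurable lebesgue \<Longrightarrow> pst K \<sigma> s f \<in> borel_measurable PS"
  unfolding pst_def by (intro borel_measurable_times stft_measurable) auto

lemma pst_const_sq:
  assumes "\<sigma> > 0"
  shows "ennreal ((cmod (complex_of_real (1 / sqrt ((2 * pi) ^ n * wmass K \<sigma> ^ n))))\<^sup>2) * ennreal ((2 * pi) ^ n)
    = ennreal (1 / wmass K \<sigma> ^ n)"
proof -
  have W: "wmass K \<sigma> ^ n > 0" using wmass_pos(2)[OF assms, of K] by simp
  have "(cmod (complex_of_real (1 / sqrt ((2 * pi) ^ n * wmass K \<sigma> ^ n))))\<^sup>2 = 1 / ((2 * pi) ^ n * wmass K \<sigma> ^ n)"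
    unfolding norm_of_real power2_abs power_divide using W by (subst real_sqrt_pow2) auto
  then show ?thesis using W by (simp add: ennreal_mult[symmetric])
qed

lemma pst_slice:
  assumes \<sigma>: "\<sigma> > 0" and f: "L2 lborel (f :: real^'n \<Rightarrow> complex)"
  shows "(\<integral>\<^sup>+\<xi>. ennreal ((cmod (pst K \<sigma> s f (x, \<xi>)))\<^sup>2) \<partial>lborel) =
    ennreal (1 / wmass K \<sigma> ^ CARD('n)) * (\<integral>\<^sup>+y. ennreal ((cmod (packet K \<sigma> s (y - x)))\<^sup>2) * ennreal ((cmod (f y))\<^sup>2) \<partial>lborel)"
proof -
  have fm: "f \<in> borel_measurable borel" using f by (simp add: L2_def)
  note [measurable] = stft_measurable[OF lebesgue_measurable_borel[OF fm], of K \<sigma> s]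
  have [measurable]: "(\<lambda>\<xi>. stft K \<sigma> s f x \<xi>) \<in> borel_measurable borel"
    using measurable_compose[OF measurable_Pair1'[of x lborel lborel] stft_measurable[OF lebesgue_measurable_borel[OF fm], of K \<sigma> s]] by simp
  have "(\<integral>\<^sup>+\<xi>. ennreal ((cmod (pst K \<sigma> s f (x, \<xi>)))\<^sup>2) \<partial>lborel) =
     ennreal ((cmod (complex_of_real (1 / sqrt ((2 * pi) ^ CARD('n) * wmass K \<sigma> ^ CARD('n)))))\<^sup>2) * (\<integral>\<^sup>+\<xi>. ennreal ((cmod (stft K \<sigma> s f x \<xi>))\<^sup>2) \<partial>lborel)"
    unfolding pst_def fst_conv snd_conv norm_mult power_mult_distrib
    by (subst nn_integral_cmult[symmetric]) (auto simp: ennreal_mult)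
  then show ?thesis unfolding stft_slice[OF \<sigma> f] mult.assoc[symmetric] pst_const_sq[OF \<sigma>] .
qed

lemma pst_cong_AE:
  assumes "AE x in lebesgue. f x = g x" "f \<in> borel_measurable lebesgue" "g \<in> borel_measurable lebesgue"
  shows "pst K \<sigma> s f = pst K \<sigma> s g"
  unfolding pst_def[abs_def] stft_cong_AE[OF assms] ..

lemma mass_cancel:
  assumes "\<sigma> > 0" "x \<ge> 0"
  shows "ennreal (1 / wmass K \<sigma> ^ n) * (ennreal (x * wmass K \<sigma> ^ n) * y) = ennreal x * y"
  using wmass_pos(2)[OF assms(1), of K] assms(2)
  by (simp add: mult.assoc[symmetric] ennreal_mult[symmetric])

lemma nn_integral_PS:
  assumes [measurable]: "g \<in> borel_measurable PS"
  shows "(\<integral>\<^sup>+z. g z \<partial>PS) = (\<integral>\<^sup>+x. \<integral>\<^sup>+\<xi>. g (x, \<xi>) \<partial>lborel \<partial>lborel)"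
    and "(\<integral>\<^sup>+z. g z \<partial>PS) = (\<integral>\<^sup>+\<xi>. \<integral>\<^sup>+x. g (x, \<xi>) \<partial>lborel \<partial>lborel)"
proof -
  show 1: "(\<integral>\<^sup>+z. g z \<partial>PS) = (\<integral>\<^sup>+x. \<integral>\<^sup>+\<xi>. g (x, \<xi>) \<partial>lborel \<partial>lborel)"
    by (rule lborel.nn_integral_fst[symmetric]) measurable
  show "(\<integral>\<^sup>+z. g z \<partial>PS) = (\<integral>\<^sup>+\<xi>. \<integral>\<^sup>+x. g (x, \<xi>) \<partial>lborel \<partial>lborel)"
    unfolding 1 by (rule lborel_pair.Fubini'[symmetric]) measurable
qed

text \<open>Integrating the slices over x produces the convolution of |packet|^2 with |f|^2, and the
  mass of the packet is independent of s.\<close>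

lemma
  assumes \<sigma>: "\<sigma> > 0" and f: "L2 lebesgue (f :: real^'n \<Rightarrow> complex)"
  shows L2_pst: "L2 PS (pst K \<sigma> s f)" and nm_pst: "nm PS (pst K \<sigma> s f) = nm lebesgue f"
proof -
  obtain g where g: "L2 lborel g" "L2 lebesgue g" and m[measurable]: "g \<in> borel_measurable borel"
    and ae: "AE x in lebesgue. f x = g x" and n: "nm lebesgue f = nm lborel g"
    using L2_borel_representative[OF f] by blast
  have eq: "pst K \<sigma> s f = pst K \<sigma> s g" by (rule pst_cong_AE[OF ae L2_measurable[OF f] L2_measurable[OF g(2)]])
  have pm[measurable]: "pst K \<sigma> s g \<in> borel_measurable PS" by (rule pst_measurable[OF L2_measurable[OF g(2)]])
  have "(\<integral>\<^sup>+z. ennreal ((cmod (pst K \<sigma> s g z))\<^sup>2) \<partial>PS) = (\<integral>\<^sup>+x. \<integral>\<^sup>+\<xi>. ennreal ((cmod (pst K \<sigma> s g (x, \<xi>)))\<^sup>2) \<partial>lborel \<partial>lborel)"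
    by (rule nn_integral_PS(1)) measurable
  also have "\<dots> = ennreal (1 / wmass K \<sigma> ^ CARD('n)) * (\<integral>\<^sup>+x. \<integral>\<^sup>+y. ennreal ((cmod (packet K \<sigma> s (y - x)))\<^sup>2) * ennreal ((cmod (g y))\<^sup>2) \<partial>lborel \<partial>lborel)"
    unfolding pst_slice[OF \<sigma> g(1)] by (rule nn_integral_cmult) measurable
  also have "(\<integral>\<^sup>+x. \<integral>\<^sup>+y. ennreal ((cmod (packet K \<sigma> s (y - x)))\<^sup>2) * ennreal ((cmod (g y))\<^sup>2) \<partial>lborel \<partial>lborel)
      = ennreal (1 * wmass K \<sigma> ^ CARD('n)) * ennreal ((nm lborel g)\<^sup>2)"
    by (subst nn_integral_convolution) (auto simp: nn_integral_packet[OF \<sigma>] nn_integral_nm[OF g(1)])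
  also have "ennreal (1 / wmass K \<sigma> ^ CARD('n)) * (ennreal (1 * wmass K \<sigma> ^ CARD('n)) * ennreal ((nm lborel g)\<^sup>2)) = ennreal ((nm lebesgue f)\<^sup>2)"
    unfolding n by (subst mass_cancel[OF \<sigma>]) auto
  finally have *: "(\<integral>\<^sup>+z. ennreal ((cmod (pst K \<sigma> s f z))\<^sup>2) \<partial>PS) = ennreal ((nm lebesgue f)\<^sup>2)" unfolding eq .
  show L: "L2 PS (pst K \<sigma> s f)" unfolding eq by (rule L2_I_nn[OF pm]) (simp only: *[unfolded eq], simp)
  show "nm PS (pst K \<sigma> s f) = nm lebesgue f" using * unfolding nn_integral_nm[OF L] by (simp add: ennreal_inj)
qed

lemma pst_diff:
  assumes "\<sigma> > 0" "L2 lebesgue f" "L2 lebesgue g"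
  shows "pst K \<sigma> s (\<lambda>y. f y - g y) z = pst K \<sigma> s f z - pst K \<sigma> s g z"
  unfolding pst_def by (simp add: stft_diff[OF assms] right_diff_distrib)

lemma pst_add:
  assumes "\<sigma> > 0" "L2 lebesgue f" "L2 lebesgue g"
  shows "pst K \<sigma> s (\<lambda>y. f y + g y) z = pst K \<sigma> s f z + pst K \<sigma> s g z"
  unfolding pst_def by (simp add: stft_add[OF assms] distrib_left)

lemma pst_scale: "pst K \<sigma> s (\<lambda>y. c * f y) z = c * pst K \<sigma> s f z"
  unfolding pst_def by (simp add: stft_scale)

subsection \<open>Propagation into a region and the decay of the source\<close>

text \<open>The unevolved window is used throughout: time enters only through \<open>schr\<close>
  applied to f.\<close>

definition pnm :: "nat \<Rightarrow> real \<Rightarrow> ((real^'n) \<times> (real^'n)) set \<Rightarrow> (real^'n \<Rightarrow> complex) \<Rightarrow> real" where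
  "pnm K \<sigma> S f = nm PS (\<lambda>z. indicator S z * pst K \<sigma> 0 f z)"

lemma L2_indicator_mult:
  assumes "L2 M f" "S \<in> sets M" shows "L2 M (\<lambda>z. indicator S z * f z)"
  by (rule L2_bound[OF assms(1), where c=1]) (use assms in \<open>auto simp: indicator_def L2_measurable\<close>)

text \<open>By covariance, evolving f amounts to moving S along the classical flow, hence to
  positions of norm at least D, with an evolved window. A point there sees f either at distance at
  least D / 2 from the origin or through the part of the packet beyond D / 2.\<close>

lemma pnm_schr_le:
  fixes f :: "real^'n \<Rightarrow> complex"
  assumes \<sigma>: "\<sigma> > 0" and f: "L2 lebesgue f" and S: "S \<in> sets PS"
    and D: "\<And>x \<xi>. (x, \<xi>) \<in> S \<Longrightarrow> D \<le> norm (x + (2 * s) *\<^sub>R \<xi>)" and \<tau>: "\<tau> \<ge> 0"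
    and tail: "(\<integral>\<^sup>+z. indicator {z. D / 2 \<le> norm z} z * ennreal ((cmod (packet K \<sigma> s (z::real^'n)))\<^sup>2) \<partial>lborel) \<le> ennreal (\<tau> * wmass K \<sigma> ^ CARD('n))"
  shows "(pnm K \<sigma> S (schr (- s) f))\<^sup>2 \<le> (nm lebesgue (\<lambda>y. indicator {y. D / 2 \<le> norm y} y * f y))\<^sup>2 + \<tau> * (nm lebesgue f)\<^sup>2"
proof -
  obtain g where g: "L2 lborel g" "L2 lebesgue g" and m[measurable]: "g \<in> borel_measurable borel"
    and ae: "AE x in lebesgue. f x = g x" and n: "nm lebesgue f = nm lborel g"
    using L2_borel_representative[OF f] by blast
  let ?W = "wmass K \<sigma> ^ CARD('n)"
  let ?I = "indicator {y::real^'n. D / 2 \<le> norm y} :: real^'n \<Rightarrow> ennreal"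
  let ?A = "\<lambda>y. indicator {y. D / 2 \<le> norm y} y * g y :: complex"
  have Iset: "{y::real^'n. D / 2 \<le> norm y} \<in> sets borel" by measurable
  have LA: "L2 lborel ?A" using Iset by (intro L2_indicator_mult g) simp
  have nA: "nm lebesgue (\<lambda>y. indicator {y. D / 2 \<le> norm y} y * f y) = nm lborel ?A"
  proof -
    have "nm lebesgue (\<lambda>y. indicator {y. D / 2 \<le> norm y} y * f y) = nm lebesgue ?A"
    proof (rule nm_cong_AE)
      show "AE y in lebesgue. indicator {y. D / 2 \<le> norm y} y * f y = ?A y" using ae by eventually_elim simp
    qed (use Iset L2_indicator_mult[OF f] L2_indicator_mult[OF g(2)] in \<open>auto intro: L2_measurable\<close>)
    then show ?thesis using nm_lebesgue[of ?A] by simp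
  qed
  note [measurable] = pst_measurable[OF L2_measurable[OF g(2)], of K \<sigma> s] S
    pst_measurable[OF L2_measurable[OF L2_schr[OF f]], of K \<sigma> 0 "-s"]
  have cov: "cmod (pst K \<sigma> 0 (schr (- s) f) (x, \<xi>)) = cmod (pst K \<sigma> s g (x + (2 * s) *\<^sub>R \<xi>, \<xi>))" for x \<xi>
  proof -
    have "cmod (stft K \<sigma> 0 (schr (- s) f) x \<xi>) = cmod (stft K \<sigma> s g (x + (2 * s) *\<^sub>R \<xi>) \<xi>)"
      using stft_covariance[OF \<sigma> f, of K s x \<xi>] stft_cong_AE[OF ae L2_measurable[OF f] L2_measurable[OF g(2)], of K \<sigma> s]
      by (simp add: norm_mult)
    then show ?thesis unfolding pst_def fst_conv snd_conv norm_mult by (simp only:)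
  qed
  let ?J = "indicator {x::real^'n. D \<le> norm x} :: real^'n \<Rightarrow> ennreal"
  have LS: "L2 PS (\<lambda>z. indicator S z * pst K \<sigma> 0 (schr (- s) f) z)"
    by (rule L2_indicator_mult[OF L2_pst[OF \<sigma> L2_schr[OF f]] S])
  have "ennreal ((pnm K \<sigma> S (schr (- s) f))\<^sup>2) = (\<integral>\<^sup>+z. ennreal ((cmod (indicator S z * pst K \<sigma> 0 (schr (- s) f) z))\<^sup>2) \<partial>PS)"
    unfolding pnm_def by (rule nn_integral_nm[OF LS, symmetric])
  \<comment> \<open>Frequency is made the outer variable: for fixed \<xi> the flow is a translation
    in x and preserves the inner integral.\<close>
  also have "\<dots> = (\<integral>\<^sup>+\<xi>. \<integral>\<^sup>+x. ennreal ((cmod (indicator S (x, \<xi>) * pst K \<sigma> 0 (schr (- s) f) (x, \<xi>)))\<^sup>2) \<partial>lborel \<partial>lborel)"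
    by (rule nn_integral_PS(2)) measurable
  also have "\<dots> \<le> (\<integral>\<^sup>+\<xi>. \<integral>\<^sup>+x. ?J ((2 * s) *\<^sub>R \<xi> + x) * ennreal ((cmod (pst K \<sigma> s g ((2 * s) *\<^sub>R \<xi> + x, \<xi>)))\<^sup>2) \<partial>lborel \<partial>lborel)"
  proof (intro nn_integral_mono)
    fix \<xi> x :: "real^'n"
    show "ennreal ((cmod (indicator S (x, \<xi>) * pst K \<sigma> 0 (schr (- s) f) (x, \<xi>)))\<^sup>2) \<le> ?J ((2 * s) *\<^sub>R \<xi> + x) * ennreal ((cmod (pst K \<sigma> s g ((2 * s) *\<^sub>R \<xi> + x, \<xi>)))\<^sup>2)"
      using D[of x \<xi>] by (cases "(x, \<xi>) \<in> S") (auto simp: norm_mult cov add.commute)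
  qed
  also have "\<dots> = (\<integral>\<^sup>+\<xi>. \<integral>\<^sup>+x. ?J x * ennreal ((cmod (pst K \<sigma> s g (x, \<xi>)))\<^sup>2) \<partial>lborel \<partial>lborel)"
    by (intro nn_integral_cong lborel_nn_integral_translate) measurable
  also have "\<dots> = (\<integral>\<^sup>+x. \<integral>\<^sup>+\<xi>. ?J x * ennreal ((cmod (pst K \<sigma> s g (x, \<xi>)))\<^sup>2) \<partial>lborel \<partial>lborel)"
    by (rule lborel_pair.Fubini') measurable
  also have "\<dots> = (\<integral>\<^sup>+x. ?J x * (ennreal (1 / ?W) * (\<integral>\<^sup>+y. ennreal ((cmod (packet K \<sigma> s (y - x)))\<^sup>2) * ennreal ((cmod (g y))\<^sup>2) \<partial>lborel)) \<partial>lborel)"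
    by (intro nn_integral_cong, subst nn_integral_cmult, measurable) (simp add: pst_slice[OF \<sigma> g(1)])
  also have "\<dots> = ennreal (1 / ?W) * (\<integral>\<^sup>+x. \<integral>\<^sup>+y. ?J x * (ennreal ((cmod (packet K \<sigma> s (y - x)))\<^sup>2) * ennreal ((cmod (g y))\<^sup>2)) \<partial>lborel \<partial>lborel)"
    by (subst nn_integral_cmult[symmetric], measurable) (simp add: nn_integral_cmult mult.left_commute)
  \<comment> \<open>D \<le> |x| \<le> |y| + |y - x|, so one of the two summands is at least D /
    2.\<close>
  also have "\<dots> \<le> ennreal (1 / ?W) * (\<integral>\<^sup>+x. \<integral>\<^sup>+y. (ennreal ((cmod (packet K \<sigma> s (y - x)))\<^sup>2) * ennreal ((cmod (?A y))\<^sup>2)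
       + (?I (y - x) * ennreal ((cmod (packet K \<sigma> s (y - x)))\<^sup>2)) * ennreal ((cmod (g y))\<^sup>2)) \<partial>lborel \<partial>lborel)"
  proof (intro mult_left_mono nn_integral_mono)
    fix x y :: "real^'n"
    have "norm x \<le> norm y + norm (y - x)" using norm_triangle_ineq4[of y "y - x"] by simp
    then show "?J x * (ennreal ((cmod (packet K \<sigma> s (y - x)))\<^sup>2) * ennreal ((cmod (g y))\<^sup>2)) \<le>
       ennreal ((cmod (packet K \<sigma> s (y - x)))\<^sup>2) * ennreal ((cmod (?A y))\<^sup>2)
       + (?I (y - x) * ennreal ((cmod (packet K \<sigma> s (y - x)))\<^sup>2)) * ennreal ((cmod (g y))\<^sup>2)"
      by (cases "D / 2 \<le> norm y"; cases "D / 2 \<le> norm (y - x)"; cases "D \<le> norm x") (auto simp: indicator_def)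
  qed simp
  also have "\<dots> = ennreal (1 / ?W) * ((\<integral>\<^sup>+x. \<integral>\<^sup>+y. ennreal ((cmod (packet K \<sigma> s (y - x)))\<^sup>2) * ennreal ((cmod (?A y))\<^sup>2) \<partial>lborel \<partial>lborel)
       + (\<integral>\<^sup>+x. \<integral>\<^sup>+y. (?I (y - x) * ennreal ((cmod (packet K \<sigma> s (y - x)))\<^sup>2)) * ennreal ((cmod (g y))\<^sup>2) \<partial>lborel \<partial>lborel))"
    by (simp add: nn_integral_add)
  also have "\<dots> = ennreal (1 / ?W) * (ennreal (1 * ?W) * ennreal ((nm lborel ?A)\<^sup>2)
       + (\<integral>\<^sup>+z. ?I z * ennreal ((cmod (packet K \<sigma> s z))\<^sup>2) \<partial>lborel) * ennreal ((nm lborel g)\<^sup>2))"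
  proof -
    have 1: "(\<integral>\<^sup>+x. \<integral>\<^sup>+y. ennreal ((cmod (packet K \<sigma> s (y - x)))\<^sup>2) * ennreal ((cmod (?A y))\<^sup>2) \<partial>lborel \<partial>lborel)
        = ennreal (1 * ?W) * ennreal ((nm lborel ?A)\<^sup>2)"
      by (subst nn_integral_convolution, measurable) (simp only: nn_integral_packet[OF \<sigma>] nn_integral_nm[OF LA] mult_1)
    have 2: "(\<integral>\<^sup>+x. \<integral>\<^sup>+y. (?I (y - x) * ennreal ((cmod (packet K \<sigma> s (y - x)))\<^sup>2)) * ennreal ((cmod (g y))\<^sup>2) \<partial>lborel \<partial>lborel)
        = (\<integral>\<^sup>+z. ?I z * ennreal ((cmod (packet K \<sigma> s z))\<^sup>2) \<partial>lborel) * ennreal ((nm lborel g)\<^sup>2)"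
      by (subst nn_integral_convolution[of "\<lambda>z. ?I z * ennreal ((cmod (packet K \<sigma> s z))\<^sup>2)"], measurable) (simp only: nn_integral_nm[OF g(1)])
    show ?thesis unfolding 1 2 ..
  qed
  also have "\<dots> \<le> ennreal (1 / ?W) * (ennreal (1 * ?W) * ennreal ((nm lborel ?A)\<^sup>2) + ennreal (\<tau> * ?W) * ennreal ((nm lborel g)\<^sup>2))"
    by (intro mult_left_mono add_left_mono mult_right_mono tail) auto
  also have "\<dots> = ennreal ((nm lborel ?A)\<^sup>2 + \<tau> * (nm lborel g)\<^sup>2)"
    unfolding distrib_left using mass_cancel[OF \<sigma>, of 1 K "CARD('n)"] mass_cancel[OF \<sigma> \<tau>, of K "CARD('n)"] \<tau>
    by (simp add: ennreal_mult)
  finally have "(pnm K \<sigma> S (schr (- s) f))\<^sup>2 \<le> (nm lborel ?A)\<^sup>2 + \<tau> * (nm lborel g)\<^sup>2"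
    using \<tau> by (subst (asm) ennreal_le_iff) auto
  then show ?thesis unfolding n nA .
qed

subsection \<open>Commutators with cutoffs\<close>

text \<open>At position x the commutator is the transform of (a(y) - a(x)) f(y). Within distance D
  of x the Lipschitz bound gives L D; farther away the difference is at most 2, whose square is the
  factor 4, and the packet tail makes up for it.\<close>

lemma pst_position_commutator:
  fixes f :: "real^'n \<Rightarrow> complex"
  assumes \<sigma>: "\<sigma> > 0" and f: "L2 lebesgue f" and a: "a \<in> borel_measurable borel" "\<And>x. cmod (a x) \<le> 1"
    and Lip: "\<And>x y. cmod (a y - a x) \<le> L * norm (y - x)" and \<tau>: "\<tau> \<ge> 0"
    and tail: "(\<integral>\<^sup>+z. indicator {z. D \<le> norm z} z * ennreal ((cmod (packet K \<sigma> 0 (z::real^'n)))\<^sup>2) \<partial>lborel) \<le> ennreal (\<tau> * wmass K \<sigma> ^ CARD('n))"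
    and L: "L \<ge> 0"
  shows "L2 PS (\<lambda>z. pst K \<sigma> 0 (\<lambda>x. a x * f x) z - a (fst z) * pst K \<sigma> 0 f z)"
    and "(nm PS (\<lambda>z. pst K \<sigma> 0 (\<lambda>x. a x * f x) z - a (fst z) * pst K \<sigma> 0 f z))\<^sup>2 \<le> ((L * D)\<^sup>2 + 4 * \<tau>) * (nm lebesgue f)\<^sup>2"
proof -
  obtain g where g: "L2 lborel g" "L2 lebesgue g" and m[measurable]: "g \<in> borel_measurable borel"
    and ae: "AE x in lebesgue. f x = g x" and n: "nm lebesgue f = nm lborel g"
    using L2_borel_representative[OF f] by blast
  note [measurable] = a(1)
  let ?W = "wmass K \<sigma> ^ CARD('n)" and ?N = "(nm lborel g)\<^sup>2"
  let ?I = "indicator {z::real^'n. D \<le> norm z} :: real^'n \<Rightarrow> ennreal"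
  have af: "L2 lebesgue (\<lambda>x. a x * f x)" "L2 lebesgue (\<lambda>x. a x * g x)" by (intro L2_bounded_mult a f g)+
  have eq: "pst K \<sigma> 0 f = pst K \<sigma> 0 g" "pst K \<sigma> 0 (\<lambda>x. a x * f x) = pst K \<sigma> 0 (\<lambda>x. a x * g x)"
    by (rule pst_cong_AE, use ae in eventually_elim, simp, intro L2_measurable f g af, intro L2_measurable f g af)+
  have pm[measurable]: "pst K \<sigma> 0 g \<in> borel_measurable PS" "pst K \<sigma> 0 (\<lambda>x. a x * g x) \<in> borel_measurable PS"
    by (intro pst_measurable L2_measurable g af)+
  let ?c = "\<lambda>z. pst K \<sigma> 0 (\<lambda>x. a x * f x) z - a (fst z) * pst K \<sigma> 0 f z"
  have cm: "?c \<in> borel_measurable PS" unfolding eq by measurable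
  have sl: "?c (x, \<xi>) = pst K \<sigma> 0 (\<lambda>y. (a y - a x) * g y) (x, \<xi>)" for x \<xi>
    unfolding eq left_diff_distrib pst_diff[OF \<sigma> af(2) L2_scale[OF g(2)]] pst_scale by simp
  have La: "L2 lborel (\<lambda>y. (a y - a x) * g y)" for x
  proof (rule L2_bound[OF g(1), where c=2])
    show "AE y in lborel. cmod ((a y - a x) * g y) \<le> 2 * cmod (g y)"
      using norm_triangle_ineq4[of "a _" "a x"] a(2) 
      by (intro AE_I2) (auto simp: norm_mult intro!: mult_right_mono order_trans[OF norm_triangle_ineq4] order_trans[OF add_mono[OF a(2) a(2)]])
  qed measurable
  have "(\<integral>\<^sup>+z. ennreal ((cmod (?c z))\<^sup>2) \<partial>PS) = (\<integral>\<^sup>+x. \<integral>\<^sup>+\<xi>. ennreal ((cmod (?c (x, \<xi>)))\<^sup>2) \<partial>lborel \<partial>lborel)"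
    by (rule nn_integral_PS(1)) (use cm in measurable)
  also have "\<dots> = (\<integral>\<^sup>+x. ennreal (1 / ?W) * (\<integral>\<^sup>+y. ennreal ((cmod (packet K \<sigma> 0 (y - x)))\<^sup>2) * ennreal ((cmod ((a y - a x) * g y))\<^sup>2) \<partial>lborel) \<partial>lborel)"
    unfolding sl pst_slice[OF \<sigma> La] ..
  also have "\<dots> = ennreal (1 / ?W) * (\<integral>\<^sup>+x. \<integral>\<^sup>+y. ennreal ((cmod (packet K \<sigma> 0 (y - x)))\<^sup>2) * ennreal ((cmod ((a y - a x) * g y))\<^sup>2) \<partial>lborel \<partial>lborel)"
    by (rule nn_integral_cmult) measurable
  also have "\<dots> \<le> ennreal (1 / ?W) * (\<integral>\<^sup>+x. \<integral>\<^sup>+y. ((ennreal ((L * D)\<^sup>2) + 4 * ?I (y - x)) * ennreal ((cmod (packet K \<sigma> 0 (y - x)))\<^sup>2)) * ennreal ((cmod (g y))\<^sup>2) \<partial>lborel \<partial>lborel)"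
  proof (intro mult_left_mono nn_integral_mono)
    fix x y :: "real^'n"
    have 1: "ennreal ((cmod (a y - a x))\<^sup>2) \<le> ennreal ((L * D)\<^sup>2) + 4 * ?I (y - x)"
    proof (cases "D \<le> norm (y - x)")
      case True
      have "cmod (a y - a x) \<le> 2" using norm_triangle_ineq4[of "a y" "a x"] a(2)[of x] a(2)[of y] by linarith
      then have "(cmod (a y - a x))\<^sup>2 \<le> 2\<^sup>2" by (intro power_mono) auto
      then have "ennreal ((cmod (a y - a x))\<^sup>2) \<le> ennreal 4" by (intro ennreal_leI) simp
      then show ?thesis using True by (simp add: add_increasing)
    next
      case False
      have "cmod (a y - a x) \<le> L * D" using Lip[of y x] False L by (meson less_imp_le mult_left_mono not_le order_trans)
      then have "(cmod (a y - a x))\<^sup>2 \<le> (L * D)\<^sup>2" by (intro power_mono) auto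
      then show ?thesis using False by (simp add: ennreal_leI)
    qed
    have "ennreal ((cmod (packet K \<sigma> 0 (y - x)))\<^sup>2) * ennreal ((cmod ((a y - a x) * g y))\<^sup>2)
       = (ennreal ((cmod (a y - a x))\<^sup>2) * ennreal ((cmod (packet K \<sigma> 0 (y - x)))\<^sup>2)) * ennreal ((cmod (g y))\<^sup>2)"
      by (simp add: norm_mult power_mult_distrib ennreal_mult mult_ac)
    also have "\<dots> \<le> ((ennreal ((L * D)\<^sup>2) + 4 * ?I (y - x)) * ennreal ((cmod (packet K \<sigma> 0 (y - x)))\<^sup>2)) * ennreal ((cmod (g y))\<^sup>2)"
      by (intro mult_right_mono 1) auto
    finally show "ennreal ((cmod (packet K \<sigma> 0 (y - x)))\<^sup>2) * ennreal ((cmod ((a y - a x) * g y))\<^sup>2)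
       \<le> ((ennreal ((L * D)\<^sup>2) + 4 * ?I (y - x)) * ennreal ((cmod (packet K \<sigma> 0 (y - x)))\<^sup>2)) * ennreal ((cmod (g y))\<^sup>2)" .
  qed simp
  also have "\<dots> = ennreal (1 / ?W) * ((\<integral>\<^sup>+z. (ennreal ((L * D)\<^sup>2) + 4 * ?I z) * ennreal ((cmod (packet K \<sigma> 0 z))\<^sup>2) \<partial>lborel) * ennreal ?N)"
    by (subst nn_integral_convolution[of "\<lambda>z. (ennreal ((L * D)\<^sup>2) + 4 * ?I z) * ennreal ((cmod (packet K \<sigma> 0 z))\<^sup>2)"], measurable) (simp only: nn_integral_nm[OF g(1)])
  also have "(\<integral>\<^sup>+z. (ennreal ((L * D)\<^sup>2) + 4 * ?I z) * ennreal ((cmod (packet K \<sigma> 0 z))\<^sup>2) \<partial>lborel)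
      = ennreal ((L * D)\<^sup>2) * ennreal ?W + 4 * (\<integral>\<^sup>+z. ?I z * ennreal ((cmod (packet K \<sigma> 0 z))\<^sup>2) \<partial>lborel)"
    unfolding distrib_right mult.assoc
    by (subst nn_integral_add, measurable) (simp add: nn_integral_cmult nn_integral_packet[OF \<sigma>])
  also have "ennreal (1 / ?W) * ((ennreal ((L * D)\<^sup>2) * ennreal ?W + 4 * (\<integral>\<^sup>+z. ?I z * ennreal ((cmod (packet K \<sigma> 0 z))\<^sup>2) \<partial>lborel)) * ennreal ?N)
      \<le> ennreal (1 / ?W) * ((ennreal ((L * D)\<^sup>2) * ennreal ?W + ennreal 4 * ennreal (\<tau> * ?W)) * ennreal ?N)"
    using tail by (intro mult_left_mono add_left_mono mult_right_mono mult_mono) auto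
  also have "ennreal ((L * D)\<^sup>2) * ennreal ?W + ennreal 4 * ennreal (\<tau> * ?W) = ennreal (((L * D)\<^sup>2 + 4 * \<tau>) * ?W)"
  proof -
    have W: "?W > 0" using wmass_pos(2)[OF \<sigma>, of K] by simp
    have 1: "ennreal ((L * D)\<^sup>2) * ennreal ?W = ennreal ((L * D)\<^sup>2 * ?W)" using W by (intro ennreal_mult[symmetric]) auto
    have 2: "ennreal 4 * ennreal (\<tau> * ?W) = ennreal (4 * (\<tau> * ?W))" using W \<tau> by (intro ennreal_mult[symmetric]) auto
    show ?thesis unfolding 1 2 using W \<tau> by (subst ennreal_plus[symmetric]) (auto simp: algebra_simps)
  qed
  also have "ennreal (1 / ?W) * (ennreal (((L * D)\<^sup>2 + 4 * \<tau>) * ?W) * ennreal ?N) = ennreal (((L * D)\<^sup>2 + 4 * \<tau>) * ?N)"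
    using \<tau> by (subst mass_cancel[OF \<sigma>]) (auto simp: ennreal_mult)
  finally have *: "(\<integral>\<^sup>+z. ennreal ((cmod (?c z))\<^sup>2) \<partial>PS) \<le> ennreal (((L * D)\<^sup>2 + 4 * \<tau>) * ?N)" .
  show Lc: "L2 PS ?c" by (rule L2_I_nn[OF cm]) (use * in \<open>auto intro: order_le_less_trans\<close>)
  show "(nm PS ?c)\<^sup>2 \<le> ((L * D)\<^sup>2 + 4 * \<tau>) * (nm lebesgue f)\<^sup>2"
    using * \<tau> unfolding nn_integral_nm[OF Lc] n by (subst (asm) ennreal_le_iff) auto
qed

text \<open>On the frequency side the commutator carries the factor b(\<eta>) - b(\<xi>), and the
  support of the window confines \<eta> to distance n / \<sigma> from \<xi>. Unlike in the position
  commutator there is no tail term.\<close>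

lemma pst_momentum_commutator:
  fixes f :: "real^'n \<Rightarrow> complex"
  assumes \<sigma>: "\<sigma> > 0" and f: "L2 lebesgue f" and b: "b \<in> borel_measurable borel" "\<And>x. cmod (b x) \<le> 1"
    and Lip: "\<And>x y. cmod (b y - b x) \<le> L * norm (y - x)" and L: "L \<ge> 0"
  shows "L2 PS (\<lambda>z. pst K \<sigma> 0 (fmult b f) z - b (snd z) * pst K \<sigma> 0 f z)"
    and "nm PS (\<lambda>z. pst K \<sigma> 0 (fmult b f) z - b (snd z) * pst K \<sigma> 0 f z) \<le> L * CARD('n) / \<sigma> * nm lebesgue f"
proof -
  let ?W = "wmass K \<sigma> ^ CARD('n)" and ?N = "nm lebesgue f" and ?k = "L * CARD('n) / \<sigma>"
  have Ff: "L2 lebesgue (fourier_L2 (-1) f)" by (rule L2_fourier_L2[OF f]) simp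
  obtain g where g: "L2 lborel g" "L2 lebesgue g" and m[measurable]: "g \<in> borel_measurable borel"
    and ae: "AE x in lebesgue. fourier_L2 (-1) f x = g x" and n: "nm lebesgue (fourier_L2 (-1) f) = nm lborel g"
    using L2_borel_representative[OF Ff] by blast
  have nf: "nm lborel g = ?N" using n nm_fourier_L2[OF f, of "-1"] by simp
  note [measurable] = b(1)
  note bf = L2_fmult[OF b f]
  let ?c = "\<lambda>z. pst K \<sigma> 0 (fmult b f) z - b (snd z) * pst K \<sigma> 0 f z"
  have pm[measurable]: "pst K \<sigma> 0 f \<in> borel_measurable PS" "pst K \<sigma> 0 (fmult b f) \<in> borel_measurable PS"
    by (intro pst_measurable L2_measurable f bf)+
  have cm[measurable]: "?c \<in> borel_measurable PS" by measurable
  let ?q = "complex_of_real (1 / sqrt ((2 * pi) ^ CARD('n) * ?W))"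
  define u where "u \<xi> \<eta> = complex_of_real (window K \<sigma> (\<eta> - \<xi>)) * (b \<eta> - b \<xi>) * g \<eta>" for \<xi> \<eta>
  have um[measurable]: "(\<lambda>z. u (fst z) (snd z)) \<in> borel_measurable (borel \<Otimes>\<^sub>M borel)"
    unfolding u_def by measurable
  have bb: "cmod (b \<eta> - b \<xi>) \<le> 2" for \<eta> \<xi> using norm_triangle_ineq4[of "b \<eta>" "b \<xi>"] b(2)[of \<eta>] b(2)[of \<xi>] by linarith
  have ub: "cmod (u \<xi> \<eta>) \<le> ?k * (window K \<sigma> (\<eta> - \<xi>) * cmod (g \<eta>))" for \<xi> \<eta>
  proof (cases "window K \<sigma> (\<eta> - \<xi>) = 0")
    case False
    have "cmod (b \<eta> - b \<xi>) \<le> L * norm (\<eta> - \<xi>)" by (rule Lip)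
    also have "\<dots> \<le> L * (CARD('n) / \<sigma>)" by (rule mult_left_mono[OF window_support[OF False \<sigma>] L])
    finally have "window K \<sigma> (\<eta> - \<xi>) * cmod (b \<eta> - b \<xi>) * cmod (g \<eta>) \<le> window K \<sigma> (\<eta> - \<xi>) * ?k * cmod (g \<eta>)"
      using window_bounds(1) by (intro mult_right_mono mult_left_mono) auto
    then show ?thesis using window_bounds(1)[of K \<sigma> "\<eta> - \<xi>"] by (simp add: u_def norm_mult mult_ac)
  qed (simp add: u_def)
  have u2: "cmod (u \<xi> \<eta>) \<le> 2 * cmod (g \<eta>)" for \<xi> \<eta>
  proof -
    have "window K \<sigma> (\<eta> - \<xi>) * cmod (b \<eta> - b \<xi>) * cmod (g \<eta>) \<le> 1 * 2 * cmod (g \<eta>)"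
      using window_bounds[of K \<sigma> "\<eta> - \<xi>"] bb[of \<eta> \<xi>] by (intro mult_right_mono mult_mono) auto
    then show ?thesis using window_bounds(1)[of K \<sigma> "\<eta> - \<xi>"] by (simp add: u_def norm_mult)
  qed
  have um2: "(\<lambda>\<eta>. u \<xi> \<eta>) \<in> borel_measurable borel" for \<xi> unfolding u_def by measurable
  have uL: "L2 lborel (u \<xi>)" for \<xi>
    by (rule L2_bound[OF g(1), where c=2]) (use u2 um2 in auto)
  have ui: "integrable lborel (u \<xi>)" for \<xi>
  proof -
    have "L2 lborel (\<lambda>\<eta>::real^'n. complex_of_real (window K \<sigma> \<eta>) * cis (- 0 * (norm \<eta>)\<^sup>2))" by (rule L2_window[OF \<sigma>])
    from L2_translate[OF this, of "-\<xi>"] have w: "L2 lborel (\<lambda>\<eta>. complex_of_real (window K \<sigma> (\<eta> - \<xi>)))" by simp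
    have "L2 lborel (\<lambda>\<eta>. (b \<eta> - b \<xi>) * g \<eta>)"
      by (rule L2_bound[OF g(1), where c=2]) (use bb in \<open>auto simp: norm_mult intro!: mult_right_mono\<close>)
    from ip_integrable[OF w this] show ?thesis unfolding u_def by (simp add: mult.assoc)
  qed
  have eq: "cmod (?c (x, \<xi>)) = cmod ?q * cmod (LINT \<eta>|lborel. cis (1 * (\<eta> \<bullet> x)) * u \<xi> \<eta>)" for x \<xi>
  proof -
    have i: "integrable lebesgue (\<lambda>\<eta>. cis (x \<bullet> (\<eta> - \<xi>)) * (complex_of_real (window K \<sigma> (\<eta> - \<xi>)) * cis (0 * (norm (\<eta> - \<xi>))\<^sup>2)) * h \<eta>)"
      if h: "L2 lebesgue h" for h
    proof -
      have m: "(\<lambda>\<eta>. cis (- (x \<bullet> (\<eta> - \<xi>))) * complex_of_real (window K \<sigma> (\<eta> - \<xi>))) \<in> borel_measurable borel" by measurable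
      have "L2 lborel (\<lambda>\<eta>::real^'n. complex_of_real (window K \<sigma> \<eta>) * cis (- 0 * (norm \<eta>)\<^sup>2))" by (rule L2_window[OF \<sigma>])
      from L2_translate[OF this, of "-\<xi>"] have "L2 lborel (\<lambda>\<eta>. complex_of_real (window K \<sigma> (\<eta> - \<xi>)))" by simp
      then have "L2 lborel (\<lambda>\<eta>. cis (- (x \<bullet> (\<eta> - \<xi>))) * complex_of_real (window K \<sigma> (\<eta> - \<xi>)))"
        by (rule L2_mult_cis) measurable
      then have "L2 lebesgue (\<lambda>\<eta>. cis (- (x \<bullet> (\<eta> - \<xi>))) * complex_of_real (window K \<sigma> (\<eta> - \<xi>)))"
        using L2_lebesgue_iff[OF m] by simp
      from ip_integrable[OF this h] show ?thesis by (simp add: cis_cnj)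
    qed
    let ?e = "\<lambda>\<eta>. cis (x \<bullet> (\<eta> - \<xi>)) * (complex_of_real (window K \<sigma> (\<eta> - \<xi>)) * cis (0 * (norm (\<eta> - \<xi>))\<^sup>2))"
    have em: "?e \<in> borel_measurable borel" by measurable
    have "stft K \<sigma> 0 (fmult b f) x \<xi> - b \<xi> * stft K \<sigma> 0 f x \<xi> =
       (LINT \<eta>|lebesgue. ?e \<eta> * fourier_L2 (-1) (fmult b f) \<eta> - b \<xi> * (?e \<eta> * fourier_L2 (-1) f \<eta>))"
    proof -
      have i1: "integrable lebesgue (\<lambda>\<eta>. ?e \<eta> * fourier_L2 (-1) (fmult b f) \<eta>)" by (intro i L2_fourier_L2 bf) simp
      have i2: "integrable lebesgue (\<lambda>\<eta>. ?e \<eta> * fourier_L2 (-1) f \<eta>)" by (intro i L2_fourier_L2 f) simp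
      show ?thesis
        unfolding stft_frequency[OF \<sigma> f] stft_frequency[OF \<sigma> bf]
          Bochner_Integration.integral_diff[OF i1 integrable_mult_right[OF i2]] integral_mult_right_zero ..
    qed
    also have "\<dots> = (LINT \<eta>|lebesgue. ?e \<eta> * ((b \<eta> - b \<xi>) * g \<eta>))"
    proof (rule integral_cong_AE)
      show "AE \<eta> in lebesgue. ?e \<eta> * fourier_L2 (-1) (fmult b f) \<eta> - b \<xi> * (?e \<eta> * fourier_L2 (-1) f \<eta>) = ?e \<eta> * ((b \<eta> - b \<xi>) * g \<eta>)"
        using ae fourier_fmult[OF b f] by eventually_elim (simp add: algebra_simps)
      have em': "?e \<in> borel_measurable lebesgue" by (rule lebesgue_measurable_borel[OF em])
      have fm: "fourier_L2 (-1) (fmult b f) \<in> borel_measurable lebesgue" "fourier_L2 (-1) f \<in> borel_measurable lebesgue"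
        by (intro L2_measurable L2_fourier_L2 f bf; simp)+
      show "(\<lambda>\<eta>. ?e \<eta> * fourier_L2 (-1) (fmult b f) \<eta> - b \<xi> * (?e \<eta> * fourier_L2 (-1) f \<eta>)) \<in> borel_measurable lebesgue"
        by (intro borel_measurable_diff borel_measurable_times borel_measurable_const em' fm)
      show "(\<lambda>\<eta>. ?e \<eta> * ((b \<eta> - b \<xi>) * g \<eta>)) \<in> borel_measurable lebesgue"
        by (rule lebesgue_measurable_borel) measurable
    qed
    also have "\<dots> = (LINT \<eta>|lborel. ?e \<eta> * ((b \<eta> - b \<xi>) * g \<eta>))" by (rule integral_lebesgue) measurable
    also have "\<dots> = (LINT \<eta>|lborel. cis (- (x \<bullet> \<xi>)) * (cis (1 * (\<eta> \<bullet> x)) * u \<xi> \<eta>))"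
    proof -
      have "cis (x \<bullet> (\<eta> - \<xi>)) = cis (- (x \<bullet> \<xi>)) * cis (1 * (\<eta> \<bullet> x))" for \<eta>
        unfolding cis_mult by (simp add: inner_diff_right inner_commute)
      then show ?thesis by (simp add: u_def mult.assoc)
    qed
    also have "\<dots> = cis (- (x \<bullet> \<xi>)) * (LINT \<eta>|lborel. cis (1 * (\<eta> \<bullet> x)) * u \<xi> \<eta>)" by (rule integral_mult_right_zero)
    finally have s: "stft K \<sigma> 0 (fmult b f) x \<xi> - b \<xi> * stft K \<sigma> 0 f x \<xi> = cis (- (x \<bullet> \<xi>)) * (LINT \<eta>|lborel. cis (1 * (\<eta> \<bullet> x)) * u \<xi> \<eta>)" .
    have "?c (x, \<xi>) = ?q * (stft K \<sigma> 0 (fmult b f) x \<xi> - b \<xi> * stft K \<sigma> 0 f x \<xi>)"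
      unfolding pst_def fst_conv snd_conv by (simp only: right_diff_distrib mult_ac)
    then show ?thesis unfolding s by (simp only: norm_mult norm_cis mult_1)
  qed
  have "(\<integral>\<^sup>+z. ennreal ((cmod (?c z))\<^sup>2) \<partial>PS) = (\<integral>\<^sup>+\<xi>. \<integral>\<^sup>+x. ennreal ((cmod (?c (x, \<xi>)))\<^sup>2) \<partial>lborel \<partial>lborel)"
    by (rule nn_integral_PS(2)) measurable
  also have "\<dots> = (\<integral>\<^sup>+\<xi>. ennreal (1 / ?W) * (\<integral>\<^sup>+\<eta>. ennreal ((cmod (u \<xi> \<eta>))\<^sup>2) \<partial>lborel) \<partial>lborel)"
  proof (rule nn_integral_cong)
    fix \<xi> :: "real^'n"
    have [measurable]: "u \<xi> \<in> borel_measurable borel" using uL[of \<xi>] by (simp add: L2_def)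
    have "(\<integral>\<^sup>+x. ennreal ((cmod (?c (x, \<xi>)))\<^sup>2) \<partial>lborel) = ennreal ((cmod ?q)\<^sup>2) * (\<integral>\<^sup>+x. ennreal ((cmod (LINT \<eta>|lborel. cis (1 * (\<eta> \<bullet> x)) * u \<xi> \<eta>))\<^sup>2) \<partial>lborel)"
      unfolding eq power_mult_distrib by (subst nn_integral_cmult[symmetric], measurable) (simp add: ennreal_mult)
    also have "\<dots> = ennreal (1 / ?W) * (\<integral>\<^sup>+\<eta>. ennreal ((cmod (u \<xi> \<eta>))\<^sup>2) \<partial>lborel)"
      unfolding nn_integral_Plancherel[OF ui uL power_one] mult.assoc[symmetric] pst_const_sq[OF \<sigma>] ..
    finally show "(\<integral>\<^sup>+x. ennreal ((cmod (?c (x, \<xi>)))\<^sup>2) \<partial>lborel) = ennreal (1 / ?W) * (\<integral>\<^sup>+\<eta>. ennreal ((cmod (u \<xi> \<eta>))\<^sup>2) \<partial>lborel)" .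
  qed
  also have "\<dots> \<le> (\<integral>\<^sup>+\<xi>. ennreal (1 / ?W) * (\<integral>\<^sup>+\<eta>. ennreal (?k\<^sup>2 * (window K \<sigma> (\<eta> - \<xi>))\<^sup>2) * ennreal ((cmod (g \<eta>))\<^sup>2) \<partial>lborel) \<partial>lborel)"
  proof (intro nn_integral_mono mult_left_mono)
    fix \<xi> \<eta> :: "real^'n"
    have "(cmod (u \<xi> \<eta>))\<^sup>2 \<le> (?k * (window K \<sigma> (\<eta> - \<xi>) * cmod (g \<eta>)))\<^sup>2" by (intro power_mono ub) auto
    then show "ennreal ((cmod (u \<xi> \<eta>))\<^sup>2) \<le> ennreal (?k\<^sup>2 * (window K \<sigma> (\<eta> - \<xi>))\<^sup>2) * ennreal ((cmod (g \<eta>))\<^sup>2)"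
      by (simp add: ennreal_mult[symmetric] power_mult_distrib power_divide mult_ac ennreal_leI)
  qed simp
  also have "\<dots> = ennreal (1 / ?W) * (\<integral>\<^sup>+\<xi>. \<integral>\<^sup>+\<eta>. ennreal (?k\<^sup>2 * (window K \<sigma> (\<eta> - \<xi>))\<^sup>2) * ennreal ((cmod (g \<eta>))\<^sup>2) \<partial>lborel \<partial>lborel)"
    by (rule nn_integral_cmult) measurable
  also have "\<dots> = ennreal (1 / ?W) * ((\<integral>\<^sup>+z. ennreal (?k\<^sup>2 * (window K \<sigma> (z::real^'n))\<^sup>2) \<partial>lborel) * ennreal (?N\<^sup>2))"
    by (subst nn_integral_convolution[of "\<lambda>z. ennreal (?k\<^sup>2 * (window K \<sigma> z)\<^sup>2)"], measurable) (simp only: nn_integral_nm[OF g(1)] nf)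
  also have "(\<integral>\<^sup>+z. ennreal (?k\<^sup>2 * (window K \<sigma> (z::real^'n))\<^sup>2) \<partial>lborel) = ennreal (?k\<^sup>2 * ?W)"
  proof -
    have "(\<integral>\<^sup>+z. ennreal (?k\<^sup>2 * (window K \<sigma> (z::real^'n))\<^sup>2) \<partial>lborel) = (\<integral>\<^sup>+z. ennreal (?k\<^sup>2) * ennreal ((window K \<sigma> (z::real^'n))\<^sup>2) \<partial>lborel)"
      by (intro nn_integral_cong ennreal_mult) auto
    also have "\<dots> = ennreal (?k\<^sup>2) * ennreal ?W" by (subst nn_integral_cmult, measurable) (simp only: nn_integral_window[OF \<sigma>])
    also have "\<dots> = ennreal (?k\<^sup>2 * ?W)" by (rule ennreal_mult[symmetric]) (use wmass_pos(2)[OF \<sigma>, of K] in auto)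
    finally show ?thesis .
  qed
  also have "ennreal (1 / ?W) * (ennreal (?k\<^sup>2 * ?W) * ennreal (?N\<^sup>2)) = ennreal ((?k * ?N)\<^sup>2)"
    unfolding power_mult_distrib[of ?k] by (subst mass_cancel[OF \<sigma>], simp, rule ennreal_mult[symmetric]) auto
  finally have *: "(\<integral>\<^sup>+z. ennreal ((cmod (?c z))\<^sup>2) \<partial>PS) \<le> ennreal ((?k * ?N)\<^sup>2)" .
  have "?k * ?N \<ge> 0" using L \<sigma> by simp
  from L2_I_nn_le[OF cm * this] show "L2 PS ?c" "nm PS ?c \<le> ?k * ?N" by auto
qed

subsection \<open>Duality\<close>

lemma pnm_nonneg: "pnm K \<sigma> S f \<ge> 0"
  by (simp add: pnm_def)

text \<open>Converts bounds on inner products into bounds on \<open>pnm\<close>. With T the phase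
  space transform, the extremal q is T^* 1_S T h, obtained as a Riesz representative: it satisfies
  the test condition with k = \<open>pnm K \<sigma> S h\<close>, while its inner product with h is
  the square of this number.\<close>

lemma pnm_dual:
  fixes h :: "real^'n \<Rightarrow> complex"
  assumes \<sigma>: "\<sigma> > 0" and h: "L2 lebesgue h" and S: "S \<in> sets PS" and B: "B \<ge> 0"
    and dual: "\<And>q k. L2 lebesgue q \<Longrightarrow> k \<ge> 0 \<Longrightarrow> (\<And>f. L2 lebesgue f \<Longrightarrow> cmod (ip lebesgue q f) \<le> k * pnm K \<sigma> S f) \<Longrightarrow> cmod (ip lebesgue q h) \<le> k * B"
  shows "pnm K \<sigma> S h \<le> B"
proof -
  let ?H = "\<lambda>z. indicator S z * pst K \<sigma> 0 h z"
  have H: "L2 PS ?H" by (intro L2_indicator_mult L2_pst \<sigma> h S)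
  define l where "l f = ip PS ?H (pst K \<sigma> 0 f)" for f
  have lS: "l f = ip PS ?H (\<lambda>z. indicator S z * pst K \<sigma> 0 f z)" for f
    unfolding l_def ip_def by (intro Bochner_Integration.integral_cong) (auto simp: indicator_def)
  have lb: "cmod (l f) \<le> pnm K \<sigma> S h * pnm K \<sigma> S f" if f: "L2 lebesgue f" for f
    unfolding lS pnm_def by (intro Cauchy_Schwarz_L2 H L2_indicator_mult L2_pst \<sigma> f S)
  have "\<exists>q. L2 lebesgue q \<and> (\<forall>f. L2 lebesgue f \<longrightarrow> l f = ip lebesgue q f)"
  proof (rule L2_Riesz)
    fix f g :: "real^'n \<Rightarrow> complex" assume f: "L2 lebesgue f" and g: "L2 lebesgue g"
    have "pst K \<sigma> 0 (\<lambda>x. f x + g x) = (\<lambda>z. pst K \<sigma> 0 f z + pst K \<sigma> 0 g z)" by (rule ext) (rule pst_add[OF \<sigma> f g])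
    then show "l (\<lambda>x. f x + g x) = l f + l g" unfolding l_def by (simp add: ip_add_right H L2_pst \<sigma> f g)
  next
    fix f :: "real^'n \<Rightarrow> complex" and c assume f: "L2 lebesgue f"
    have "pst K \<sigma> 0 (\<lambda>x. c * f x) = (\<lambda>z. c * pst K \<sigma> 0 f z)" by (rule ext) (rule pst_scale)
    then show "l (\<lambda>x. c * f x) = c * l f" unfolding l_def by (simp add: ip_scale_right)
    show "cmod (l f) \<le> nm PS ?H * nm lebesgue f"
      unfolding l_def nm_pst[OF \<sigma> f, of K 0, symmetric] by (intro Cauchy_Schwarz_L2 H L2_pst \<sigma> f)
  qed
  then obtain q where q: "L2 lebesgue q" and lq: "\<And>f. L2 lebesgue f \<Longrightarrow> l f = ip lebesgue q f" by blast
  have "cmod (ip lebesgue q h) \<le> pnm K \<sigma> S h * B"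
    by (rule dual[OF q]) (use lb lq in \<open>auto simp: pnm_nonneg\<close>)
  moreover have "ip lebesgue q h = complex_of_real ((pnm K \<sigma> S h)\<^sup>2)"
    unfolding lq[OF h, symmetric] lS by (simp add: ip_self pnm_def)
  ultimately have "(pnm K \<sigma> S h)\<^sup>2 \<le> pnm K \<sigma> S h * B" by (simp add: norm_power)
  then show ?thesis
    using pnm_nonneg[of K \<sigma> S h] B by (cases "pnm K \<sigma> S h = 0") (auto simp: power2_eq_square mult_le_cancel_left)
qed

section \<open>Decay and cutoff estimates\<close>

lemma nm_indicator_split:
  assumes f: "L2 M f" and S: "S1 \<in> sets M" "S2 \<in> sets M"
  shows "nm M (\<lambda>z. indicator (S1 \<union> S2) z * f z) \<le> nm M (\<lambda>z. indicator S1 z * f z) + nm M (\<lambda>z. indicator S2 z * f z)"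
proof -
  have "nm M (\<lambda>z. indicator (S1 \<union> S2) z * f z) = nm M (\<lambda>z. indicator S1 z * f z + indicator (S2 - S1) z * f z)"
    by (rule arg_cong[where f="nm M"]) (auto simp: indicator_def fun_eq_iff)
  also have "\<dots> \<le> nm M (\<lambda>z. indicator S1 z * f z) + nm M (\<lambda>z. indicator (S2 - S1) z * f z)"
    by (intro nm_triangle L2_indicator_mult f S sets.Diff)
  also have "nm M (\<lambda>z. indicator (S2 - S1) z * f z) \<le> 1 * nm M (\<lambda>z. indicator S2 z * f z)"
    using S f by (intro nm_bound L2_indicator_mult AE_I2) (auto simp: indicator_def intro!: L2_measurable[OF L2_indicator_mult[OF f]])
  finally show ?thesis by simp
qed

lemma pnm_Un:
  assumes "\<sigma> > 0" "L2 lebesgue f" "S1 \<in> sets PS" "S2 \<in> sets PS"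
  shows "pnm K \<sigma> (S1 \<union> S2) f \<le> pnm K \<sigma> S1 f + pnm K \<sigma> S2 f"
  unfolding pnm_def using assms by (intro nm_indicator_split L2_pst)

lemma pnm_add:
  assumes \<sigma>: "\<sigma> > 0" and f: "L2 lebesgue f" and g: "L2 lebesgue g" and S: "S \<in> sets PS"
  shows "pnm K \<sigma> S (\<lambda>x. f x + g x) \<le> pnm K \<sigma> S f + pnm K \<sigma> S g"
proof -
  have "pnm K \<sigma> S (\<lambda>x. f x + g x) = nm PS (\<lambda>z. indicator S z * pst K \<sigma> 0 f z + indicator S z * pst K \<sigma> 0 g z)"
    unfolding pnm_def pst_add[OF \<sigma> f g] by (simp add: distrib_left)
  also have "\<dots> \<le> pnm K \<sigma> S f + pnm K \<sigma> S g"
    unfolding pnm_def by (intro nm_triangle L2_indicator_mult L2_pst \<sigma> f g S)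
  finally show ?thesis .
qed

lemma pnm_cong_AE:
  assumes "AE x in lebesgue. f x = g x" "L2 lebesgue f" "L2 lebesgue g"
  shows "pnm K \<sigma> S f = pnm K \<sigma> S g"
  unfolding pnm_def pst_cong_AE[OF assms(1) L2_measurable[OF assms(2)] L2_measurable[OF assms(3)]] ..

text \<open>Pulling the position cutoff and then the multiplier through the transform leaves a(x)
  b(\<xi>) times the transform of h, supported in S, plus two commutators. The isometry then turns a
  bound in phase space into one for the operator product.\<close>

lemma cutoff_product_bound:
  fixes h :: "real^'n \<Rightarrow> complex"
  assumes \<sigma>: "\<sigma> > 0" and h: "L2 lebesgue h"
    and a: "a \<in> borel_measurable borel" "\<And>x. cmod (a x) \<le> 1" "\<And>x y. cmod (a y - a x) \<le> La * norm (y - x)" "La \<ge> 0"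
    and b: "b \<in> borel_measurable borel" "\<And>x. cmod (b x) \<le> 1" "\<And>x y. cmod (b y - b x) \<le> Lb * norm (y - x)" "Lb \<ge> 0"
    and S: "S \<in> sets PS" "\<And>x \<xi>. a x * b \<xi> \<noteq> 0 \<Longrightarrow> (x, \<xi>) \<in> S"
    and \<tau>: "\<tau> \<ge> 0"
    and tail: "(\<integral>\<^sup>+z. indicator {z. D \<le> norm z} z * ennreal ((cmod (packet K \<sigma> 0 (z::real^'n)))\<^sup>2) \<partial>lborel) \<le> ennreal (\<tau> * wmass K \<sigma> ^ CARD('n))"
  shows "nm lebesgue (\<lambda>x. a x * fmult b h x) \<le> pnm K \<sigma> S h + (sqrt ((La * D)\<^sup>2 + 4 * \<tau>) + Lb * CARD('n) / \<sigma>) * nm lebesgue h"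
proof -
  let ?B = "fmult b h" and ?T = "pst K \<sigma> 0"
  have B: "L2 lebesgue ?B" by (rule L2_fmult[OF b(1,2) h])
  have AB: "L2 lebesgue (\<lambda>x. a x * ?B x)" by (rule L2_bounded_mult[OF a(1,2) B])
  note xc = pst_position_commutator[OF \<sigma> B a(1-3) \<tau> tail a(4)]
  note pc = pst_momentum_commutator[OF \<sigma> h b]
  let ?c1 = "\<lambda>z. ?T (\<lambda>x. a x * ?B x) z - a (fst z) * ?T ?B z" and ?c2 = "\<lambda>z. ?T ?B z - b (snd z) * ?T h z"
  have am: "(\<lambda>z. a (fst z)) \<in> borel_measurable PS" and bm: "(\<lambda>z. b (snd z)) \<in> borel_measurable PS"
    using a(1) b(1) by measurable
  have L2a: "L2 PS (\<lambda>z. a (fst z) * f z)" "nm PS (\<lambda>z. a (fst z) * f z) \<le> 1 * nm PS f" if "L2 PS f" for f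
    using am that a(2) by (intro L2_bound[OF that, where c=1] nm_bound[OF that] AE_I2 cmod_mult_le_one; auto simp: L2_measurable)+
  have L2b: "L2 PS (\<lambda>z. b (snd z) * f z)" if "L2 PS f" for f
    using bm that b(2) by (intro L2_bound[OF that, where c=1] AE_I2 cmod_mult_le_one; auto simp: L2_measurable)
  let ?c3 = "\<lambda>z. a (fst z) * (b (snd z) * ?T h z)"
  have Th: "L2 PS (?T h)" by (rule L2_pst[OF \<sigma> h])
  have c3: "L2 PS ?c3" by (rule L2a(1)[OF L2b[OF Th]])
  have eq: "?T (\<lambda>x. a x * ?B x) = (\<lambda>z. ?c1 z + (a (fst z) * ?c2 z + ?c3 z))"
    by (simp add: fun_eq_iff algebra_simps)
  have "nm lebesgue (\<lambda>x. a x * ?B x) = nm PS (?T (\<lambda>x. a x * ?B x))" by (rule nm_pst[OF \<sigma> AB, symmetric])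
  also have "\<dots> = nm PS (\<lambda>z. ?c1 z + (a (fst z) * ?c2 z + ?c3 z))" by (rule arg_cong[OF eq])
  also have "\<dots> \<le> nm PS ?c1 + nm PS (\<lambda>z. a (fst z) * ?c2 z + ?c3 z)"
    by (intro nm_triangle xc(1) L2_add L2a(1) pc(1) c3)
  also have "\<dots> \<le> nm PS ?c1 + (nm PS (\<lambda>z. a (fst z) * ?c2 z) + nm PS ?c3)"
    by (intro add_left_mono nm_triangle L2a(1) pc(1) c3)
  also have "\<dots> \<le> sqrt ((La * D)\<^sup>2 + 4 * \<tau>) * nm lebesgue h + (Lb * CARD('n) / \<sigma> * nm lebesgue h + pnm K \<sigma> S h)"
  proof (intro add_mono)
    have "(nm PS ?c1)\<^sup>2 \<le> ((La * D)\<^sup>2 + 4 * \<tau>) * (nm lebesgue h)\<^sup>2"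
      using nm_fmult_le[OF b(1,2) h] \<tau> by (intro order_trans[OF xc(2)] mult_left_mono power_mono) auto
    from real_sqrt_le_mono[OF this] show "nm PS ?c1 \<le> sqrt ((La * D)\<^sup>2 + 4 * \<tau>) * nm lebesgue h"
      by (simp add: real_sqrt_mult)
    show "nm PS (\<lambda>z. a (fst z) * ?c2 z) \<le> Lb * CARD('n) / \<sigma> * nm lebesgue h"
      by (rule order_trans[OF L2a(2)[OF pc(1)]]) (use pc(2)[of K] in simp)
    have "nm PS ?c3 \<le> 1 * nm PS (\<lambda>z. indicator S z * ?T h z)"
    proof (rule nm_bound[OF L2_indicator_mult[OF Th S(1)] L2_measurable[OF c3]])
      show "AE z in PS. cmod (?c3 z) \<le> 1 * cmod (indicator S z * ?T h z)"
      proof (rule AE_I2)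
        fix z :: "(real^'n) \<times> (real^'n)"
        show "cmod (?c3 z) \<le> 1 * cmod (indicator S z * ?T h z)"
        proof (cases "z \<in> S")
          case True
          have "cmod (a (fst z) * b (snd z)) \<le> 1" using a(2)[of "fst z"] b(2)[of "snd z"] by (simp add: norm_mult mult_le_one)
          from cmod_mult_le_one[OF this, of "?T h z"] show ?thesis using True by (simp add: mult.assoc)
        next
          case False
          then have "a (fst z) * b (snd z) = 0" using S(2)[of "fst z" "snd z"] by auto
          then show ?thesis by auto
        qed
      qed
    qed simp
    then show "nm PS ?c3 \<le> pnm K \<sigma> S h" by (simp add: pnm_def)
  qed
  finally show ?thesis by (simp add: algebra_simps)
qed

lemma tendsto_multiplier_one:
  fixes f :: "'a \<Rightarrow> complex" and m :: "real \<Rightarrow> 'a \<Rightarrow> complex"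
  assumes f: "L2 M f" and m: "\<And>t. m t \<in> borel_measurable M" "\<And>t x. cmod (m t x) \<le> 1"
    and one: "AE x in M. \<forall>\<^sub>F t in at_top. m t x = 1"
  shows "((\<lambda>t. nm M (\<lambda>x. f x - m t x * f x)) \<longlongrightarrow> 0) at_top"
proof -
  note [measurable] = L2_measurable[OF f] m(1)
  have "((\<lambda>t. LINT x|M. (cmod (f x - m t x * f x))\<^sup>2) \<longlongrightarrow> (LINT x|M. 0)) at_top"
  proof (rule integral_dominated_convergence_at_top[where w="\<lambda>x. (2 * cmod (f x))\<^sup>2"])
    show "integrable M (\<lambda>x. (2 * cmod (f x))\<^sup>2)" using f by (simp add: L2_def power_mult_distrib)
    show "AE x in M. ((\<lambda>t. (cmod (f x - m t x * f x))\<^sup>2) \<longlongrightarrow> 0) at_top"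
      using one
    proof eventually_elim
      case (elim x)
      then have "\<forall>\<^sub>F t in at_top. (cmod (f x - m t x * f x))\<^sup>2 = 0" by eventually_elim simp
      then show ?case by (rule tendsto_eventually)
    qed
    show "\<forall>\<^sub>F t in at_top. AE x in M. norm ((cmod (f x - m t x * f x))\<^sup>2) \<le> (2 * cmod (f x))\<^sup>2"
    proof (intro always_eventually allI AE_I2)
      fix t x
      have "cmod (f x - m t x * f x) \<le> cmod (f x) + 1 * cmod (f x)"
        by (intro order_trans[OF norm_triangle_ineq4] add_left_mono cmod_mult_le_one m(2))
      then have "(cmod (f x - m t x * f x))\<^sup>2 \<le> (2 * cmod (f x))\<^sup>2" by (intro power_mono) auto
      then show "norm ((cmod (f x - m t x * f x))\<^sup>2) \<le> (2 * cmod (f x))\<^sup>2" by simp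
    qed
  qed measurable
  from tendsto_real_sqrt[OF this] show ?thesis by (simp add: nm_def)
qed

section \<open>Elementary estimates for real powers\<close>

lemma le_of_sq_le_mult:
  fixes a b :: real
  assumes "a\<^sup>2 \<le> a * b" "0 \<le> b" "0 \<le> a" shows "a \<le> b"
  using assms by (cases "a = 0") (auto simp: power2_eq_square mult_le_cancel_left)

lemma eventually_powr_le:
  assumes "p < (q::real)" shows "\<forall>\<^sub>F t::real in at_top. c * t powr p \<le> t powr q"
proof -
  have "((\<lambda>t::real. c * t powr (p - q)) \<longlongrightarrow> c * 0) at_top"
    using assms by (intro tendsto_mult tendsto_const tendsto_neg_powr filterlim_ident) auto
  then have "\<forall>\<^sub>F t::real in at_top. c * t powr (p - q) < 1" by (intro order_tendstoD(2)) auto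
  then show ?thesis using eventually_gt_at_top[of 0]
  proof eventually_elim
    case (elim t)
    have "c * t powr p = (c * t powr (p - q)) * t powr q" using elim by (simp add: powr_diff)
    also have "\<dots> \<le> 1 * t powr q" using elim by (intro mult_right_mono) auto
    finally show ?case by simp
  qed
qed

lemma tendsto_powr_0: "p < (0::real) \<Longrightarrow> ((\<lambda>t::real. c * t powr p) \<longlongrightarrow> 0) at_top"
  using tendsto_mult[OF tendsto_const tendsto_neg_powr[OF _ filterlim_ident], of p c] by simp

text \<open>The bound is independent of T, so that T may later be sent to infinity.\<close>

lemma integral_affine_powr:
  fixes A k \<delta> t T :: real
  assumes A: "A > 0" and k: "k > 0" and \<delta>: "\<delta> > 1" and tT: "t \<le> T"
  shows "\<exists>I. ((\<lambda>s. (A + k * (s - t)) powr (- \<delta>)) has_integral I) {t..T} \<and> I \<le> A powr (1 - \<delta>) / ((\<delta> - 1) * k)"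
proof -
  let ?F = "\<lambda>s. (A + k * (s - t)) powr (1 - \<delta>) / ((1 - \<delta>) * k)"
  have pos: "A + k * (s - t) > 0" if "s \<in> {t..T}" for s
  proof -
    have "0 \<le> k * (s - t)" using that k by simp
    then show ?thesis using A by linarith
  qed
  have "((\<lambda>s. (A + k * (s - t)) powr (- \<delta>)) has_integral (?F T - ?F t)) {t..T}"
  proof (rule fundamental_theorem_of_calculus[OF tT])
    fix s assume s: "s \<in> {t..T}"
    have "((\<lambda>s. (A + k * (s - t)) powr (1 - \<delta>)) has_real_derivative (1 - \<delta>) * (A + k * (s - t)) powr (1 - \<delta> - 1) * k) (at s)"
      using pos[OF s] by (auto intro!: derivative_eq_intros)
    then have "(?F has_real_derivative ((1 - \<delta>) * (A + k * (s - t)) powr (1 - \<delta> - 1) * k) / ((1 - \<delta>) * k)) (at s)"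
      by (rule DERIV_cdivide)
    moreover have "((1 - \<delta>) * (A + k * (s - t)) powr (1 - \<delta> - 1) * k) / ((1 - \<delta>) * k) = (A + k * (s - t)) powr (- \<delta>)"
      using k \<delta> by simp
    ultimately show "(?F has_vector_derivative (A + k * (s - t)) powr (- \<delta>)) (at s within {t..T})"
      by (metis has_real_derivative_iff_has_vector_derivative has_vector_derivative_at_within)
  qed
  moreover have "?F T - ?F t \<le> A powr (1 - \<delta>) / ((\<delta> - 1) * k)"
  proof -
    have "?F T \<le> 0" using \<delta> k by (intro divide_nonneg_nonpos) (auto simp: mult_nonpos_nonneg)
    moreover have "- ?F t = A powr (1 - \<delta>) / ((\<delta> - 1) * k)" using \<delta> k by (simp add: divide_simps) (simp add: algebra_simps)
    ultimately show ?thesis by linarith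
  qed
  ultimately show ?thesis by blast
qed

section \<open>The interaction picture\<close>

text \<open>Only the pointwise decay of the source \<open>W\<close> relative to \<psi> matters; the
  nonlinear equation is treated as the free one with a given forcing.\<close>

locale scattering =
  fixes \<psi> W :: "real \<Rightarrow> real^'n \<Rightarrow> complex" and M C \<delta> :: real
  assumes L2_psi: "L2 lebesgue (\<psi> t)" and nm_psi: "nm lebesgue (\<psi> t) \<le> M"
    and L2_W: "L2 lebesgue (W s)"
    and W_decay: "cmod (W s x) \<le> C * (1 + (norm x)\<^sup>2) powr (- \<delta> / 2) * cmod (\<psi> s x)"
    and C: "C \<ge> 0" and \<delta>: "\<delta> > 1"
    and duhamel_integrable: "L2 lebesgue \<phi> \<Longrightarrow> interval_lebesgue_integrable lborel 0 t (\<lambda>s. ip lebesgue \<phi> (schr (t - s) (W s)))"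
    and duhamel: "L2 lebesgue \<phi> \<Longrightarrow> ip lebesgue \<phi> (\<psi> t) = ip lebesgue \<phi> (schr t (\<psi> 0)) - \<i> * (LBINT s=0..t. ip lebesgue \<phi> (schr (t - s) (W s)))"
begin

lemma M_nonneg: "M \<ge> 0"
  using nm_nonneg nm_psi order_trans by blast

definition \<Phi> :: "real \<Rightarrow> real^'n \<Rightarrow> complex" where "\<Phi> t = schr (- t) (\<psi> t)"

lemma L2_\<Phi>: "L2 lebesgue (\<Phi> t)"
  unfolding \<Phi>_def by (rule L2_schr[OF L2_psi])

lemma nm_\<Phi>: "nm lebesgue (\<Phi> t) = nm lebesgue (\<psi> t)"
  unfolding \<Phi>_def by (rule nm_schr[OF L2_psi])

lemma nm_\<Phi>_le: "nm lebesgue (\<Phi> t) \<le> M"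
  unfolding nm_\<Phi> by (rule nm_psi)

section \<open>Duhamel's formula in the interaction picture\<close>

lemma \<Phi>_integral:
  assumes \<theta>: "L2 lebesgue \<theta>" and t: "t \<ge> 0"
  shows "(\<lambda>s. ip lebesgue \<theta> (schr (- s) (W s))) integrable_on {0..t}"
    and "ip lebesgue \<theta> (\<Phi> t) = ip lebesgue \<theta> (\<psi> 0) - \<i> * integral {0..t} (\<lambda>s. ip lebesgue \<theta> (schr (- s) (W s)))"
proof -
  have eq: "ip lebesgue (schr t \<theta>) (schr (t - s) (W s)) = ip lebesgue \<theta> (schr (- s) (W s))" for s
    using ip_schr[OF L2_schr[OF L2_W] \<theta>] schr_schr[OF L2_W] by simp
  have i: "interval_lebesgue_integrable lborel 0 t (\<lambda>s. ip lebesgue \<theta> (schr (- s) (W s)))"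
    using duhamel_integrable[OF L2_schr[OF \<theta>], of t t] by (simp add: eq)
  then have si: "set_integrable lborel (einterval (ereal 0) (ereal t)) (\<lambda>s. ip lebesgue \<theta> (schr (- s) (W s)))"
    using t by (simp add: interval_lebesgue_integrable_def zero_ereal_def)
  from set_borel_integral_eq_integral(1)[OF si]
  show "(\<lambda>s. ip lebesgue \<theta> (schr (- s) (W s))) integrable_on {0..t}"
    by (simp add: integrable_on_open_interval_real)
  have "(LBINT s=ereal 0..ereal t. ip lebesgue \<theta> (schr (- s) (W s))) = integral {0..t} (\<lambda>s. ip lebesgue \<theta> (schr (- s) (W s)))"
    using interval_integral_eq_integral'[OF _ si] t by (simp add: integral_open_interval_real)
  moreover have "ip lebesgue \<theta> (\<Phi> t) = ip lebesgue (schr t \<theta>) (\<psi> t)"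
    unfolding \<Phi>_def using ip_schr[OF L2_psi \<theta>] by simp
  moreover have "ip lebesgue (schr t \<theta>) (schr t (\<psi> 0)) = ip lebesgue \<theta> (\<psi> 0)"
  proof -
    have "ip lebesgue (schr t \<theta>) (schr t (\<psi> 0)) = ip lebesgue \<theta> (schr 0 (\<psi> 0))"
      using ip_schr[OF L2_schr[OF L2_psi] \<theta>] schr_schr[OF L2_psi] by simp
    also have "\<dots> = ip lebesgue \<theta> (\<psi> 0)"
      by (intro ip_cong_AE AE_I2 refl schr_0 L2_measurable L2_schr L2_psi \<theta>)
    finally show ?thesis .
  qed
  ultimately show "ip lebesgue \<theta> (\<Phi> t) = ip lebesgue \<theta> (\<psi> 0) - \<i> * integral {0..t} (\<lambda>s. ip lebesgue \<theta> (schr (- s) (W s)))"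
    using duhamel[OF L2_schr[OF \<theta>], of t t] by (simp add: eq zero_ereal_def)
qed

lemma \<Phi>_diff_bound:
  assumes \<theta>: "L2 lebesgue \<theta>" and t: "0 \<le> t" "t \<le> T"
    and N: "\<And>s. s \<in> {t..T} \<Longrightarrow> cmod (ip lebesgue \<theta> (schr (- s) (W s))) \<le> N s" and I: "(N has_integral I) {t..T}"
  shows "cmod (ip lebesgue \<theta> (\<lambda>x. \<Phi> T x - \<Phi> t x)) \<le> I"
proof -
  let ?f = "\<lambda>s. ip lebesgue \<theta> (schr (- s) (W s))"
  have T: "0 \<le> T" using t by simp
  have fT: "?f integrable_on {0..T}" by (rule \<Phi>_integral(1)[OF \<theta> T])
  then have fi: "?f integrable_on {t..T}" using t by (rule_tac integrable_on_subinterval) auto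
  have "integral {0..t} ?f + integral {t..T} ?f = integral {0..T} ?f"
    by (rule Henstock_Kurzweil_Integration.integral_combine[OF t fT])
  then have "ip lebesgue \<theta> (\<lambda>x. \<Phi> T x - \<Phi> t x) = - \<i> * integral {t..T} ?f"
    unfolding ip_diff_right[OF \<theta> L2_\<Phi> L2_\<Phi>] \<Phi>_integral(2)[OF \<theta> T] \<Phi>_integral(2)[OF \<theta> t(1)]
    by (simp add: algebra_simps flip: distrib_left)
  then have "cmod (ip lebesgue \<theta> (\<lambda>x. \<Phi> T x - \<Phi> t x)) = norm (integral {t..T} ?f)" by (simp add: norm_mult)
  also have "\<dots> \<le> integral {t..T} N"
    by (rule Henstock_Kurzweil_Integration.integral_norm_bound_integral[OF fi _ N]) (use I in auto)
  also have "\<dots> = I" using I by (rule integral_unique)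
  finally show ?thesis .
qed

text \<open>Minkowski's integral inequality for \<open>pnm\<close>. It goes through duality because
  the integrand is only known to be integrable against test functions; the unitary
  \<open>schr r\<close> is absorbed into the test function.\<close>

lemma pnm_\<Phi>_diff:
  assumes \<sigma>: "\<sigma> > 0" and S: "S \<in> sets PS" and t: "0 \<le> t" "t \<le> T"
    and N: "\<And>s. s \<in> {t..T} \<Longrightarrow> pnm K \<sigma> S (schr (r - s) (W s)) \<le> N s" and I: "(N has_integral I) {t..T}"
  shows "pnm K \<sigma> S (schr r (\<lambda>x. \<Phi> T x - \<Phi> t x)) \<le> I"
proof (rule pnm_dual[OF \<sigma> L2_schr[OF L2_diff[OF L2_\<Phi> L2_\<Phi>]] S])
  have "N s \<ge> 0" if "s \<in> {t..T}" for s using N[OF that] pnm_nonneg order_trans by blast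
  then show "0 \<le> I" using I by (rule_tac has_integral_nonneg)
  fix q :: "real^'n \<Rightarrow> complex" and k :: real
  assume q: "L2 lebesgue q" and k: "k \<ge> 0" and qk: "\<And>f. L2 lebesgue f \<Longrightarrow> cmod (ip lebesgue q f) \<le> k * pnm K \<sigma> S f"
  have "ip lebesgue q (schr r (\<lambda>x. \<Phi> T x - \<Phi> t x)) = ip lebesgue (schr (-r) q) (\<lambda>x. \<Phi> T x - \<Phi> t x)"
    using ip_schr[OF L2_diff[OF L2_\<Phi> L2_\<Phi>] q] by simp
  also have "cmod \<dots> \<le> k * I"
  proof (rule \<Phi>_diff_bound[OF L2_schr[OF q] t])
    show "((\<lambda>s. k * N s) has_integral k * I) {t..T}" using I by (rule has_integral_mult_right)
    fix s assume s: "s \<in> {t..T}"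
    have "ip lebesgue (schr (- r) q) (schr (- s) (W s)) = ip lebesgue q (schr (r - s) (W s))"
      using ip_schr[OF L2_schr[OF L2_W] q] schr_schr[OF L2_W] by simp
    also have "cmod \<dots> \<le> k * pnm K \<sigma> S (schr (r - s) (W s))" by (rule qk[OF L2_schr[OF L2_W]])
    also have "\<dots> \<le> k * N s" by (rule mult_left_mono[OF N[OF s] k])
    finally show "cmod (ip lebesgue (schr (- r) q) (schr (- s) (W s))) \<le> k * N s" .
  qed
  finally show "cmod (ip lebesgue q (schr r (\<lambda>x. \<Phi> T x - \<Phi> t x))) \<le> k * I" .
qed

section \<open>Decay of the source away from the origin\<close>

lemma W_bound: "nm lebesgue (W s) \<le> C * nm lebesgue (\<psi> s)"
proof (rule nm_bound[OF L2_psi L2_measurable[OF L2_W] _ C])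
  have "cmod (W s x) \<le> C * 1 * cmod (\<psi> s x)" for x
  proof (rule order_trans[OF W_decay])
    have p: "1 + (norm x)\<^sup>2 > 0" by (simp add: add_pos_nonneg)
    have "(1 + (norm x)\<^sup>2) powr (- \<delta> / 2) \<le> (1 + (norm x)\<^sup>2) powr 0" using \<delta> by (intro powr_mono) auto
    also have "\<dots> = 1" using p by simp
    finally show "C * (1 + (norm x)\<^sup>2) powr (- \<delta> / 2) * cmod (\<psi> s x) \<le> C * 1 * cmod (\<psi> s x)"
      using C by (intro mult_right_mono mult_left_mono) auto
  qed
  then show "AE x in lebesgue. cmod (W s x) \<le> C * cmod (\<psi> s x)" by simp
qed

lemma W_exterior:
  assumes D: "D > 0"
  shows "nm lebesgue (\<lambda>y. indicator {y. D \<le> norm y} y * W s y) \<le> C * M * D powr (- \<delta>)"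
proof -
  have "{y::real^'n. D \<le> norm y} \<in> sets borel" by measurable
  then have S: "{y::real^'n. D \<le> norm y} \<in> sets lebesgue" by simp
  have "nm lebesgue (\<lambda>y. indicator {y. D \<le> norm y} y * W s y) \<le> (C * D powr (- \<delta>)) * nm lebesgue (\<psi> s)"
  proof (rule nm_bound[OF L2_psi])
    show "(\<lambda>y. indicator {y. D \<le> norm y} y * W s y) \<in> borel_measurable lebesgue"
      by (rule L2_measurable[OF L2_indicator_mult[OF L2_W S]])
    have "cmod (W s y) \<le> C * D powr (- \<delta>) * cmod (\<psi> s y)" if y: "D \<le> norm y" for y
    proof (rule order_trans[OF W_decay])
      have "D\<^sup>2 \<le> 1 + (norm y)\<^sup>2" 
      proof -
        have "D\<^sup>2 \<le> (norm y)\<^sup>2" using y D by (intro power_mono) auto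
        then show ?thesis by simp
      qed
      then have "(1 + (norm y)\<^sup>2) powr (- \<delta> / 2) \<le> (D\<^sup>2) powr (- \<delta> / 2)"
        using D \<delta> by (intro powr_mono2') auto
      also have "(D\<^sup>2) powr (- \<delta> / 2) = D powr (- \<delta>)"
        using D by (simp add: powr_powr flip: powr_numeral)
      finally show "C * (1 + (norm y)\<^sup>2) powr (- \<delta> / 2) * cmod (\<psi> s y) \<le> C * D powr (- \<delta>) * cmod (\<psi> s y)"
        using C by (intro mult_right_mono mult_left_mono) auto
    qed
    then show "AE y in lebesgue. cmod (indicator {y. D \<le> norm y} y * W s y) \<le> C * D powr (- \<delta>) * cmod (\<psi> s y)"
      using C by (intro AE_I2) (auto simp: indicator_def)
    show "0 \<le> C * D powr (- \<delta>)" using C by simp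
  qed
  also have "\<dots> \<le> (C * D powr (- \<delta>)) * M" using C by (intro mult_left_mono nm_psi) auto
  finally show ?thesis by (simp add: mult_ac)
qed

text \<open>The tail of the packet is of order \<open>(\<sigma> / D) ^ (2 * K - 1)\<close>; as \<open>D\<close> is at least a power larger
  than one of \<open>\<sigma>\<close>, a large \<open>K\<close> makes it negligible compared with the decay \<open>D powr (- \<delta>)\<close> of the source.\<close>

lemma pnm_source_decay:
  assumes \<rho>: "\<rho> > 1"
  shows "\<exists>K\<ge>1. \<exists>K0\<ge>0. \<exists>c0>0. \<forall>\<sigma> \<tau> D S s. \<sigma> \<ge> 1 \<longrightarrow> c0 * \<sigma> powr \<rho> \<le> D \<longrightarrow> c0 * \<bar>\<tau>\<bar> \<le> D * \<sigma> \<longrightarrow> S \<in> sets PS \<longrightarrow>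
    (\<forall>x \<xi>. (x, \<xi>) \<in> S \<longrightarrow> D \<le> norm (x + (2 * \<tau>) *\<^sub>R \<xi>)) \<longrightarrow> pnm K \<sigma> S (schr (- \<tau>) (W s)) \<le> K0 * D powr (- \<delta>)"
proof -
  let ?n = "real CARD('n)"
  \<comment> \<open>The condition on D gives \<sigma> / D \<le> D powr (- \<eta>). The tail enters
    the squared norm and has to stay below D powr (- 2 \<delta>), so K must satisfy \<eta> (2K - 1)
    \<ge> 2\<delta>.\<close>
  define \<eta> where "\<eta> = 1 - 1 / \<rho>"
  have \<eta>: "\<eta> > 0" using \<rho> by (simp add: \<eta>_def)
  define K where "K = nat \<lceil>\<delta> / \<eta>\<rceil> + 1"
  have K1: "K \<ge> 1" by (simp add: K_def)
  have "\<delta> / \<eta> \<le> real K - 1" unfolding K_def by (simp add: real_nat_ceiling_ge)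
  then have "\<delta> \<le> \<eta> * (real K - 1)" using \<eta> by (simp add: field_simps)
  moreover have "real (2 * K - 1) = 2 * (real K - 1) + 1" using K1 by (simp add: of_nat_diff)
  ultimately have K2: "2 * \<delta> \<le> \<eta> * real (2 * K - 1)" using \<eta> by (simp add: algebra_simps)
  obtain Ct where Ct: "Ct \<ge> 0" "\<And>\<sigma> s D::real. \<sigma> > 0 \<Longrightarrow> D > 0 \<Longrightarrow> 4 * ?n * \<bar>s\<bar> \<le> D * \<sigma> \<Longrightarrow>
    (\<integral>\<^sup>+z. indicator {z. D \<le> norm z} z * ennreal ((cmod (packet K \<sigma> s (z::real^'n)))\<^sup>2) \<partial>lborel)
      \<le> ennreal (Ct * (\<sigma> / D) ^ (2 * K - 1) * wmass K \<sigma> ^ CARD('n))"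
    using packet_tail[OF K1, where 'n='n] by blast
  define Z where "Z = (C * M * 2 powr \<delta>)\<^sup>2 + Ct * 2 ^ (2 * K - 1) * (C * M)\<^sup>2"
  have Z: "Z \<ge> 0" using Ct(1) by (simp add: Z_def)
  have n1: "?n \<ge> 1" by (simp add: Suc_leI)
  \<comment> \<open>The factor 8 replaces the 4 of the tail estimate because the tail is taken at
    radius D / 2.\<close>
  have main: "pnm K \<sigma> S (schr (- \<tau>) (W s)) \<le> sqrt Z * D powr (- \<delta>)"
    if \<sigma>: "\<sigma> \<ge> 1" and D: "8 * ?n * \<sigma> powr \<rho> \<le> D" and \<tau>: "8 * ?n * \<bar>\<tau>\<bar> \<le> D * \<sigma>" and S: "S \<in> sets PS"
      and Sx: "\<And>x \<xi>. (x, \<xi>) \<in> S \<Longrightarrow> D \<le> norm (x + (2 * \<tau>) *\<^sub>R \<xi>)" for \<sigma> \<tau> D S s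
  proof -
    have s1: "\<sigma> powr \<rho> \<ge> 1" using \<sigma> \<rho> by (simp add: ge_one_powr_ge_zero)
    have "1 \<le> 8 * ?n" using n1 by linarith
    then have "1 * \<sigma> powr \<rho> \<le> 8 * ?n * \<sigma> powr \<rho>" by (rule mult_right_mono) simp
    then have sD: "\<sigma> powr \<rho> \<le> D" using D by simp
    then have D1: "D \<ge> 1" using s1 by simp
    define \<mu> where "\<mu> = Ct * (\<sigma> / (D / 2)) ^ (2 * K - 1)"
    have \<mu>0: "\<mu> \<ge> 0" using Ct(1) \<sigma> D1 by (simp add: \<mu>_def)
    have tail: "(\<integral>\<^sup>+z. indicator {z. D / 2 \<le> norm z} z * ennreal ((cmod (packet K \<sigma> \<tau> (z::real^'n)))\<^sup>2) \<partial>lborel) \<le> ennreal (\<mu> * wmass K \<sigma> ^ CARD('n))"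
      unfolding \<mu>_def using \<sigma> D1 \<tau> by (intro Ct(2)) auto
    have \<sigma>0: "\<sigma> > 0" using \<sigma> by simp
    have "(pnm K \<sigma> S (schr (- \<tau>) (W s)))\<^sup>2 \<le> (nm lebesgue (\<lambda>y. indicator {y. D / 2 \<le> norm y} y * W s y))\<^sup>2 + \<mu> * (nm lebesgue (W s))\<^sup>2"
      by (rule pnm_schr_le[OF \<sigma>0 L2_W S Sx \<mu>0 tail])
    also have "\<dots> \<le> (C * M * (D / 2) powr (- \<delta>))\<^sup>2 + \<mu> * (C * M)\<^sup>2"
    proof (intro add_mono power_mono mult_left_mono)
      show "nm lebesgue (\<lambda>y. indicator {y. D / 2 \<le> norm y} y * W s y) \<le> C * M * (D / 2) powr (- \<delta>)"
        using D1 by (intro W_exterior) simp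
      show "nm lebesgue (W s) \<le> C * M" by (rule order_trans[OF W_bound mult_left_mono[OF nm_psi C]])
    qed (use \<mu>0 in auto)
    also have "\<dots> \<le> Z * (D powr (- \<delta>))\<^sup>2"
    proof -
      have 1: "(C * M * (D / 2) powr (- \<delta>))\<^sup>2 = (C * M * 2 powr \<delta>)\<^sup>2 * (D powr (- \<delta>))\<^sup>2"
        using D1 by (simp add: powr_divide powr_minus power_mult_distrib field_simps)
      have "\<sigma> \<le> D powr (1 / \<rho>)"
        using powr_mono2[OF _ _ sD, of "1 / \<rho>"] \<rho> \<sigma> by (simp add: powr_powr)
      then have "\<sigma> / D \<le> D powr (1 / \<rho>) / D" using D1 by (simp add: divide_right_mono)
      also have "\<dots> = D powr (- \<eta>)" using D1 by (simp add: \<eta>_def powr_diff)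
      finally have "(\<sigma> / D) ^ (2 * K - 1) \<le> (D powr (- \<eta>)) ^ (2 * K - 1)" using \<sigma> D1 by (intro power_mono) auto
      also have "\<dots> = D powr (- \<eta> * real (2 * K - 1))" using D1 by (simp add: powr_realpow[symmetric] powr_powr)
      also have "\<dots> \<le> D powr (- (2 * \<delta>))" using K2 D1 by (intro powr_mono) auto
      also have "\<dots> = (D powr (- \<delta>))\<^sup>2" by (simp add: power2_eq_square powr_add[symmetric])
      finally have "Ct * 2 ^ (2 * K - 1) * (C * M)\<^sup>2 * (\<sigma> / D) ^ (2 * K - 1) \<le> Ct * 2 ^ (2 * K - 1) * (C * M)\<^sup>2 * (D powr (- \<delta>))\<^sup>2"
        using Ct(1) by (intro mult_left_mono) auto
      moreover have "\<mu> * (C * M)\<^sup>2 = Ct * 2 ^ (2 * K - 1) * (C * M)\<^sup>2 * (\<sigma> / D) ^ (2 * K - 1)"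
        unfolding \<mu>_def by (simp add: power_mult_distrib power_divide mult_ac)
      ultimately have "\<mu> * (C * M)\<^sup>2 \<le> Ct * 2 ^ (2 * K - 1) * (C * M)\<^sup>2 * (D powr (- \<delta>))\<^sup>2" by (simp only:)
      then show ?thesis unfolding 1 Z_def distrib_right by (rule add_left_mono)
    qed
    finally have "(pnm K \<sigma> S (schr (- \<tau>) (W s)))\<^sup>2 \<le> (sqrt Z * D powr (- \<delta>))\<^sup>2"
      using Z by (simp add: power_mult_distrib)
    then show ?thesis by (rule power2_le_imp_le) (use Z in auto)
  qed
  show ?thesis
  proof (rule exI[of _ K], intro conjI K1, rule exI[of _ "sqrt Z"], intro conjI, goal_cases)
    case 2
    show ?case
    proof (rule exI[of _ "8 * ?n"], intro conjI allI impI, goal_cases)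
      case (2 \<sigma> \<tau> D S s)
      show ?case by (rule main[OF 2(1-4)]) (use 2(5) in blast)
    qed simp
  qed (use Z in simp)
qed

text \<open>Gronwall by iteration: testing Duhamel's formula with \<Phi> t itself improves the bound
  M (C t)^k / k! to the next k. It settles the case \<psi> 0 = 0 of the localisation estimate, whose
  right-hand side vanishes there.\<close>

lemma vanishing_solution:
  assumes 0: "nm lebesgue (\<psi> 0) = 0" and t: "t \<ge> 0"
  shows "nm lebesgue (\<psi> t) = 0"
proof -
  have step: "nm lebesgue (\<psi> t) \<le> M * ((C * t) ^ k / fact k)" if "t \<ge> 0" for t k
    using that
  proof (induction k arbitrary: t)
    case 0
    then show ?case using nm_psi[of t] by simp
  next
    case (Suc k)
    let ?a = "nm lebesgue (\<Phi> t)"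
    have I: "((\<lambda>s. ?a * (C * (M * ((C * s) ^ k / fact k)))) has_integral ?a * (M * ((C * t) ^ Suc k / fact (Suc k)) - M * ((C * 0) ^ Suc k / fact (Suc k)))) {0..t}"
    proof (rule has_integral_mult_right, rule fundamental_theorem_of_calculus[OF Suc.prems])
      fix s
      have "((\<lambda>s. (C * s) ^ Suc k) has_real_derivative (1 + of_nat k) * (C * (C * s) ^ k)) (at s within {0..t})"
        by (rule DERIV_power_Suc) (auto intro!: derivative_eq_intros)
      then have "((\<lambda>s. M * ((C * s) ^ Suc k / fact (Suc k))) has_real_derivative M * (((1 + of_nat k) * (C * (C * s) ^ k)) / fact (Suc k))) (at s within {0..t})"
        by (intro DERIV_cmult DERIV_cdivide)
      moreover have "M * (((1 + of_nat k) * (C * (C * s) ^ k)) / fact (Suc k)) = C * (M * ((C * s) ^ k / fact k))"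
        by (simp add: divide_simps)
      ultimately show "((\<lambda>s. M * ((C * s) ^ Suc k / fact (Suc k))) has_vector_derivative C * (M * ((C * s) ^ k / fact k))) (at s within {0..t})"
        by (simp only: has_real_derivative_iff_has_vector_derivative)
    qed
    have "cmod (ip lebesgue (\<Phi> t) (\<lambda>x. \<Phi> t x - \<Phi> 0 x)) \<le> ?a * (M * ((C * t) ^ Suc k / fact (Suc k)) - M * ((C * 0) ^ Suc k / fact (Suc k)))"
    proof (rule \<Phi>_diff_bound[OF L2_\<Phi> order_refl Suc.prems _ I])
      fix s assume s: "s \<in> {0..t}"
      have "cmod (ip lebesgue (\<Phi> t) (schr (- s) (W s))) \<le> ?a * nm lebesgue (schr (- s) (W s))"
        by (intro Cauchy_Schwarz_L2 L2_\<Phi> L2_schr L2_W)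
      also have "nm lebesgue (schr (- s) (W s)) = nm lebesgue (W s)" by (rule nm_schr[OF L2_W])
      also have "?a * nm lebesgue (W s) \<le> ?a * (C * (M * ((C * s) ^ k / fact k)))"
        using s Suc.IH[of s] C by (intro mult_left_mono order_trans[OF W_bound] mult_left_mono) auto
      finally show "cmod (ip lebesgue (\<Phi> t) (schr (- s) (W s))) \<le> ?a * (C * (M * ((C * s) ^ k / fact k)))" .
    qed
    moreover have "ip lebesgue (\<Phi> t) (\<Phi> 0) = 0"
      using Cauchy_Schwarz_L2[OF L2_\<Phi> L2_\<Phi>, of t 0] by (simp add: nm_\<Phi>[of 0] 0)
    ultimately have "?a\<^sup>2 \<le> ?a * (M * ((C * t) ^ Suc k / fact (Suc k)))"
      by (simp add: ip_diff_right L2_\<Phi> ip_self norm_power)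
    moreover have "0 \<le> M * ((C * t) ^ Suc k / fact (Suc k))" using M_nonneg C Suc.prems by simp
    ultimately have "?a \<le> M * ((C * t) ^ Suc k / fact (Suc k))"
      by (rule le_of_sq_le_mult) (rule nm_nonneg)
    then show ?case by (simp only: nm_\<Phi>)
  qed
  have "(\<lambda>k. inverse (fact k) * (C * t) ^ k) \<longlonglongrightarrow> 0" by (rule summable_LIMSEQ_zero[OF summable_exp])
  then have "(\<lambda>k. M * ((C * t) ^ k / fact k)) \<longlonglongrightarrow> M * 0" by (intro tendsto_mult tendsto_const) (simp add: divide_inverse mult.commute)
  from LIMSEQ_le_const[OF this, of "nm lebesgue (\<psi> t)"] step[OF t]
  have "nm lebesgue (\<psi> t) \<le> M * 0" by blast
  then show ?thesis using nm_nonneg[of lebesgue "\<psi> t"] by simp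
qed

end

section \<open>The cutoffs\<close>

text \<open>The derivative is bounded on the compact transition interval, and f is unchanged when
  its argument is clamped to that interval.\<close>

lemma cutoff_Lipschitz:
  assumes "cutoff f" shows "\<exists>L\<ge>0. \<forall>x y. \<bar>f x - f y\<bar> \<le> L * \<bar>x - y\<bar>"
proof -
  have sm: "((deriv ^^ k) f) differentiable (at x)" for k x using assms by (auto simp: cutoff_def smooth_fun_def)
  have d: "(f has_field_derivative deriv f x) (at x)" for x
    using sm[of 0 x] by (simp add: DERIV_deriv_iff_real_differentiable)
  have "isCont (deriv f) x" for x
    using sm[of 1 x] by (simp add: differentiable_imp_continuous_within)
  then have "compact (deriv f ` {1/2..1})"
    by (intro compact_continuous_image continuous_at_imp_continuous_on ballI) auto
  then have "bounded (deriv f ` {1/2..1})" by (rule compact_imp_bounded)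
  then obtain L where "\<forall>y\<in>deriv f ` {1/2..1}. norm y \<le> L" unfolding bounded_iff by blast
  then have L: "\<bar>deriv f x\<bar> \<le> L" if "x \<in> {1/2..1}" for x using that by auto
  have L0: "L \<ge> 0" using L[of 1] by auto
  define c :: "real \<Rightarrow> real" where "c x = max (1/2) (min 1 x)" for x
  have fc: "f x = f (c x)" for x using assms by (auto simp: c_def cutoff_def max_def min_def)
  have lip: "\<bar>f x - f y\<bar> \<le> L * \<bar>x - y\<bar>" if "x \<in> {1/2..1}" "y \<in> {1/2..1}" for x y
    using field_differentiable_bound[of "{1/2..1}" f "deriv f" L x y] that L d
    by (auto intro: has_field_derivative_at_within)
  have "\<bar>f x - f y\<bar> \<le> L * \<bar>x - y\<bar>" for x y
  proof -
    have "\<bar>f (c x) - f (c y)\<bar> \<le> L * \<bar>c x - c y\<bar>" by (rule lip) (auto simp: c_def)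
    also have "\<dots> \<le> L * \<bar>x - y\<bar>" using L0 by (intro mult_left_mono) (auto simp: c_def max_def min_def)
    finally show ?thesis by (simp only: fc[of x] fc[of y])
  qed
  with L0 show ?thesis by blast
qed

lemma cutoff_measurable:
  assumes "cutoff f" shows "f \<in> borel_measurable borel"
proof -
  have "isCont f x" for x
  proof -
    have "((deriv ^^ 0) f) differentiable (at x)" using assms unfolding cutoff_def smooth_fun_def by blast
    then show ?thesis by (simp add: differentiable_imp_continuous_within)
  qed
  then show ?thesis by (intro borel_measurable_continuous_onI continuous_at_imp_continuous_on) auto
qed

definition acut :: "(real \<Rightarrow> real) \<Rightarrow> real \<Rightarrow> real \<Rightarrow> real^'n \<Rightarrow> complex" where
  "acut chi \<alpha> t x = complex_of_real (1 - chi (norm x / t powr \<alpha>))"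

definition bcut :: "(real \<Rightarrow> real) \<Rightarrow> real \<Rightarrow> real \<Rightarrow> real^'n \<Rightarrow> complex" where
  "bcut F b t \<xi> = complex_of_real (F (t powr b * norm \<xi>))"

lemma acut_simple:
  assumes "cutoff chi"
  shows acut_measurable: "acut chi \<alpha> t \<in> borel_measurable borel"
    and acut_le_1: "cmod (acut chi \<alpha> t x) \<le> 1"
    and acut_cnj: "cnj (acut chi \<alpha> t x) = acut chi \<alpha> t x"
    and acut_support: "t > 0 \<Longrightarrow> acut chi \<alpha> t x \<noteq> 0 \<Longrightarrow> norm x \<le> t powr \<alpha>"
proof -
  note [measurable] = cutoff_measurable[OF assms]
  show "acut chi \<alpha> t \<in> borel_measurable borel" unfolding acut_def[abs_def] by measurable
  have "\<bar>1 - chi (norm x / t powr \<alpha>)\<bar> \<le> 1" using assms by (simp add: cutoff_def abs_le_iff)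
  then show "cmod (acut chi \<alpha> t x) \<le> 1" unfolding acut_def norm_of_real .
  show "cnj (acut chi \<alpha> t x) = acut chi \<alpha> t x" by (simp add: acut_def)
  show "norm x \<le> t powr \<alpha>" if "t > 0" "acut chi \<alpha> t x \<noteq> 0"
  proof (rule ccontr)
    assume "\<not> norm x \<le> t powr \<alpha>"
    then have "1 \<le> norm x / t powr \<alpha>" using that(1) by (simp add: field_simps)
    then have "chi (norm x / t powr \<alpha>) = 1" using assms by (simp add: cutoff_def)
    then show False using that(2) by (simp add: acut_def)
  qed
qed

lemma bcut_simple:
  assumes "cutoff F"
  shows bcut_measurable: "bcut F b t \<in> borel_measurable borel"
    and bcut_le_1: "cmod (bcut F b t \<xi>) \<le> 1"
    and bcut_compl_le_1: "cmod (1 - bcut F b t \<xi>) \<le> 1"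
    and bcut_cnj: "cnj (bcut F b t \<xi>) = bcut F b t \<xi>"
    and bcut_support: "t > 0 \<Longrightarrow> bcut F b t \<xi> \<noteq> 0 \<Longrightarrow> t powr (- b) / 2 \<le> norm \<xi>"
proof -
  note [measurable] = cutoff_measurable[OF assms]
  show "bcut F b t \<in> borel_measurable borel" unfolding bcut_def[abs_def] by measurable
  have 1: "\<bar>F (t powr b * norm \<xi>)\<bar> \<le> 1" "\<bar>1 - F (t powr b * norm \<xi>)\<bar> \<le> 1" using assms by (auto simp: cutoff_def abs_le_iff)
  then show "cmod (bcut F b t \<xi>) \<le> 1" unfolding bcut_def norm_of_real by simp
  have "1 - bcut F b t \<xi> = complex_of_real (1 - F (t powr b * norm \<xi>))" by (simp add: bcut_def)
  then show "cmod (1 - bcut F b t \<xi>) \<le> 1" using 1(2) by (simp only: norm_of_real)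
  show "cnj (bcut F b t \<xi>) = bcut F b t \<xi>" by (simp add: bcut_def)
  show "t powr (- b) / 2 \<le> norm \<xi>" if "t > 0" "bcut F b t \<xi> \<noteq> 0"
  proof (rule ccontr)
    assume "\<not> t powr (- b) / 2 \<le> norm \<xi>"
    then have "t powr b * norm \<xi> \<le> t powr b * (t powr (- b) / 2)" by (intro mult_left_mono) auto
    also have "\<dots> = 1/2" using that(1) by (simp add: powr_minus)
    finally have "F (t powr b * norm \<xi>) = 0" using assms by (simp add: cutoff_def)
    then show False using that(2) by (simp add: bcut_def)
  qed
qed

lemma acut_Lipschitz:
  assumes L: "\<And>x y. \<bar>chi x - chi y\<bar> \<le> L * \<bar>x - y\<bar>" "L \<ge> 0" and t: "t > 0"
  shows "cmod (acut chi \<alpha> t y - acut chi \<alpha> t x) \<le> L * t powr (- \<alpha>) * norm (y - x)"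
proof -
  have "acut chi \<alpha> t y - acut chi \<alpha> t x = complex_of_real (chi (norm x / t powr \<alpha>) - chi (norm y / t powr \<alpha>))"
    by (simp add: acut_def)
  then have "cmod (acut chi \<alpha> t y - acut chi \<alpha> t x) = \<bar>chi (norm x / t powr \<alpha>) - chi (norm y / t powr \<alpha>)\<bar>"
    by (simp only: norm_of_real)
  also have "\<dots> \<le> L * \<bar>norm x / t powr \<alpha> - norm y / t powr \<alpha>\<bar>" by (rule L)
  also have "\<bar>norm x / t powr \<alpha> - norm y / t powr \<alpha>\<bar> = t powr (- \<alpha>) * \<bar>norm x - norm y\<bar>"
    using t by (simp add: powr_minus divide_inverse abs_mult flip: left_diff_distrib)
  also have "\<dots> \<le> t powr (- \<alpha>) * norm (y - x)"
    using norm_triangle_ineq3[of x y] by (intro mult_left_mono) (auto simp: norm_minus_commute)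
  finally show ?thesis using L(2) by (simp add: mult_left_mono mult.assoc)
qed

lemma bcut_Lipschitz:
  assumes L: "\<And>x y. \<bar>F x - F y\<bar> \<le> L * \<bar>x - y\<bar>" "L \<ge> 0"
  shows "cmod (bcut F b t y - bcut F b t x) \<le> L * t powr b * norm (y - x)"
proof -
  have "bcut F b t y - bcut F b t x = complex_of_real (F (t powr b * norm y) - F (t powr b * norm x))"
    by (simp add: bcut_def)
  then have "cmod (bcut F b t y - bcut F b t x) = \<bar>F (t powr b * norm y) - F (t powr b * norm x)\<bar>"
    by (simp only: norm_of_real)
  also have "\<dots> \<le> L * \<bar>t powr b * norm y - t powr b * norm x\<bar>" by (rule L)
  also have "\<bar>t powr b * norm y - t powr b * norm x\<bar> = t powr b * \<bar>norm y - norm x\<bar>"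
    by (simp add: abs_mult flip: right_diff_distrib)
  also have "\<dots> \<le> t powr b * norm (y - x)" by (intro mult_left_mono norm_triangle_ineq3) auto
  finally show ?thesis using L(2) by (simp add: mult_left_mono mult.assoc)
qed

lemma acut_eventually_1:
  assumes "cutoff chi" "\<alpha> > 0" shows "\<forall>\<^sub>F t in at_top. acut chi \<alpha> t x = 1"
  using eventually_powr_le[OF assms(2), of "2 * norm x"] eventually_gt_at_top[of 0]
proof eventually_elim
  case (elim t)
  then have "norm x / t powr \<alpha> \<le> 1/2" by (simp add: field_simps)
  then have "chi (norm x / t powr \<alpha>) = 0" using assms(1) by (simp add: cutoff_def)
  then show ?case by (simp add: acut_def)
qed

lemma bcut_eventually_1:
  assumes "cutoff F" "b > 0" "\<xi> \<noteq> 0" shows "\<forall>\<^sub>F t in at_top. bcut F b t \<xi> = 1"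
  using eventually_powr_le[OF assms(2), of "1 / norm \<xi>"] eventually_gt_at_top[of 0]
proof eventually_elim
  case (elim t)
  then have "1 \<le> t powr b * norm \<xi>" using assms(3) by (simp add: field_simps)
  then have "F (t powr b * norm \<xi>) = 1" using assms(1) by (simp add: cutoff_def)
  then show ?case by (simp add: bcut_def)
qed

section \<open>Adjoints and strong limits of the cutoffs\<close>

lemma ip_acut_bcut:
  assumes chi: "cutoff chi" and F: "cutoff F" and \<theta>: "L2 lebesgue \<theta>" and h: "L2 lebesgue h"
  shows "ip lebesgue \<theta> (\<lambda>x. acut chi \<alpha> t x * fmult (bcut F b t) h x) = ip lebesgue (fmult (bcut F b t) (\<lambda>x. acut chi \<alpha> t x * \<theta> x)) h"
proof -
  have L: "L2 lebesgue (\<lambda>x. acut chi \<alpha> t x * \<theta> x)" by (rule L2_bounded_mult[OF acut_measurable[OF chi] acut_le_1[OF chi] \<theta>])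
  have "ip lebesgue \<theta> (\<lambda>x. acut chi \<alpha> t x * fmult (bcut F b t) h x) = ip lebesgue (\<lambda>x. acut chi \<alpha> t x * \<theta> x) (fmult (bcut F b t) h)"
    unfolding ip_def by (simp add: acut_cnj[OF chi] mult_ac)
  also have "\<dots> = ip lebesgue (fmult (\<lambda>\<xi>. cnj (bcut F b t \<xi>)) (\<lambda>x. acut chi \<alpha> t x * \<theta> x)) h"
    by (rule ip_fmult_adjoint[OF bcut_measurable[OF F] bcut_le_1[OF F] h L, symmetric])
  finally show ?thesis by (simp add: bcut_cnj[OF F])
qed

lemma acut_tendsto:
  assumes chi: "cutoff chi" and \<alpha>: "\<alpha> > 0" and \<theta>: "L2 lebesgue \<theta>"
  shows "((\<lambda>t. nm lebesgue (\<lambda>x. \<theta> x - acut chi \<alpha> t x * \<theta> x)) \<longlongrightarrow> 0) at_top"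
  by (rule tendsto_multiplier_one[OF \<theta>])
    (auto intro: lebesgue_measurable_borel acut_measurable acut_le_1 acut_eventually_1 chi \<alpha>)

lemma bcut_tendsto:
  fixes \<theta> :: "real^'n \<Rightarrow> complex"
  assumes F: "cutoff F" and b: "b > 0" and \<theta>: "L2 lebesgue \<theta>"
  shows "((\<lambda>t. nm lebesgue (\<lambda>x. \<theta> x - fmult (bcut F b t) \<theta> x)) \<longlongrightarrow> 0) at_top"
proof -
  let ?h = "fourier_L2 (-1) \<theta>"
  have h: "L2 lebesgue ?h" by (rule L2_fourier_L2[OF \<theta>]) simp
  note B = bcut_measurable[OF F] bcut_le_1[OF F]
  have m': "(\<lambda>\<xi>. 1 - bcut F b t \<xi>) \<in> borel_measurable borel" for t using B(1) by measurable
  have "nm lebesgue (\<lambda>x. \<theta> x - fmult (bcut F b t) \<theta> x) = nm lebesgue (\<lambda>\<xi>. ?h \<xi> - bcut F b t \<xi> * ?h \<xi>)" for t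
  proof -
    have L: "L2 lebesgue (\<lambda>\<xi>. bcut F b t \<xi> * ?h \<xi>)" by (rule L2_bounded_mult[OF B h])
    have "AE x in lebesgue. \<theta> x - fmult (bcut F b t) \<theta> x = fmult (\<lambda>\<xi>. 1 - bcut F b t \<xi>) \<theta> x"
    proof (rule L2_eqI)
      fix g :: "real^'n \<Rightarrow> complex" assume g: "L2 lebesgue g"
      have g': "L2 lebesgue (fourier_L2 (-1) g)" by (rule L2_fourier_L2[OF g]) simp
      have "ip lebesgue g (\<lambda>x. \<theta> x - fmult (bcut F b t) \<theta> x) = ip lebesgue (fourier_L2 (-1) g) ?h - ip lebesgue (fourier_L2 (-1) g) (\<lambda>\<xi>. bcut F b t \<xi> * ?h \<xi>)"
        unfolding ip_diff_right[OF g \<theta> L2_fmult[OF B \<theta>]] ip_fmult[OF B \<theta> g] by (simp add: ip_fourier_L2 g \<theta>)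
      also have "\<dots> = ip lebesgue (fourier_L2 (-1) g) (\<lambda>\<xi>. (1 - bcut F b t \<xi>) * ?h \<xi>)"
        unfolding ip_diff_right[OF g' h L, symmetric] by (simp add: left_diff_distrib)
      also have "\<dots> = ip lebesgue g (fmult (\<lambda>\<xi>. 1 - bcut F b t \<xi>) \<theta>)" by (rule ip_fmult[OF m' bcut_compl_le_1[OF F] \<theta> g, symmetric])
      finally show "ip lebesgue g (\<lambda>x. \<theta> x - fmult (bcut F b t) \<theta> x) = ip lebesgue g (fmult (\<lambda>\<xi>. 1 - bcut F b t \<xi>) \<theta>)" .
    qed (intro L2_diff \<theta> L2_fmult B m' bcut_compl_le_1[OF F])+
    then have "nm lebesgue (\<lambda>x. \<theta> x - fmult (bcut F b t) \<theta> x) = nm lebesgue (fmult (\<lambda>\<xi>. 1 - bcut F b t \<xi>) \<theta>)"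
      by (rule nm_cong_AE) (intro L2_measurable L2_diff \<theta> L2_fmult B m' bcut_compl_le_1[OF F])+
    also have "\<dots> = nm lebesgue (\<lambda>\<xi>. (1 - bcut F b t \<xi>) * ?h \<xi>)"
      unfolding fmult_def by (intro nm_fourier_L2 L2_bounded_mult m' bcut_compl_le_1[OF F] h) simp
    finally show ?thesis by (simp add: left_diff_distrib)
  qed
  moreover have "((\<lambda>t. nm lebesgue (\<lambda>\<xi>. ?h \<xi> - bcut F b t \<xi> * ?h \<xi>)) \<longlongrightarrow> 0) at_top"
  proof (rule tendsto_multiplier_one[OF h])
    \<comment> \<open>At \<xi> = 0 the multiplier is F 0 = 0 for every t, so this null set has to be
      excluded.\<close>
    have "AE \<xi> in lborel. (\<xi>::real^'n) \<noteq> 0" by (rule AE_lborel_singleton)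
    then have "AE \<xi> in lebesgue. (\<xi>::real^'n) \<noteq> 0" by (simp only: AE_completion_iff)
    then show "AE \<xi> in lebesgue. \<forall>\<^sub>F t in at_top. bcut F b t (\<xi>::real^'n) = 1"
      by eventually_elim (rule bcut_eventually_1[OF F b])
  qed (auto intro: lebesgue_measurable_borel B)
  ultimately show ?thesis by simp
qed

lemma ab_cut_tendsto:
  assumes chi: "cutoff chi" and F: "cutoff F" and \<alpha>: "\<alpha> > 0" and b: "b > 0" and \<theta>: "L2 lebesgue \<theta>"
  shows acut_bcut_tendsto: "((\<lambda>t. nm lebesgue (\<lambda>x. \<theta> x - acut chi \<alpha> t x * fmult (bcut F b t) \<theta> x)) \<longlongrightarrow> 0) at_top"
    and bcut_acut_tendsto: "((\<lambda>t. nm lebesgue (\<lambda>x. \<theta> x - fmult (bcut F b t) (\<lambda>x. acut chi \<alpha> t x * \<theta> x) x)) \<longlongrightarrow> 0) at_top"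
proof -
  note A = acut_measurable[OF chi] acut_le_1[OF chi] and B = bcut_measurable[OF F] bcut_le_1[OF F]
  note a\<theta> = L2_bounded_mult[OF A \<theta>] and b\<theta> = L2_fmult[OF B \<theta>]
  have lim: "((\<lambda>t. nm lebesgue (\<lambda>x. \<theta> x - acut chi \<alpha> t x * \<theta> x) + nm lebesgue (\<lambda>x. \<theta> x - fmult (bcut F b t) \<theta> x)) \<longlongrightarrow> 0) at_top"
    using tendsto_add[OF acut_tendsto[OF chi \<alpha> \<theta>] bcut_tendsto[OF F b \<theta>]] by simp
  have 1: "nm lebesgue (\<lambda>x. \<theta> x - acut chi \<alpha> t x * fmult (bcut F b t) \<theta> x) \<le> nm lebesgue (\<lambda>x. \<theta> x - acut chi \<alpha> t x * \<theta> x) + nm lebesgue (\<lambda>x. \<theta> x - fmult (bcut F b t) \<theta> x)" for t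
  proof -
    have "nm lebesgue (\<lambda>x. \<theta> x - acut chi \<alpha> t x * fmult (bcut F b t) \<theta> x) \<le> nm lebesgue (\<lambda>x. \<theta> x - acut chi \<alpha> t x * \<theta> x) + nm lebesgue (\<lambda>x. acut chi \<alpha> t x * \<theta> x - acut chi \<alpha> t x * fmult (bcut F b t) \<theta> x)"
      by (intro nm_triangle_diff \<theta> a\<theta> L2_bounded_mult A b\<theta>)
    also have "nm lebesgue (\<lambda>x. acut chi \<alpha> t x * \<theta> x - acut chi \<alpha> t x * fmult (bcut F b t) \<theta> x) \<le> 1 * nm lebesgue (\<lambda>x. \<theta> x - fmult (bcut F b t) \<theta> x)"
      unfolding right_diff_distrib[symmetric]
      by (intro nm_bound L2_diff \<theta> b\<theta> AE_I2 cmod_mult_le_one A L2_measurable[OF L2_bounded_mult[OF A L2_diff[OF \<theta> b\<theta>]]]) simp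
    finally show ?thesis by simp
  qed
  show "((\<lambda>t. nm lebesgue (\<lambda>x. \<theta> x - acut chi \<alpha> t x * fmult (bcut F b t) \<theta> x)) \<longlongrightarrow> 0) at_top"
    by (rule tendsto_sandwich[OF _ _ tendsto_const lim]) (use 1 in auto)
  have 2: "nm lebesgue (\<lambda>x. \<theta> x - fmult (bcut F b t) (\<lambda>x. acut chi \<alpha> t x * \<theta> x) x) \<le> nm lebesgue (\<lambda>x. \<theta> x - acut chi \<alpha> t x * \<theta> x) + nm lebesgue (\<lambda>x. \<theta> x - fmult (bcut F b t) \<theta> x)" for t
  proof -
    have "nm lebesgue (\<lambda>x. \<theta> x - fmult (bcut F b t) (\<lambda>x. acut chi \<alpha> t x * \<theta> x) x) \<le> nm lebesgue (\<lambda>x. \<theta> x - fmult (bcut F b t) \<theta> x) + nm lebesgue (\<lambda>x. fmult (bcut F b t) \<theta> x - fmult (bcut F b t) (\<lambda>x. acut chi \<alpha> t x * \<theta> x) x)"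
      by (intro nm_triangle_diff \<theta> b\<theta> L2_fmult B a\<theta>)
    also have "nm lebesgue (\<lambda>x. fmult (bcut F b t) \<theta> x - fmult (bcut F b t) (\<lambda>x. acut chi \<alpha> t x * \<theta> x) x) = nm lebesgue (fmult (bcut F b t) (\<lambda>x. \<theta> x - acut chi \<alpha> t x * \<theta> x))"
      by (intro nm_cong_AE AE_symmetric[OF fmult_diff[OF B \<theta> a\<theta>]] L2_measurable L2_diff L2_fmult B \<theta> a\<theta>)
    also have "\<dots> \<le> nm lebesgue (\<lambda>x. \<theta> x - acut chi \<alpha> t x * \<theta> x)" by (intro nm_fmult_le B L2_diff \<theta> a\<theta>)
    finally show ?thesis by simp
  qed
  show "((\<lambda>t. nm lebesgue (\<lambda>x. \<theta> x - fmult (bcut F b t) (\<lambda>x. acut chi \<alpha> t x * \<theta> x) x)) \<longlongrightarrow> 0) at_top"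
    by (rule tendsto_sandwich[OF _ _ tendsto_const lim]) (use 2 in auto)
qed

lemma PS_pred_sets:
  fixes P :: "(real^'n) \<times> (real^'n) \<Rightarrow> bool"
  assumes "P \<in> measurable PS (count_space UNIV)" shows "{z. P z} \<in> sets PS"
  using predE[OF assms] by (simp add: space_pair_measure)

lemma half_powr:
  fixes x \<delta> :: real
  assumes "x \<ge> 0"
  shows "(x / 2) powr (1 - \<delta>) = x powr (1 - \<delta>) * (2 powr \<delta> / 2)"
    and "(x / 2) powr (- \<delta>) = x powr (- \<delta>) * 2 powr \<delta>"
proof -
  have "(2::real) powr (1 - \<delta>) = 2 / 2 powr \<delta>" by (simp add: powr_diff)
  then show "(x / 2) powr (1 - \<delta>) = x powr (1 - \<delta>) * (2 powr \<delta> / 2)"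
    using assms by (simp add: powr_divide)
  show "(x / 2) powr (- \<delta>) = x powr (- \<delta>) * 2 powr \<delta>"
    using assms powr_minus_divide[of 2 \<delta>] by (simp add: powr_divide)
qed

section \<open>The weak limit and the channel wave operator\<close>

context scattering
begin

definition weak_limit :: "(real^'n \<Rightarrow> complex) \<Rightarrow> bool" where
  "weak_limit Q \<longleftrightarrow> L2 lebesgue Q \<and> (\<forall>\<theta>. L2 lebesgue \<theta> \<longrightarrow> ((\<lambda>t. ip lebesgue \<theta> (\<Phi> t)) \<longlongrightarrow> ip lebesgue \<theta> Q) at_top)"

lemma weak_limit_nm:
  assumes "weak_limit Q" shows "nm lebesgue Q \<le> M"
proof -
  have Q: "L2 lebesgue Q" and l: "((\<lambda>t. ip lebesgue Q (\<Phi> t)) \<longlongrightarrow> ip lebesgue Q Q) at_top"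
    using assms by (auto simp: weak_limit_def)
  have "cmod (ip lebesgue Q Q) \<le> nm lebesgue Q * M"
  proof (rule tendsto_upperbound[OF tendsto_norm[OF l] always_eventually[OF allI]])
    fix t show "cmod (ip lebesgue Q (\<Phi> t)) \<le> nm lebesgue Q * M"
      by (rule order_trans[OF Cauchy_Schwarz_L2[OF Q L2_\<Phi>] mult_left_mono[OF nm_\<Phi>_le]]) simp
  qed simp
  then have "(nm lebesgue Q)\<^sup>2 \<le> nm lebesgue Q * M" by (simp add: ip_self norm_power)
  then show ?thesis by (rule le_of_sq_le_mult[OF _ M_nonneg nm_nonneg])
qed

lemma weak_limit_exists:
  assumes cauchy: "\<And>\<theta> e. L2 lebesgue \<theta> \<Longrightarrow> e > 0 \<Longrightarrow> \<exists>t0. \<forall>t\<ge>t0. \<forall>T\<ge>t. cmod (ip lebesgue \<theta> (\<lambda>x. \<Phi> T x - \<Phi> t x)) < e"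
  shows "\<exists>Q. weak_limit Q"
proof -
  have diff: "ip lebesgue \<theta> (\<lambda>x. \<Phi> T x - \<Phi> t x) = ip lebesgue \<theta> (\<Phi> T) - ip lebesgue \<theta> (\<Phi> t)" if "L2 lebesgue \<theta>" for \<theta> t T
    by (rule ip_diff_right[OF that L2_\<Phi> L2_\<Phi>])
  have conv: "convergent (\<lambda>n. ip lebesgue \<theta> (\<Phi> (real n)))" if \<theta>: "L2 lebesgue \<theta>" for \<theta>
  proof (rule Cauchy_convergent, rule metric_CauchyI)
    fix e :: real assume e: "0 < e"
    obtain t0 where "\<forall>t\<ge>t0. \<forall>T\<ge>t. cmod (ip lebesgue \<theta> (\<Phi> T) - ip lebesgue \<theta> (\<Phi> t)) < e"
      using cauchy[OF \<theta> e] unfolding diff[OF \<theta>] by blast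
    then have t0: "\<And>t T. t \<ge> t0 \<Longrightarrow> T \<ge> t \<Longrightarrow> cmod (ip lebesgue \<theta> (\<Phi> T) - ip lebesgue \<theta> (\<Phi> t)) < e" by blast
    have "dist (ip lebesgue \<theta> (\<Phi> (real m))) (ip lebesgue \<theta> (\<Phi> (real n))) < e" if "m \<ge> nat \<lceil>t0\<rceil>" "n \<ge> nat \<lceil>t0\<rceil>" for m n
    proof -
      have "real m \<ge> t0" "real n \<ge> t0" using that by linarith+
      then show ?thesis using t0[of "real m" "real n"] t0[of "real n" "real m"]
        by (cases "m \<le> n") (auto simp: dist_norm norm_minus_commute)
    qed
    then show "\<exists>N. \<forall>m\<ge>N. \<forall>n\<ge>N. dist (ip lebesgue \<theta> (\<Phi> (real m))) (ip lebesgue \<theta> (\<Phi> (real n))) < e" by blast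
  qed
  \<comment> \<open>Conjugated so that the limit functional is linear in its argument, as the Riesz
    theorem requires.\<close>
  define l where "l \<theta> = cnj (lim (\<lambda>n. ip lebesgue \<theta> (\<Phi> (real n))))" for \<theta>
  have lim: "(\<lambda>n. ip lebesgue (\<Phi> (real n)) \<theta>) \<longlonglongrightarrow> l \<theta>" if "L2 lebesgue \<theta>" for \<theta>
    using tendsto_cnj[OF conv[OF that, unfolded convergent_LIMSEQ_iff]] unfolding l_def by (simp only: ip_cnj)
  have "\<exists>q. L2 lebesgue q \<and> (\<forall>f. L2 lebesgue f \<longrightarrow> l f = ip lebesgue q f)"
  proof (rule L2_Riesz)
    fix f g :: "real^'n \<Rightarrow> complex" assume f: "L2 lebesgue f" and g: "L2 lebesgue g"
    show "l (\<lambda>x. f x + g x) = l f + l g"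
      by (rule LIMSEQ_unique[OF lim[OF L2_add[OF f g]]]) (use tendsto_add[OF lim[OF f] lim[OF g]] in \<open>simp add: ip_add_right L2_\<Phi> f g\<close>)
  next
    fix f :: "real^'n \<Rightarrow> complex" and c assume f: "L2 lebesgue f"
    show "l (\<lambda>x. c * f x) = c * l f"
      by (rule LIMSEQ_unique[OF lim[OF L2_scale[OF f]]]) (use tendsto_mult[OF tendsto_const lim[OF f], of c] in \<open>simp add: ip_scale_right\<close>)
    show "cmod (l f) \<le> M * nm lebesgue f"
    proof (rule LIMSEQ_le_const2[OF tendsto_norm[OF lim[OF f]]], intro exI allI impI)
      fix n show "cmod (ip lebesgue (\<Phi> (real n)) f) \<le> M * nm lebesgue f"
        by (rule order_trans[OF Cauchy_Schwarz_L2[OF L2_\<Phi> f] mult_right_mono[OF nm_\<Phi>_le]]) simp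
    qed
  qed
  then obtain Q where Q: "L2 lebesgue Q" and lQ: "\<And>f. L2 lebesgue f \<Longrightarrow> l f = ip lebesgue Q f" by blast
  have "((\<lambda>t. ip lebesgue \<theta> (\<Phi> t)) \<longlongrightarrow> ip lebesgue \<theta> Q) at_top" if \<theta>: "L2 lebesgue \<theta>" for \<theta>
  proof (rule tendstoI)
    fix e :: real assume e: "e > 0"
    have e2: "e / 2 > 0" using e by simp
    obtain t0 where "\<forall>t\<ge>t0. \<forall>T\<ge>t. cmod (ip lebesgue \<theta> (\<Phi> T) - ip lebesgue \<theta> (\<Phi> t)) < e/2"
      using cauchy[OF \<theta> e2] unfolding diff[OF \<theta>] by blast
    then have t0: "\<And>t T. t \<ge> t0 \<Longrightarrow> T \<ge> t \<Longrightarrow> cmod (ip lebesgue \<theta> (\<Phi> T) - ip lebesgue \<theta> (\<Phi> t)) < e/2" by blast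
    have "(\<lambda>n. ip lebesgue \<theta> (\<Phi> (real n))) \<longlonglongrightarrow> ip lebesgue \<theta> Q"
      using tendsto_cnj[OF lim[OF \<theta>]] unfolding lQ[OF \<theta>] by (simp only: ip_cnj)
    from metric_LIMSEQ_D[OF this, of "e/2"] e obtain n0 where n0: "\<And>n. n \<ge> n0 \<Longrightarrow> dist (ip lebesgue \<theta> (\<Phi> (real n))) (ip lebesgue \<theta> Q) < e/2" by auto
    define n where "n = max n0 (nat \<lceil>t0\<rceil>)"
    have n: "n \<ge> n0" "real n \<ge> t0" unfolding n_def by linarith+
    show "\<forall>\<^sub>F t in at_top. dist (ip lebesgue \<theta> (\<Phi> t)) (ip lebesgue \<theta> Q) < e"
      using eventually_ge_at_top[of "real n"]
    proof eventually_elim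
      case (elim t)
      have "dist (ip lebesgue \<theta> (\<Phi> t)) (ip lebesgue \<theta> (\<Phi> (real n))) < e/2" using t0[OF n(2) elim] by (simp add: dist_norm)
      then show ?case using n0[OF n(1)] dist_triangle[of "ip lebesgue \<theta> (\<Phi> t)" "ip lebesgue \<theta> Q" "ip lebesgue \<theta> (\<Phi> (real n))"] by linarith
    qed
  qed
  with Q show ?thesis unfolding weak_limit_def by blast
qed

lemma weak_limit_ip_le:
  assumes Q: "weak_limit Q" and v: "L2 lebesgue v"
    and B: "\<And>T. T \<ge> t \<Longrightarrow> cmod (ip lebesgue v (\<lambda>x. \<Phi> T x - \<Phi> t x)) \<le> B"
  shows "cmod (ip lebesgue v (\<lambda>x. Q x - \<Phi> t x)) \<le> B"
proof -
  have LQ: "L2 lebesgue Q" using Q by (simp add: weak_limit_def)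
  have l: "((\<lambda>T. ip lebesgue v (\<Phi> T) - ip lebesgue v (\<Phi> t)) \<longlongrightarrow> ip lebesgue v Q - ip lebesgue v (\<Phi> t)) at_top"
    using Q v by (intro tendsto_diff tendsto_const) (auto simp: weak_limit_def)
  have "cmod (ip lebesgue v Q - ip lebesgue v (\<Phi> t)) \<le> B"
  proof (rule tendsto_upperbound[OF tendsto_norm[OF l]])
    show "\<forall>\<^sub>F T in at_top. cmod (ip lebesgue v (\<Phi> T) - ip lebesgue v (\<Phi> t)) \<le> B"
      using eventually_ge_at_top[of t] by eventually_elim (use B in \<open>simp add: ip_diff_right[OF v L2_\<Phi> L2_\<Phi>]\<close>)
  qed simp
  then show ?thesis by (simp add: ip_diff_right[OF v LQ L2_\<Phi>])
qed

text \<open>Weak lower semicontinuity of \<open>pnm\<close>, again through its dual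
  characterisation.\<close>

lemma pnm_weak_limit:
  assumes Q: "weak_limit Q" and \<sigma>: "\<sigma> > 0" and S: "S \<in> sets PS"
    and B: "\<And>T. T \<ge> t \<Longrightarrow> pnm K \<sigma> S (schr r (\<lambda>x. \<Phi> T x - \<Phi> t x)) \<le> B"
  shows "pnm K \<sigma> S (schr r (\<lambda>x. Q x - \<Phi> t x)) \<le> B"
proof -
  have LQ: "L2 lebesgue Q" using Q by (simp add: weak_limit_def)
  note d = L2_diff[OF L2_\<Phi> L2_\<Phi>] L2_diff[OF LQ L2_\<Phi>]
  show ?thesis
  proof (rule pnm_dual[OF \<sigma> L2_schr[OF d(2)] S])
    show "0 \<le> B" using B[OF order_refl] pnm_nonneg order_trans by blast
    fix q :: "real^'n \<Rightarrow> complex" and k :: real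
    assume q: "L2 lebesgue q" and k: "k \<ge> 0" and qk: "\<And>f. L2 lebesgue f \<Longrightarrow> cmod (ip lebesgue q f) \<le> k * pnm K \<sigma> S f"
    have m: "ip lebesgue q (schr r f) = ip lebesgue (schr (- r) q) f" if "L2 lebesgue f" for f
      using ip_schr[OF that q, of "-r"] by simp
    show "cmod (ip lebesgue q (schr r (\<lambda>x. Q x - \<Phi> t x))) \<le> k * B"
      unfolding m[OF d(2)]
    proof (rule weak_limit_ip_le[OF Q L2_schr[OF q]])
      fix T assume T: "T \<ge> t"
      show "cmod (ip lebesgue (schr (- r) q) (\<lambda>x. \<Phi> T x - \<Phi> t x)) \<le> k * B"
        unfolding m[OF d(1), symmetric] by (rule order_trans[OF qk[OF L2_schr[OF d(1)]] mult_left_mono[OF B[OF T] k]])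
    qed
  qed
qed

text \<open>The error depends on t alone, which permits T to tend to infinity afterwards. It
  consists of the source emitted after t and of the commutators of the two cutoffs with the phase
  space localisation.\<close>

lemma channel_Cauchy:
  assumes chi: "cutoff chi" and F: "cutoff F" and b: "0 < b" "b < \<alpha>" "\<alpha> < 1 - b" and b\<delta>: "b * \<delta> < \<delta> - 1"
  shows "\<exists>\<epsilon>. (\<epsilon> \<longlongrightarrow> 0) at_top \<and>
    (\<forall>\<^sub>F t in at_top. \<forall>T\<ge>t. nm lebesgue (\<lambda>x. acut chi \<alpha> t x * fmult (bcut F b t) (\<lambda>x. \<Phi> T x - \<Phi> t x) x) \<le> \<epsilon> t)"
proof -
  \<comment> \<open>The packet width t powr \<beta> must be small against the position cutoff t powr
    \<alpha>, and its frequency width t powr (- \<beta>) small against the momentum cutoff t powr (-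
    b). The radius t powr \<beta>' lies between packet width and cutoff scale and separates the core
    of the packet from its tail. The choice of \<rho> makes \<sigma> powr \<rho> equal to t powr
    \<alpha>.\<close>
  define \<beta> where "\<beta> = (b + \<alpha>) / 2"
  define \<beta>' where "\<beta>' = (\<beta> + \<alpha>) / 2"
  have \<beta>: "b < \<beta>" "\<beta> < \<beta>'" "\<beta>' < \<alpha>" "0 < \<beta>" using b by (auto simp: \<beta>_def \<beta>'_def)
  define \<rho> where "\<rho> = \<alpha> / \<beta>"
  have \<rho>: "\<rho> > 1" using \<beta> by (simp add: \<rho>_def)
  obtain L1 where L1: "L1 \<ge> 0" "\<And>x y. \<bar>chi x - chi y\<bar> \<le> L1 * \<bar>x - y\<bar>" using cutoff_Lipschitz[OF chi] by blast
  obtain L2' where L2': "L2' \<ge> 0" "\<And>x y. \<bar>F x - F y\<bar> \<le> L2' * \<bar>x - y\<bar>" using cutoff_Lipschitz[OF F] by blast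
  obtain K K0 c0 where K: "K \<ge> 1" and K0: "K0 \<ge> 0" and c0: "c0 > 0"
    and src: "\<And>\<sigma> \<tau> D S s. \<sigma> \<ge> 1 \<Longrightarrow> c0 * \<sigma> powr \<rho> \<le> D \<Longrightarrow> c0 * \<bar>\<tau>\<bar> \<le> D * \<sigma> \<Longrightarrow> S \<in> sets PS \<Longrightarrow>
      (\<And>x \<xi>. (x, \<xi>) \<in> S \<Longrightarrow> D \<le> norm (x + (2 * \<tau>) *\<^sub>R \<xi>)) \<Longrightarrow> pnm K \<sigma> S (schr (- \<tau>) (W s)) \<le> K0 * D powr (- \<delta>)"
    using pnm_source_decay[OF \<rho>] by blast
  obtain Ct where Ct: "Ct \<ge> 0" "\<And>\<sigma> s D::real. \<sigma> > 0 \<Longrightarrow> D > 0 \<Longrightarrow> 4 * real CARD('n) * \<bar>s\<bar> \<le> D * \<sigma> \<Longrightarrow>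
    (\<integral>\<^sup>+z. indicator {z. D \<le> norm z} z * ennreal ((cmod (packet K \<sigma> s (z::real^'n)))\<^sup>2) \<partial>lborel)
      \<le> ennreal (Ct * (\<sigma> / D) ^ (2 * K - 1) * wmass K \<sigma> ^ CARD('n))"
    using packet_tail[OF K, where 'n='n] by blast
  let ?n = "real CARD('n)"
  \<comment> \<open>This is A powr (1 - \<delta>) / ((\<delta> - 1) k) for A = t powr (1 - b) / 2
    and k = t powr (- b) / 2. The exponent equals 1 - \<delta> + b \<delta>, negative by the
    assumption on b \<delta>.\<close>
  define \<epsilon>1 where "\<epsilon>1 t = K0 * (2 powr \<delta> / (\<delta> - 1)) * t powr ((1 - b) * (1 - \<delta>) + b)" for t :: real
  define err where "err t = sqrt ((L1 * t powr (\<beta>' - \<alpha>))\<^sup>2 + 4 * (Ct * (1 * t powr (\<beta> - \<beta>')) ^ (2 * K - 1))) + L2' * ?n * t powr (b - \<beta>)" for t :: real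
  have "((\<lambda>t. (\<epsilon>1 t) + err t * (2 * M)) \<longlongrightarrow> 0 + (sqrt (0\<^sup>2 + 4 * (Ct * 0 ^ (2 * K - 1))) + 0) * (2 * M)) at_top"
    unfolding \<epsilon>1_def err_def using \<beta> b\<delta>
    by (intro tendsto_intros tendsto_powr_0) (auto simp: algebra_simps)
  also have "0 + (sqrt (0\<^sup>2 + 4 * (Ct * 0 ^ (2 * K - 1))) + 0) * (2 * M) = 0" using K by (simp add: power_0_left)
  finally have lim: "((\<lambda>t. \<epsilon>1 t + err t * (2 * M)) \<longlongrightarrow> 0) at_top" .
  \<comment> \<open>In turn: the distance beats the scale \<sigma> powr \<rho> in the source
    estimate, the initial position is small against the distance travelled, and the spreading s /
    \<sigma> of the packet is small against it too.\<close>
  have e1: "\<forall>\<^sub>F t::real in at_top. 2 * c0 * t powr \<alpha> \<le> t powr (1 - b)" by (rule eventually_powr_le) (use b in simp)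
  have e2: "\<forall>\<^sub>F t::real in at_top. 2 * t powr \<alpha> \<le> t powr (1 - b)" by (rule eventually_powr_le) (use b in simp)
  have e3: "\<forall>\<^sub>F t::real in at_top. 2 * c0 * t powr b \<le> t powr \<beta>" by (rule eventually_powr_le) (use \<beta> in simp)
  have "\<forall>\<^sub>F t in at_top. \<forall>T\<ge>t. nm lebesgue (\<lambda>x. acut chi \<alpha> t x * fmult (bcut F b t) (\<lambda>x. \<Phi> T x - \<Phi> t x) x) \<le> \<epsilon>1 t + err t * (2 * M)"
    using e1 e2 e3 eventually_ge_at_top[of 1]
  proof (eventually_elim, intro allI impI)
    fix t T :: real
    assume c1: "2 * c0 * t powr \<alpha> \<le> t powr (1 - b)" and c2: "2 * t powr \<alpha> \<le> t powr (1 - b)"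
      and c3: "2 * c0 * t powr b \<le> t powr \<beta>" and t: "1 \<le> t" and T: "t \<le> T"
    define \<sigma> where "\<sigma> = t powr \<beta>"
    define D' where "D' = t powr \<beta>'"
    define A where "A = t powr (1 - b) / 2"
    define k where "k = t powr (- b) / 2"
    have \<sigma>1: "\<sigma> \<ge> 1" using t \<beta> by (simp add: \<sigma>_def ge_one_powr_ge_zero)
    have pos: "\<sigma> > 0" "D' > 0" "A > 0" "k > 0" using t by (auto simp: \<sigma>_def D'_def A_def k_def)
    have \<sigma>\<rho>: "\<sigma> powr \<rho> = t powr \<alpha>" using \<beta> by (simp add: \<sigma>_def \<rho>_def powr_powr)
    \<comment> \<open>Hence A + k (s - t) = k s: the distance at time s takes the affine form that
      the integral bound expects.\<close>
    have Ak: "A = k * t" using t by (simp add: A_def k_def powr_diff powr_minus field_simps)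
    let ?S = "{z::(real^'n) \<times> (real^'n). norm (fst z) \<le> t powr \<alpha> \<and> t powr (- b) / 2 \<le> norm (snd z)}"
    have S: "?S \<in> sets PS" by (rule PS_pred_sets) measurable
    let ?h = "\<lambda>x. \<Phi> T x - \<Phi> t x"
    have h: "L2 lebesgue ?h" by (intro L2_diff L2_\<Phi>)
    have nh: "nm lebesgue ?h \<le> 2 * M" using nm_diff_le[OF L2_\<Phi> L2_\<Phi>, of T t] nm_\<Phi>_le[of T] nm_\<Phi>_le[of t] by linarith
    obtain I where I: "((\<lambda>s. (A + k * (s - t)) powr (- \<delta>)) has_integral I) {t..T}" "I \<le> A powr (1 - \<delta>) / ((\<delta> - 1) * k)"
      using integral_affine_powr[OF pos(3,4) \<delta> T] by blast
    have "pnm K \<sigma> ?S (schr 0 ?h) \<le> K0 * I"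
    proof (rule pnm_\<Phi>_diff[OF pos(1) S _ T _ has_integral_mult_right[OF I(1)]])
      show "0 \<le> t" using t by simp
      fix s assume s: "s \<in> {t..T}"
      define D where "D = A + k * (s - t)"
      have Ds: "D = k * s" by (simp add: D_def Ak algebra_simps)
      have s0: "0 < s" using s t by simp
      have AD: "A \<le> D" using pos(4) s by (simp add: D_def)
      have "pnm K \<sigma> ?S (schr (- s) (W s)) \<le> K0 * D powr (- \<delta>)"
      proof (rule src[OF \<sigma>1 _ _ S])
        show "c0 * \<sigma> powr \<rho> \<le> D" using AD c1 by (simp add: \<sigma>\<rho> A_def)
        have "c0 * s = (c0 * t powr b) * (t powr (- b) * s)" using t by (simp add: powr_minus)
        also have "\<dots> \<le> (t powr \<beta> / 2) * (t powr (- b) * s)" using c3 s0 by (intro mult_right_mono) auto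
        also have "\<dots> = D * \<sigma>" by (simp add: Ds k_def \<sigma>_def)
        finally show "c0 * \<bar>s\<bar> \<le> D * \<sigma>" using s0 by simp
        fix x \<xi> :: "real^'n" assume "(x, \<xi>) \<in> ?S"
        then have x: "norm x \<le> A" and \<xi>: "k \<le> norm \<xi>" using c2 by (auto simp: A_def k_def)
        \<comment> \<open>The packet has travelled at least 2 D from a point of norm at most A \<le>
          D.\<close>
        have "norm ((2 * s) *\<^sub>R \<xi>) = 2 * s * norm \<xi>" using s0 by simp
        also have "\<dots> \<ge> 2 * s * k" using \<xi> s0 by (intro mult_left_mono) auto
        finally have "2 * D \<le> norm ((2 * s) *\<^sub>R \<xi>)" by (simp add: Ds mult_ac)
        then show "D \<le> norm (x + (2 * s) *\<^sub>R \<xi>)"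
          using norm_triangle_ineq4[of "x + (2 * s) *\<^sub>R \<xi>" x] x AD by simp
      qed
      then show "pnm K \<sigma> ?S (schr (0 - s) (W s)) \<le> K0 * (A + k * (s - t)) powr (- \<delta>)" by (simp add: D_def)
    qed
    also have "K0 * I \<le> K0 * (A powr (1 - \<delta>) / ((\<delta> - 1) * k))" by (rule mult_left_mono[OF I(2) K0])
    also have "A powr (1 - \<delta>) / ((\<delta> - 1) * k) = (2 powr \<delta> / (\<delta> - 1)) * t powr ((1 - b) * (1 - \<delta>) + b)"
    proof -
      have 1: "A powr (1 - \<delta>) = t powr ((1 - b) * (1 - \<delta>)) * (2 powr \<delta> / 2)"
        unfolding A_def half_powr(1)[OF powr_ge_zero] powr_powr ..
      have 2: "1 / k = 2 * t powr b" by (simp add: k_def powr_minus_divide)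
      have "A powr (1 - \<delta>) / ((\<delta> - 1) * k) = A powr (1 - \<delta>) * (1 / k) / (\<delta> - 1)" by simp
      also have "\<dots> = (2 powr \<delta> / (\<delta> - 1)) * (t powr ((1 - b) * (1 - \<delta>)) * t powr b)"
        unfolding 1 2 by simp
      finally show ?thesis unfolding powr_add .
    qed
    finally have pS: "pnm K \<sigma> ?S (schr 0 ?h) \<le> \<epsilon>1 t" by (simp add: \<epsilon>1_def mult.assoc)
    have "pnm K \<sigma> ?S ?h = pnm K \<sigma> ?S (schr 0 ?h)"
      by (intro pnm_cong_AE AE_symmetric[OF schr_0[OF h]] h L2_schr)
    then have pS': "pnm K \<sigma> ?S ?h \<le> \<epsilon>1 t" using pS by simp
    have tail: "(\<integral>\<^sup>+z. indicator {z. D' \<le> norm z} z * ennreal ((cmod (packet K \<sigma> 0 (z::real^'n)))\<^sup>2) \<partial>lborel)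
      \<le> ennreal (Ct * (\<sigma> / D') ^ (2 * K - 1) * wmass K \<sigma> ^ CARD('n))"
      by (rule Ct(2)) (use pos in auto)
    have t0: "t > 0" using t by simp
    have "nm lebesgue (\<lambda>x. acut chi \<alpha> t x * fmult (bcut F b t) ?h x) \<le> pnm K \<sigma> ?S ?h
       + (sqrt ((L1 * t powr (- \<alpha>) * D')\<^sup>2 + 4 * (Ct * (\<sigma> / D') ^ (2 * K - 1))) + L2' * t powr b * CARD('n) / \<sigma>) * nm lebesgue ?h"
    proof (rule cutoff_product_bound[OF pos(1) h acut_measurable[OF chi] acut_le_1[OF chi] acut_Lipschitz[OF L1(2,1) t0] _
          bcut_measurable[OF F] bcut_le_1[OF F] bcut_Lipschitz[OF L2'(2,1)] _ S _ _ tail])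
      show "(x, \<xi>) \<in> ?S" if "acut chi \<alpha> t x * bcut F b t \<xi> \<noteq> 0" for x \<xi>
        using that acut_support[OF chi t0, of \<alpha> x] bcut_support[OF F t0, of b \<xi>] by auto
    qed (use L1 L2' Ct(1) pos in auto)
    also have "sqrt ((L1 * t powr (- \<alpha>) * D')\<^sup>2 + 4 * (Ct * (\<sigma> / D') ^ (2 * K - 1))) + L2' * t powr b * CARD('n) / \<sigma> = err t"
    proof -
      have "L1 * t powr (- \<alpha>) * D' = L1 * t powr (\<beta>' - \<alpha>)" using t by (simp add: D'_def powr_diff powr_minus field_simps)
      moreover have "\<sigma> / D' = 1 * t powr (\<beta> - \<beta>')" using t by (simp add: D'_def \<sigma>_def powr_diff)
      moreover have "L2' * t powr b * CARD('n) / \<sigma> = L2' * ?n * t powr (b - \<beta>)" using t by (simp add: \<sigma>_def powr_diff)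
      ultimately show ?thesis unfolding err_def by (simp only:)
    qed
    also have "pnm K \<sigma> ?S ?h + err t * nm lebesgue ?h \<le> \<epsilon>1 t + err t * (2 * M)"
    proof (intro add_mono pS' mult_left_mono nh)
      show "0 \<le> err t" unfolding err_def using L2'(1) Ct(1) by (intro add_nonneg_nonneg mult_nonneg_nonneg) auto
    qed
    finally show "nm lebesgue (\<lambda>x. acut chi \<alpha> t x * fmult (bcut F b t) ?h x) \<le> \<epsilon>1 t + err t * (2 * M)" .
  qed
  with lim show ?thesis by blast
qed

text \<open>Weak convergence: a test function is close to its image under the adjoint cutoffs, and
  moving these onto \<Phi> T - \<Phi> t makes the uniform bound available. Strong convergence: that
  bound passes to Q - \<Phi> t, while the cutoffs applied to the fixed function Q tend to Q.\<close>

lemma channel_wave_operator: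
  assumes chi: "cutoff chi" and F: "cutoff F" and b: "0 < b" "b < \<alpha>" "\<alpha> < 1 - b" and b\<delta>: "b * \<delta> < \<delta> - 1"
  shows "\<exists>Q. weak_limit Q \<and> ((\<lambda>t. nm lebesgue (\<lambda>x. acut chi \<alpha> t x * fmult (bcut F b t) (\<Phi> t) x - Q x)) \<longlongrightarrow> 0) at_top"
proof -
  have \<alpha>: "\<alpha> > 0" using b by simp
  note A = acut_measurable[OF chi] acut_le_1[OF chi] and B = bcut_measurable[OF F] bcut_le_1[OF F]
  have LAB: "L2 lebesgue (\<lambda>x. acut chi \<alpha> t x * fmult (bcut F b t) h x)" if "L2 lebesgue h" for t h
    by (intro L2_bounded_mult A L2_fmult B that)
  have LBA: "L2 lebesgue (fmult (bcut F b t) (\<lambda>x. acut chi \<alpha> t x * h x))" if "L2 lebesgue h" for t h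
    by (intro L2_bounded_mult A L2_fmult B that)
  obtain \<epsilon> where \<epsilon>: "(\<epsilon> \<longlongrightarrow> 0) at_top" and ev:
    "\<forall>\<^sub>F t in at_top. \<forall>T\<ge>t. nm lebesgue (\<lambda>x. acut chi \<alpha> t x * fmult (bcut F b t) (\<lambda>x. \<Phi> T x - \<Phi> t x) x) \<le> \<epsilon> t"
    using channel_Cauchy[OF chi F b b\<delta>] by blast
  have "\<exists>Q. weak_limit Q"
  proof (rule weak_limit_exists)
    fix \<theta> :: "real^'n \<Rightarrow> complex" and e :: real assume \<theta>: "L2 lebesgue \<theta>" and e: "e > 0"
    let ?d = "\<lambda>t. nm lebesgue (\<lambda>x. \<theta> x - fmult (bcut F b t) (\<lambda>x. acut chi \<alpha> t x * \<theta> x) x)"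
    have "((\<lambda>t. ?d t * (2 * M) + nm lebesgue \<theta> * \<epsilon> t) \<longlongrightarrow> 0 * (2 * M) + nm lebesgue \<theta> * 0) at_top"
      by (intro tendsto_intros \<epsilon> bcut_acut_tendsto[OF chi F \<alpha> b(1) \<theta>])
    then have "\<forall>\<^sub>F t in at_top. ?d t * (2 * M) + nm lebesgue \<theta> * \<epsilon> t < e" using e by (intro order_tendstoD(2)) auto
    with ev have "\<forall>\<^sub>F t in at_top. \<forall>T\<ge>t. cmod (ip lebesgue \<theta> (\<lambda>x. \<Phi> T x - \<Phi> t x)) < e"
    proof (eventually_elim, intro allI impI)
      fix t T assume 1: "\<forall>T\<ge>t. nm lebesgue (\<lambda>x. acut chi \<alpha> t x * fmult (bcut F b t) (\<lambda>x. \<Phi> T x - \<Phi> t x) x) \<le> \<epsilon> t"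
        and 2: "?d t * (2 * M) + nm lebesgue \<theta> * \<epsilon> t < e" and T: "t \<le> T"
      let ?h = "\<lambda>x. \<Phi> T x - \<Phi> t x" and ?v = "fmult (bcut F b t) (\<lambda>x. acut chi \<alpha> t x * \<theta> x)"
      have h: "L2 lebesgue ?h" by (intro L2_diff L2_\<Phi>)
      have nh: "nm lebesgue ?h \<le> 2 * M" using nm_diff_le[OF L2_\<Phi> L2_\<Phi>, of T t] nm_\<Phi>_le[of T] nm_\<Phi>_le[of t] by linarith
      have eq: "ip lebesgue \<theta> ?h = ip lebesgue (\<lambda>x. \<theta> x - ?v x) ?h + ip lebesgue \<theta> (\<lambda>x. acut chi \<alpha> t x * fmult (bcut F b t) ?h x)"
        unfolding ip_acut_bcut[OF chi F \<theta> h] by (simp add: ip_diff_left h \<theta> LBA)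
      have 3: "cmod (ip lebesgue (\<lambda>x. \<theta> x - ?v x) ?h) \<le> ?d t * (2 * M)"
        by (rule order_trans[OF Cauchy_Schwarz_L2[OF L2_diff[OF \<theta> LBA[OF \<theta>]] h] mult_left_mono[OF nh nm_nonneg]])
      have 4: "nm lebesgue (\<lambda>x. acut chi \<alpha> t x * fmult (bcut F b t) ?h x) \<le> \<epsilon> t" using 1 T by blast
      have 5: "cmod (ip lebesgue \<theta> (\<lambda>x. acut chi \<alpha> t x * fmult (bcut F b t) ?h x)) \<le> nm lebesgue \<theta> * \<epsilon> t"
        by (rule order_trans[OF Cauchy_Schwarz_L2[OF \<theta> LAB[OF h]] mult_left_mono[OF 4 nm_nonneg]])
      have "cmod (ip lebesgue \<theta> ?h) \<le> ?d t * (2 * M) + nm lebesgue \<theta> * \<epsilon> t"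
        unfolding eq by (rule norm_triangle_le[OF add_mono[OF 3 5]])
      then show "cmod (ip lebesgue \<theta> ?h) < e" using 2 by (rule order_le_less_trans)
    qed
    then show "\<exists>t0. \<forall>t\<ge>t0. \<forall>T\<ge>t. cmod (ip lebesgue \<theta> (\<lambda>x. \<Phi> T x - \<Phi> t x)) < e"
      by (simp add: eventually_at_top_linorder)
  qed
  then obtain Q where Q: "weak_limit Q" by blast
  have LQ: "L2 lebesgue Q" using Q by (simp add: weak_limit_def)
  have ev2: "\<forall>\<^sub>F t in at_top. nm lebesgue (\<lambda>x. acut chi \<alpha> t x * fmult (bcut F b t) (\<Phi> t) x - Q x)
      \<le> \<epsilon> t + nm lebesgue (\<lambda>x. Q x - acut chi \<alpha> t x * fmult (bcut F b t) Q x)"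
    using ev
  proof eventually_elim
    case (elim t)
    let ?h = "\<lambda>x. Q x - \<Phi> t x"
    let ?u = "\<lambda>x. acut chi \<alpha> t x * fmult (bcut F b t) ?h x"
    have h: "L2 lebesgue ?h" by (intro L2_diff LQ L2_\<Phi>)
    have u: "L2 lebesgue ?u" by (rule LAB[OF h])
    \<comment> \<open>Pairing \<open>?u\<close> with itself makes it a fixed test function, so that
      the bound for \<Phi> T - \<Phi> t survives a limit in T which is only weak.\<close>
    have "cmod (ip lebesgue ?u ?u) = cmod (ip lebesgue (fmult (bcut F b t) (\<lambda>x. acut chi \<alpha> t x * ?u x)) ?h)"
      unfolding ip_acut_bcut[OF chi F u h] ..
    also have "\<dots> \<le> nm lebesgue ?u * \<epsilon> t"
    proof (rule weak_limit_ip_le[OF Q LBA[OF u]])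
      fix T assume T: "t \<le> T"
      have d: "L2 lebesgue (\<lambda>x. \<Phi> T x - \<Phi> t x)" by (intro L2_diff L2_\<Phi>)
      have "cmod (ip lebesgue ?u (\<lambda>x. acut chi \<alpha> t x * fmult (bcut F b t) (\<lambda>x. \<Phi> T x - \<Phi> t x) x)) \<le> nm lebesgue ?u * \<epsilon> t"
        using elim T by (intro order_trans[OF Cauchy_Schwarz_L2[OF u LAB[OF d]]] mult_left_mono) auto
      then show "cmod (ip lebesgue (fmult (bcut F b t) (\<lambda>x. acut chi \<alpha> t x * ?u x)) (\<lambda>x. \<Phi> T x - \<Phi> t x)) \<le> nm lebesgue ?u * \<epsilon> t"
        unfolding ip_acut_bcut[OF chi F u d] .
    qed
    finally have "(nm lebesgue ?u)\<^sup>2 \<le> nm lebesgue ?u * \<epsilon> t" by (simp add: ip_self norm_power)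
    moreover have "0 \<le> \<epsilon> t" using elim nm_nonneg order_trans by blast
    ultimately have nu: "nm lebesgue ?u \<le> \<epsilon> t" by (rule le_of_sq_le_mult) simp
    let ?a = "\<lambda>x. acut chi \<alpha> t x * fmult (bcut F b t) (\<Phi> t) x" and ?c = "\<lambda>x. acut chi \<alpha> t x * fmult (bcut F b t) Q x"
    have "nm lebesgue (\<lambda>x. ?a x - Q x) \<le> nm lebesgue (\<lambda>x. ?a x - ?c x) + nm lebesgue (\<lambda>x. ?c x - Q x)"
      by (intro nm_triangle_diff LAB LQ L2_\<Phi>)
    also have "nm lebesgue (\<lambda>x. ?a x - ?c x) = nm lebesgue ?u"
    proof -
      have "nm lebesgue ?u = nm lebesgue (\<lambda>x. ?c x - ?a x)"
      proof (rule nm_cong_AE)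
        show "AE x in lebesgue. ?u x = ?c x - ?a x"
          using fmult_diff[OF bcut_measurable[OF F, of b t] bcut_le_1[OF F, of b t] LQ L2_\<Phi>[of t]]
          by eventually_elim (simp add: right_diff_distrib)
      qed (rule L2_measurable[OF u] L2_measurable[OF L2_diff[OF LAB[OF LQ] LAB[OF L2_\<Phi>]]])+
      then show ?thesis by (rule trans[OF nm_minus_commute sym])
    qed
    finally show ?case using nu nm_minus_commute[of lebesgue ?c Q] by simp
  qed
  have "((\<lambda>t. \<epsilon> t + nm lebesgue (\<lambda>x. Q x - acut chi \<alpha> t x * fmult (bcut F b t) Q x)) \<longlongrightarrow> 0 + 0) at_top"
    by (intro tendsto_add \<epsilon> acut_bcut_tendsto[OF chi F \<alpha> b(1) LQ])
  then have lim: "((\<lambda>t. \<epsilon> t + nm lebesgue (\<lambda>x. Q x - acut chi \<alpha> t x * fmult (bcut F b t) Q x)) \<longlongrightarrow> 0) at_top" by simp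
  have "((\<lambda>t. nm lebesgue (\<lambda>x. acut chi \<alpha> t x * fmult (bcut F b t) (\<Phi> t) x - Q x)) \<longlongrightarrow> 0) at_top"
    by (rule tendsto_sandwich[OF _ ev2 tendsto_const lim]) simp
  then show ?thesis by (intro exI[of _ Q] conjI Q)
qed

end

section \<open>The weakly localised part\<close>

lemma schr_diff:
  assumes "L2 lebesgue f" "L2 lebesgue g"
  shows "AE x in lebesgue. schr t (\<lambda>x. f x - g x) x = schr t f x - schr t g x"
  unfolding schr_def by (rule fmult_diff[OF schr_sym assms])

lemma pnm_schr_minus:
  assumes f: "L2 lebesgue f" and g: "L2 lebesgue g"
  shows "pnm K \<sigma> S (schr r (\<lambda>x. f x - g x)) = pnm K \<sigma> S (schr r (\<lambda>x. g x - f x))"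
proof -
  have "pnm K \<sigma> S (schr r (\<lambda>x. f x - g x)) = pnm K \<sigma> S (\<lambda>x. -1 * schr r (\<lambda>x. g x - f x) x)"
  proof (rule pnm_cong_AE)
    show "AE x in lebesgue. schr r (\<lambda>x. f x - g x) x = -1 * schr r (\<lambda>x. g x - f x) x"
      using schr_diff[OF f g, of r] schr_diff[OF g f, of r] by eventually_elim simp
  qed (intro L2_scale L2_schr L2_diff f g)+
  also have "\<dots> = pnm K \<sigma> S (schr r (\<lambda>x. g x - f x))"
    unfolding pnm_def pst_scale by (simp add: nm_def)
  finally show ?thesis .
qed

text \<open>Piecewise linear in the norm: the position commutator asks for a Lipschitz function,
  here with constant 1 / R.\<close>

definition ecut :: "real \<Rightarrow> real^'n \<Rightarrow> complex" where
  "ecut R x = complex_of_real (min 1 (max 0 (norm x / R - 1)))"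

lemma ecut_simple:
  assumes R: "R > 0"
  shows ecut_measurable: "ecut R \<in> borel_measurable borel"
    and ecut_le_1: "cmod (ecut R x) \<le> 1"
    and ecut_compl_le_1: "cmod (1 - ecut R x) \<le> 1"
    and ecut_support: "ecut R x \<noteq> 0 \<Longrightarrow> R < norm x"
    and ecut_compl_support: "1 - ecut R x \<noteq> 0 \<Longrightarrow> norm x \<le> 2 * R"
    and ecut_Lipschitz: "cmod (ecut R y - ecut R x) \<le> 1 / R * norm (y - x)"
proof -
  show "ecut R \<in> borel_measurable borel" unfolding ecut_def[abs_def] by measurable
  show "cmod (ecut R x) \<le> 1" unfolding ecut_def norm_of_real by simp
  have "1 - ecut R x = complex_of_real (1 - min 1 (max 0 (norm x / R - 1)))" by (simp add: ecut_def)
  then show "cmod (1 - ecut R x) \<le> 1" by (simp only: norm_of_real)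
  show "R < norm x" if "ecut R x \<noteq> 0"
  proof (rule ccontr)
    assume "\<not> R < norm x"
    then have "norm x / R \<le> 1" using R by simp
    then show False using that by (simp add: ecut_def max_def min_def split: if_splits)
  qed
  show "norm x \<le> 2 * R" if "1 - ecut R x \<noteq> 0"
  proof (rule ccontr)
    assume "\<not> norm x \<le> 2 * R"
    then have "2 \<le> norm x / R" using R by (simp add: field_simps)
    then show False using that by (simp add: ecut_def max_def min_def split: if_splits)
  qed
  let ?c = "\<lambda>r::real. min 1 (max 0 (r - 1))"
  have "ecut R y - ecut R x = complex_of_real (?c (norm y / R) - ?c (norm x / R))" by (simp add: ecut_def)
  then have "cmod (ecut R y - ecut R x) = \<bar>?c (norm y / R) - ?c (norm x / R)\<bar>" by (simp only: norm_of_real)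
  also have "\<dots> \<le> \<bar>norm y / R - norm x / R\<bar>" by (auto simp: min_def max_def)
  also have "\<dots> = 1 / R * \<bar>norm y - norm x\<bar>" using R by (simp add: diff_divide_distrib[symmetric])
  also have "\<dots> \<le> 1 / R * norm (y - x)" using R by (intro mult_left_mono norm_triangle_ineq3) auto
  finally show "cmod (ecut R y - ecut R x) \<le> 1 / R * norm (y - x)" .
qed

text \<open>For x \<bullet> \<xi> \<ge> 0 the cross term only helps, so the squared distance is at
  least R^2 + (2 \<kappa> \<tau>)^2. The weaker lower bound R/2 + \<kappa> \<tau> is chosen because
  it is affine in \<tau> and can be integrated directly.\<close>

lemma norm_outgoing:
  fixes x \<xi> :: "'a::real_inner"
  assumes "0 \<le> x \<bullet> \<xi>" "0 \<le> \<tau>" "0 \<le> R" "0 \<le> \<kappa>" "R \<le> norm x" "\<kappa> \<le> norm \<xi>"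
  shows "R / 2 + \<kappa> * \<tau> \<le> norm (x + (2 * \<tau>) *\<^sub>R \<xi>)"
proof (rule power2_le_imp_le)
  have "R\<^sup>2 \<le> (norm x)\<^sup>2" "(2 * \<tau> * \<kappa>)\<^sup>2 \<le> (2 * \<tau> * norm \<xi>)\<^sup>2" using assms by (intro power_mono mult_left_mono; simp)+
  moreover have "(norm (x + (2 * \<tau>) *\<^sub>R \<xi>))\<^sup>2 = (norm x)\<^sup>2 + 4 * \<tau> * (x \<bullet> \<xi>) + (2 * \<tau> * norm \<xi>)\<^sup>2"
    unfolding power2_norm_eq_inner power_mult_distrib by (simp add: inner_simps inner_commute power2_eq_square algebra_simps)
  moreover have "0 \<le> 4 * \<tau> * (x \<bullet> \<xi>)" using assms by simp
  moreover have "(R / 2 + \<kappa> * \<tau>)\<^sup>2 \<le> R\<^sup>2 + (2 * \<tau> * \<kappa>)\<^sup>2"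
  proof -
    have "(R / 2 + \<kappa> * \<tau>)\<^sup>2 + (R / 2 - \<kappa> * \<tau>)\<^sup>2 + R\<^sup>2 / 2 + 2 * (\<kappa> * \<tau>)\<^sup>2 = R\<^sup>2 + (2 * \<tau> * \<kappa>)\<^sup>2"
      by (simp add: power2_eq_square field_simps)
    moreover have "0 \<le> (R / 2 - \<kappa> * \<tau>)\<^sup>2" "0 \<le> R\<^sup>2" "0 \<le> (\<kappa> * \<tau>)\<^sup>2" by simp_all
    ultimately show ?thesis by linarith
  qed
  ultimately show "(R / 2 + \<kappa> * \<tau>)\<^sup>2 \<le> (norm (x + (2 * \<tau>) *\<^sub>R \<xi>))\<^sup>2" by linarith
qed simp

text \<open>What moves inwards now was farther out in the past.\<close>

lemma norm_incoming:
  fixes x \<xi> :: "'a::real_inner"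
  assumes "x \<bullet> \<xi> \<le> 0" "0 \<le> \<tau>"
  shows "norm x \<le> norm (x + (- (2 * \<tau>)) *\<^sub>R \<xi>)"
proof (rule power2_le_imp_le)
  have "(norm (x + (- (2 * \<tau>)) *\<^sub>R \<xi>))\<^sup>2 = (norm x)\<^sup>2 - 4 * \<tau> * (x \<bullet> \<xi>) + (2 * \<tau> * norm \<xi>)\<^sup>2"
    unfolding power2_norm_eq_inner power_mult_distrib by (simp add: inner_simps inner_commute power2_eq_square algebra_simps)
  moreover have "4 * \<tau> * (x \<bullet> \<xi>) \<le> 0" using assms by (simp add: mult_nonneg_nonpos)
  ultimately show "(norm x)\<^sup>2 \<le> (norm (x + (- (2 * \<tau>)) *\<^sub>R \<xi>))\<^sup>2" using zero_le_power2[of "2 * \<tau> * norm \<xi>"] by linarith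
qed simp

context scattering
begin

text \<open>Packets in \<open>|x| > R\<close> that move inwards or slowly come from the past and are controlled by
  Duhamel's formula on \<open>[0, t]\<close>; the others escape to infinity and are controlled by Duhamel's formula on \<open>[t, \<infinity>)\<close>.\<close>

lemma exterior_part_vanishes:
  assumes \<delta>2: "\<delta> > 2" and \<epsilon>: "\<epsilon> > 0" and Q: "weak_limit Q"
  shows "((\<lambda>t. nm lebesgue (\<lambda>x. ecut (t powr (1/2 + \<epsilon>)) x * schr t (\<lambda>x. \<Phi> t x - Q x) x)) \<longlongrightarrow> 0) at_top"
proof -
  let ?n = "real CARD('n)"
  have LQ: "L2 lebesgue Q" using Q by (simp add: weak_limit_def)
  \<comment> \<open>With \<sigma> = t powr (1/2) this makes \<sigma> powr \<rho> = t powr (1/2 +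
    \<epsilon>/2), halfway between the packet width and R in the exponent.\<close>
  define \<rho> where "\<rho> = 1 + \<epsilon>"
  have \<rho>: "\<rho> > 1" using \<epsilon> by (simp add: \<rho>_def)
  obtain K K0 c0 where K: "K \<ge> 1" and K0: "K0 \<ge> 0" and c0: "c0 > 0"
    and src: "\<And>\<sigma> \<tau> D S s. \<sigma> \<ge> 1 \<Longrightarrow> c0 * \<sigma> powr \<rho> \<le> D \<Longrightarrow> c0 * \<bar>\<tau>\<bar> \<le> D * \<sigma> \<Longrightarrow> S \<in> sets PS \<Longrightarrow>
      (\<And>x \<xi>. (x, \<xi>) \<in> S \<Longrightarrow> D \<le> norm (x + (2 * \<tau>) *\<^sub>R \<xi>)) \<Longrightarrow> pnm K \<sigma> S (schr (- \<tau>) (W s)) \<le> K0 * D powr (- \<delta>)"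
    using pnm_source_decay[OF \<rho>] by blast
  obtain Ct where Ct: "Ct \<ge> 0" "\<And>\<sigma> s D::real. \<sigma> > 0 \<Longrightarrow> D > 0 \<Longrightarrow> 4 * real CARD('n) * \<bar>s\<bar> \<le> D * \<sigma> \<Longrightarrow>
    (\<integral>\<^sup>+z. indicator {z. D \<le> norm z} z * ennreal ((cmod (packet K \<sigma> s (z::real^'n)))\<^sup>2) \<partial>lborel)
      \<le> ennreal (Ct * (\<sigma> / D) ^ (2 * K - 1) * wmass K \<sigma> ^ CARD('n))"
    using packet_tail[OF K, where 'n='n] by blast
  define w where "w x = \<Phi> 0 x - Q x" for x
  have w: "L2 lebesgue w" unfolding w_def[abs_def] by (intro L2_diff L2_\<Phi> LQ)
  define R where "R t = t powr (1/2 + \<epsilon>)" for t :: real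
  \<comment> \<open>The mass of the fixed function \<Phi> 0 - Q far out. Of the factor 4, one half
    allows for the displacement of slow packets, the other is lost in \<open>pnm_schr_le\<close>;
    \<open>Y\<close> is the packet tail at the same radius.\<close>
  define X where "X t = nm lebesgue (\<lambda>y. indicator {y. R t / 4 \<le> norm y} y * w y)" for t
  define Y where "Y t = Ct * (4 * t powr (- \<epsilon>)) ^ (2 * K - 1)" for t :: real
  \<comment> \<open>\<open>E1\<close> collects the incoming and slow packets, namely the source on
    [0, t] plus the initial difference; \<open>E2\<close> the outgoing ones; \<open>E3\<close> the
    commutator with the exterior cutoff.\<close>
  define E1 where "E1 t = K0 * 2 powr \<delta> * t powr (1 - (1/2 + \<epsilon>) * \<delta>) + sqrt ((X t)\<^sup>2 + Y t * (nm lebesgue w)\<^sup>2)" for t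
  define E2 where "E2 t = K0 * (2 powr \<delta> / 2 / (\<delta> - 1)) * t powr ((1/2 + \<epsilon>) * (1 - \<delta>) + (1/2 - \<epsilon>/2))" for t :: real
  define E3 where "E3 t = sqrt ((1 * t powr (- \<epsilon> / 2))\<^sup>2 + 4 * (Ct * (1 * t powr (- \<epsilon> / 2)) ^ (2 * K - 1)))" for t :: real
  have Xlim: "(X \<longlongrightarrow> 0) at_top"
  proof -
    let ?m = "\<lambda>t y. complex_of_real (1 - indicator {y::real^'n. R t / 4 \<le> norm y} y)"
    have "((\<lambda>t. nm lebesgue (\<lambda>y. w y - ?m t y * w y)) \<longlongrightarrow> 0) at_top"
    proof (rule tendsto_multiplier_one[OF w])
      show "?m t \<in> borel_measurable lebesgue" for t by (rule lebesgue_measurable_borel) measurable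
      show "cmod (?m t y) \<le> 1" for t y by (auto simp: indicator_def)
      have pe: "(0::real) < 1/2 + \<epsilon>" using \<epsilon> by simp
      have "\<forall>\<^sub>F t in at_top. ?m t y = 1" for y
        using eventually_powr_le[OF pe, of "4 * (norm y + 1)"] eventually_gt_at_top[of 0]
      proof eventually_elim
        case (elim t)
        have "norm y < R t / 4" using elim \<epsilon> by (simp add: R_def)
        then show ?case by simp
      qed
      then show "AE y in lebesgue. \<forall>\<^sub>F t in at_top. ?m t y = 1" by simp
    qed
    moreover have "(\<lambda>y. w y - ?m t y * w y) = (\<lambda>y. indicator {y. R t / 4 \<le> norm y} y * w y)" for t
      by (auto simp: indicator_def fun_eq_iff)
    ultimately show ?thesis unfolding X_def[abs_def] by simp
  qed
  \<comment> \<open>The exponents in \<open>p1\<close> and \<open>p2\<close> both lie below 1 -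
    \<delta>/2, which is where \<delta> > 2 enters.\<close>
  have p1: "1 - (1/2 + \<epsilon>) * \<delta> < 0"
  proof -
    have "1 < (1/2) * \<delta>" using \<delta>2 by simp
    also have "(1/2) * \<delta> \<le> (1/2 + \<epsilon>) * \<delta>" using \<epsilon> \<delta> by (intro mult_right_mono) auto
    finally show ?thesis by simp
  qed
  have p2: "(1/2 + \<epsilon>) * (1 - \<delta>) + (1/2 - \<epsilon>/2) < 0"
  proof -
    have "(1/2 + \<epsilon>) * (1 - \<delta>) \<le> (1/2) * (1 - \<delta>)" using \<epsilon> \<delta> by (intro mult_right_mono_neg) auto
    moreover have "(1/2) * (1 - \<delta>) + (1/2 - \<epsilon>/2) < 0" using \<delta>2 \<epsilon> by (simp add: field_simps)
    ultimately show ?thesis by (rule order.strict_trans1[OF add_right_mono])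
  qed
  have "((\<lambda>t. E1 t + E2 t + E3 t * (2 * M)) \<longlongrightarrow>
      (0 + sqrt (0\<^sup>2 + (Ct * 0 ^ (2 * K - 1)) * (nm lebesgue w)\<^sup>2)) + 0 + sqrt (0\<^sup>2 + 4 * (Ct * 0 ^ (2 * K - 1))) * (2 * M)) at_top"
    unfolding E1_def E2_def E3_def Y_def using \<epsilon> by (intro tendsto_intros tendsto_powr_0 Xlim p1 p2) auto
  also have "(0 + sqrt (0\<^sup>2 + (Ct * 0 ^ (2 * K - 1)) * (nm lebesgue w)\<^sup>2)) + 0 + sqrt (0\<^sup>2 + 4 * (Ct * 0 ^ (2 * K - 1))) * (2 * M) = 0"
    using K by (simp add: power_0_left)
  finally have lim: "((\<lambda>t. E1 t + E2 t + E3 t * (2 * M)) \<longlongrightarrow> 0) at_top" .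
  have e1: "\<forall>\<^sub>F t::real in at_top. 2 * c0 * t powr (1/2 + \<epsilon>/2) \<le> t powr (1/2 + \<epsilon>)" by (rule eventually_powr_le) (use \<epsilon> in simp)
  have e2: "\<forall>\<^sub>F t::real in at_top. 4 * t powr (1/2 + \<epsilon>/2) \<le> t powr (1/2 + \<epsilon>)" by (rule eventually_powr_le) (use \<epsilon> in simp)
  have e3: "\<forall>\<^sub>F t::real in at_top. 2 * c0 * t powr 1 \<le> t powr (1 + \<epsilon>)" by (rule eventually_powr_le) (use \<epsilon> in simp)
  have e4: "\<forall>\<^sub>F t::real in at_top. c0 * t powr 0 \<le> t powr (\<epsilon>/2)" by (rule eventually_powr_le) (use \<epsilon> in simp)
  have e5: "\<forall>\<^sub>F t::real in at_top. 16 * ?n * t powr 1 \<le> t powr (1 + \<epsilon>)" by (rule eventually_powr_le) (use \<epsilon> in simp)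
  have ev: "\<forall>\<^sub>F t in at_top. nm lebesgue (\<lambda>x. ecut (R t) x * schr t (\<lambda>x. \<Phi> t x - Q x) x) \<le> E1 t + E2 t + E3 t * (2 * M)"
    using e1 e2 e3 e4 e5 eventually_ge_at_top[of 1]
  proof eventually_elim
    fix t :: real
    assume c1: "2 * c0 * t powr (1/2 + \<epsilon>/2) \<le> t powr (1/2 + \<epsilon>)" and c2: "4 * t powr (1/2 + \<epsilon>/2) \<le> t powr (1/2 + \<epsilon>)"
      and c3: "2 * c0 * t powr 1 \<le> t powr (1 + \<epsilon>)" and c4: "c0 * t powr 0 \<le> t powr (\<epsilon>/2)"
      and c5: "16 * ?n * t powr 1 \<le> t powr (1 + \<epsilon>)" and t: "1 \<le> t"
    have t0: "t > 0" using t by simp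
    define \<sigma> where "\<sigma> = t powr (1/2)"
    \<comment> \<open>The threshold between slow and fast. Slow packets cover at most 2 t \<kappa> =
      2 t powr (1/2 + \<epsilon>/2), below R / 2. For fast ones \<kappa> \<sigma> = t powr
      (\<epsilon>/2) is large, so they outrun the spreading of their own window at all later
      times.\<close>
    define \<kappa> where "\<kappa> = t powr (- (1/2) + \<epsilon>/2)"
    define D' where "D' = t powr (1/2 + \<epsilon>/2)"
    have \<sigma>1: "\<sigma> \<ge> 1" using t by (simp add: \<sigma>_def ge_one_powr_ge_zero)
    have pos: "\<sigma> > 0" "\<kappa> > 0" "D' > 0" "R t > 0" using t by (auto simp: \<sigma>_def \<kappa>_def D'_def R_def)
    have \<sigma>\<rho>: "\<sigma> powr \<rho> = t powr (1/2 + \<epsilon>/2)" by (simp add: \<sigma>_def \<rho>_def powr_powr add_divide_distrib)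
    have c1': "c0 * \<sigma> powr \<rho> \<le> R t / 2" using c1 by (simp add: \<sigma>\<rho> R_def)
    have t\<kappa>: "t * \<kappa> = t powr (1/2 + \<epsilon>/2)" using t0 by (simp add: \<kappa>_def powr_mult_base)
    have slow: "2 * t * \<kappa> \<le> R t / 2" using c2 t\<kappa> by (simp add: R_def)
    have R\<sigma>: "R t * \<sigma> = t powr (1 + \<epsilon>)" using t0 by (simp add: R_def \<sigma>_def powr_add[symmetric])
    have c3': "c0 * t \<le> R t / 2 * \<sigma>" using c3 R\<sigma> t0 by simp
    have \<kappa>\<sigma>: "\<kappa> * \<sigma> = t powr (\<epsilon>/2)" using t0 by (simp add: \<kappa>_def \<sigma>_def powr_add[symmetric])
    have c4': "c0 \<le> \<kappa> * \<sigma>" using c4 t0 \<kappa>\<sigma> by simp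
    let ?S = "{z::(real^'n) \<times> (real^'n). R t < norm (fst z)}"
    let ?S1 = "{z::(real^'n) \<times> (real^'n). R t < norm (fst z) \<and> (norm (snd z) \<le> \<kappa> \<or> fst z \<bullet> snd z \<le> 0)}"
    let ?S2 = "{z::(real^'n) \<times> (real^'n). R t < norm (fst z) \<and> \<kappa> < norm (snd z) \<and> 0 < fst z \<bullet> snd z}"
    have S: "?S \<in> sets PS" by (rule PS_pred_sets) measurable
    have S1: "?S1 \<in> sets PS" by (rule PS_pred_sets) measurable
    have S2: "?S2 \<in> sets PS" by (rule PS_pred_sets) measurable
    have SU: "?S = ?S1 \<union> ?S2" by auto
    let ?v = "schr t (\<lambda>x. \<Phi> t x - Q x)"
    have v: "L2 lebesgue ?v" by (intro L2_schr L2_diff L2_\<Phi> LQ)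
    have nv: "nm lebesgue ?v \<le> 2 * M"
      unfolding nm_schr[OF L2_diff[OF L2_\<Phi> LQ]]
      using nm_diff_le[OF L2_\<Phi> LQ, of t] nm_\<Phi>_le[of t] weak_limit_nm[OF Q] by linarith
    have reg1: "R t / 2 \<le> norm (x + (2 * (- \<tau>)) *\<^sub>R \<xi>)" if \<tau>: "0 \<le> \<tau>" "\<tau> \<le> t" and x: "(x, \<xi>) \<in> ?S1" for x \<xi> :: "real^'n" and \<tau>
    proof (cases "x \<bullet> \<xi> \<le> 0")
      case True
      show ?thesis using norm_incoming[OF True \<tau>(1)] x pos(4) by simp
    next
      case False
      then have x\<xi>: "R t < norm x" "norm \<xi> \<le> \<kappa>" using x by auto
      have "norm ((2 * \<tau>) *\<^sub>R \<xi>) = 2 * (\<tau> * norm \<xi>)" using \<tau> by simp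
      also have "\<dots> \<le> 2 * (t * \<kappa>)" using \<tau> x\<xi> by (intro mult_left_mono mult_mono) auto
      finally have "norm ((2 * \<tau>) *\<^sub>R \<xi>) \<le> R t / 2" using slow by simp
      then show ?thesis using norm_triangle_ineq2[of x "(2 * \<tau>) *\<^sub>R \<xi>"] x\<xi>(1) by simp
    qed
    have P1: "pnm K \<sigma> ?S1 (schr t (\<lambda>x. \<Phi> t x - \<Phi> 0 x)) \<le> (t - 0) * (K0 * (R t / 2) powr (- \<delta>))"
    proof (rule pnm_\<Phi>_diff[OF pos(1) S1, where N="\<lambda>_. K0 * (R t / 2) powr (- \<delta>)"])
      show "((\<lambda>_. K0 * (R t / 2) powr (- \<delta>)) has_integral (t - 0) * (K0 * (R t / 2) powr (- \<delta>))) {0..t}"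
        using has_integral_const_real[of "K0 * (R t / 2) powr (- \<delta>)" 0 t] t0 by simp
      fix s assume s: "s \<in> {0..t}"
      have "pnm K \<sigma> ?S1 (schr (- (- (t - s))) (W s)) \<le> K0 * (R t / 2) powr (- \<delta>)"
      proof (rule src[OF \<sigma>1 c1' _ S1])
        have "c0 * \<bar>- (t - s)\<bar> \<le> c0 * t" using s c0 by (intro mult_left_mono) auto
        then show "c0 * \<bar>- (t - s)\<bar> \<le> R t / 2 * \<sigma>" using c3' by linarith
        show "R t / 2 \<le> norm (x + (2 * (- (t - s))) *\<^sub>R \<xi>)" if "(x, \<xi>) \<in> ?S1" for x \<xi>
          using s by (intro reg1 that) auto
      qed
      then show "pnm K \<sigma> ?S1 (schr (t - s) (W s)) \<le> K0 * (R t / 2) powr (- \<delta>)" by simp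
    qed (use t0 in auto)
    have P1': "(t - 0) * (K0 * (R t / 2) powr (- \<delta>)) = K0 * 2 powr \<delta> * t powr (1 - (1/2 + \<epsilon>) * \<delta>)"
    proof -
      have "(R t / 2) powr (- \<delta>) = t powr (- ((1/2 + \<epsilon>) * \<delta>)) * 2 powr \<delta>"
        unfolding R_def half_powr(2)[OF powr_ge_zero] powr_powr mult_minus_right ..
      moreover have "t * t powr (- ((1/2 + \<epsilon>) * \<delta>)) = t powr (1 - (1/2 + \<epsilon>) * \<delta>)"
        using t0 by (simp add: powr_mult_base)
      ultimately show ?thesis by (simp add: mult_ac)
    qed
    \<comment> \<open>The initial difference does not depend on t, so in place of decay of a source
      its mass beyond R / 4 is used, which tends to 0.\<close>
    have P2: "pnm K \<sigma> ?S1 (schr t w) \<le> sqrt ((X t)\<^sup>2 + Y t * (nm lebesgue w)\<^sup>2)"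
    proof -
      have Y0: "Y t \<ge> 0" using Ct(1) by (simp add: Y_def)
      have Y': "Ct * (\<sigma> / (R t / 2 / 2)) ^ (2 * K - 1) = Y t"
      proof -
        have "\<sigma> / (R t / 2 / 2) = 4 * (t powr (1/2) / t powr (1/2 + \<epsilon>))" by (simp add: \<sigma>_def R_def)
        also have "\<dots> = 4 * t powr (- \<epsilon>)" unfolding powr_diff[symmetric] by simp
        finally show ?thesis by (simp add: Y_def)
      qed
      have tl: "(\<integral>\<^sup>+z. indicator {z. R t / 2 / 2 \<le> norm z} z * ennreal ((cmod (packet K \<sigma> (- t) (z::real^'n)))\<^sup>2) \<partial>lborel) \<le> ennreal (Y t * wmass K \<sigma> ^ CARD('n))"
        unfolding Y'[symmetric] using pos c5 R\<sigma> t0 by (intro Ct(2)) auto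
      have "(pnm K \<sigma> ?S1 (schr (- (- t)) w))\<^sup>2 \<le> (nm lebesgue (\<lambda>y. indicator {y. R t / 2 / 2 \<le> norm y} y * w y))\<^sup>2 + Y t * (nm lebesgue w)\<^sup>2"
        by (rule pnm_schr_le[OF pos(1) w S1 reg1 Y0 tl]) (use t0 in auto)
      then have "(pnm K \<sigma> ?S1 (schr t w))\<^sup>2 \<le> (X t)\<^sup>2 + Y t * (nm lebesgue w)\<^sup>2" by (simp add: X_def)
      from real_sqrt_le_mono[OF this] show ?thesis using pnm_nonneg[of K \<sigma> ?S1 "schr t w"] by simp
    qed
    \<comment> \<open>\<Phi> t - Q is split at time 0 into the Duhamel part over [0, t] and the
      initial difference \<open>w\<close>.\<close>
    have "pnm K \<sigma> ?S1 ?v = pnm K \<sigma> ?S1 (\<lambda>x. schr t (\<lambda>x. \<Phi> t x - \<Phi> 0 x) x + schr t w x)"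
    proof (rule pnm_cong_AE[OF _ v])
      show "AE x in lebesgue. ?v x = schr t (\<lambda>x. \<Phi> t x - \<Phi> 0 x) x + schr t w x"
        using schr_diff[OF L2_\<Phi> LQ, of t t] schr_diff[OF L2_\<Phi> L2_\<Phi>, of t t 0] schr_diff[OF L2_\<Phi> LQ, of t 0]
        unfolding w_def[abs_def] by eventually_elim simp
    qed (intro L2_add L2_schr L2_diff L2_\<Phi> w)
    also have "\<dots> \<le> pnm K \<sigma> ?S1 (schr t (\<lambda>x. \<Phi> t x - \<Phi> 0 x)) + pnm K \<sigma> ?S1 (schr t w)"
      by (intro pnm_add pos(1) L2_schr L2_diff L2_\<Phi> w S1)
    also have "\<dots> \<le> E1 t" unfolding E1_def by (rule add_mono[OF P1[unfolded P1'] P2])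
    finally have bound1: "pnm K \<sigma> ?S1 ?v \<le> E1 t" .
    \<comment> \<open>A bound over [t, T] uniform in T passes to the weak limit, which stands for T
      at infinity. The sign is turned first because that limit is taken of \<Phi> T - \<Phi>
      t.\<close>
    have bound2: "pnm K \<sigma> ?S2 ?v \<le> E2 t"
      unfolding pnm_schr_minus[OF L2_\<Phi> LQ]
    proof (rule pnm_weak_limit[OF Q pos(1) S2])
      fix T assume T: "t \<le> T"
      have A: "R t / 2 > 0" using pos by simp
      obtain I where I: "((\<lambda>s. (R t / 2 + \<kappa> * (s - t)) powr (- \<delta>)) has_integral I) {t..T}" "I \<le> (R t / 2) powr (1 - \<delta>) / ((\<delta> - 1) * \<kappa>)"
        using integral_affine_powr[OF A pos(2) \<delta> T] by blast
      have "pnm K \<sigma> ?S2 (schr t (\<lambda>x. \<Phi> T x - \<Phi> t x)) \<le> K0 * I"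
      proof (rule pnm_\<Phi>_diff[OF pos(1) S2 _ T _ has_integral_mult_right[OF I(1)]])
        show "0 \<le> t" using t by simp
        fix s assume s: "s \<in> {t..T}"
        have ks: "0 \<le> \<kappa> * (s - t)" using s pos by simp
        have "pnm K \<sigma> ?S2 (schr (- (s - t)) (W s)) \<le> K0 * (R t / 2 + \<kappa> * (s - t)) powr (- \<delta>)"
        proof (rule src[OF \<sigma>1 _ _ S2])
          show "c0 * \<sigma> powr \<rho> \<le> R t / 2 + \<kappa> * (s - t)" using c1' ks by linarith
          have "c0 * (s - t) \<le> \<kappa> * \<sigma> * (s - t)" using s by (intro mult_right_mono c4') auto
          moreover have "0 \<le> R t / 2 * \<sigma>" using pos by simp
          moreover have "(R t / 2 + \<kappa> * (s - t)) * \<sigma> = R t / 2 * \<sigma> + \<kappa> * \<sigma> * (s - t)" by (simp add: algebra_simps)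
          moreover have "\<bar>s - t\<bar> = s - t" using s by simp
          ultimately show "c0 * \<bar>s - t\<bar> \<le> (R t / 2 + \<kappa> * (s - t)) * \<sigma>" by linarith
          show "R t / 2 + \<kappa> * (s - t) \<le> norm (x + (2 * (s - t)) *\<^sub>R \<xi>)" if "(x, \<xi>) \<in> ?S2" for x \<xi>
            using that s pos by (intro norm_outgoing) auto
        qed
        then show "pnm K \<sigma> ?S2 (schr (t - s) (W s)) \<le> K0 * (R t / 2 + \<kappa> * (s - t)) powr (- \<delta>)" by simp
      qed
      also have "K0 * I \<le> K0 * ((R t / 2) powr (1 - \<delta>) / ((\<delta> - 1) * \<kappa>))" by (rule mult_left_mono[OF I(2) K0])
      also have "\<dots> = E2 t"
      proof -
        have 1: "(R t / 2) powr (1 - \<delta>) = t powr ((1/2 + \<epsilon>) * (1 - \<delta>)) * (2 powr \<delta> / 2)"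
          unfolding R_def half_powr(1)[OF powr_ge_zero] powr_powr ..
        have 2: "1 / \<kappa> = t powr (1/2 - \<epsilon>/2)" using t0 unfolding \<kappa>_def by (simp add: powr_minus_divide[symmetric])
        have "(R t / 2) powr (1 - \<delta>) / ((\<delta> - 1) * \<kappa>) = (2 powr \<delta> / 2 / (\<delta> - 1)) * (t powr ((1/2 + \<epsilon>) * (1 - \<delta>)) * (1 / \<kappa>))"
          unfolding 1 by (simp only: divide_inverse inverse_mult_distrib mult_ac mult_1)
        then show ?thesis unfolding 2 E2_def powr_add[symmetric] by (simp add: mult.assoc)
      qed
      finally show "pnm K \<sigma> ?S2 (schr t (\<lambda>x. \<Phi> T x - \<Phi> t x)) \<le> E2 t" .
    qed
    have tail: "(\<integral>\<^sup>+z. indicator {z. D' \<le> norm z} z * ennreal ((cmod (packet K \<sigma> 0 (z::real^'n)))\<^sup>2) \<partial>lborel)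
      \<le> ennreal (Ct * (\<sigma> / D') ^ (2 * K - 1) * wmass K \<sigma> ^ CARD('n))"
      by (rule Ct(2)) (use pos in auto)
    note E = ecut_measurable[OF pos(4)] ecut_le_1[OF pos(4)]
    \<comment> \<open>The identity multiplier is inserted so that the bound for products of cutoffs
      applies with Lipschitz constant 0 in frequency.\<close>
    have "nm lebesgue (\<lambda>x. ecut (R t) x * ?v x) = nm lebesgue (\<lambda>x. ecut (R t) x * fmult (\<lambda>_. 1) ?v x)"
    proof (rule nm_cong_AE)
      show "AE x in lebesgue. ecut (R t) x * ?v x = ecut (R t) x * fmult (\<lambda>_. 1) ?v x"
        using fmult_one[OF v] by eventually_elim simp
    qed (rule L2_measurable[OF L2_bounded_mult[OF E v]], rule L2_measurable[OF L2_bounded_mult[OF E L2_fmult[OF _ _ v]]], simp_all)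
    also have "\<dots> \<le> pnm K \<sigma> ?S ?v + (sqrt ((1 / R t * D')\<^sup>2 + 4 * (Ct * (\<sigma> / D') ^ (2 * K - 1))) + 0 * real CARD('n) / \<sigma>) * nm lebesgue ?v"
    proof (rule cutoff_product_bound[OF pos(1) v E ecut_Lipschitz[OF pos(4)] _ _ _ _ _ S _ _ tail])
      show "(x, \<xi>) \<in> ?S" if "ecut (R t) x * 1 \<noteq> 0" for x \<xi> :: "real^'n"
        using that ecut_support[OF pos(4), of x] by auto
    qed (use Ct(1) pos in auto)
    also have "(sqrt ((1 / R t * D')\<^sup>2 + 4 * (Ct * (\<sigma> / D') ^ (2 * K - 1))) + 0 * real CARD('n) / \<sigma>) = E3 t"
    proof -
      have "1 / R t * D' = 1 * t powr (- \<epsilon> / 2)" using t0 by (simp add: R_def D'_def powr_diff[symmetric])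
      moreover have "\<sigma> / D' = 1 * t powr (- \<epsilon> / 2)" using t0 by (simp add: \<sigma>_def D'_def powr_diff[symmetric])
      ultimately show ?thesis unfolding E3_def by simp
    qed
    also have "pnm K \<sigma> ?S ?v + E3 t * nm lebesgue ?v \<le> (E1 t + E2 t) + E3 t * (2 * M)"
    proof (intro add_mono mult_left_mono nv)
      show "pnm K \<sigma> ?S ?v \<le> E1 t + E2 t"
        unfolding SU using pnm_Un[OF pos(1) v S1 S2, of K] bound1 bound2 by linarith
      show "0 \<le> E3 t" using Ct(1) by (simp add: E3_def)
    qed
    finally show "nm lebesgue (\<lambda>x. ecut (R t) x * ?v x) \<le> E1 t + E2 t + E3 t * (2 * M)" .
  qed
  have "((\<lambda>t. nm lebesgue (\<lambda>x. ecut (R t) x * schr t (\<lambda>x. \<Phi> t x - Q x) x)) \<longlongrightarrow> 0) at_top"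
    by (rule tendsto_sandwich[OF _ ev tendsto_const lim]) simp
  then show ?thesis by (simp add: R_def)
qed

text \<open>The remainder is cut off smoothly enough at R and has norm at most 2M. To express its
  moment through the initial norm the constant is divided by that norm squared; if the norm is 0 the
  solution vanishes for t \<ge> 0 and zero functions serve as both parts.\<close>

lemma weakly_localised_part:
  assumes \<delta>2: "\<delta> > 2" and \<epsilon>: "\<epsilon> > 0" and Q: "weak_limit Q"
  shows "\<exists>p w. L2 lebesgue p \<and> (\<forall>t\<ge>1. L2 lebesgue (w t)) \<and>
     ((\<lambda>t. nm lebesgue (\<lambda>x. \<psi> t x - schr t p x - w t x)) \<longlongrightarrow> 0) at_top \<and>
     (\<exists>B. \<forall>t\<ge>1. integrable lebesgue (\<lambda>x. norm x * (cmod (w t x))\<^sup>2) \<and>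
        (LINT x|lebesgue. norm x * (cmod (w t x))\<^sup>2) \<le> B * t powr (1/2 + \<epsilon>) * (nm lebesgue (\<psi> 0))\<^sup>2)"
proof (cases "nm lebesgue (\<psi> 0) = 0")
  case True
  have z: "AE x in lebesgue. schr t (\<lambda>_. 0) x = (0::complex)" for t
    by (rule nm_eq_0_AE[OF L2_schr[OF L2_zero]]) (simp add: nm_schr)
  have "\<forall>\<^sub>F t in at_top. nm lebesgue (\<lambda>x. \<psi> t x - schr t (\<lambda>_. 0) x - 0) = 0"
    using eventually_ge_at_top[of 0]
  proof eventually_elim
    case (elim t)
    have "nm lebesgue (\<lambda>x. \<psi> t x - schr t (\<lambda>_. 0) x - 0) = nm lebesgue (\<psi> t)"
    proof (rule nm_cong_AE)
      show "AE x in lebesgue. \<psi> t x - schr t (\<lambda>_. 0) x - 0 = \<psi> t x" using z[of t] by eventually_elim simp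
    qed (intro L2_measurable L2_diff L2_psi L2_schr L2_zero)+
    then show ?case using vanishing_solution[OF True elim] by simp
  qed
  then have "((\<lambda>t. nm lebesgue (\<lambda>x. \<psi> t x - schr t (\<lambda>_. 0) x - 0)) \<longlongrightarrow> 0) at_top" by (rule tendsto_eventually)
  then show ?thesis by (intro exI[of _ "\<lambda>_. 0"] exI[of _ "\<lambda>_ _. 0"]) (auto simp: True)
next
  case False
  have LQ: "L2 lebesgue Q" using Q by (simp add: weak_limit_def)
  define R where "R t = t powr (1/2 + \<epsilon>)" for t :: real
  define v where "v t = schr t (\<lambda>x. \<Phi> t x - Q x)" for t
  define w where "w t x = (1 - ecut (R t) x) * v t x" for t x
  have R: "R t > 0" if "t \<ge> 1" for t using that by (simp add: R_def)
  have v: "L2 lebesgue (v t)" for t unfolding v_def by (intro L2_schr L2_diff L2_\<Phi> LQ)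
  have nv: "nm lebesgue (v t) \<le> 2 * M" for t
    unfolding v_def nm_schr[OF L2_diff[OF L2_\<Phi> LQ]]
    using nm_diff_le[OF L2_\<Phi> LQ, of t] nm_\<Phi>_le[of t] weak_limit_nm[OF Q] by linarith
  have Ec: "(\<lambda>x::real^'n. 1 - ecut (R t) x) \<in> borel_measurable borel" if "t \<ge> 1" for t
    using ecut_measurable[OF R[OF that]] by measurable
  have w: "L2 lebesgue (w t)" if "t \<ge> 1" for t
    unfolding w_def[abs_def] by (rule L2_bounded_mult[OF Ec[OF that] ecut_compl_le_1[OF R[OF that]] v])
  have vAE: "AE x in lebesgue. v t x = \<psi> t x - schr t Q x" for t
  proof -
    have e: "schr t (\<Phi> t) = schr 0 (\<psi> t)" unfolding \<Phi>_def schr_schr[OF L2_psi] by simp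
    show ?thesis using schr_diff[OF L2_\<Phi> LQ, of t t] schr_0[OF L2_psi, of t]
      unfolding v_def e by eventually_elim simp
  qed
  have "\<forall>\<^sub>F t in at_top. nm lebesgue (\<lambda>x. ecut (R t) x * v t x) = nm lebesgue (\<lambda>x. \<psi> t x - schr t Q x - w t x)"
    using eventually_ge_at_top[of 1]
  proof eventually_elim
    case (elim t)
    show ?case
    proof (rule nm_cong_AE)
      show "AE x in lebesgue. ecut (R t) x * v t x = \<psi> t x - schr t Q x - w t x"
        using vAE[of t] by eventually_elim (simp add: w_def algebra_simps)
    qed (intro L2_measurable L2_diff L2_bounded_mult[OF ecut_measurable[OF R[OF elim]] ecut_le_1[OF R[OF elim]] v] L2_psi L2_schr LQ w elim)+
  qed
  then have lim: "((\<lambda>t. nm lebesgue (\<lambda>x. \<psi> t x - schr t Q x - w t x)) \<longlongrightarrow> 0) at_top"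
    using exterior_part_vanishes[OF \<delta>2 \<epsilon> Q] by (simp add: R_def v_def tendsto_cong)
  \<comment> \<open>|x| \<le> 2 R on the support of the cutoff, and 2M bounds the norm of v; the
    division prepares the factor demanded on the right.\<close>
  define B where "B = 2 * (2 * M)\<^sup>2 / (nm lebesgue (\<psi> 0))\<^sup>2"
  have "integrable lebesgue (\<lambda>x. norm x * (cmod (w t x))\<^sup>2) \<and>
        (LINT x|lebesgue. norm x * (cmod (w t x))\<^sup>2) \<le> B * R t * (nm lebesgue (\<psi> 0))\<^sup>2" if t: "t \<ge> 1" for t
  proof -
    have R0: "R t > 0" by (rule R[OF t])
    have b: "norm x * (cmod (w t x))\<^sup>2 \<le> 2 * R t * (cmod (v t x))\<^sup>2" for x
    proof (cases "1 - ecut (R t) x = 0")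
      case False
      have "cmod (w t x) \<le> 1 * cmod (v t x)" unfolding w_def by (rule cmod_mult_le_one[OF ecut_compl_le_1[OF R0]])
      then have "(cmod (w t x))\<^sup>2 \<le> (cmod (v t x))\<^sup>2" by (intro power_mono) auto
      then show ?thesis using ecut_compl_support[OF R0 False] R0 by (intro mult_mono) auto
    qed (use R0 in \<open>simp add: w_def\<close>)
    have vi: "integrable lebesgue (\<lambda>x. 2 * R t * (cmod (v t x))\<^sup>2)" using L2_integrable[OF v] by simp
    have wm: "(\<lambda>x. norm x * (cmod (w t x))\<^sup>2) \<in> borel_measurable lebesgue"
    proof -
      have "(\<lambda>x::real^'n. norm x) \<in> borel_measurable lebesgue" by (rule measurable_completion) measurable
      then show ?thesis using L2_measurable[OF w[OF t]] by measurable
    qed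
    have i: "integrable lebesgue (\<lambda>x. norm x * (cmod (w t x))\<^sup>2)"
      by (rule Bochner_Integration.integrable_bound[OF vi wm]) (use b R0 in auto)
    have "(LINT x|lebesgue. norm x * (cmod (w t x))\<^sup>2) \<le> (LINT x|lebesgue. 2 * R t * (cmod (v t x))\<^sup>2)"
      by (rule integral_mono[OF i vi b])
    also have "\<dots> = 2 * R t * (nm lebesgue (v t))\<^sup>2" by (simp add: nm_sq)
    also have "\<dots> \<le> 2 * R t * (2 * M)\<^sup>2" using R0 nv by (intro mult_left_mono power_mono) auto
    also have "\<dots> = B * R t * (nm lebesgue (\<psi> 0))\<^sup>2" using False by (simp add: B_def)
    finally show ?thesis using i by blast
  qed
  then show ?thesis using LQ w lim unfolding R_def by (intro exI[of _ Q] exI[of _ w] conjI exI[of _ B]) auto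
qed

end

text \<open>The momentum cutoff commutes with the free group, both being Fourier multipliers, and
  the outer unitary cancels. In the interaction picture only a multiplication in x after a
  multiplier remains.\<close>

lemma Fc_F1_interaction:
  fixes f :: "real^'n \<Rightarrow> complex"
  assumes chi: "cutoff chi" and F: "cutoff F" and f: "L2 lebesgue f"
  shows "L2 lebesgue (Fc_op chi \<alpha> t (F1_op F b t f))"
    and "AE x in lebesgue. schr (- t) (Fc_op chi \<alpha> t (F1_op F b t f)) x = acut chi \<alpha> t x * fmult (bcut F b t) (schr (- t) f) x"
proof -
  note A = acut_measurable[OF chi] acut_le_1[OF chi] and B = bcut_measurable[OF F] bcut_le_1[OF F]
  have comm: "schr (- t) (fmult (bcut F b t) f) = fmult (bcut F b t) (schr (- t) f)"
    unfolding schr_def fmult_fmult[OF B schr_sym f] fmult_fmult[OF schr_sym B f] by (simp only: mult.commute)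
  have eq: "Fc_op chi \<alpha> t (F1_op F b t f) = schr t (\<lambda>x. acut chi \<alpha> t x * fmult (bcut F b t) (schr (- t) f) x)"
    by (simp only: Fc_op_def F1_op_def acut_def comm[unfolded bcut_def[abs_def]] bcut_def[abs_def])
  have L: "L2 lebesgue (\<lambda>x. acut chi \<alpha> t x * fmult (bcut F b t) (schr (- t) f) x)"
    by (intro L2_bounded_mult A L2_fmult B L2_schr f)
  show "L2 lebesgue (Fc_op chi \<alpha> t (F1_op F b t f))" unfolding eq by (rule L2_schr[OF L])
  show "AE x in lebesgue. schr (- t) (Fc_op chi \<alpha> t (F1_op F b t f)) x = acut chi \<alpha> t x * fmult (bcut F b t) (schr (- t) f) x"
    using schr_0[OF L] unfolding eq schr_schr[OF L] by simp
qed

text \<open>The definitions do not require \<open>N\<close> to be measurable: where the source is not measurable, every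
  Fourier integral of its large truncations is \<open>0\<close>, so it enters Duhamel's formula as the zero function.\<close>

lemma global_solution_scattering:
  fixes N :: "real^'n \<Rightarrow> real \<Rightarrow> real \<Rightarrow> complex" and \<psi> :: "real \<Rightarrow> real^'n \<Rightarrow> complex"
  assumes sol: "global_solution N \<psi>" and bdd: "\<exists>M. \<forall>t. l2norm (\<psi> t) \<le> M" and \<delta>: "\<delta> > 1"
    and decay: "\<exists>C. \<forall>x t. (1 + (norm x)\<^sup>2) powr (\<delta> / 2) * cmod (N x t (cmod (\<psi> t x))) \<le> C"
  shows "\<exists>W M C. scattering \<psi> W M C \<delta>"
proof -
  obtain M where M: "\<And>t. nm lebesgue (\<psi> t) \<le> M" using bdd unfolding l2norm_eq_nm by blast
  obtain C where C: "\<And>x t. (1 + (norm x)\<^sup>2) powr (\<delta> / 2) * cmod (N x t (cmod (\<psi> t x))) \<le> C" using decay by blast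
  define V where "V s x = N x s (cmod (\<psi> s x)) * \<psi> s x" for s x
  define W where "W s = (if V s \<in> borel_measurable lebesgue then V s else (\<lambda>_. 0))" for s
  have C0: "C \<ge> 0" by (rule order_trans[OF _ C[of 0 0]]) simp
  have L2\<psi>: "L2 lebesgue (\<psi> t)" for t using sol unfolding global_solution_def sqint_eq_L2 by blast
  have Vd: "cmod (V s x) \<le> C * (1 + (norm x)\<^sup>2) powr (- \<delta> / 2) * cmod (\<psi> s x)" for s x
  proof -
    have p: "1 + (norm x)\<^sup>2 > 0" by (simp add: add_pos_nonneg)
    have "cmod (N x s (cmod (\<psi> s x))) = (1 + (norm x)\<^sup>2) powr (- \<delta> / 2) * ((1 + (norm x)\<^sup>2) powr (\<delta> / 2) * cmod (N x s (cmod (\<psi> s x))))"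
      unfolding mult.assoc[symmetric] powr_add[symmetric] using p by simp
    also have "\<dots> \<le> (1 + (norm x)\<^sup>2) powr (- \<delta> / 2) * C" by (intro mult_left_mono C) simp
    finally have "cmod (N x s (cmod (\<psi> s x))) \<le> C * (1 + (norm x)\<^sup>2) powr (- \<delta> / 2)" by (simp only: mult.commute)
    then show ?thesis unfolding V_def norm_mult by (rule mult_right_mono) simp
  qed
  have Wd: "cmod (W s x) \<le> C * (1 + (norm x)\<^sup>2) powr (- \<delta> / 2) * cmod (\<psi> s x)" for s x
    using Vd[of s x] C0 by (simp add: W_def)
  have WC: "cmod (W s x) \<le> C * cmod (\<psi> s x)" for s x
  proof (rule order_trans[OF Wd])
    have p: "1 + (norm x)\<^sup>2 > 0" by (simp add: add_pos_nonneg)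
    have "(1 + (norm x)\<^sup>2) powr (- \<delta> / 2) \<le> (1 + (norm x)\<^sup>2) powr 0" using \<delta> by (intro powr_mono) auto
    also have "\<dots> = 1" using p by simp
    finally have "C * (1 + (norm x)\<^sup>2) powr (- \<delta> / 2) * cmod (\<psi> s x) \<le> C * 1 * cmod (\<psi> s x)"
      by (intro mult_right_mono mult_left_mono C0) auto
    then show "C * (1 + (norm x)\<^sup>2) powr (- \<delta> / 2) * cmod (\<psi> s x) \<le> C * cmod (\<psi> s x)" by simp
  qed
  have Wm: "W s \<in> borel_measurable lebesgue" for s by (simp add: W_def)
  have L2W: "L2 lebesgue (W s)" for s by (rule L2_bound[OF L2\<psi>[of s] Wm, where c=C]) (use WC in simp)
  have sW: "schr t (V s) = schr t (W s)" for t s using schr_nonmeasurable[of "V s" t] by (simp add: W_def)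
  have VI: "(\<lambda>x. N x s (cmod (\<psi> s x)) * \<psi> s x) = V s" for s by (simp add: V_def fun_eq_iff)
  have du: "interval_lebesgue_integrable lborel 0 t (\<lambda>s. ip lebesgue \<phi> (schr (t - s) (W s))) \<and>
      ip lebesgue \<phi> (\<psi> t) = ip lebesgue \<phi> (schr t (\<psi> 0)) - \<i> * (LBINT s=0..t. ip lebesgue \<phi> (schr (t - s) (W s)))"
    if "L2 lebesgue \<phi>" for \<phi> t
    using sol[unfolded global_solution_def, THEN conjunct2, THEN conjunct2, unfolded sqint_eq_L2 l2inner_eq_ip VI sW, rule_format, OF that] .
  have "scattering \<psi> W M C \<delta>"
    by unfold_locales ((rule L2\<psi> M L2W Wd C0 \<delta> conjunct1[OF du] conjunct2[OF du]; assumption?)+)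
  then show ?thesis by blast
qed

theorem theorem2p2:
  fixes N :: "real^'n \<Rightarrow> real \<Rightarrow> real \<Rightarrow> complex"
    and \<psi> :: "real \<Rightarrow> real^'n \<Rightarrow> complex"
    and chi_c F1 :: "real \<Rightarrow> real"
    and \<delta> :: real
  assumes chi_c: "cutoff chi_c" and F1: "cutoff F1"
    and sol: "global_solution N \<psi>"
    and bdd: "\<exists>M. \<forall>t. l2norm (\<psi> t) \<le> M"
    and \<delta>: "\<delta> > 1"
    and decay: "\<exists>C. \<forall>x t. (1 + (norm x)\<^sup>2) powr (\<delta> / 2) * cmod (N x t (cmod (\<psi> t x))) \<le> C"
  shows
    "(\<forall>b \<alpha>. 0 < b \<and> b < 1 - (1 + 1 / \<delta>) / 2 \<and> b < \<alpha> \<and> \<alpha> < 1 - b \<longrightarrow>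
        (\<exists>g. sqint g \<and>
           ((\<lambda>t. l2norm (\<lambda>x. schr (- t) (Fc_op chi_c \<alpha> t (F1_op F1 b t (\<psi> t))) x - g x))
              \<longlongrightarrow> 0) at_top) \<and>
        (\<forall>\<phi>. sqint \<phi> \<longrightarrow>
           ((\<lambda>t. l2inner \<phi> (schr (- t)
                (\<lambda>x. \<psi> t x - Fc_op chi_c \<alpha> t (F1_op F1 b t (\<psi> t)) x))) \<longlongrightarrow> 0) at_top))
     \<and>
     (\<delta> > 2 \<longrightarrow>
        (\<forall>\<epsilon>>0. \<exists>\<psi>p \<psi>w. sqint \<psi>p \<and> (\<forall>t\<ge>1. sqint (\<psi>w t)) \<and>
           ((\<lambda>t. l2norm (\<lambda>x. \<psi> t x - schr t \<psi>p x - \<psi>w t x)) \<longlongrightarrow> 0) at_top \<and>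
           (\<exists>C. \<forall>t\<ge>1. integrable lebesgue (\<lambda>x. norm x * (cmod (\<psi>w t x))\<^sup>2) \<and>
               (LINT x|lebesgue. norm x * (cmod (\<psi>w t x))\<^sup>2)
                 \<le> C * t powr (1/2 + \<epsilon>) * (l2norm (\<psi> 0))\<^sup>2)))"
proof -
  obtain W M C where "scattering \<psi> W M C \<delta>"
    using global_solution_scattering[OF sol bdd \<delta> decay] by blast
  then interpret scattering \<psi> W M C \<delta> .
  have one: "(\<exists>g. sqint g \<and>
           ((\<lambda>t. l2norm (\<lambda>x. schr (- t) (Fc_op chi_c \<alpha> t (F1_op F1 b t (\<psi> t))) x - g x)) \<longlongrightarrow> 0) at_top) \<and>
        (\<forall>\<phi>. sqint \<phi> \<longrightarrow>
           ((\<lambda>t. l2inner \<phi> (schr (- t) (\<lambda>x. \<psi> t x - Fc_op chi_c \<alpha> t (F1_op F1 b t (\<psi> t)) x))) \<longlongrightarrow> 0) at_top)"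
    if b: "0 < b" "b < 1 - (1 + 1 / \<delta>) / 2" "b < \<alpha>" "\<alpha> < 1 - b" for b \<alpha>
  proof -
    have "b * \<delta> < \<delta> - 1"
    proof -
      have "b * \<delta> < (1 - (1 + 1 / \<delta>) / 2) * \<delta>" using b(2) \<delta> by (intro mult_strict_right_mono) auto
      also have "\<dots> = (\<delta> - 1) / 2" using \<delta> by (simp add: field_simps)
      finally show ?thesis using \<delta> by simp
    qed
    from channel_wave_operator[OF chi_c F1 b(1,3,4) this]
    obtain Q where Q: "weak_limit Q"
      and lim: "((\<lambda>t. nm lebesgue (\<lambda>x. acut chi_c \<alpha> t x * fmult (bcut F1 b t) (\<Phi> t) x - Q x)) \<longlongrightarrow> 0) at_top" by blast
    have LQ: "L2 lebesgue Q" using Q by (simp add: weak_limit_def)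
    let ?f = "\<lambda>t. Fc_op chi_c \<alpha> t (F1_op F1 b t (\<psi> t))"
    note f = Fc_F1_interaction[OF chi_c F1 L2_psi, folded \<Phi>_def]
    have AB: "L2 lebesgue (\<lambda>x. acut chi_c \<alpha> t x * fmult (bcut F1 b t) (\<Phi> t) x)" for t
      by (intro L2_bounded_mult acut_measurable acut_le_1 chi_c L2_fmult bcut_measurable bcut_le_1 F1 L2_\<Phi>)
    have "nm lebesgue (\<lambda>x. schr (- t) (?f t) x - Q x) = nm lebesgue (\<lambda>x. acut chi_c \<alpha> t x * fmult (bcut F1 b t) (\<Phi> t) x - Q x)" for t
    proof (rule nm_cong_AE)
      show "AE x in lebesgue. schr (- t) (?f t) x - Q x = acut chi_c \<alpha> t x * fmult (bcut F1 b t) (\<Phi> t) x - Q x"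
        using f(2)[where \<alpha>=\<alpha> and t=t and b=b, of t] unfolding \<Phi>_def by eventually_elim simp
    qed (intro L2_measurable L2_diff L2_schr f(1) AB LQ)+
    then have lim': "((\<lambda>t. nm lebesgue (\<lambda>x. schr (- t) (?f t) x - Q x)) \<longlongrightarrow> 0) at_top" using lim by simp
    have "((\<lambda>t. ip lebesgue \<phi> (schr (- t) (\<lambda>x. \<psi> t x - ?f t x))) \<longlongrightarrow> 0) at_top" if \<phi>: "L2 lebesgue \<phi>" for \<phi>
    proof -
      have "ip lebesgue \<phi> (schr (- t) (\<lambda>x. \<psi> t x - ?f t x)) = ip lebesgue \<phi> (\<Phi> t) - ip lebesgue \<phi> (schr (- t) (?f t))" for t
      proof -
        have "ip lebesgue \<phi> (schr (- t) (\<lambda>x. \<psi> t x - ?f t x)) = ip lebesgue \<phi> (\<lambda>x. schr (- t) (\<psi> t) x - schr (- t) (?f t) x)"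
          by (intro ip_cong_AE AE_I2 refl schr_diff L2_measurable L2_diff L2_schr L2_psi f(1) \<phi>)
        then show ?thesis by (simp add: ip_diff_right \<phi> L2_schr L2_psi f(1) \<Phi>_def)
      qed
      \<comment> \<open>Both terms tend to the same Q, the first weakly and the second because its
        right factor converges in norm.\<close>
      moreover have "((\<lambda>t. ip lebesgue \<phi> (\<Phi> t) - ip lebesgue \<phi> (schr (- t) (?f t))) \<longlongrightarrow> ip lebesgue \<phi> Q - ip lebesgue \<phi> Q) at_top"
      proof (rule tendsto_diff)
        show "((\<lambda>t. ip lebesgue \<phi> (\<Phi> t)) \<longlongrightarrow> ip lebesgue \<phi> Q) at_top" using Q \<phi> by (simp add: weak_limit_def)
        show "((\<lambda>t. ip lebesgue \<phi> (schr (- t) (?f t))) \<longlongrightarrow> ip lebesgue \<phi> Q) at_top"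
          by (rule tendsto_ip[OF \<phi> L2_schr[OF f(1)] \<phi> LQ _ lim']) simp
      qed
      ultimately show ?thesis by simp
    qed
    then show ?thesis using LQ lim' unfolding sqint_eq_L2 l2norm_eq_nm l2inner_eq_ip by blast
  qed
  have two: "\<exists>\<psi>p \<psi>w. sqint \<psi>p \<and> (\<forall>t\<ge>1. sqint (\<psi>w t)) \<and>
           ((\<lambda>t. l2norm (\<lambda>x. \<psi> t x - schr t \<psi>p x - \<psi>w t x)) \<longlongrightarrow> 0) at_top \<and>
           (\<exists>C. \<forall>t\<ge>1. integrable lebesgue (\<lambda>x. norm x * (cmod (\<psi>w t x))\<^sup>2) \<and>
               (LINT x|lebesgue. norm x * (cmod (\<psi>w t x))\<^sup>2)
                 \<le> C * t powr (1/2 + \<epsilon>) * (l2norm (\<psi> 0))\<^sup>2)"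
    if \<delta>2: "\<delta> > 2" and \<epsilon>: "\<epsilon> > 0" for \<epsilon>
  proof -
    \<comment> \<open>Any admissible pair of exponents will do, since the weak limit of \<Phi> does
      not refer to b or \<alpha>; 1/4 and 1/2 are admissible when \<delta> > 2.\<close>
    have "(1/4) * \<delta> < \<delta> - 1" using \<delta>2 by simp
    from channel_wave_operator[OF chi_c F1, of "1/4" "1/2", OF _ _ _ this]
    obtain Q where Q: "weak_limit Q" by auto
    show ?thesis using weakly_localised_part[OF \<delta>2 \<epsilon> Q] unfolding sqint_eq_L2 l2norm_eq_nm .
  qed
  show ?thesis using one two by blast
qed

end
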